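(* Let $K$ be a compact convex subset of $\mathbb{R}^d$, $m\ge0$ an integer and $\alpha\in(0,1]$. Then $\mathbf{CH}^{m,\alpha}(K)$ is isometrically isomorphic to the dual space of the Banach space $(\mathbf F^\alpha_m(K),\mathbf F^\alpha)$, and the corresponding duality bracket $\langle\cdot,\cdot\rangle\colon\mathbf{CH}^{m,\alpha}(K)\times\mathbf F^\alpha_m(K)\to\mathbb{R}$ satisfies $$\langle\omega,T\rangle=\omega(T)$$ for all $\omega\in\mathbf{CH}^{m,\alpha}(K)$ and all $T\in\mathbf N_m(K)$.
   Context: Currents: a (compactly supported) $m$-current $T$ in $\mathbb{R}^d$ is a continuous linear functional on $C^\infty(\mathbb{R}^d;\wedge^m\mathbb{R}^d)$ (smooth $m$-forms with the usual topology); $\partial T(\omega)=T(d\omega)$ for $m\ge1$. Covectors carry the comass norm and $\|\omega\|_\infty$ is the supremum of the comass. $\mathbf M(T)=\sup\{T(\omega):\|\omega\|_\infty\le1\}$; $\mathbf N(T)=\mathbf M(T)+\mathbf M(\partial T)$ for $m\ge1$, $\mathbf N=\mathbf M$ for $m=0$; $T$ is normal if $\mathbf N(T)<\infty$. For normal $T$, the flat norm is $\mathbf F(T)=\sup\{T(\omega):\max\{\|\omega\|_\infty,\|d\omega\|_\infty\}\le1\}$. $T$ is flat if it is the weak limit of an $\mathbf F$-Cauchy sequence $(T_n)$ of normal currents with $\bigcup_n\operatorname{spt}T_n$ relatively compact; then $\mathbf F(T)=\lim\mathbf F(T_n)$. $\mathbf N_m(K)$ is the space of normal $m$-currents supported in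 $K$. A flat $m$-current $T$ is $\alpha$-fractional if it admits an $\alpha$-fractional decomposition, i.e. a sequence $(T_k)_{k\ge0}$ of normal $m$-currents, all supported in a common compact set, with $\sum_k\mathbf N(T_k)^{1-\alpha}\mathbf F(T_k)^\alpha<\infty$ and $T=\sum_kT_k$ ($\mathbf F$-convergent series). $\mathbf F^\alpha(T)=\inf\sum_k\mathbf N(T_k)^{1-\alpha}\mathbf F(T_k)^\alpha$ over all such decompositions. $\mathbf F^\alpha_m(K)$ is the space of $\alpha$-fractional $m$-currents with support in $K$, normed by $\mathbf F^\alpha$. An $\alpha$-fractional $m$-charge over $K$ is a linear functional $\omega\colon\mathbf N_m(K)\to\mathbb{R}$ for which there is $C\ge0$ with $|\omega(T)|\le C\,\mathbf N(T)^{1-\alpha}\mathbf F(T)^\alpha$ for all $T\in\mathbf N_m(K)$; $\mathbf{CH}^{m,\alpha}(K)$ is the space of these, and $\|\omega\|_{\mathbf{CH}^{m,\alpha}(K)}$ is the infimum of such $C$. *)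

theory Defs
  imports "HOL-Analysis.Analysis" "HOL-Library.Function_Algebras"
begin

section \<open>Function spaces as real vector spaces\<close>

text \<open>Forms, currents and functionals on currents are all functions; they get the pointwise
  vector space structure.\<close>

instantiation "fun" :: (type, scaleR) scaleR
begin
definition scaleR_fun :: "real \<Rightarrow> ('a \<Rightarrow> 'b) \<Rightarrow> 'a \<Rightarrow> 'b"
  where "scaleR_fun c f = (\<lambda>x. c *\<^sub>R f x)"
instance ..
end

instance "fun" :: (type, real_vector) real_vector
  by standard (simp_all add: scaleR_fun_def fun_eq_iff plus_fun_def algebra_simps)

definition linear_on :: "'v::real_vector set \<Rightarrow> ('v \<Rightarrow> 'w::real_vector) \<Rightarrow> bool" where
  "linear_on V f \<longleftrightarrow>
     (\<forall>x\<in>V. \<forall>y\<in>V. f (x + y) = f x + f y) \<and> (\<forall>c. \<forall>x\<in>V. f (c *\<^sub>R x) = c *\<^sub>R f x)"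

definition normed_space_on :: "'v::real_vector set \<Rightarrow> ('v \<Rightarrow> real) \<Rightarrow> bool" where
  "normed_space_on V n \<longleftrightarrow> subspace V \<and>
     (\<forall>x\<in>V. 0 \<le> n x \<and> (n x = 0 \<longleftrightarrow> x = 0)) \<and>
     (\<forall>c. \<forall>x\<in>V. n (c *\<^sub>R x) = \<bar>c\<bar> * n x) \<and>
     (\<forall>x\<in>V. \<forall>y\<in>V. n (x + y) \<le> n x + n y)"

definition Cauchy_wrt :: "('v::real_vector \<Rightarrow> real) \<Rightarrow> (nat \<Rightarrow> 'v) \<Rightarrow> bool" where
  "Cauchy_wrt n s \<longleftrightarrow> (\<forall>\<epsilon>>0. \<exists>N. \<forall>i\<ge>N. \<forall>j\<ge>N. n (s i - s j) < \<epsilon>)"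

definition banach_space_on :: "'v::real_vector set \<Rightarrow> ('v \<Rightarrow> real) \<Rightarrow> bool" where
  "banach_space_on V n \<longleftrightarrow> normed_space_on V n \<and>
     (\<forall>s. (\<forall>k. s k \<in> V) \<and> Cauchy_wrt n s \<longrightarrow> (\<exists>x\<in>V. (\<lambda>k. n (s k - x)) \<longlonglongrightarrow> 0))"

text \<open>A functional on a subspace \<open>V\<close> is represented by the function extending it by \<open>0\<close> outside
  \<open>V\<close>, so that equality of representatives is equality of functionals on \<open>V\<close>.\<close>

definition dual_space :: "'v::real_vector set \<Rightarrow> ('v \<Rightarrow> real) \<Rightarrow> ('v \<Rightarrow> real) set" where
  "dual_space V n = {f. linear_on V f \<and> (\<exists>C. \<forall>x\<in>V. \<bar>f x\<bar> \<le> C * n x) \<and> (\<forall>x. x \<notin> V \<longrightarrow> f x = 0)}"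

definition dual_norm :: "'v::real_vector set \<Rightarrow> ('v \<Rightarrow> real) \<Rightarrow> ('v \<Rightarrow> real) \<Rightarrow> real" where
  "dual_norm V n f = Sup {\<bar>f x\<bar> | x. x \<in> V \<and> n x \<le> 1}"

definition isometric_isomorphism ::
  "'v::real_vector set \<Rightarrow> ('v \<Rightarrow> real) \<Rightarrow> 'w::real_vector set \<Rightarrow> ('w \<Rightarrow> real) \<Rightarrow> ('v \<Rightarrow> 'w) \<Rightarrow> bool" where
  "isometric_isomorphism V n W p \<Phi> \<longleftrightarrow>
     linear_on V \<Phi> \<and> bij_betw \<Phi> V W \<and> (\<forall>x\<in>V. p (\<Phi> x) = n x)"


section \<open>Smooth differential forms\<close>

text \<open>An \<open>m\<close>-covector is an alternating \<open>m\<close>-linear map, taking its arguments as a list of length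
  \<open>m\<close> (and extended by \<open>0\<close> to lists of other lengths).\<close>

definition covectors :: "nat \<Rightarrow> ('a::euclidean_space list \<Rightarrow> real) set" where
  "covectors m = {\<phi>.
     (\<forall>vs i. length vs = m \<and> i < m \<longrightarrow> linear (\<lambda>v. \<phi> (vs[i := v]))) \<and>
     (\<forall>vs i j. length vs = m \<and> i < j \<and> j < m \<and> vs ! i = vs ! j \<longrightarrow> \<phi> vs = 0) \<and>
     (\<forall>vs. length vs \<noteq> m \<longrightarrow> \<phi> vs = 0)}"

text \<open>The Euclidean norm of the simple multivector \<open>v\<^sub>1 \<and> \<dots> \<and> v\<^sub>m\<close>, i.e. the square root of the
  Gram determinant (Leibniz formula).\<close>

definition wedge_norm :: "'a::euclidean_space list \<Rightarrow> real" where
  "wedge_norm vs = sqrt (\<Sum>p | p permutes {..<length vs}.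
     of_int (sign p) * (\<Prod>i<length vs. vs ! i \<bullet> vs ! p i))"

definition comass :: "nat \<Rightarrow> ('a::euclidean_space list \<Rightarrow> real) \<Rightarrow> ereal" where
  "comass m \<phi> = (SUP vs \<in> {vs. length vs = m \<and> wedge_norm vs \<le> 1}. ereal \<bar>\<phi> vs\<bar>)"

definition partial_deriv :: "'a::euclidean_space \<Rightarrow> ('a \<Rightarrow> real) \<Rightarrow> 'a \<Rightarrow> real" where
  "partial_deriv b f x = frechet_derivative f (at x) b"

text \<open>\<^term>\<open>foldr partial_deriv bs f\<close> is the iterated partial derivative of \<open>f\<close> along the list
  \<open>bs\<close> of basis vectors.\<close>

definition smooth :: "('a::euclidean_space \<Rightarrow> real) \<Rightarrow> bool" where
  "smooth f \<longleftrightarrow> (\<forall>bs\<in>lists Basis. \<forall>x. foldr partial_deriv bs f differentiable (at x))"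

type_synonym 'a form = "'a \<Rightarrow> 'a list \<Rightarrow> real"

definition smooth_forms :: "nat \<Rightarrow> 'a::euclidean_space form set" where
  "smooth_forms m = {\<omega>. (\<forall>x. \<omega> x \<in> covectors m) \<and> (\<forall>vs. smooth (\<lambda>x. \<omega> x vs))}"

text \<open>The usual Frechet topology: uniform convergence on compact sets of all partial derivatives
  of all components.\<close>

definition form_topology :: "nat \<Rightarrow> 'a::euclidean_space form topology" where
  "form_topology m = topology_generated_by
     {{\<eta> \<in> smooth_forms m. \<forall>x\<in>C. \<bar>foldr partial_deriv bs (\<lambda>y. \<eta> y vs) x
                                - foldr partial_deriv bs (\<lambda>y. \<omega> y vs) x\<bar> < \<epsilon>}
      | \<omega> C bs vs \<epsilon>. \<omega> \<in> smooth_forms m \<and> compact C \<and> bs \<in> lists Basis \<and> length vs = m \<and> \<epsilon> > 0}"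

text \<open>\<open>d\<omega>(x)(v\<^sub>0,\<dots>,v\<^sub>m) = \<Sum>\<^sub>i (-1)\<^sup>i D(\<omega>(\<cdot>)(v\<^sub>0,\<dots>,v\<^sub>m without v\<^sub>i))(x)(v\<^sub>i)\<close>\<close>

definition ext_deriv :: "'a::euclidean_space form \<Rightarrow> 'a form" where
  "ext_deriv \<omega> x vs = (\<Sum>i<length vs. (-1) ^ i *
     frechet_derivative (\<lambda>y. \<omega> y (take i vs @ drop (Suc i) vs)) (at x) (vs ! i))"

definition form_norm :: "nat \<Rightarrow> 'a::euclidean_space form \<Rightarrow> ereal" where
  "form_norm m \<omega> = (SUP x. comass m (\<omega> x))"


section \<open>Currents\<close>

type_synonym 'a current = "'a form \<Rightarrow> real"

definition currents :: "nat \<Rightarrow> 'a::euclidean_space current set" where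
  "currents m = {T. linear_on (smooth_forms m) T \<and>
     continuous_map (form_topology m) euclideanreal T \<and> (\<forall>\<omega>. \<omega> \<notin> smooth_forms m \<longrightarrow> T \<omega> = 0)}"

text \<open>The boundary of an \<open>m\<close>-current; only used for \<open>m \<ge> 1\<close>.\<close>

definition boundary :: "nat \<Rightarrow> 'a::euclidean_space current \<Rightarrow> 'a current" where
  "boundary m T = (\<lambda>\<omega>. if \<omega> \<in> smooth_forms (m - 1) then T (ext_deriv \<omega>) else 0)"

definition form_support :: "'a::euclidean_space form \<Rightarrow> 'a set" where
  "form_support \<omega> = closure {x. \<omega> x \<noteq> 0}"

definition spt :: "nat \<Rightarrow> 'a::euclidean_space current \<Rightarrow> 'a set" where
  "spt m T = - \<Union> {U. open U \<and>
     (\<forall>\<omega>\<in>smooth_forms m. compact (form_support \<omega>) \<and> form_support \<omega> \<subseteq> U \<longrightarrow> T \<omega> = 0)}"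

definition mass :: "nat \<Rightarrow> 'a::euclidean_space current \<Rightarrow> ereal" where
  "mass m T = (SUP \<omega> \<in> {\<omega> \<in> smooth_forms m. form_norm m \<omega> \<le> 1}. ereal (T \<omega>))"

definition normal_mass :: "nat \<Rightarrow> 'a::euclidean_space current \<Rightarrow> ereal" where
  "normal_mass m T = (if m = 0 then mass m T else mass m T + mass (m - 1) (boundary m T))"

definition normal_currents :: "nat \<Rightarrow> 'a::euclidean_space current set" where
  "normal_currents m = {T \<in> currents m. normal_mass m T < \<infinity>}"

definition normal_currents_in :: "nat \<Rightarrow> 'a::euclidean_space set \<Rightarrow> 'a current set" where
  "normal_currents_in m K = {T \<in> normal_currents m. spt m T \<subseteq> K}"

definition normal_norm :: "nat \<Rightarrow> 'a::euclidean_space current \<Rightarrow> real" where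
  "normal_norm m T = real_of_ereal (normal_mass m T)"

text \<open>The flat norm of normal currents; its extension to all flat currents is \<open>flat_norm\<close> below.\<close>

definition normal_flat_norm :: "nat \<Rightarrow> 'a::euclidean_space current \<Rightarrow> real" where
  "normal_flat_norm m T = Sup {T \<omega> | \<omega>. \<omega> \<in> smooth_forms m \<and>
     max (form_norm m \<omega>) (form_norm (Suc m) (ext_deriv \<omega>)) \<le> 1}"

definition flat_approx :: "nat \<Rightarrow> (nat \<Rightarrow> 'a::euclidean_space current) \<Rightarrow> 'a current \<Rightarrow> bool" where
  "flat_approx m S T \<longleftrightarrow>
     (\<forall>n. S n \<in> normal_currents m) \<and> Cauchy_wrt (normal_flat_norm m) S \<and>
     compact (closure (\<Union>n. spt m (S n))) \<and>
     (\<forall>\<omega>\<in>smooth_forms m. (\<lambda>n. S n \<omega>) \<longlonglongrightarrow> T \<omega>)"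

definition flat_currents :: "nat \<Rightarrow> 'a::euclidean_space current set" where
  "flat_currents m = {T \<in> currents m. \<exists>S. flat_approx m S T}"

definition flat_norm :: "nat \<Rightarrow> 'a::euclidean_space current \<Rightarrow> real" where
  "flat_norm m T = (THE L. \<exists>S. flat_approx m S T \<and> (\<lambda>n. normal_flat_norm m (S n)) \<longlonglongrightarrow> L)"


section \<open>Fractional currents and fractional charges\<close>

text \<open>Since \<open>0 powr 0 = 0\<close>, the case \<open>\<alpha> = 1\<close>, \<open>T = 0\<close> gives \<open>0\<close>, as it would with \<open>0 powr 0 = 1\<close>
  because of the second factor.\<close>

definition interp :: "real \<Rightarrow> nat \<Rightarrow> 'a::euclidean_space current \<Rightarrow> real" where
  "interp \<alpha> m T = normal_norm m T powr (1 - \<alpha>) * normal_flat_norm m T powr \<alpha>"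

definition fractional_decomposition ::
  "real \<Rightarrow> nat \<Rightarrow> 'a::euclidean_space current \<Rightarrow> (nat \<Rightarrow> 'a current) \<Rightarrow> bool" where
  "fractional_decomposition \<alpha> m T S \<longleftrightarrow>
     (\<forall>k. S k \<in> normal_currents m) \<and>
     (\<exists>C. compact C \<and> (\<forall>k. spt m (S k) \<subseteq> C)) \<and>
     summable (\<lambda>k. interp \<alpha> m (S k)) \<and>
     (\<lambda>n. flat_norm m (T - (\<Sum>k<n. S k))) \<longlonglongrightarrow> 0"

definition fractional_currents :: "real \<Rightarrow> nat \<Rightarrow> 'a::euclidean_space current set" where
  "fractional_currents \<alpha> m = {T \<in> flat_currents m. \<exists>S. fractional_decomposition \<alpha> m T S}"

definition fractional_currents_in ::
  "real \<Rightarrow> nat \<Rightarrow> 'a::euclidean_space set \<Rightarrow> 'a current set" where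
  "fractional_currents_in \<alpha> m K = {T \<in> fractional_currents \<alpha> m. spt m T \<subseteq> K}"

definition fractional_norm :: "real \<Rightarrow> nat \<Rightarrow> 'a::euclidean_space current \<Rightarrow> real" where
  "fractional_norm \<alpha> m T = Inf {\<Sum>k. interp \<alpha> m (S k) | S. fractional_decomposition \<alpha> m T S}"

definition fractional_charges ::
  "real \<Rightarrow> nat \<Rightarrow> 'a::euclidean_space set \<Rightarrow> ('a current \<Rightarrow> real) set" where
  "fractional_charges \<alpha> m K = {\<omega>. linear_on (normal_currents_in m K) \<omega> \<and>
     (\<exists>C\<ge>0. \<forall>T\<in>normal_currents_in m K. \<bar>\<omega> T\<bar> \<le> C * interp \<alpha> m T) \<and>
     (\<forall>T. T \<notin> normal_currents_in m K \<longrightarrow> \<omega> T = 0)}"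

definition charge_norm ::
  "real \<Rightarrow> nat \<Rightarrow> 'a::euclidean_space set \<Rightarrow> ('a current \<Rightarrow> real) \<Rightarrow> real" where
  "charge_norm \<alpha> m K \<omega> =
     Inf {C. C \<ge> 0 \<and> (\<forall>T\<in>normal_currents_in m K. \<bar>\<omega> T\<bar> \<le> C * interp \<alpha> m T)}"

end

theory Submission
  imports Defs
begin

text \<open>A fractional current supported in \<open>K\<close> has, up to an arbitrarily small increase of the cost
  \<open>\<Sum> N(S\<^sub>k)\<^bsup>1-\<alpha>\<^esup>F(S\<^sub>k)\<^bsup>\<alpha>\<^esup>\<close>, a decomposition whose terms are themselves supported in
  \<open>K\<close>: push the terms \<open>S\<^sub>k\<close> forward by smooth non-expansive maps \<open>p\<^sub>i\<close> into \<open>K\<close>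
  (mollifications of the nearest point projection) and use the telescoping series
  \<open>T = p\<^sub>0\<^sub>#T + \<Sum>(p\<^sub>i\<^sub>+\<^sub>1\<^sub>#T - p\<^sub>i\<^sub>#T)\<close>, whose differences are cheap by the homotopy formula. A charge
  \<open>\<omega>\<close> then extends to fractional currents by \<open>\<omega>(T) = \<Sum> \<omega>(S\<^sub>k)\<close>. This does not depend on the
  decomposition: if \<open>\<Sum> S\<^sub>k = 0\<close>, then suitable finite partial sums have arbitrarily small
  \<open>N\<^bsup>1-\<alpha>\<^esup>F\<^bsup>\<alpha>\<^esup>\<close>. Conversely, a bounded functional on fractional currents is determined by its
  restriction to normal currents, since the tails of a decomposition tend to zero in norm, and
  this restriction is a charge because a normal current is a decomposition of itself.\<close>

subsection \<open>Smooth functions\<close>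

text \<open>Three obstacles shape the proof. The cost N^(1-\<alpha>) F^\<alpha> of a normal current
  need not be subadditive, and the sum of the N of the terms of a decomposition may diverge; so
  neither the vanishing of a charge on null series nor the cost of a pushed series follows termwise.
  Both are handled by treating finitely many terms through N and all others through the summable
  cost. Second, a smooth map into a convex set close to the nearest point projection generally moves
  the points of the set, and T itself has no finite N; that the push-forwards of T return to T is
  therefore read off from a normal approximant of T, tested on forms that are cut off near the set.
  Third, an isometry admits no lost constants. Hence the maps must be non-expansive, and comass is
  used as the bound of a covector by B times the product of the norms of its arguments, a condition
  that pullbacks by such maps keep with the same B.\<close>

lemma foldr_partial_snoc: "foldr partial_deriv (bs @ [b]) f = foldr partial_deriv bs (partial_deriv b f)"
  by simp

lemma smooth_iff:
  "smooth f \<longleftrightarrow> (\<forall>x. f differentiable (at x)) \<and> (\<forall>b\<in>Basis. smooth (partial_deriv b f))"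
proof
  assume s: "smooth f"
  have "foldr partial_deriv [] f differentiable (at x)" for x
    using s unfolding smooth_def by blast
  moreover have "smooth (partial_deriv b f)" if "b \<in> Basis" for b
    unfolding smooth_def
  proof (intro ballI allI)
    fix bs x assume "bs \<in> lists (Basis :: 'a set)"
    then have "bs @ [b] \<in> lists Basis" using that by simp
    then have "foldr partial_deriv (bs @ [b]) f differentiable (at x)"
      using s unfolding smooth_def by blast
    then show "foldr partial_deriv bs (partial_deriv b f) differentiable (at x)"
      by (simp add: foldr_partial_snoc)
  qed
  ultimately show "(\<forall>x. f differentiable (at x)) \<and> (\<forall>b\<in>Basis. smooth (partial_deriv b f))" by simp
next
  assume r: "(\<forall>x. f differentiable (at x)) \<and> (\<forall>b\<in>Basis. smooth (partial_deriv b f))"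
  show "smooth f" unfolding smooth_def
  proof (intro ballI allI)
    fix bs x assume bs: "bs \<in> lists (Basis :: 'a set)"
    show "foldr partial_deriv bs f differentiable (at x)"
    proof (cases bs rule: rev_exhaust)
      case Nil then show ?thesis using r by simp
    next
      case (snoc bs' b)
      then have "b \<in> Basis" "bs' \<in> lists Basis" using bs by auto
      then have "foldr partial_deriv bs' (partial_deriv b f) differentiable (at x)"
        using r unfolding smooth_def by blast
      then show ?thesis by (simp add: snoc)
    qed
  qed
qed

text \<open>The tool behind all closure results: one guesses a class of differentiable functions
  stable under \<open>partial_deriv\<close>, and induction on the list of directions never leaves
  it.\<close>

lemma smooth_coinduct:
  assumes "P f"
    and "\<And>f x. P f \<Longrightarrow> f differentiable (at x)"
    and "\<And>f b. P f \<Longrightarrow> b \<in> Basis \<Longrightarrow> P (partial_deriv b f)"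
  shows "smooth f"
  unfolding smooth_def
proof (intro ballI allI)
  fix bs x assume "bs \<in> lists (Basis :: 'a set)"
  then have "P (foldr partial_deriv bs f)"
    by (induction bs) (auto intro: assms)
  then show "foldr partial_deriv bs f differentiable (at x)" by (rule assms(2))
qed

lemma smooth_differentiable: "smooth f \<Longrightarrow> f differentiable (at x)"
  using smooth_iff by blast

lemma smooth_partial: "smooth f \<Longrightarrow> b \<in> Basis \<Longrightarrow> smooth (partial_deriv b f)"
  using smooth_iff by blast

lemma smooth_has_derivative:
  "smooth f \<Longrightarrow> (f has_derivative frechet_derivative f (at x)) (at x)"
  using smooth_differentiable frechet_derivative_works by blast

lemma smooth_continuous_on: "smooth f \<Longrightarrow> continuous_on S f"
  by (meson continuous_at_imp_continuous_on differentiable_imp_continuous_within smooth_differentiable)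

lemma has_derivative_partial_deriv:
  "(f has_derivative f') (at x) \<Longrightarrow> partial_deriv b f x = f' b"
  unfolding partial_deriv_def by (simp add: frechet_derivative_at[symmetric])

lemma linear_sum_Basis:
  fixes f :: "'a::euclidean_space \<Rightarrow> 'b::real_vector"
  assumes "linear f" shows "f v = (\<Sum>b\<in>Basis. (v \<bullet> b) *\<^sub>R f b)"
proof -
  have "f v = f (\<Sum>b\<in>Basis. (v \<bullet> b) *\<^sub>R b)" by (simp add: euclidean_representation)
  also have "\<dots> = (\<Sum>b\<in>Basis. (v \<bullet> b) *\<^sub>R f b)"
    using assms by (simp add: linear_sum linear_scale)
  finally show ?thesis .
qed

lemma frechet_derivative_linear_smooth: "smooth f \<Longrightarrow> linear (frechet_derivative f (at x))"
  using smooth_differentiable linear_frechet_derivative by blast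

lemma frechet_derivative_partial:
  "smooth f \<Longrightarrow> frechet_derivative f (at x) v = (\<Sum>b\<in>Basis. (v \<bullet> b) * partial_deriv b f x)"
  unfolding partial_deriv_def
  by (subst linear_sum_Basis[OF frechet_derivative_linear_smooth]) auto

lemma partial_deriv_const [simp]: "partial_deriv b (\<lambda>x. c) = (\<lambda>x. 0)"
  by (auto simp: partial_deriv_def)

lemma smooth_const [simp]: "smooth (\<lambda>x. c)"
  by (rule smooth_coinduct[where P = "\<lambda>f. \<exists>c. f = (\<lambda>x. c)"]) auto

lemma smooth_linear:
  assumes "bounded_linear f" shows "smooth f"
proof (subst smooth_iff, intro conjI ballI allI)
  fix x show "f differentiable at x"
    by (rule bounded_linear_imp_differentiable[OF assms])
next
  fix b :: 'a
  have "partial_deriv b f = (\<lambda>x. f b)"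
    by (rule ext, rule has_derivative_partial_deriv, rule bounded_linear_imp_has_derivative, rule assms)
  then show "smooth (partial_deriv b f)" by simp
qed

text \<open>Chain, quotient and product rules produce sums of products of functions of the same
  kinds, so this class is stable under differentiation and \<open>smooth_coinduct\<close> applies to
  it. For \<open>inverse\<close> a smooth \<open>h\<close> suffices, since the derivative of 1/h is
  a product of a smooth function with two more copies of 1/h.\<close>

inductive smooth_over :: "('a::euclidean_space \<Rightarrow> 'b::euclidean_space) \<Rightarrow> ('a \<Rightarrow> real) \<Rightarrow> bool" for F where
  base: "smooth f \<Longrightarrow> smooth_over F f"
| comp: "smooth g \<Longrightarrow> smooth_over F (\<lambda>x. g (F x))"
| inverse: "smooth h \<Longrightarrow> (\<And>x. h x \<noteq> 0) \<Longrightarrow> smooth_over F (\<lambda>x. inverse (h x))"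
| add: "smooth_over F f \<Longrightarrow> smooth_over F g \<Longrightarrow> smooth_over F (\<lambda>x. f x + g x)"
| mult: "smooth_over F f \<Longrightarrow> smooth_over F g \<Longrightarrow> smooth_over F (\<lambda>x. f x * g x)"

lemma smooth_over_sum:
  assumes "finite A" "\<And>a. a \<in> A \<Longrightarrow> smooth_over F (f a)"
  shows "smooth_over F (\<lambda>x. \<Sum>a\<in>A. f a x)"
  using assms
proof (induction A)
  case empty
  then show ?case by (simp add: smooth_over.base)
next
  case (insert a A)
  then show ?case by (simp add: smooth_over.add)
qed

section \<open>Smooth maps between Euclidean spaces\<close>

definition vsmooth :: "('a::euclidean_space \<Rightarrow> 'b::euclidean_space) \<Rightarrow> bool" where
  "vsmooth F \<longleftrightarrow> (\<forall>c\<in>Basis. smooth (\<lambda>x. F x \<bullet> c))"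

lemma vsmooth_real [simp]: "vsmooth f \<longleftrightarrow> smooth f" for f :: "'a::euclidean_space \<Rightarrow> real"
  by (simp add: vsmooth_def)

lemma vsmooth_differentiable: "vsmooth F \<Longrightarrow> F differentiable (at x)"
  unfolding vsmooth_def
  by (subst differentiable_componentwise_within) (blast intro: smooth_differentiable)

lemma vsmooth_has_derivative:
  "vsmooth F \<Longrightarrow> (F has_derivative frechet_derivative F (at x)) (at x)"
  using vsmooth_differentiable frechet_derivative_works by blast

lemma vsmooth_continuous_on: "vsmooth F \<Longrightarrow> continuous_on S F"
  by (meson continuous_at_imp_continuous_on differentiable_imp_continuous_within vsmooth_differentiable)

lemma frechet_derivative_inner:
  assumes "vsmooth F"
  shows "frechet_derivative (\<lambda>x. F x \<bullet> c) (at x) v = frechet_derivative F (at x) v \<bullet> c"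
proof -
  have "((\<lambda>x. F x \<bullet> c) has_derivative (\<lambda>v. frechet_derivative F (at x) v \<bullet> c)) (at x)"
    using vsmooth_has_derivative[OF assms] by (rule has_derivative_inner_left)
  then show ?thesis by (simp add: frechet_derivative_at[symmetric])
qed

lemma frechet_derivative_comp:
  fixes F :: "'a::euclidean_space \<Rightarrow> 'b::euclidean_space" and g :: "'b \<Rightarrow> 'c::euclidean_space"
  assumes "vsmooth g" "vsmooth F"
  shows "frechet_derivative (\<lambda>x. g (F x)) (at x) v = frechet_derivative g (at (F x)) (frechet_derivative F (at x) v)"
proof -
  have "((\<lambda>x. g (F x)) has_derivative (\<lambda>v. frechet_derivative g (at (F x)) (frechet_derivative F (at x) v))) (at x)"
    by (rule has_derivative_compose[OF vsmooth_has_derivative[OF assms(2)] vsmooth_has_derivative[OF assms(1)]])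
  then show ?thesis by (simp add: frechet_derivative_at[symmetric])
qed

lemma smooth_over_differentiable:
  assumes "vsmooth F" "smooth_over F f" shows "f differentiable (at x)"
  using assms(2)
proof induction
  case (comp g)
  then show ?case
    using differentiable_chain_at[OF vsmooth_differentiable[OF assms(1)] smooth_differentiable[of g]]
    by (simp add: o_def)
qed (auto intro: smooth_differentiable differentiable_inverse)

lemma smooth_over_partial:
  assumes F: "vsmooth F" and "smooth_over F f" "b \<in> Basis" shows "smooth_over F (partial_deriv b f)"
  using assms(2)
proof induction
  case (base f)
  then show ?case using smooth_partial assms smooth_over.base by blast
next
  case (comp g)
  have "partial_deriv b (\<lambda>x. g (F x)) x = (\<Sum>c\<in>Basis. partial_deriv b (\<lambda>x. F x \<bullet> c) x * partial_deriv c g (F x))" for x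
  proof -
    have "partial_deriv b (\<lambda>x. g (F x)) x = frechet_derivative g (at (F x)) (frechet_derivative F (at x) b)"
      unfolding partial_deriv_def using comp F by (intro frechet_derivative_comp) auto
    also have "\<dots> = (\<Sum>c\<in>Basis. (frechet_derivative F (at x) b \<bullet> c) * partial_deriv c g (F x))"
      by (rule frechet_derivative_partial[OF comp])
    finally show ?thesis by (simp add: partial_deriv_def frechet_derivative_inner[OF F])
  qed
  then have *: "partial_deriv b (\<lambda>x. g (F x)) = (\<lambda>x. \<Sum>c\<in>Basis. partial_deriv b (\<lambda>x. F x \<bullet> c) x * partial_deriv c g (F x))"
    by blast
  show ?case unfolding *
    by (intro smooth_over_sum smooth_over.mult finite_Basis smooth_over.base smooth_over.comp[of "partial_deriv c g" for c]
      smooth_partial comp assms(3)) (use F in \<open>auto simp: vsmooth_def\<close>)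
next
  case (inverse h)
  have *: "partial_deriv b (\<lambda>x. inverse (h x)) = (\<lambda>x. (-1) * (partial_deriv b h x * (inverse (h x) * inverse (h x))))"
  proof
    fix x
    have "((\<lambda>x. inverse (h x)) has_derivative (\<lambda>v. - (inverse (h x) * frechet_derivative h (at x) v * inverse (h x)))) (at x)"
      by (rule Deriv.has_derivative_inverse[OF inverse(2) smooth_has_derivative[OF inverse(1)]])
    then have "partial_deriv b (\<lambda>x. inverse (h x)) x = - (inverse (h x) * frechet_derivative h (at x) b * inverse (h x))"
      by (rule has_derivative_partial_deriv)
    then show "partial_deriv b (\<lambda>x. inverse (h x)) x = (-1) * (partial_deriv b h x * (inverse (h x) * inverse (h x)))"
      by (simp add: partial_deriv_def)
  qed
  show ?case unfolding *
    by (intro smooth_over.mult smooth_over.inverse inverse smooth_over.base smooth_partial assms smooth_const)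
next
  case (add f g)
  have *: "partial_deriv b (\<lambda>x. f x + g x) = (\<lambda>x. partial_deriv b f x + partial_deriv b g x)"
  proof
    fix x
    have "((\<lambda>x. f x + g x) has_derivative (\<lambda>v. frechet_derivative f (at x) v + frechet_derivative g (at x) v)) (at x)"
      using smooth_over_differentiable[OF F add(1)] smooth_over_differentiable[OF F add(2)]
      unfolding frechet_derivative_works by (intro has_derivative_add)
    then show "partial_deriv b (\<lambda>x. f x + g x) x = partial_deriv b f x + partial_deriv b g x"
      by (subst has_derivative_partial_deriv) (auto simp: partial_deriv_def)
  qed
  show ?case unfolding * using add by (intro smooth_over.add)
next
  case (mult f g)
  have *: "partial_deriv b (\<lambda>x. f x * g x) = (\<lambda>x. f x * partial_deriv b g x + partial_deriv b f x * g x)"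
  proof
    fix x
    have "((\<lambda>x. f x * g x) has_derivative (\<lambda>v. f x * frechet_derivative g (at x) v + frechet_derivative f (at x) v * g x)) (at x)"
      using smooth_over_differentiable[OF F mult(1)] smooth_over_differentiable[OF F mult(2)]
      unfolding frechet_derivative_works by (intro has_derivative_mult)
    then show "partial_deriv b (\<lambda>x. f x * g x) x = f x * partial_deriv b g x + partial_deriv b f x * g x"
      by (subst has_derivative_partial_deriv) (auto simp: partial_deriv_def)
  qed
  show ?case unfolding * using mult by (intro smooth_over.add smooth_over.mult)
qed

lemma smooth_over_smooth: "vsmooth F \<Longrightarrow> smooth_over F f \<Longrightarrow> smooth f"
  by (rule smooth_coinduct[where P = "smooth_over F"]) (auto intro: smooth_over_differentiable smooth_over_partial)

lemma smooth_compose: "smooth g \<Longrightarrow> vsmooth F \<Longrightarrow> smooth (\<lambda>x. g (F x))"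
  by (rule smooth_over_smooth[of F], assumption, rule smooth_over.comp)

text \<open>Only the arithmetic rules of \<open>smooth_over\<close> matter here; the constant map is
  a dummy for the inner function.\<close>

lemma smooth_add: "smooth f \<Longrightarrow> smooth g \<Longrightarrow> smooth (\<lambda>x. f x + g x)"
  by (rule smooth_over_smooth[of "\<lambda>x. 0::real"]) (simp, intro smooth_over.add smooth_over.base)

lemma smooth_mult: "smooth f \<Longrightarrow> smooth g \<Longrightarrow> smooth (\<lambda>x. f x * g x)"
  by (rule smooth_over_smooth[of "\<lambda>x. 0::real"]) (simp, intro smooth_over.mult smooth_over.base)

lemma smooth_inverse: "smooth f \<Longrightarrow> (\<And>x. f x \<noteq> 0) \<Longrightarrow> smooth (\<lambda>x. inverse (f x))"
  by (rule smooth_over_smooth[of "\<lambda>x. 0::real"], simp, rule smooth_over.inverse)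

lemma smooth_minus: "smooth f \<Longrightarrow> smooth (\<lambda>x. - f x)"
  using smooth_mult[of "\<lambda>x. -1" f] by simp

lemma smooth_diff: "smooth f \<Longrightarrow> smooth g \<Longrightarrow> smooth (\<lambda>x. f x - g x)"
  using smooth_add[of f "\<lambda>x. - g x"] smooth_minus[of g] by simp

lemma smooth_sum: "(\<And>a. a \<in> A \<Longrightarrow> smooth (f a)) \<Longrightarrow> smooth (\<lambda>x. \<Sum>a\<in>A. f a x)"
  by (induction A rule: infinite_finite_induct) (auto intro: smooth_add)

lemma vsmooth_linear: "bounded_linear F \<Longrightarrow> vsmooth F"
  unfolding vsmooth_def by (auto intro!: smooth_linear bounded_linear_inner_left_comp)

lemma vsmooth_const [simp]: "vsmooth (\<lambda>x. c)"
  by (simp add: vsmooth_def)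

lemma vsmooth_id [simp]: "vsmooth (\<lambda>x. x)"
  by (simp add: vsmooth_linear bounded_linear_ident)

lemma vsmooth_inner: "vsmooth F \<Longrightarrow> smooth (\<lambda>x. F x \<bullet> c)"
  using smooth_compose[OF smooth_linear[OF bounded_linear_inner_left]] .

lemma vsmooth_add: "vsmooth F \<Longrightarrow> vsmooth G \<Longrightarrow> vsmooth (\<lambda>x. F x + G x)"
  by (auto simp: vsmooth_def inner_add_left intro!: smooth_add)

lemma vsmooth_scale: "smooth c \<Longrightarrow> vsmooth F \<Longrightarrow> vsmooth (\<lambda>x. c x *\<^sub>R F x)"
  by (auto simp: vsmooth_def intro!: smooth_mult)

lemma vsmooth_diff: "vsmooth F \<Longrightarrow> vsmooth G \<Longrightarrow> vsmooth (\<lambda>x. F x - G x)"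
  by (auto simp: vsmooth_def inner_diff_left intro!: smooth_diff)

lemma vsmooth_compose: "vsmooth G \<Longrightarrow> vsmooth F \<Longrightarrow> vsmooth (\<lambda>x. G (F x))"
  by (auto simp: vsmooth_def[of "\<lambda>x. G (F x)"] intro!: smooth_compose[of "\<lambda>y. G y \<bullet> c" for c] vsmooth_inner[of G])

lemma smooth_norm_sq:
  assumes "vsmooth F" shows "smooth (\<lambda>x. (norm (F x))\<^sup>2)"
proof -
  have "(\<lambda>x. (norm (F x))\<^sup>2) = (\<lambda>x. \<Sum>c\<in>Basis. (F x \<bullet> c) * (F x \<bullet> c))"
    by (auto simp: power2_norm_eq_inner euclidean_inner[of "F x" "F x" for x])
  then show ?thesis using vsmooth_inner[OF assms] by (auto intro!: smooth_sum smooth_mult)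
qed

lemma smooth_frechet_derivative: "smooth f \<Longrightarrow> smooth (\<lambda>x. frechet_derivative f (at x) v)"
  by (auto simp: frechet_derivative_partial intro!: smooth_sum smooth_mult smooth_partial)

lemma vsmooth_frechet_derivative:
  assumes "vsmooth F" shows "vsmooth (\<lambda>x. frechet_derivative F (at x) v)"
  using smooth_frechet_derivative[OF vsmooth_inner[OF assms]]
  by (auto simp: vsmooth_def frechet_derivative_inner[OF assms])

section \<open>Locality of derivatives and symmetry of second derivatives\<close>

lemma frechet_derivative_cong_open:
  assumes "open U" "\<And>x. x \<in> U \<Longrightarrow> f x = g x" "x \<in> U"
  shows "frechet_derivative f (at x) = frechet_derivative g (at x)"
proof -
  have "(f has_derivative D) (at x) \<longleftrightarrow> (g has_derivative D) (at x)" for D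
  proof
    assume "(f has_derivative D) (at x)"
    then show "(g has_derivative D) (at x)"
      by (rule has_derivative_transform_within_open[OF _ assms(1,3)]) (simp add: assms(2))
  next
    assume "(g has_derivative D) (at x)"
    then show "(f has_derivative D) (at x)"
      by (rule has_derivative_transform_within_open[OF _ assms(1,3)]) (simp add: assms(2))
  qed
  then show ?thesis by (simp add: frechet_derivative_def)
qed

lemma foldr_partial_cong_near:
  assumes "open U" "\<And>x. x \<in> U \<Longrightarrow> f x = g x" "x \<in> U"
  shows "foldr partial_deriv bs f x = foldr partial_deriv bs g x"
  using assms(3)
proof (induction bs arbitrary: x)
  case Nil
  then show ?case using assms by simp
next
  case (Cons b bs)
  then show ?case
    using frechet_derivative_cong_open[OF assms(1) Cons.IH] by (simp add: partial_deriv_def)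
qed

text \<open>Used for the mollification, where the domain of integration can be kept fixed only near
  a given point.\<close>

lemma smooth_local:
  assumes "\<And>x. \<exists>U g. open U \<and> x \<in> U \<and> smooth g \<and> (\<forall>y\<in>U. f y = g y)"
  shows "smooth f"
  unfolding smooth_def
proof (intro ballI allI)
  fix bs x assume bs: "bs \<in> lists (Basis :: 'a set)"
  obtain U g where U: "open U" "x \<in> U" "smooth g" "\<forall>y\<in>U. f y = g y" using assms by blast
  have "foldr partial_deriv bs g differentiable (at x)" using U bs by (auto simp: smooth_def)
  then obtain D where "(foldr partial_deriv bs g has_derivative D) (at x)" by (auto simp: differentiable_def)
  then have "(foldr partial_deriv bs f has_derivative D) (at x)"
    by (rule has_derivative_transform_within_open[OF _ U(1,2)])
      (use U foldr_partial_cong_near[of U f g] in auto)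
  then show "foldr partial_deriv bs f differentiable (at x)" by (auto simp: differentiable_def)
qed

lemma smooth_line_derivative:
  assumes "smooth f"
  shows "((\<lambda>s. f (y + s *\<^sub>R u)) has_real_derivative partial_deriv u f (y + s *\<^sub>R u)) (at s)"
proof -
  have "((\<lambda>s. y + s *\<^sub>R u) has_derivative (\<lambda>h. h *\<^sub>R u)) (at s)"
    by (auto intro!: derivative_eq_intros)
  from has_derivative_compose[OF this smooth_has_derivative[OF assms]]
  have "((\<lambda>s. f (y + s *\<^sub>R u)) has_derivative (\<lambda>h. frechet_derivative f (at (y + s *\<^sub>R u)) (h *\<^sub>R u))) (at s)" .
  also have "(\<lambda>h. frechet_derivative f (at (y + s *\<^sub>R u)) (h *\<^sub>R u)) = (\<lambda>h. partial_deriv u f (y + s *\<^sub>R u) * h)"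
    using linear_scale[OF frechet_derivative_linear_smooth[OF assms]]
    by (auto simp: partial_deriv_def)
  finally show ?thesis by (simp add: has_field_derivative_def)
qed

lemma smooth_partial_any: "smooth f \<Longrightarrow> smooth (partial_deriv v f)"
  using smooth_frechet_derivative[of f v] by (simp add: partial_deriv_def[abs_def])

text \<open>The mean value theorem is applied twice, first along u to the difference in direction v,
  then along v. The left-hand side is symmetric under exchanging (s, u) with (t, v), which the
  right-hand side is not on its face.\<close>

lemma second_difference:
  assumes "smooth f" "0 < s" "0 < t"
  shows "\<exists>\<xi> \<eta>. 0 < \<xi> \<and> \<xi> < s \<and> 0 < \<eta> \<and> \<eta> < t \<and>
    f (x + s *\<^sub>R u + t *\<^sub>R v) - f (x + s *\<^sub>R u) - f (x + t *\<^sub>R v) + f x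
      = s * t * partial_deriv v (partial_deriv u f) (x + \<xi> *\<^sub>R u + \<eta> *\<^sub>R v)"
proof -
  define g where "g \<sigma> = f ((x + t *\<^sub>R v) + \<sigma> *\<^sub>R u) - f (x + \<sigma> *\<^sub>R u)" for \<sigma>
  have dg: "(g has_real_derivative (partial_deriv u f ((x + t *\<^sub>R v) + \<sigma> *\<^sub>R u) - partial_deriv u f (x + \<sigma> *\<^sub>R u))) (at \<sigma>)" for \<sigma>
    unfolding g_def by (intro DERIV_diff smooth_line_derivative assms)
  then obtain \<xi> where \<xi>: "0 < \<xi>" "\<xi> < s"
    "g s - g 0 = (s - 0) * (partial_deriv u f ((x + t *\<^sub>R v) + \<xi> *\<^sub>R u) - partial_deriv u f (x + \<xi> *\<^sub>R u))"
    using MVT2[OF assms(2) dg] by auto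
  define h where "h \<tau> = partial_deriv u f ((x + \<xi> *\<^sub>R u) + \<tau> *\<^sub>R v)" for \<tau>
  have dh: "(h has_real_derivative (partial_deriv v (partial_deriv u f) ((x + \<xi> *\<^sub>R u) + \<tau> *\<^sub>R v))) (at \<tau>)" for \<tau>
    unfolding h_def by (intro smooth_line_derivative smooth_partial_any assms)
  then obtain \<eta> where \<eta>: "0 < \<eta>" "\<eta> < t"
    "h t - h 0 = (t - 0) * (partial_deriv v (partial_deriv u f) ((x + \<xi> *\<^sub>R u) + \<eta> *\<^sub>R v))"
    using MVT2[OF assms(3) dh] by auto
  have "g s - g 0 = s * (h t - h 0)"
    using \<xi>(3) by (simp add: h_def algebra_simps)
  then show ?thesis
    using \<xi>(1,2) \<eta> by (intro exI[of _ \<xi>] exI[of _ \<eta>]) (simp add: g_def algebra_simps)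
qed

text \<open>The second difference over one small square equals both mixed derivatives at
  intermediate points; continuity of both at x then excludes different values at x.\<close>

lemma partial_deriv_commute:
  assumes "smooth f"
  shows "partial_deriv u (partial_deriv v f) x = partial_deriv v (partial_deriv u f) x"
proof (rule ccontr)
  let ?A = "partial_deriv u (partial_deriv v f)" and ?B = "partial_deriv v (partial_deriv u f)"
  assume ne: "?A x \<noteq> ?B x"
  define e where "e = \<bar>?A x - ?B x\<bar> / 2"
  have e: "e > 0" using ne by (simp add: e_def)
  have "continuous (at x) ?A" "continuous (at x) ?B"
    using assms by (simp_all add: differentiable_imp_continuous_within smooth_differentiable smooth_partial_any)
  then obtain d1 d2 where d: "d1 > 0" "d2 > 0" "\<And>y. dist y x < d1 \<Longrightarrow> dist (?A y) (?A x) < e"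
    "\<And>y. dist y x < d2 \<Longrightarrow> dist (?B y) (?B x) < e"
    using e unfolding continuous_at_eps_delta by metis
  \<comment> \<open>With this side length every intermediate point of the square stays within both
    continuity radii, see \<open>near\<close>.\<close>
  define s where "s = min d1 d2 / (norm u + norm v + 1)"
  have s: "s > 0" unfolding s_def using d by (auto intro!: divide_pos_pos add_nonneg_pos)
  have sm: "s * (norm u + norm v + 1) = min d1 d2"
    unfolding s_def using norm_ge_zero[of u] norm_ge_zero[of v] by (simp add: field_simps del: norm_ge_zero)
  have near: "dist (x + \<xi> *\<^sub>R a + \<eta> *\<^sub>R b) x < min d1 d2"
    if "0 < \<xi>" "\<xi> < s" "0 < \<eta>" "\<eta> < s" "norm a + norm b = norm u + norm v" for \<xi> \<eta> a b
  proof -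
    have "norm (\<xi> *\<^sub>R a + \<eta> *\<^sub>R b) \<le> \<xi> * norm a + \<eta> * norm b"
      using that norm_triangle_ineq[of "\<xi> *\<^sub>R a" "\<eta> *\<^sub>R b"] by simp
    also have "\<dots> \<le> s * norm a + s * norm b"
      using that by (intro add_mono mult_right_mono) auto
    also have "\<dots> = s * (norm u + norm v)" using that(5) by (simp add: distrib_left[symmetric])
    also have "\<dots> < s * (norm u + norm v + 1)" using s by simp
    finally show ?thesis using sm by (simp add: dist_norm add.assoc)
  qed
  obtain \<xi> \<eta> where 1: "0 < \<xi>" "\<xi> < s" "0 < \<eta>" "\<eta> < s"
    "f (x + s *\<^sub>R u + s *\<^sub>R v) - f (x + s *\<^sub>R u) - f (x + s *\<^sub>R v) + f x
      = s * s * ?B (x + \<xi> *\<^sub>R u + \<eta> *\<^sub>R v)"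
    using second_difference[OF assms s s] by blast
  obtain \<xi>' \<eta>' where 2: "0 < \<xi>'" "\<xi>' < s" "0 < \<eta>'" "\<eta>' < s"
    "f (x + s *\<^sub>R v + s *\<^sub>R u) - f (x + s *\<^sub>R v) - f (x + s *\<^sub>R u) + f x
      = s * s * ?A (x + \<xi>' *\<^sub>R v + \<eta>' *\<^sub>R u)"
    using second_difference[OF assms s s] by blast
  have "s * s * ?A (x + \<xi>' *\<^sub>R v + \<eta>' *\<^sub>R u) = s * s * ?B (x + \<xi> *\<^sub>R u + \<eta> *\<^sub>R v)"
  proof -
    have "x + s *\<^sub>R v + s *\<^sub>R u = x + s *\<^sub>R u + s *\<^sub>R v" by simp
    then have "f (x + s *\<^sub>R v + s *\<^sub>R u) - f (x + s *\<^sub>R v) - f (x + s *\<^sub>R u) + f x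
      = f (x + s *\<^sub>R u + s *\<^sub>R v) - f (x + s *\<^sub>R u) - f (x + s *\<^sub>R v) + f x"
      by (simp only: algebra_simps)
    then show ?thesis unfolding 1(5) 2(5) .
  qed
  then have eq: "?A (x + \<xi>' *\<^sub>R v + \<eta>' *\<^sub>R u) = ?B (x + \<xi> *\<^sub>R u + \<eta> *\<^sub>R v)"
    using s by simp
  have "dist (?A (x + \<xi>' *\<^sub>R v + \<eta>' *\<^sub>R u)) (?A x) < e"
    using near[OF 2(1-4), of v u] by (intro d(3)) (auto simp: add.commute)
  moreover have "dist (?B (x + \<xi> *\<^sub>R u + \<eta> *\<^sub>R v)) (?B x) < e"
    using near[OF 1(1-4), of u v] by (intro d(4)) auto
  ultimately have "\<bar>?A x - ?B x\<bar> < e + e"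
    unfolding eq dist_real_def abs_diff_less_iff by linarith
  then show False by (simp add: e_def)
qed

subsection \<open>Integrals depending on a parameter\<close>

lemma smooth_integral_aux:
  fixes k :: "'a::euclidean_space \<Rightarrow> 'b::euclidean_space \<Rightarrow> real"
  assumes sm: "\<And>y. smooth (\<lambda>x. k x y)"
    and cont: "\<And>bs. bs \<in> lists Basis \<Longrightarrow>
      continuous_on (UNIV \<times> cbox a b) (\<lambda>(x, y). foldr partial_deriv bs (\<lambda>x. k x y) x)"
  shows "((\<lambda>x. integral (cbox a b) (k x)) has_derivative
      (\<lambda>v. integral (cbox a b) (\<lambda>y. frechet_derivative (\<lambda>x. k x y) (at x) v))) (at x)"
proof -
  \<comment> \<open>Leibniz' rule asks for the derivative as a jointly continuous map into the
    bounded linear functionals, so it is assembled from the partial derivatives.\<close>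
  define fx where "fx x y = (\<Sum>i\<in>Basis. partial_deriv i (\<lambda>x. k x y) x *\<^sub>R blinfun_inner_left i)" for x y
  have fx: "blinfun_apply (fx x y) = frechet_derivative (\<lambda>x. k x y) (at x)" for x y
    by (rule ext) (simp add: fx_def blinfun.bilinear_simps blinfun.sum_left frechet_derivative_partial[OF sm]
      inner_commute mult.commute)
  have c0: "continuous_on (UNIV \<times> cbox a b) (\<lambda>(x, y). k x y)"
    using cont[of "[]"] by simp
  have c1: "continuous_on (UNIV \<times> cbox a b) (\<lambda>(x, y). fx x y)"
    unfolding fx_def split_beta
    by (intro continuous_intros) (use cont[of "[i]" for i] in \<open>simp add: split_beta\<close>)
  have slice: "continuous_on (cbox a b) (k x)" for x
    by (rule continuous_on_compose2[OF c0, of "cbox a b" "\<lambda>y. (x, y)", simplified])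
      (auto intro!: continuous_intros)
  have slice1: "continuous_on (cbox a b) (fx x)" for x
    by (rule continuous_on_compose2[OF c1, of "cbox a b" "\<lambda>y. (x, y)", simplified])
      (auto intro!: continuous_intros)
  have "((\<lambda>x. integral (cbox a b) (k x)) has_derivative integral (cbox a b) (fx x)) (at x within UNIV)"
  proof (rule leibniz_rule)
    show "\<And>x t. ((\<lambda>x. k x t) has_derivative blinfun_apply (fx x t)) (at x within UNIV)"
      unfolding fx using smooth_has_derivative[OF sm] by simp
  qed (auto intro!: integrable_continuous slice c1)
  moreover have "integral (cbox a b) (fx x) v = integral (cbox a b) (\<lambda>y. frechet_derivative (\<lambda>x. k x y) (at x) v)" for v
    using blinfun_apply_integral[OF integrable_continuous[OF slice1[of x]], of v] by (simp add: fx)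
  ultimately have "((\<lambda>x. integral (cbox a b) (k x)) has_derivative integral (cbox a b) (fx x)) (at x)"
    "blinfun_apply (integral (cbox a b) (fx x))
      = (\<lambda>v. integral (cbox a b) (\<lambda>y. frechet_derivative (\<lambda>x. k x y) (at x) v))" by auto
  then show ?thesis by metis
qed

text \<open>The class for the coinduction consists of parameter integrals whose integrands have
  jointly continuous derivatives of every order; differentiating under the integral replaces the
  kernel by one of its partial derivatives.\<close>

lemma smooth_integral:
  fixes k :: "'a::euclidean_space \<Rightarrow> 'b::euclidean_space \<Rightarrow> real"
  assumes sm: "\<And>y. smooth (\<lambda>x. k x y)"
    and cont: "\<And>bs. bs \<in> lists Basis \<Longrightarrow>
      continuous_on (UNIV \<times> cbox a b) (\<lambda>(x, y). foldr partial_deriv bs (\<lambda>x. k x y) x)"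
  shows "smooth (\<lambda>x. integral (cbox a b) (k x))"
proof (rule smooth_coinduct[where P = "\<lambda>f. \<exists>k. (\<forall>y. smooth (\<lambda>x. k x y)) \<and>
    (\<forall>bs\<in>lists Basis. continuous_on (UNIV \<times> cbox a b) (\<lambda>(x, y). foldr partial_deriv bs (\<lambda>x. k x y) x)) \<and>
    f = (\<lambda>x. integral (cbox a b) (k x))"])
  show "\<exists>k'. (\<forall>y. smooth (\<lambda>x. k' x y)) \<and>
    (\<forall>bs\<in>lists Basis. continuous_on (UNIV \<times> cbox a b) (\<lambda>(x, y). foldr partial_deriv bs (\<lambda>x. k' x y) x)) \<and>
    (\<lambda>x. integral (cbox a b) (k x)) = (\<lambda>x. integral (cbox a b) (k' x))"
    using assms by blast
next
  fix f :: "'a \<Rightarrow> real" and x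
  assume "\<exists>k. (\<forall>y. smooth (\<lambda>x. k x y)) \<and>
    (\<forall>bs\<in>lists Basis. continuous_on (UNIV \<times> cbox a b) (\<lambda>(x, y). foldr partial_deriv bs (\<lambda>x. k x y) x)) \<and>
    f = (\<lambda>x. integral (cbox a b) (k x))"
  then obtain k where k: "\<And>y. smooth (\<lambda>x. k x y)"
    "\<And>bs. bs\<in>lists Basis \<Longrightarrow> continuous_on (UNIV \<times> cbox a b) (\<lambda>(x, y). foldr partial_deriv bs (\<lambda>x. k x y) x)"
    "f = (\<lambda>x. integral (cbox a b) (k x))" by blast
  show "f differentiable (at x)"
    unfolding k(3) by (rule Derivative.differentiableI[OF smooth_integral_aux[OF k(1,2)]])
next
  fix f :: "'a \<Rightarrow> real" and i :: 'a
  assume "\<exists>k. (\<forall>y. smooth (\<lambda>x. k x y)) \<and>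
    (\<forall>bs\<in>lists Basis. continuous_on (UNIV \<times> cbox a b) (\<lambda>(x, y). foldr partial_deriv bs (\<lambda>x. k x y) x)) \<and>
    f = (\<lambda>x. integral (cbox a b) (k x))" and i: "i \<in> Basis"
  then obtain k where k: "\<And>y. smooth (\<lambda>x. k x y)"
    "\<And>bs. bs\<in>lists Basis \<Longrightarrow> continuous_on (UNIV \<times> cbox a b) (\<lambda>(x, y). foldr partial_deriv bs (\<lambda>x. k x y) x)"
    "f = (\<lambda>x. integral (cbox a b) (k x))" by blast
  have "partial_deriv i f = (\<lambda>x. integral (cbox a b) (\<lambda>y. partial_deriv i (\<lambda>x. k x y) x))"
    unfolding k(3) using has_derivative_partial_deriv[OF smooth_integral_aux[OF k(1,2)]]
    by (auto simp: partial_deriv_def)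
  moreover have "continuous_on (UNIV \<times> cbox a b) (\<lambda>(x, y). foldr partial_deriv bs (partial_deriv i (\<lambda>x. k x y)) x)"
    if "bs \<in> lists Basis" for bs
    using k(2)[of "bs @ [i]"] that i by simp
  ultimately show "\<exists>k. (\<forall>y. smooth (\<lambda>x. k x y)) \<and>
    (\<forall>bs\<in>lists Basis. continuous_on (UNIV \<times> cbox a b) (\<lambda>(x, y). foldr partial_deriv bs (\<lambda>x. k x y) x)) \<and>
    partial_deriv i f = (\<lambda>x. integral (cbox a b) (k x))"
    by (intro exI[of _ "\<lambda>x y. partial_deriv i (\<lambda>x. k x y) x"]) (auto intro: smooth_partial k(1) i)
qed

lemma frechet_derivative_integral:
  fixes k :: "'a::euclidean_space \<Rightarrow> 'b::euclidean_space \<Rightarrow> real"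
  assumes "\<And>y. smooth (\<lambda>x. k x y)"
    and "\<And>bs. bs \<in> lists Basis \<Longrightarrow>
      continuous_on (UNIV \<times> cbox a b) (\<lambda>(x, y). foldr partial_deriv bs (\<lambda>x. k x y) x)"
  shows "frechet_derivative (\<lambda>x. integral (cbox a b) (k x)) (at x) v
    = integral (cbox a b) (\<lambda>y. frechet_derivative (\<lambda>x. k x y) (at x) v)"
  by (subst frechet_derivative_at[OF smooth_integral_aux[OF assms], symmetric]) simp_all

subsection \<open>A smooth step\<close>

text \<open>With an arbitrary polynomial factor the family is closed under differentiation.\<close>

definition exp_bump :: "real poly \<Rightarrow> real \<Rightarrow> real" where
  "exp_bump p x = (if x > 0 then poly p (1 / x) * exp (- (1 / x)) else 0)"

lemma poly_exp_tendsto_0: "((\<lambda>y. poly p y * exp (- y)) \<longlongrightarrow> 0) at_top" for p :: "real poly"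
proof -
  have "((\<lambda>y. \<Sum>i\<le>degree p. coeff p i * (y ^ i / exp y)) \<longlongrightarrow> (\<Sum>i\<le>degree p. coeff p i * 0)) at_top"
    by (intro tendsto_intros tendsto_power_div_exp_0)
  then show ?thesis
    by (simp add: poly_altdef sum_distrib_right exp_minus divide_inverse mult.assoc)
qed

text \<open>With y = 1/x one has dy/dx = -y^2, so p(y) exp(-y) has derivative y^2 (p(y) - p'(y))
  exp(-y); the polynomial \<open>[:0, 0, 1:]\<close> is y^2.\<close>

lemma exp_bump_derivative:
  "(exp_bump p has_real_derivative exp_bump ([:0, 0, 1:] * (p - pderiv p)) x) (at x)"
proof -
  consider "x > 0" | "x < 0" | "x = 0" by linarith
  then show ?thesis
  proof cases
    case 1
    have "((\<lambda>x. poly p (1 / x) * exp (- (1 / x))) has_real_derivative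
      exp_bump ([:0, 0, 1:] * (p - pderiv p)) x) (at x)"
      using 1 unfolding exp_bump_def
      by (auto intro!: derivative_eq_intros DERIV_chain2[OF poly_DERIV] simp: field_simps power2_eq_square)
    then show ?thesis
      by (rule has_field_derivative_transform_within_open[of _ _ _ "{0<..}"]) (use 1 in \<open>auto simp: exp_bump_def\<close>)
  next
    case 2
    have "((\<lambda>x. 0) has_real_derivative exp_bump ([:0, 0, 1:] * (p - pderiv p)) x) (at x)"
      using 2 by (simp add: exp_bump_def)
    then show ?thesis
      by (rule has_field_derivative_transform_within_open[of _ _ _ "{..<0}"]) (use 2 in \<open>auto simp: exp_bump_def\<close>)
  next
    case 3
    have "((\<lambda>h. (exp_bump p (0 + h) - exp_bump p 0) / h) \<longlongrightarrow> 0) (at_right 0)"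
    proof -
      \<comment> \<open>At 0 the right-hand quotient is read in the variable y = 1/h: dividing by h
        becomes the extra factor y, that is \<open>[:0, 1:]\<close>.\<close>
      have "((\<lambda>y. poly (p * [:0, 1:]) y * exp (- y)) \<longlongrightarrow> 0) at_top" by (rule poly_exp_tendsto_0)
      then have "((\<lambda>h. poly (p * [:0, 1:]) (inverse h) * exp (- inverse h)) \<longlongrightarrow> 0) (at_right 0)"
        by (rule filterlim_compose[OF _ filterlim_inverse_at_top_right])
      then show ?thesis
        by (rule Lim_transform_eventually)
          (auto simp: eventually_at_filter exp_bump_def field_simps)
    qed
    moreover have "((\<lambda>h. (exp_bump p (0 + h) - exp_bump p 0) / h) \<longlongrightarrow> 0) (at_left 0)"
      by (rule Lim_transform_eventually[of "\<lambda>_. 0"]) (auto simp: eventually_at_filter exp_bump_def)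
    ultimately have "((\<lambda>h. (exp_bump p (0 + h) - exp_bump p 0) / h) \<longlongrightarrow> 0) (at 0)"
      by (simp add: filterlim_split_at)
    then show ?thesis using 3 by (simp add: DERIV_def exp_bump_def)
  qed
qed

lemma smooth_exp_bump: "smooth (exp_bump p)"
proof (rule smooth_coinduct[where P = "\<lambda>f. \<exists>p. f = exp_bump p"])
  fix f :: "real \<Rightarrow> real" and x assume "\<exists>p. f = exp_bump p"
  then show "f differentiable (at x)"
    using exp_bump_derivative real_differentiable_def by blast
next
  fix f :: "real \<Rightarrow> real" and b :: real assume "\<exists>p. f = exp_bump p" "b \<in> Basis"
  then obtain p where p: "f = exp_bump p" "b = 1" by auto
  have "partial_deriv b f = exp_bump ([:0, 0, 1:] * (p - pderiv p))"
    unfolding p by (rule ext, subst has_derivative_partial_deriv[OF has_field_derivative_imp_has_derivative[OF exp_bump_derivative]]) simp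
  then show "\<exists>p. partial_deriv b f = exp_bump p" by blast
qed auto

text \<open>The usual quotient of exponential bumps, with its transition in [1, 2]. It is meant to
  be applied to squared norms, so that cutoffs are smooth at their centre as well.\<close>

definition smooth_step :: "real \<Rightarrow> real" where
  "smooth_step x = exp_bump 1 (2 - x) * inverse (exp_bump 1 (2 - x) + exp_bump 1 (x - 1))"

lemma exp_bump_nonneg: "exp_bump 1 x \<ge> 0" and exp_bump_pos: "x > 0 \<Longrightarrow> exp_bump 1 x > 0"
  and exp_bump_zero: "x \<le> 0 \<Longrightarrow> exp_bump 1 x = 0"
  by (auto simp: exp_bump_def)

lemma exp_bump_denominator: "exp_bump 1 (2 - x) + exp_bump 1 (x - 1) > 0"
  using exp_bump_pos[of "2 - x"] exp_bump_pos[of "x - 1"] exp_bump_nonneg[of "2 - x"] exp_bump_nonneg[of "x - 1"]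
  by (cases "x < 2") (auto intro: add_pos_nonneg add_nonneg_pos)

lemma smooth_smooth_step: "smooth smooth_step"
proof -
  have 1: "smooth (\<lambda>x. exp_bump 1 (2 - x))"
    by (rule smooth_compose[OF smooth_exp_bump]) (auto intro!: vsmooth_diff simp del: vsmooth_real)
  have 2: "smooth (\<lambda>x. exp_bump 1 (x - 1))"
    by (rule smooth_compose[OF smooth_exp_bump]) (auto intro!: vsmooth_diff simp del: vsmooth_real)
  show ?thesis unfolding smooth_step_def[abs_def]
    by (intro smooth_mult smooth_inverse smooth_add 1 2) (use exp_bump_denominator in \<open>metis less_irrefl\<close>)
qed

lemma smooth_step_bounds: "0 \<le> smooth_step x" "smooth_step x \<le> 1"
  using exp_bump_denominator[of x] exp_bump_nonneg[of "2 - x"] exp_bump_nonneg[of "x - 1"]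
  by (auto simp: smooth_step_def field_simps)

lemma smooth_step_1: "x \<le> 1 \<Longrightarrow> smooth_step x = 1"
  using exp_bump_denominator[of x] by (simp add: smooth_step_def exp_bump_zero)

lemma smooth_step_0: "x \<ge> 2 \<Longrightarrow> smooth_step x = 0"
  by (simp add: smooth_step_def exp_bump_zero)

text \<open>The derivative vanishes off the transition interval, which is compact.\<close>

lemma smooth_step_derivative_bound: "\<exists>B>0. \<forall>x. \<bar>partial_deriv 1 smooth_step x\<bar> \<le> B"
proof -
  let ?D = "partial_deriv 1 smooth_step"
  have "compact (?D ` {1..2})"
    by (intro compact_continuous_image smooth_continuous_on smooth_partial_any smooth_smooth_step) simp
  then obtain B where B: "\<And>x. x \<in> {1..2} \<Longrightarrow> \<bar>?D x\<bar> \<le> B"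
    using compact_imp_bounded[of "?D ` {1..2}"] unfolding bounded_iff by (metis imageI real_norm_def)
  have out: "?D x = 0" if "x \<notin> {1..2}" for x
  proof -
    have "frechet_derivative smooth_step (at x) = frechet_derivative (\<lambda>_. smooth_step x) (at x)"
    proof (cases "x < 1")
      case True
      then show ?thesis
        by (intro frechet_derivative_cong_open[of "{..<1}"]) (auto simp: smooth_step_1)
    next
      case False
      then show ?thesis using that
        by (intro frechet_derivative_cong_open[of "{2<..}"]) (auto simp: smooth_step_0)
    qed
    then show ?thesis by (simp add: partial_deriv_def)
  qed
  have "\<bar>?D x\<bar> \<le> max B 1" for x
    by (cases "x \<in> {1..2}") (use B[of x] out[of x] in auto)
  then show ?thesis by (intro exI[of _ "max B 1"]) auto
qed


subsection \<open>Mollification of non-expansive maps\<close>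

text \<open>A hyperplane strictly separating the weighted mean from K gives an inequality at every
  value of f, and integrating it against \<rho> contradicts the separation.\<close>

lemma integral_closed_convex:
  fixes f :: "'a::euclidean_space \<Rightarrow> 'b::euclidean_space"
  assumes "closed K" "convex K" "\<And>z. f z \<in> K" "\<And>z. \<rho> z \<ge> 0"
    and c: "integral Q \<rho> = c" "c > 0" and int: "\<rho> integrable_on Q" "(\<lambda>z. \<rho> z *\<^sub>R f z) integrable_on Q"
  shows "(1 / c) *\<^sub>R integral Q (\<lambda>z. \<rho> z *\<^sub>R f z) \<in> K"
proof (rule ccontr)
  let ?p = "(1 / c) *\<^sub>R integral Q (\<lambda>z. \<rho> z *\<^sub>R f z)"
  assume "?p \<notin> K"
  then obtain a b where ab: "a \<bullet> ?p < b" "\<And>x. x \<in> K \<Longrightarrow> a \<bullet> x > b"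
    using separating_hyperplane_closed_point[OF assms(2,1)] by blast
  have "c * b = integral Q (\<lambda>z. \<rho> z * b)" using c by simp
  also have "\<dots> \<le> integral Q (\<lambda>z. a \<bullet> (\<rho> z *\<^sub>R f z))"
  proof (rule integral_le)
    show "(\<lambda>z. \<rho> z * b) integrable_on Q" by (rule integrable_on_mult_left[OF int(1)])
    show "(\<lambda>z. a \<bullet> (\<rho> z *\<^sub>R f z)) integrable_on Q"
      using integrable_linear[OF int(2) bounded_linear_inner_right[of a]] by (simp add: o_def)
    show "\<rho> z * b \<le> a \<bullet> (\<rho> z *\<^sub>R f z)" for z
      using ab(2)[OF assms(3)[of z]] assms(4)[of z] by (simp add: mult_left_mono)
  qed
  also have "\<dots> = a \<bullet> integral Q (\<lambda>z. \<rho> z *\<^sub>R f z)"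
    using integral_linear[OF int(2) bounded_linear_inner_right[of a]] by (simp add: o_def)
  finally have "b \<le> a \<bullet> ?p" using c(2) by (simp add: field_simps)
  then show False using ab(1) by simp
qed

text \<open>Averaging translates of f keeps the values in K by convexity and keeps the Lipschitz
  constant 1 because all translates share it. Smoothness is seen after a change of variable that
  leaves x only in the smooth weight.\<close>

lemma mollify:
  fixes f :: "'a::euclidean_space \<Rightarrow> 'b::euclidean_space"
  assumes K: "closed K" "convex K" and fK: "\<And>x. f x \<in> K"
    and lip: "\<And>x y. norm (f x - f y) \<le> norm (x - y)" and \<delta>: "\<delta> > 0"
  shows "\<exists>p. vsmooth p \<and> (\<forall>x. p x \<in> K) \<and> (\<forall>x. norm (p x - f x) \<le> \<delta>) \<and>
    (\<forall>x y. norm (p x - p y) \<le> norm (x - y))"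
proof -
  \<comment> \<open>The argument reaches 2 exactly at norm \<delta>, so the weight vanishes from
    there on.\<close>
  define \<rho> :: "'a \<Rightarrow> real" where "\<rho> z = smooth_step (2 * (norm z)\<^sup>2 / \<delta>\<^sup>2)" for z
  define Q :: "'a set" where "Q = cbox (- \<delta> *\<^sub>R One) (\<delta> *\<^sub>R One)"
  define c where "c = integral Q \<rho>"
  define p where "p x = (1 / c) *\<^sub>R integral Q (\<lambda>z. \<rho> z *\<^sub>R f (x - z))" for x
  have fcont: "continuous_on S f" for S
    by (rule continuous_on_subset[of UNIV])
      (auto simp: continuous_on_iff dist_norm intro: le_less_trans[OF lip])
  have \<rho>sm: "smooth \<rho>"
    unfolding \<rho>_def
    by (rule smooth_compose[OF smooth_smooth_step])
      (simp add: divide_inverse, intro smooth_mult smooth_const smooth_norm_sq vsmooth_id)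
  have \<rho>0: "\<rho> z \<ge> 0" for z by (simp add: \<rho>_def smooth_step_bounds)
  have \<rho>out: "\<rho> z = 0" if "norm z \<ge> \<delta>" for z
  proof -
    have "\<delta>\<^sup>2 \<le> (norm z)\<^sup>2" using that \<delta> by (intro power_mono) auto
    then show ?thesis unfolding \<rho>_def using \<delta> by (intro smooth_step_0) (simp add: field_simps)
  qed
  have \<rho>c: "continuous_on S \<rho>" for S by (rule smooth_continuous_on[OF \<rho>sm])
  have Qmem: "z \<in> Q" if "norm z \<le> \<delta>" for z
    unfolding Q_def mem_box
  proof
    fix i :: 'a assume i: "i \<in> Basis"
    have "\<bar>z \<bullet> i\<bar> \<le> \<delta>" using Basis_le_norm[OF i, of z] that by linarith
    then show "(- \<delta> *\<^sub>R One) \<bullet> i \<le> z \<bullet> i \<and> z \<bullet> i \<le> (\<delta> *\<^sub>R One) \<bullet> i"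
      using i by (simp add: abs_le_iff)
  qed
  have \<rho>int: "\<rho> integrable_on Q" unfolding Q_def by (intro integrable_continuous \<rho>c)
  have fint: "(\<lambda>z. \<rho> z *\<^sub>R f (x - z)) integrable_on Q" for x
    unfolding Q_def
    by (intro integrable_continuous continuous_on_scaleR \<rho>c continuous_on_compose2[OF fcont[of UNIV]])
      (auto intro!: continuous_intros)
  have c: "c > 0"
  proof -
    have "c \<noteq> 0"
    proof
      assume "c = 0"
      then have "(\<rho> has_integral 0) Q" using \<rho>int by (simp add: c_def has_integral_integral)
      then have "\<rho> 0 = 0"
        unfolding Q_def by (rule has_integral_0_cbox_imp_0[rotated 2])
          (use \<rho>c \<rho>0 \<delta> in \<open>auto simp: mem_box box_ne_empty\<close>)
      then show False using smooth_step_1[of 0] by (simp add: \<rho>_def)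
    qed
    moreover have "c \<ge> 0" unfolding c_def by (rule integral_nonneg[OF \<rho>int]) (rule \<rho>0)
    ultimately show ?thesis by simp
  qed
  have bound: "norm ((1 / c) *\<^sub>R integral Q g) \<le> r"
    if "g integrable_on Q" "\<And>z. norm (g z) \<le> \<rho> z * r" for g :: "'a \<Rightarrow> 'b" and r
  proof -
    have "norm (integral Q g) \<le> integral Q (\<lambda>z. \<rho> z * r)"
      by (rule integral_norm_bound_integral[OF that(1)]) (use that(2) \<rho>int in \<open>auto intro: integrable_on_mult_left\<close>)
    also have "\<dots> = c * r" by (simp add: c_def)
    finally show ?thesis using c by (simp add: field_simps)
  qed
  have pK: "p x \<in> K" for x
    unfolding p_def using c
    by (intro integral_closed_convex[OF K] fK \<rho>0 \<rho>int fint) (simp_all add: c_def)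
  have pf: "norm (p x - f x) \<le> \<delta>" for x
  proof -
    have cf: "f x = (1 / c) *\<^sub>R integral Q (\<lambda>z. \<rho> z *\<^sub>R f x)"
    proof -
      have "((\<lambda>z. \<rho> z *\<^sub>R f x) has_integral c *\<^sub>R f x) Q"
        using \<rho>int unfolding c_def by (intro has_integral_scaleR_left integrable_integral)
      then have "integral Q (\<lambda>z. \<rho> z *\<^sub>R f x) = c *\<^sub>R f x" by (rule integral_unique)
      then show ?thesis using c by simp
    qed
    have i1: "(\<lambda>z. \<rho> z *\<^sub>R f x) integrable_on Q"
      by (rule integrable_on_scaleR_left[OF \<rho>int])
    have "p x - f x = (1 / c) *\<^sub>R integral Q (\<lambda>z. \<rho> z *\<^sub>R f (x - z) - \<rho> z *\<^sub>R f x)"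
      by (subst cf) (simp add: p_def integral_diff[OF fint i1] scaleR_right_diff_distrib)
    also have "norm \<dots> \<le> \<delta>"
    proof (rule bound)
      show "(\<lambda>z. \<rho> z *\<^sub>R f (x - z) - \<rho> z *\<^sub>R f x) integrable_on Q"
        by (rule integrable_diff[OF fint i1])
      fix z
      have "norm (\<rho> z *\<^sub>R f (x - z) - \<rho> z *\<^sub>R f x) = \<rho> z * norm (f (x - z) - f x)"
        using \<rho>0[of z] by (simp add: scaleR_right_diff_distrib[symmetric])
      also have "\<dots> \<le> \<rho> z * norm z" using lip[of "x - z" x] \<rho>0 by (intro mult_left_mono) auto
      also have "\<dots> \<le> \<rho> z * \<delta>" using \<rho>0[of z] \<rho>out[of z] by (cases "norm z \<ge> \<delta>") (auto intro: mult_left_mono)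
      finally show "norm (\<rho> z *\<^sub>R f (x - z) - \<rho> z *\<^sub>R f x) \<le> \<rho> z * \<delta>" .
    qed
    finally show ?thesis .
  qed
  have plip: "norm (p x - p y) \<le> norm (x - y)" for x y
  proof -
    have "p x - p y = (1 / c) *\<^sub>R integral Q (\<lambda>z. \<rho> z *\<^sub>R f (x - z) - \<rho> z *\<^sub>R f (y - z))"
      by (simp add: p_def integral_diff[OF fint fint] scaleR_right_diff_distrib)
    also have "norm \<dots> \<le> norm (x - y)"
    proof (rule bound)
      show "(\<lambda>z. \<rho> z *\<^sub>R f (x - z) - \<rho> z *\<^sub>R f (y - z)) integrable_on Q"
        by (rule integrable_diff[OF fint fint])
      fix z
      have "norm (\<rho> z *\<^sub>R f (x - z) - \<rho> z *\<^sub>R f (y - z)) = \<rho> z * norm (f (x - z) - f (y - z))"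
        using \<rho>0[of z] by (simp add: scaleR_right_diff_distrib[symmetric])
      also have "\<dots> \<le> \<rho> z * norm (x - y)" using lip[of "x - z" "y - z"] \<rho>0 by (intro mult_left_mono) auto
      finally show "norm (\<rho> z *\<^sub>R f (x - z) - \<rho> z *\<^sub>R f (y - z)) \<le> \<rho> z * norm (x - y)" .
    qed
    finally show ?thesis .
  qed
  have psm: "vsmooth p"
    unfolding vsmooth_def
  proof (intro ballI smooth_local)
    fix e :: 'b and x0 :: 'a assume e: "e \<in> Basis"
    \<comment> \<open>Large enough that the box \<open>B\<close> contains \<open>x - Q\<close> for
      all x in the unit ball around \<open>x0\<close>; there the integral can be taken over a domain
      independent of x.\<close>
    define R where "R = norm x0 + 1 + \<delta> * (1 + norm (One :: 'a))"
    define B :: "'a set" where "B = cbox (- R *\<^sub>R One) (R *\<^sub>R One)"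
    define k where "k x y = \<rho> (x - y) * (f y \<bullet> e)" for x y
    have kd: "foldr partial_deriv bs (\<lambda>x. k x y) = (\<lambda>x. foldr partial_deriv bs \<rho> (x - y) * (f y \<bullet> e))"
      if "bs \<in> lists Basis" for bs y
      using that
    proof (induction bs)
      case Nil
      then show ?case by (simp add: k_def)
    next
      case (Cons b bs)
      let ?g = "foldr partial_deriv bs \<rho>"
      have diff: "(?g has_derivative frechet_derivative ?g (at (x - y))) (at (x - y))" for x
      proof -
        have "bs \<in> lists Basis" using Cons by auto
        then have "?g differentiable (at (x - y))" using \<rho>sm unfolding smooth_def by blast
        then show ?thesis by (rule frechet_derivative_works[THEN iffD1])
      qed
      have sub: "((\<lambda>x. x - y) has_derivative (\<lambda>v. v)) (at x)" for x
        by (auto intro!: derivative_eq_intros)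
      have "((\<lambda>x. ?g (x - y) * (f y \<bullet> e)) has_derivative
          (\<lambda>v. frechet_derivative ?g (at (x - y)) v * (f y \<bullet> e))) (at x)" for x
        by (rule has_derivative_mult_left[OF has_derivative_compose[OF sub diff]])
      then have "partial_deriv b (\<lambda>x. ?g (x - y) * (f y \<bullet> e)) x = frechet_derivative ?g (at (x - y)) b * (f y \<bullet> e)" for x
        by (rule has_derivative_partial_deriv)
      then have "partial_deriv b (\<lambda>x. ?g (x - y) * (f y \<bullet> e)) = (\<lambda>x. partial_deriv b ?g (x - y) * (f y \<bullet> e))"
        unfolding partial_deriv_def[of b ?g] by (rule ext)
      moreover have "foldr partial_deriv bs (\<lambda>x. k x y) = (\<lambda>x. ?g (x - y) * (f y \<bullet> e))"
        using Cons by blast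
      ultimately show ?case by (simp only: foldr_Cons o_def)
    qed
    have "smooth (\<lambda>x. integral B (k x))"
      unfolding B_def
    proof (rule smooth_integral)
      show "smooth (\<lambda>x. k x y)" for y
        unfolding k_def
        by (rule smooth_mult[OF smooth_compose[OF \<rho>sm vsmooth_diff[OF vsmooth_id vsmooth_const]] smooth_const])
      fix bs assume bs: "bs \<in> lists (Basis :: 'a set)"
      have "foldr partial_deriv bs \<rho> differentiable (at z)" for z
        using \<rho>sm bs unfolding smooth_def by blast
      then have c\<rho>: "continuous_on UNIV (foldr partial_deriv bs \<rho>)"
        by (simp add: continuous_on_eq_continuous_at differentiable_imp_continuous_within)
      have "continuous_on (UNIV \<times> cbox (- R *\<^sub>R One) (R *\<^sub>R One)) (\<lambda>z. foldr partial_deriv bs \<rho> (fst z - snd z))"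
        by (rule continuous_on_compose2[OF c\<rho>]) (auto intro!: continuous_intros)
      moreover have "continuous_on (UNIV \<times> cbox (- R *\<^sub>R One) (R *\<^sub>R One)) (\<lambda>z :: 'a \<times> 'a. f (snd z) \<bullet> e)"
        by (rule continuous_on_inner[OF continuous_on_compose2[OF fcont[of UNIV]]]) (auto intro!: continuous_intros)
      ultimately show "continuous_on (UNIV \<times> cbox (- R *\<^sub>R One) (R *\<^sub>R One)) (\<lambda>(x, y). foldr partial_deriv bs (\<lambda>x. k x y) x)"
        unfolding kd[OF bs] split_beta by (rule continuous_on_mult)
    qed
    then have sm: "smooth (\<lambda>x. (1 / c) * integral B (k x))" by (intro smooth_mult smooth_const)
    have eq: "p x \<bullet> e = (1 / c) * integral B (k x)" if "x \<in> ball x0 1" for x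
    proof -
      \<comment> \<open>The substitution y = x - z moves x from f, which is merely Lipschitz, into
        \<rho>, which is smooth.\<close>
      have "((\<lambda>z. \<rho> z *\<^sub>R f (x - z)) has_integral integral Q (\<lambda>z. \<rho> z *\<^sub>R f (x - z))) Q"
        using fint by (rule integrable_integral)
      from has_integral_affinity[OF this[unfolded Q_def], of "-1" x]
      have "((\<lambda>y. \<rho> (x - y) *\<^sub>R f y) has_integral integral Q (\<lambda>z. \<rho> z *\<^sub>R f (x - z))) ((\<lambda>z. x - z) ` Q)"
        by (simp add: Q_def add.commute)
      from has_integral_linear[OF this bounded_linear_inner_left[of e]]
      have hi: "(k x has_integral (integral Q (\<lambda>z. \<rho> z *\<^sub>R f (x - z)) \<bullet> e)) ((\<lambda>z. x - z) ` Q)"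
        by (simp add: o_def k_def[abs_def])
      have "(k x has_integral (integral Q (\<lambda>z. \<rho> z *\<^sub>R f (x - z)) \<bullet> e)) B"
      proof (rule has_integral_on_superset[OF hi])
        fix y assume "y \<notin> (\<lambda>z. x - z) ` Q"
        then have "x - y \<notin> Q" using imageI[of "x - y" Q "\<lambda>z. x - z"] by auto
        then have "norm (x - y) \<ge> \<delta>" using Qmem[of "x - y"] by linarith
        then show "k x y = 0" by (simp add: k_def \<rho>out)
      next
        show "(\<lambda>z. x - z) ` Q \<subseteq> B"
        proof
          fix y assume "y \<in> (\<lambda>z. x - z) ` Q"
          then obtain z where z: "z \<in> Q" "y = x - z" by blast
          have nx: "norm x \<le> norm x0 + 1"
            using that norm_triangle_ineq2[of x x0] by (simp add: dist_norm norm_minus_commute)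
          have yi: "\<bar>y \<bullet> i\<bar> \<le> R" if i: "i \<in> Basis" for i
          proof -
            have "\<bar>z \<bullet> i\<bar> \<le> \<delta>" using z(1) i by (auto simp: Q_def mem_box abs_le_iff inner_Basis)
            moreover have "\<bar>x \<bullet> i\<bar> \<le> norm x" by (rule Basis_le_norm[OF i])
            moreover have "\<delta> * (1 + norm (One :: 'a)) \<ge> \<delta>" using \<delta> by simp
            moreover have "\<bar>y \<bullet> i\<bar> \<le> \<bar>x \<bullet> i\<bar> + \<bar>z \<bullet> i\<bar>" by (simp add: z(2) inner_diff_left)
            ultimately show ?thesis using nx unfolding R_def by linarith
          qed
          show "y \<in> B"
            unfolding B_def mem_box
          proof
            fix i :: 'a assume i: "i \<in> Basis"
            show "(- R *\<^sub>R One) \<bullet> i \<le> y \<bullet> i \<and> y \<bullet> i \<le> (R *\<^sub>R One) \<bullet> i"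
              using yi[OF i] i by (simp add: abs_le_iff)
          qed
        qed
      qed
      then show ?thesis by (simp add: p_def integral_unique)
    qed
    show "\<exists>U g. open U \<and> x0 \<in> U \<and> smooth g \<and> (\<forall>y\<in>U. p y \<bullet> e = g y)"
      using eq sm by (intro exI[of _ "ball x0 1"] exI[of _ "\<lambda>x. (1 / c) * integral B (k x)"]) auto
  qed
  show ?thesis using psm pK pf plip by blast
qed

text \<open>Testing in the direction w of the derivative itself: the difference quotients of the
  component of p along w are at most |v| |w| and tend to |w|^2.\<close>

lemma nonexpansive_derivative:
  fixes p :: "'a::euclidean_space \<Rightarrow> 'b::euclidean_space"
  assumes "vsmooth p" "\<And>x y. norm (p x - p y) \<le> norm (x - y)"
  shows "norm (frechet_derivative p (at x) v) \<le> norm v"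
proof -
  define w where "w = frechet_derivative p (at x) v"
  define \<phi> where "\<phi> s = p (x + s *\<^sub>R v) \<bullet> w" for s
  have "(\<phi> has_real_derivative partial_deriv v (\<lambda>x. p x \<bullet> w) (x + 0 *\<^sub>R v)) (at 0)"
    unfolding \<phi>_def by (rule smooth_line_derivative[OF vsmooth_inner[OF assms(1)]])
  then have "((\<lambda>h. (\<phi> (0 + h) - \<phi> 0) / h) \<longlongrightarrow> w \<bullet> w) (at 0)"
    by (simp add: DERIV_def partial_deriv_def frechet_derivative_inner[OF assms(1)] w_def)
  moreover have "(\<phi> (0 + h) - \<phi> 0) / h \<le> norm v * norm w" for h
  proof -
    have "\<bar>\<phi> (0 + h) - \<phi> 0\<bar> \<le> norm (p (x + h *\<^sub>R v) - p x) * norm w"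
      by (simp add: \<phi>_def inner_diff_left[symmetric] Cauchy_Schwarz_ineq2)
    also have "\<dots> \<le> (\<bar>h\<bar> * norm v) * norm w"
      using assms(2)[of "x + h *\<^sub>R v" x] by (intro mult_right_mono) auto
    finally have "\<bar>(\<phi> (0 + h) - \<phi> 0) / h\<bar> \<le> norm v * norm w"
      by (cases "h = 0") (auto simp: field_simps abs_mult)
    then show ?thesis by linarith
  qed
  ultimately have "w \<bullet> w \<le> norm v * norm w"
    by (intro tendsto_upperbound[of _ _ "at (0 :: real)"]) auto
  then have "norm w * norm w \<le> norm v * norm w" by (simp add: power2_norm_eq_inner[symmetric] power2_eq_square)
  then have "norm w \<le> norm v"
    by (cases "norm w = 0") (auto simp: mult_le_cancel_right)
  then show ?thesis by (simp add: w_def)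
qed

lemma frechet_derivative_norm_sq:
  assumes "vsmooth F"
  shows "frechet_derivative (\<lambda>x. (norm (F x))\<^sup>2) (at x) v = 2 * (F x \<bullet> frechet_derivative F (at x) v)"
proof -
  have "((\<lambda>x. F x \<bullet> F x) has_derivative (\<lambda>v. F x \<bullet> frechet_derivative F (at x) v + frechet_derivative F (at x) v \<bullet> F x)) (at x)"
    by (intro has_derivative_inner vsmooth_has_derivative assms)
  then show ?thesis
    by (simp add: power2_norm_eq_inner frechet_derivative_at[symmetric] inner_commute)
qed

subsection \<open>Covectors\<close>

text \<open>Positions are given by splitting the list, which suits inductions on lists better than
  index updates. No length condition appears because covectors vanish on lists of the wrong
  length.\<close>

lemma covectors_linear:
  assumes "\<phi> \<in> covectors m" shows "linear (\<lambda>v. \<phi> (xs @ v # ys))"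
proof (cases "length xs + Suc (length ys) = m")
  case True
  have "linear (\<lambda>v. \<phi> ((xs @ undefined # ys)[length xs := v]))"
  proof -
    have "\<forall>vs i. length vs = m \<and> i < m \<longrightarrow> linear (\<lambda>v. \<phi> (vs[i := v]))"
      using assms by (simp add: covectors_def)
    from this[rule_format, of "xs @ undefined # ys" "length xs"] show ?thesis using True by simp
  qed
  then show ?thesis by simp
next
  case False
  then have "(\<lambda>v. \<phi> (xs @ v # ys)) = (\<lambda>v. 0)" using assms by (auto simp: covectors_def)
  then show ?thesis by (simp add: linear_iff)
qed

lemma covectors_linear_hd: "\<phi> \<in> covectors m \<Longrightarrow> linear (\<lambda>v. \<phi> (v # ys))"
  using covectors_linear[of \<phi> m "[]"] by simp

lemma covectors_alternating:
  assumes "\<phi> \<in> covectors m" shows "\<phi> (xs @ v # ys @ v # zs) = 0"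
proof (cases "length (xs @ v # ys @ v # zs) = m")
  case True
  let ?vs = "xs @ v # ys @ v # zs"
  have "?vs ! length xs = v" "?vs ! (length xs + Suc (length ys)) = v"
    by (simp_all add: nth_append)
  then have "length ?vs = m \<and> length xs < length xs + Suc (length ys) \<and> length xs + Suc (length ys) < m
    \<and> ?vs ! length xs = ?vs ! (length xs + Suc (length ys))"
    using True by simp
  moreover have "\<forall>vs i j. length vs = m \<and> i < j \<and> j < m \<and> vs ! i = vs ! j \<longrightarrow> \<phi> vs = 0"
    using assms by (simp add: covectors_def)
  ultimately show ?thesis by blast
next
  case False
  then show ?thesis using assms by (auto simp: covectors_def)
qed

lemma covectors_length: "\<phi> \<in> covectors m \<Longrightarrow> length vs \<noteq> m \<Longrightarrow> \<phi> vs = 0"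
  by (auto simp: covectors_def)

lemma covectorsI:
  assumes lin: "\<And>xs ys. linear (\<lambda>v. \<phi> (xs @ v # ys))"
    and alt: "\<And>xs v ys zs. \<phi> (xs @ v # ys @ v # zs) = 0"
    and len: "\<And>vs. length vs \<noteq> m \<Longrightarrow> \<phi> vs = 0"
  shows "\<phi> \<in> covectors m"
proof -
  have "linear (\<lambda>v. \<phi> (vs[i := v]))" if "length vs = m" "i < m" for vs i
    using lin[of "take i vs" "drop (Suc i) vs"] that by (simp add: upd_conv_take_nth_drop)
  moreover have "\<phi> vs = 0" if "length vs = m" "i < j" "j < m" "vs ! i = vs ! j" for vs i j
  proof -
    have "vs = take i vs @ vs ! i # drop (Suc i) vs" using that by (intro id_take_nth_drop) simp
    moreover have "drop (Suc i) vs = take (j - Suc i) (drop (Suc i) vs) @ drop (Suc i) vs ! (j - Suc i)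
        # drop (Suc (j - Suc i)) (drop (Suc i) vs)"
      using that by (intro id_take_nth_drop) simp
    moreover have "drop (Suc i) vs ! (j - Suc i) = vs ! i"
    proof -
      have *: "Suc i + (j - Suc i) = j" "Suc i \<le> length vs" using that by simp_all
      show ?thesis unfolding nth_drop[OF *(2)] *(1) by (rule that(4)[symmetric])
    qed
    ultimately have "vs = take i vs @ vs ! i # take (j - Suc i) (drop (Suc i) vs) @ vs ! i
        # drop (Suc (j - Suc i)) (drop (Suc i) vs)" by (simp only:)
    from arg_cong[OF this, of \<phi>] show ?thesis unfolding alt .
  qed
  ultimately show ?thesis using len by (auto simp: covectors_def)
qed

lemma covectors_Cons: "\<phi> \<in> covectors m \<Longrightarrow> (\<lambda>vs. \<phi> (v # vs)) \<in> covectors (m - 1)"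
  by (rule covectorsI)
    (use covectors_linear[of \<phi> m "v # xs" for xs] covectors_alternating[of \<phi> m "v # xs" for xs]
      covectors_length[of \<phi> m] in auto)

text \<open>Polarisation: expand the value on a list with v + w in two adjacent places, which is
  zero.\<close>

lemma covectors_swap:
  assumes "\<phi> \<in> covectors m" shows "\<phi> (xs @ v # w # ys) = - \<phi> (xs @ w # v # ys)"
proof -
  have "0 = \<phi> (xs @ (v + w) # (v + w) # ys)"
    using covectors_alternating[OF assms, of xs "v + w" "[]"] by simp
  also have "\<dots> = \<phi> (xs @ v # (v + w) # ys) + \<phi> (xs @ w # (v + w) # ys)"
    using covectors_linear[OF assms, of xs "(v + w) # ys"] by (rule linear_add)
  also have "\<phi> (xs @ v # (v + w) # ys) = \<phi> (xs @ v # v # ys) + \<phi> (xs @ v # w # ys)"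
    using linear_add[OF covectors_linear[OF assms, of "xs @ [v]" ys]] by simp
  also have "\<phi> (xs @ w # (v + w) # ys) = \<phi> (xs @ w # v # ys) + \<phi> (xs @ w # w # ys)"
    using linear_add[OF covectors_linear[OF assms, of "xs @ [w]" ys]] by simp
  finally show ?thesis
    using covectors_alternating[OF assms, of xs v "[]" ys] covectors_alternating[OF assms, of xs w "[]" ys] by simp
qed

lemma covectors_move:
  assumes "\<phi> \<in> covectors m" shows "\<phi> (xs @ w # ys) = (- 1) ^ length xs * \<phi> (w # xs @ ys)"
proof (induction xs arbitrary: ys rule: rev_induct)
  case (snoc x xs)
  have "\<phi> ((xs @ [x]) @ w # ys) = - \<phi> (xs @ w # x # ys)"
    using covectors_swap[OF assms, of xs x w ys] by simp
  also have "\<dots> = (- 1) ^ length (xs @ [x]) * \<phi> (w # (xs @ [x]) @ ys)"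
    using snoc[of "x # ys"] by simp
  finally show ?case .
qed simp

lemma covectors_update:
  assumes "\<phi> \<in> covectors m" "j < length vs"
  shows "\<phi> (vs[j := w]) = (- 1) ^ j * \<phi> (w # take j vs @ drop (Suc j) vs)"
  using covectors_move[OF assms(1), of "take j vs" w] assms(2) by (simp add: upd_conv_take_nth_drop)

section \<open>Orthonormal lists, Gram determinants and comass\<close>

definition orthonormal_list :: "'a::euclidean_space list \<Rightarrow> bool" where
  "orthonormal_list es \<longleftrightarrow> (\<forall>i<length es. \<forall>j<length es. es ! i \<bullet> es ! j = (if i = j then 1 else 0))"

abbreviation norms :: "'a::real_normed_vector list \<Rightarrow> real" where
  "norms vs \<equiv> prod_list (map norm vs)"

lemma norms_nonneg: "0 \<le> norms vs"
  by (induction vs) auto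

lemma orthonormal_list_norms: "orthonormal_list es \<Longrightarrow> norms es = 1"
proof -
  assume "orthonormal_list es"
  then have "norm e = 1" if "e \<in> set es" for e
    using that by (auto simp: orthonormal_list_def in_set_conv_nth norm_eq_sqrt_inner)
  then show ?thesis by (induction es) auto
qed

text \<open>Gram--Schmidt: on a fixed list of vectors every covector is the same multiple of its value on
  an orthonormal list.\<close>

lemma covectors_orthonormalize:
  fixes vs :: "'a::euclidean_space list"
  shows "\<exists>c es. length es = length vs \<and> \<bar>c\<bar> \<le> norms vs \<and> (c = 0 \<or> orthonormal_list es) \<and>
    (\<forall>\<phi>\<in>covectors (length vs). \<phi> vs = c * \<phi> es)"
proof (induction vs)
  case Nil
  show ?case by (intro exI[of _ 1] exI[of _ "[]"]) (simp add: orthonormal_list_def)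
next
  case (Cons v vs)
  then obtain c es where IH: "length es = length vs" "\<bar>c\<bar> \<le> norms vs" "c = 0 \<or> orthonormal_list es"
    "\<And>\<phi>. \<phi> \<in> covectors (length vs) \<Longrightarrow> \<phi> vs = c * \<phi> es" by blast
  \<comment> \<open>The component of v orthogonal to \<open>es\<close>. The part subtracted
    contributes nothing to any covector, since it lies in the span of the remaining
    arguments.\<close>
  define u where "u = v - (\<Sum>i<length es. (v \<bullet> es ! i) *\<^sub>R es ! i)"
  have val: "\<phi> (v # vs) = c * \<phi> (u # es)" if \<phi>: "\<phi> \<in> covectors (length (v # vs))" for \<phi>
  proof -
    have lin: "linear (\<lambda>v. \<phi> (v # es))" by (rule covectors_linear_hd[OF \<phi>])
    have z: "\<phi> (es ! i # es) = 0" if "i < length es" for i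
      using covectors_alternating[OF \<phi>, of "[]" "es ! i" "take i es" "drop (Suc i) es"]
      by (simp add: id_take_nth_drop[symmetric] that)
    have "\<phi> (v # vs) = c * \<phi> (v # es)"
      using IH(4)[of "\<lambda>vs. \<phi> (v # vs)"] covectors_Cons[OF \<phi>, of v] by simp
    also have "\<phi> (v # es) = \<phi> (u # es) + \<phi> ((\<Sum>i<length es. (v \<bullet> es ! i) *\<^sub>R es ! i) # es)"
      using linear_add[OF lin, of u "\<Sum>i<length es. (v \<bullet> es ! i) *\<^sub>R es ! i"] by (simp add: u_def)
    also have "\<phi> ((\<Sum>i<length es. (v \<bullet> es ! i) *\<^sub>R es ! i) # es) = 0"
      by (subst linear_sum[OF lin]) (simp add: linear_scale[OF lin] z)
    finally show ?thesis by simp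
  qed
  show ?case
  proof (cases "c = 0 \<or> u = 0")
    case True
    then have "\<phi> (v # vs) = 0" if "\<phi> \<in> covectors (length (v # vs))" for \<phi>
      using val[OF that] linear_0[OF covectors_linear_hd[OF that, of es]] by auto
    then show ?thesis
      using norms_nonneg[of vs] by (intro exI[of _ 0] exI[of _ "v # vs"]) auto
  next
    case False
    then have on: "orthonormal_list es" and u: "u \<noteq> 0" using IH(3) by auto
    have ort: "u \<bullet> es ! j = 0" if "j < length es" for j
    proof -
      have "(\<Sum>i<length es. (v \<bullet> es ! i) * (es ! i \<bullet> es ! j)) = (\<Sum>i<length es. if i = j then v \<bullet> es ! i else 0)"
        using on that by (intro sum.cong) (auto simp: orthonormal_list_def)
      also have "\<dots> = v \<bullet> es ! j" using that by (simp add: sum.delta)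
      finally show ?thesis by (simp add: u_def inner_diff_left inner_sum_left)
    qed
    define e where "e = u /\<^sub>R norm u"
    have ee: "e \<bullet> e = 1" using u by (simp add: e_def power2_norm_eq_inner[symmetric] power2_eq_square field_simps)
    have "orthonormal_list (e # es)"
      unfolding orthonormal_list_def
    proof (intro allI impI)
      fix i j assume "i < length (e # es)" "j < length (e # es)"
      moreover have "e \<bullet> es ! j = 0" "es ! j \<bullet> e = 0" if "j < length es" for j
        using ort[OF that] by (simp_all add: e_def inner_commute)
      moreover have "es ! i \<bullet> es ! j = (if i = j then 1 else 0)" if "i < length es" "j < length es" for i j
        using on that by (simp add: orthonormal_list_def)
      ultimately show "(e # es) ! i \<bullet> (e # es) ! j = (if i = j then 1 else 0)"
        using ee by (cases i; cases j) simp_all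
    qed
    moreover have "\<bar>c * norm u\<bar> \<le> norms (v # vs)"
    proof -
      \<comment> \<open>Pythagoras: removing the projection only shortens v. Accumulated over the
        list this is Hadamard's inequality.\<close>
      have "(norm v)\<^sup>2 = (norm u)\<^sup>2 + (norm (v - u))\<^sup>2"
      proof -
        have vu: "v - u = (\<Sum>i<length es. (v \<bullet> es ! i) *\<^sub>R es ! i)" by (simp add: u_def)
        have "u \<bullet> (v - u) = 0" unfolding vu by (simp add: inner_sum_right ort)
        then show ?thesis
          by (simp add: power2_norm_eq_inner inner_diff_left inner_diff_right inner_commute)
      qed
      then have "(norm u)\<^sup>2 \<le> (norm v)\<^sup>2" by simp
      then have "norm u \<le> norm v" by simp
      then have "norm u * \<bar>c\<bar> \<le> norm v * norms vs" using IH(2) by (intro mult_mono) auto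
      then show ?thesis by (simp add: abs_mult mult.commute)
    qed
    moreover have "\<phi> (v # vs) = (c * norm u) * \<phi> (e # es)" if "\<phi> \<in> covectors (length (v # vs))" for \<phi>
      using val[OF that] u linear_scale[OF covectors_linear_hd[OF that], of "norm u" e] by (simp add: e_def)
    moreover have "length (e # es) = length (v # vs)" using IH(1) by simp
    ultimately show ?thesis by blast
  qed
qed

text \<open>The determinant of the matrix of inner products of \<open>vs\<close> with
  \<open>ws\<close>. Fixing \<open>ws\<close> makes it a covector in \<open>vs\<close>, so that
  general facts on covectors apply to the Gram determinant itself.\<close>

definition gram :: "nat \<Rightarrow> 'a::euclidean_space list \<Rightarrow> 'a list \<Rightarrow> real" where
  "gram m ws vs = (if length vs = m then
     \<Sum>p | p permutes {..<m}. of_int (sign p) * (\<Prod>i<m. vs ! i \<bullet> ws ! p i) else 0)"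

text \<open>If two entries agree, composing all permutations with the transposition of their
  positions keeps the products and flips the signs, so the sum equals its own negative.\<close>

lemma gram_covector: "gram m ws \<in> covectors m"
proof -
  have lin: "linear (\<lambda>v. gram m ws (vs[k := v]))" if "length vs = m" "k < m" for vs k
  proof -
    have "(\<Prod>i<m. vs[k := v] ! i \<bullet> ws ! p i) = (v \<bullet> ws ! p k) * (\<Prod>i\<in>{..<m} - {k}. vs ! i \<bullet> ws ! p i)" for v p
      using that by (subst prod.remove[of _ k]) auto
    then have "gram m ws (vs[k := v]) = (\<Sum>p | p permutes {..<m}. (v \<bullet> ws ! p k) * (of_int (sign p) *
        (\<Prod>i\<in>{..<m} - {k}. vs ! i \<bullet> ws ! p i)))" for v
      using that by (simp add: gram_def mult.left_commute)
    then show ?thesis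
      by (simp add: linear_iff inner_add_left distrib_right sum.distrib sum_distrib_left mult.assoc)
  qed
  have alt: "gram m ws vs = 0" if vs: "length vs = m" "i < j" "j < m" "vs ! i = vs ! j" for vs i j
  proof -
    let ?t = "Transposition.transpose i j"
    let ?f = "\<lambda>p. of_int (sign p) * (\<Prod>i<m. vs ! i \<bullet> ws ! p i) :: real"
    have t: "?t permutes {..<m}" using that by (intro permutes_swap_id) auto
    have "gram m ws vs = (\<Sum>p | p permutes {..<m}. ?f (p \<circ> ?t))"
      unfolding gram_def if_P[OF vs(1)] by (rule sum_permutations_compose_right[OF t])
    also have "\<dots> = (\<Sum>p | p permutes {..<m}. - ?f p)"
    proof (rule sum.cong[OF refl])
      fix p assume p: "p \<in> {p. p permutes {..<m}}"
      then have pp: "permutation p" by (auto intro: permutes_imp_permutation)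
      have "(\<Prod>k<m. vs ! k \<bullet> ws ! (p \<circ> ?t) k) = (\<Prod>k<m. vs ! ?t k \<bullet> ws ! (p \<circ> ?t) k)"
        using vs(4) by (intro prod.cong) (auto simp: Transposition.transpose_def)
      also have "\<dots> = (\<Prod>k<m. vs ! k \<bullet> ws ! p k)"
        using prod.permute[OF t, of "\<lambda>k. vs ! k \<bullet> ws ! p k"] by (simp add: o_def)
      finally show "?f (p \<circ> ?t) = - ?f p"
        using vs by (simp add: sign_compose[OF pp permutation_swap_id] sign_swap_id)
    qed
    also have "\<dots> = - gram m ws vs" using that(1) by (simp add: gram_def sum_negf)
    finally show ?thesis by simp
  qed
  show ?thesis
    unfolding covectors_def using lin alt by (auto simp: gram_def)
qed

text \<open>A matrix and its transpose have the same determinant: reindex the sum by inverse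
  permutations.\<close>

lemma gram_commute:
  assumes "length vs = m" "length ws = m" shows "gram m ws vs = gram m vs ws"
proof -
  have "gram m ws vs = (\<Sum>p | p permutes {..<m}. of_int (sign (inv p)) * (\<Prod>i<m. vs ! i \<bullet> ws ! inv p i))"
    unfolding gram_def if_P[OF assms(1)] by (rule sum_permutations_inverse)
  also have "\<dots> = (\<Sum>p | p permutes {..<m}. of_int (sign p) * (\<Prod>i<m. ws ! i \<bullet> vs ! p i))"
  proof (rule sum.cong[OF refl])
    fix p assume "p \<in> {p. p permutes {..<m}}"
    then have p: "p permutes {..<m}" by simp
    have "(\<Prod>i<m. vs ! i \<bullet> ws ! inv p i) = (\<Prod>i<m. vs ! p i \<bullet> ws ! inv p (p i))"
      using prod.permute[OF p, of "\<lambda>i. vs ! i \<bullet> ws ! inv p i"] by (simp add: o_def)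
    also have "\<dots> = (\<Prod>i<m. ws ! i \<bullet> vs ! p i)"
      using permutes_inverses(2)[OF p] by (simp add: inner_commute)
    finally show "of_int (sign (inv p)) * (\<Prod>i<m. vs ! i \<bullet> ws ! inv p i)
        = of_int (sign p) * (\<Prod>i<m. ws ! i \<bullet> vs ! p i)"
      by (simp add: sign_inverse[OF permutes_imp_permutation[OF finite_lessThan p]])
  qed
  finally show ?thesis using assms by (simp add: gram_def)
qed

lemma wedge_norm_gram: "wedge_norm vs = sqrt (gram (length vs) vs vs)"
  by (simp add: wedge_norm_def gram_def)

lemma wedge_norm_orthonormal:
  assumes "orthonormal_list es" shows "gram (length es) es es = 1"
proof -
  have "gram (length es) es es = (\<Sum>p | p permutes {..<length es}. if p = id then 1 else 0)"
    unfolding gram_def if_P[OF refl]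
  proof (rule sum.cong[OF refl])
    fix p assume p: "p \<in> {p. p permutes {..<length es}}"
    show "of_int (sign p) * (\<Prod>i<length es. es ! i \<bullet> es ! p i) = (if p = id then 1 else (0::real))"
    proof (cases "p = id")
      case True
      then show ?thesis using assms by (simp add: orthonormal_list_def)
    next
      case False
      then obtain i where i: "p i \<noteq> i" by (auto simp: fun_eq_iff)
      then have "i < length es" using p by (auto simp: permutes_def)
      moreover from this have "p i < length es" using p permutes_in_image[of p "{..<length es}" i] by simp
      ultimately have "es ! i \<bullet> es ! p i = 0" using assms i by (auto simp: orthonormal_list_def)
      then show ?thesis using False \<open>i < length es\<close> by (auto intro!: prod_zero)
    qed
  qed
  then show ?thesis by (simp add: finite_permutations permutes_id)
qed

text \<open>Applying the Gram-Schmidt factor c to the Gram determinant in both of its arguments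
  gives c^2 times that of an orthonormal list, which is 1. Hence the wedge norm is |c|.\<close>

lemma covectors_wedge_norm:
  fixes vs :: "'a::euclidean_space list"
  shows "\<exists>es. length es = length vs \<and> (wedge_norm vs = 0 \<or> orthonormal_list es) \<and> wedge_norm vs \<le> norms vs \<and>
    (\<forall>\<phi>\<in>covectors (length vs). \<bar>\<phi> vs\<bar> = wedge_norm vs * \<bar>\<phi> es\<bar>)"
proof -
  obtain c es where c: "length es = length vs" "\<bar>c\<bar> \<le> norms vs" "c = 0 \<or> orthonormal_list es"
    "\<And>\<phi>. \<phi> \<in> covectors (length vs) \<Longrightarrow> \<phi> vs = c * \<phi> es"
    using covectors_orthonormalize[of vs] by blast
  let ?m = "length vs"
  have "gram ?m vs vs = c * gram ?m vs es" by (rule c(4)[OF gram_covector])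
  also have "gram ?m vs es = gram ?m es vs" using gram_commute c(1) by metis
  also have "gram ?m es vs = c * gram ?m es es" by (rule c(4)[OF gram_covector])
  also have "c * (c * gram ?m es es) = c\<^sup>2"
    using c(1,3) wedge_norm_orthonormal[of es] by (auto simp: power2_eq_square)
  finally have wn: "wedge_norm vs = \<bar>c\<bar>" by (simp add: wedge_norm_gram)
  have "\<bar>\<phi> vs\<bar> = \<bar>c\<bar> * \<bar>\<phi> es\<bar>" if "\<phi> \<in> covectors ?m" for \<phi>
    unfolding c(4)[OF that] by (rule abs_mult)
  then show ?thesis using c(1-3) unfolding wn by (intro exI[of _ es]) auto
qed

text \<open>Both conditions reduce to the values on orthonormal lists, where the wedge norm and the
  product of the norms are 1; elsewhere the wedge norm is the smaller of the two.\<close>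

lemma comass_le_iff:
  fixes \<phi> :: "'a::euclidean_space list \<Rightarrow> real"
  assumes "\<phi> \<in> covectors m" "B \<ge> 0"
  shows "comass m \<phi> \<le> ereal B \<longleftrightarrow> (\<forall>vs. \<bar>\<phi> vs\<bar> \<le> B * norms vs)"
proof
  assume "comass m \<phi> \<le> ereal B"
  then have *: "\<bar>\<phi> vs\<bar> \<le> B" if "length vs = m" "wedge_norm vs \<le> 1" for vs
    using that unfolding comass_def SUP_le_iff by auto
  show "\<forall>vs. \<bar>\<phi> vs\<bar> \<le> B * norms vs"
  proof
    fix vs :: "'a list"
    show "\<bar>\<phi> vs\<bar> \<le> B * norms vs"
    proof (cases "length vs = m")
      case True
      obtain es where es: "length es = m" "wedge_norm vs = 0 \<or> orthonormal_list es" "wedge_norm vs \<le> norms vs"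
        "\<bar>\<phi> vs\<bar> = wedge_norm vs * \<bar>\<phi> es\<bar>"
        using covectors_wedge_norm[of vs] assms True by blast
      have "wedge_norm vs * \<bar>\<phi> es\<bar> \<le> norms vs * B"
      proof (cases "wedge_norm vs = 0")
        case False
        then have "wedge_norm es \<le> 1"
          using es(2) wedge_norm_orthonormal[of es] by (simp add: wedge_norm_gram[of es])
        then have "\<bar>\<phi> es\<bar> \<le> B" using * es(1) by blast
        then show ?thesis using es(3) norms_nonneg[of vs] by (intro mult_mono) auto
      qed (use assms norms_nonneg[of vs] in simp)
      then show ?thesis unfolding es(4) mult.commute[of B] .
    next
      case False
      then show ?thesis using covectors_length[OF assms(1)] assms(2) norms_nonneg[of vs] by simp
    qed
  qed
next
  assume *: "\<forall>vs. \<bar>\<phi> vs\<bar> \<le> B * norms vs"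
  have "\<bar>\<phi> vs\<bar> \<le> B" if vs: "length vs = m" "wedge_norm vs \<le> 1" for vs
  proof -
    obtain es where es: "wedge_norm vs = 0 \<or> orthonormal_list es" "\<bar>\<phi> vs\<bar> = wedge_norm vs * \<bar>\<phi> es\<bar>"
      using covectors_wedge_norm[of vs] assms vs by blast
    show ?thesis
    proof (cases "wedge_norm vs = 0")
      case False
      then have "\<bar>\<phi> es\<bar> \<le> B" using es(1) *[rule_format, of es] orthonormal_list_norms[of es] by simp
      then have "wedge_norm vs * \<bar>\<phi> es\<bar> \<le> 1 * B" using vs(2) by (intro mult_mono) auto
      then show ?thesis using es(2) by simp
    qed (use es assms in simp)
  qed
  then show "comass m \<phi> \<le> ereal B" unfolding comass_def SUP_le_iff by auto
qed

subsection \<open>Exterior derivative\<close>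

lemma fd_add:
  "smooth f \<Longrightarrow> smooth g \<Longrightarrow>
    frechet_derivative (\<lambda>x. f x + g x) (at x) v = frechet_derivative f (at x) v + frechet_derivative g (at x) v"
  by (simp add: frechet_derivative_at[OF has_derivative_add[OF smooth_has_derivative smooth_has_derivative], symmetric])

lemma fd_mult:
  "smooth f \<Longrightarrow> smooth g \<Longrightarrow>
    frechet_derivative (\<lambda>x. f x * g x) (at x) v = f x * frechet_derivative g (at x) v + frechet_derivative f (at x) v * g x"
  by (simp add: frechet_derivative_at[OF has_derivative_mult[OF smooth_has_derivative smooth_has_derivative], symmetric])

lemma fd_cmult:
  "smooth f \<Longrightarrow> frechet_derivative (\<lambda>x. c * f x) (at x) v = c * frechet_derivative f (at x) v"
  by (subst fd_mult) auto

lemma fd_diff: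
  "smooth f \<Longrightarrow> smooth g \<Longrightarrow>
    frechet_derivative (\<lambda>x. f x - g x) (at x) v = frechet_derivative f (at x) v - frechet_derivative g (at x) v"
  by (simp add: frechet_derivative_at[OF has_derivative_diff[OF smooth_has_derivative smooth_has_derivative], symmetric])

lemma fd_sum:
  "(\<And>a. a \<in> A \<Longrightarrow> smooth (f a)) \<Longrightarrow>
    frechet_derivative (\<lambda>x. \<Sum>a\<in>A. f a x) (at x) v = (\<Sum>a\<in>A. frechet_derivative (f a) (at x) v)"
  by (induction A rule: infinite_finite_induct) (simp_all add: fd_add smooth_sum)

lemma fd_linear_add:
  "smooth f \<Longrightarrow> frechet_derivative f (at x) (v + w) = frechet_derivative f (at x) v + frechet_derivative f (at x) w"
  using linear_add[OF frechet_derivative_linear_smooth] .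

lemma fd_linear_scale:
  "smooth f \<Longrightarrow> frechet_derivative f (at x) (c *\<^sub>R v) = c * frechet_derivative f (at x) v"
  using linear_scale[OF frechet_derivative_linear_smooth, of f x c v] by simp

lemma smooth_forms_covector: "\<omega> \<in> smooth_forms m \<Longrightarrow> \<omega> x \<in> covectors m"
  and smooth_forms_smooth: "\<omega> \<in> smooth_forms m \<Longrightarrow> smooth (\<lambda>x. \<omega> x vs)"
  by (auto simp: smooth_forms_def)

lemma smooth_formsI:
  "(\<And>x. \<omega> x \<in> covectors m) \<Longrightarrow> (\<And>vs. smooth (\<lambda>x. \<omega> x vs)) \<Longrightarrow> \<omega> \<in> smooth_forms m"
  by (auto simp: smooth_forms_def)

lemma smooth_forms_length: "\<omega> \<in> smooth_forms m \<Longrightarrow> length vs \<noteq> m \<Longrightarrow> \<omega> x vs = 0"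
  using covectors_length smooth_forms_covector by blast

text \<open>Interior product with the constant vector field v.\<close>

definition contract :: "'a::euclidean_space \<Rightarrow> 'a form \<Rightarrow> 'a form" where
  "contract v \<omega> x vs = \<omega> x (v # vs)"

lemma contract_smooth_forms: "\<omega> \<in> smooth_forms m \<Longrightarrow> contract v \<omega> \<in> smooth_forms (m - 1)"
  by (rule smooth_formsI)
    (use covectors_Cons[OF smooth_forms_covector] smooth_forms_smooth in \<open>auto simp: contract_def[abs_def]\<close>)

text \<open>Lie derivative along the constant vector field v.\<close>

definition lie_const :: "'a::euclidean_space \<Rightarrow> 'a form \<Rightarrow> 'a form" where
  "lie_const v \<omega> x vs = frechet_derivative (\<lambda>y. \<omega> y vs) (at x) v"

lemma covector_derivative:
  assumes \<omega>: "\<omega> \<in> smooth_forms m"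
  shows "(\<lambda>vs. frechet_derivative (\<lambda>y. \<omega> y vs) (at x) v) \<in> covectors m"
proof (rule covectorsI)
  fix xs ys
  note lin = covectors_linear[OF smooth_forms_covector[OF \<omega>], of _ xs ys]
  show "linear (\<lambda>w. frechet_derivative (\<lambda>y. \<omega> y (xs @ w # ys)) (at x) v)"
    by (rule linearI)
      (simp_all add: linear_add[OF lin] linear_scale[OF lin] fd_add fd_cmult smooth_forms_smooth[OF \<omega>])
next
  fix xs w ys zs
  show "frechet_derivative (\<lambda>y. \<omega> y (xs @ w # ys @ w # zs)) (at x) v = 0"
    using covectors_alternating[OF smooth_forms_covector[OF \<omega>]] by simp
next
  fix vs :: "'a list" assume "length vs \<noteq> m"
  then show "frechet_derivative (\<lambda>y. \<omega> y vs) (at x) v = 0"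
    using smooth_forms_length[OF \<omega>] by simp
qed

lemma lie_const_smooth_forms: "\<omega> \<in> smooth_forms m \<Longrightarrow> lie_const v \<omega> \<in> smooth_forms m"
  unfolding lie_const_def[abs_def]
  by (rule smooth_formsI) (auto intro: covector_derivative smooth_frechet_derivative smooth_forms_smooth)

lemma ext_deriv_Nil [simp]: "ext_deriv \<omega> x [] = 0"
  by (simp add: ext_deriv_def)

text \<open>Cartan's formula for a constant field v. It reduces statements about the exterior
  derivative on a list to the tail of the list.\<close>

lemma ext_deriv_Cons:
  "ext_deriv \<omega> x (v # vs) = lie_const v \<omega> x vs - ext_deriv (contract v \<omega>) x vs"
  by (simp add: ext_deriv_def lie_const_def contract_def[abs_def] sum.lessThan_Suc_shift sum_negf del: sum.lessThan_Suc)

lemma ext_deriv_add: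
  assumes "\<omega> \<in> smooth_forms m" "\<eta> \<in> smooth_forms k"
  shows "ext_deriv (\<omega> + \<eta>) x vs = ext_deriv \<omega> x vs + ext_deriv \<eta> x vs"
  using assms by (simp add: ext_deriv_def fd_add smooth_forms_smooth distrib_left sum.distrib)

lemma ext_deriv_diff:
  assumes "\<omega> \<in> smooth_forms m" "\<eta> \<in> smooth_forms k"
  shows "ext_deriv (\<omega> - \<eta>) x vs = ext_deriv \<omega> x vs - ext_deriv \<eta> x vs"
  using assms by (simp add: ext_deriv_def fd_diff smooth_forms_smooth right_diff_distrib sum_subtractf)

lemma ext_deriv_scale:
  assumes "\<omega> \<in> smooth_forms m"
  shows "ext_deriv (c *\<^sub>R \<omega>) x vs = c * ext_deriv \<omega> x vs"
  using assms by (simp add: ext_deriv_def scaleR_fun_def fd_cmult smooth_forms_smooth sum_distrib_left mult.left_commute)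

lemma ext_deriv_linear:
  assumes "\<omega> \<in> smooth_forms m"
  shows "linear (\<lambda>v. ext_deriv \<omega> x (xs @ v # ys))"
  using assms
proof (induction xs arbitrary: \<omega> m)
  case Nil
  have c: "contract (v + w) \<omega> = contract v \<omega> + contract w \<omega>" "contract (c *\<^sub>R v) \<omega> = c *\<^sub>R contract v \<omega>" for v w c
    using linear_add[OF covectors_linear_hd[OF smooth_forms_covector[OF Nil]]]
      linear_scale[OF covectors_linear_hd[OF smooth_forms_covector[OF Nil]]]
    by (auto simp: contract_def fun_eq_iff scaleR_fun_def)
  show ?case
    by (rule linearI)
      (simp_all add: ext_deriv_Cons c ext_deriv_add[OF contract_smooth_forms[OF Nil] contract_smooth_forms[OF Nil]]
        ext_deriv_scale[OF contract_smooth_forms[OF Nil]] lie_const_def fd_linear_add fd_linear_scale smooth_forms_smooth[OF Nil]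
        algebra_simps)
next
  case (Cons u xs)
  have "linear (\<lambda>v. lie_const u \<omega> x (xs @ v # ys))"
    using covectors_linear[OF smooth_forms_covector[OF lie_const_smooth_forms[OF Cons(2)]]] .
  moreover have "linear (\<lambda>v. ext_deriv (contract u \<omega>) x (xs @ v # ys))"
    by (rule Cons(1)[OF contract_smooth_forms[OF Cons(2)]])
  ultimately show ?case by (simp add: ext_deriv_Cons linear_compose_sub)
qed

lemma ext_deriv_length:
  assumes "\<omega> \<in> smooth_forms m" "length vs \<noteq> Suc m" shows "ext_deriv \<omega> x vs = 0"
  unfolding ext_deriv_def
proof (rule sum.neutral, intro ballI)
  fix i assume "i \<in> {..<length vs}"
  then have "length (take i vs @ drop (Suc i) vs) \<noteq> m" using assms(2) by auto
  then have "(\<lambda>y. \<omega> y (take i vs @ drop (Suc i) vs)) = (\<lambda>y. 0)"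
    using smooth_forms_length[OF assms(1)] by blast
  then show "(- 1) ^ i * frechet_derivative (\<lambda>y. \<omega> y (take i vs @ drop (Suc i) vs)) (at x) (vs ! i) = 0" by simp
qed

text \<open>With v in front, Cartan's formula leaves the Lie derivative minus the derivative of the
  contraction. In the latter only the summand omitting the second v survives, and moving v back to
  its place produces exactly the Lie derivative.\<close>

lemma ext_deriv_alternating:
  assumes "\<omega> \<in> smooth_forms m"
  shows "ext_deriv \<omega> x (xs @ v # ys @ v # zs) = 0"
  using assms
proof (induction xs arbitrary: \<omega> m)
  case Nil
  note cov = smooth_forms_covector[OF Nil]
  let ?us = "ys @ v # zs"
  let ?t = "\<lambda>i. (- 1) ^ i * frechet_derivative (\<lambda>y. \<omega> y (v # take i ?us @ drop (Suc i) ?us)) (at x) (?us ! i)"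
  \<comment> \<open>Unless the second v is the omitted entry, v still occurs twice among the
    arguments.\<close>
  have z: "?t i = 0" if "i \<noteq> length ys" "i < length ?us" for i
  proof -
    obtain as bs where *: "take i ?us @ drop (Suc i) ?us = as @ v # bs"
    proof (cases "i < length ys")
      case True
      then have "take i ?us @ drop (Suc i) ?us = (take i ys @ drop (Suc i) ys) @ v # zs" by simp
      then show ?thesis using that by blast
    next
      case False
      then have "take i ?us @ drop (Suc i) ?us = ys @ v # (take (i - Suc (length ys)) zs @ drop (i - length ys) zs)"
        using \<open>i \<noteq> length ys\<close> by (simp add: take_Cons' drop_Cons')
      then show ?thesis using that by blast
    qed
    have "(\<lambda>y. \<omega> y (v # as @ v # bs)) = (\<lambda>y. 0)"
      using covectors_alternating[OF cov, of _ "[]"] by simp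
    then show ?thesis unfolding * by simp
  qed
  have "ext_deriv (contract v \<omega>) x ?us = (\<Sum>i<length ?us. ?t i)"
    by (simp only: ext_deriv_def contract_def)
  also have "\<dots> = (\<Sum>i\<in>{length ys}. ?t i)"
    by (rule sum.mono_neutral_right) (use z in auto)
  also have "\<dots> = frechet_derivative (\<lambda>y. (- 1) ^ length ys * \<omega> y (v # ys @ zs)) (at x) v"
    by (simp add: fd_cmult[OF smooth_forms_smooth[OF Nil]])
  also have "\<dots> = lie_const v \<omega> x ?us"
    unfolding lie_const_def by (simp add: covectors_move[OF cov, of _ ys v zs])
  finally show ?case by (simp add: ext_deriv_Cons)
next
  case (Cons u xs)
  have "ext_deriv (contract u \<omega>) x (xs @ v # ys @ v # zs) = 0"
    by (rule Cons(1)[OF contract_smooth_forms[OF Cons(2)]])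
  moreover have "lie_const u \<omega> x (xs @ v # ys @ v # zs) = 0"
    by (rule covectors_alternating[OF smooth_forms_covector[OF lie_const_smooth_forms[OF Cons(2)]]])
  ultimately show ?case by (simp add: ext_deriv_Cons)
qed

lemma smooth_ext_deriv: "\<omega> \<in> smooth_forms m \<Longrightarrow> smooth (\<lambda>x. ext_deriv \<omega> x vs)"
  unfolding ext_deriv_def
  by (intro smooth_sum smooth_mult smooth_const smooth_frechet_derivative smooth_forms_smooth)

lemma ext_deriv_smooth_forms: "\<omega> \<in> smooth_forms m \<Longrightarrow> ext_deriv \<omega> \<in> smooth_forms (Suc m)"
  by (intro smooth_formsI covectorsI)
    (auto intro: ext_deriv_linear ext_deriv_alternating ext_deriv_length smooth_ext_deriv)

lemma fd_commute:
  assumes "smooth f"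
  shows "frechet_derivative (\<lambda>y. frechet_derivative f (at y) u) (at x) v
    = frechet_derivative (\<lambda>y. frechet_derivative f (at y) v) (at x) u"
  using partial_deriv_commute[OF assms, of v u x] by (simp add: partial_deriv_def[abs_def])

text \<open>Cartan's formula for constant fields reduces \<open>d \<circ> d\<close> on a list to the tail of the list.\<close>

lemma ext_deriv_ext_deriv:
  assumes "\<omega> \<in> smooth_forms m" shows "ext_deriv (ext_deriv \<omega>) x vs = 0"
  using assms
proof (induction vs arbitrary: \<omega> m)
  case (Cons v vs)
  have "contract v (ext_deriv \<omega>) = lie_const v \<omega> - ext_deriv (contract v \<omega>)"
    by (auto simp: fun_eq_iff contract_def[of v "ext_deriv \<omega>"] ext_deriv_Cons)
  then have "ext_deriv (contract v (ext_deriv \<omega>)) x vs = ext_deriv (lie_const v \<omega>) x vs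
      - ext_deriv (ext_deriv (contract v \<omega>)) x vs"
    using ext_deriv_diff[OF lie_const_smooth_forms[OF Cons(2)] ext_deriv_smooth_forms[OF contract_smooth_forms[OF Cons(2)]]]
    by simp
  also have "ext_deriv (ext_deriv (contract v \<omega>)) x vs = 0"
    by (rule Cons(1)[OF contract_smooth_forms[OF Cons(2)]])
  \<comment> \<open>Differentiation along a constant field commutes with d because second
    derivatives are symmetric.\<close>
  also have "ext_deriv (lie_const v \<omega>) x vs = lie_const v (ext_deriv \<omega>) x vs"
    by (simp add: ext_deriv_def[of "lie_const v \<omega>"] lie_const_def ext_deriv_def[of \<omega>, abs_def]
      fd_sum fd_cmult smooth_mult smooth_frechet_derivative smooth_forms_smooth[OF Cons(2)] fd_commute[of _ v])
  finally show ?case by (simp add: ext_deriv_Cons[of "ext_deriv \<omega>"])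
qed simp

subsection \<open>Pullbacks\<close>

lemma covectors_sum_hd:
  assumes "\<phi> \<in> covectors m"
  shows "\<phi> (v # ys) = (\<Sum>b\<in>Basis. (v \<bullet> b) * \<phi> (b # ys))"
  by (subst linear_sum_Basis[OF covectors_linear_hd[OF assms]]) simp

text \<open>Expanding the first argument in the basis leaves coefficients times contractions with
  constant basis vectors, and these are forms with one argument fewer.\<close>

lemma smooth_form_eval:
  assumes "\<omega> \<in> smooth_forms m" "vsmooth f" "\<And>h. h \<in> set hs \<Longrightarrow> vsmooth h"
  shows "smooth (\<lambda>x. \<omega> (f x) (map (\<lambda>h. h x) hs))"
  using assms
proof (induction hs arbitrary: \<omega> m)
  case Nil
  then show ?case using smooth_compose[OF smooth_forms_smooth] by auto
next
  case (Cons h hs)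
  have eq: "(\<lambda>x. \<omega> (f x) (map (\<lambda>h. h x) (h # hs)))
      = (\<lambda>x. \<Sum>b\<in>Basis. (h x \<bullet> b) * contract b \<omega> (f x) (map (\<lambda>h. h x) hs))"
    by (simp add: covectors_sum_hd[OF smooth_forms_covector[OF Cons(2)], of _ "h x" for x] contract_def)
  show ?case
    unfolding eq using Cons(1)[OF contract_smooth_forms[OF Cons(2)] Cons(3)] Cons(4)
    by (intro smooth_sum smooth_mult vsmooth_inner) auto
qed

text \<open>The product rule for a form with moving base point and moving arguments. Its last sum,
  one summand per argument, is the source of the second derivatives in the pullback.\<close>

lemma fd_form_eval:
  assumes "\<omega> \<in> smooth_forms m" "vsmooth f" "\<And>h. h \<in> set hs \<Longrightarrow> vsmooth h"
  shows "frechet_derivative (\<lambda>x. \<omega> (f x) (map (\<lambda>h. h x) hs)) (at x) v =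
    frechet_derivative (\<lambda>y. \<omega> y (map (\<lambda>h. h x) hs)) (at (f x)) (frechet_derivative f (at x) v)
    + (\<Sum>j<length hs. \<omega> (f x) ((map (\<lambda>h. h x) hs)[j := frechet_derivative (hs ! j) (at x) v]))"
  using assms
proof (induction hs arbitrary: \<omega> m)
  case Nil
  then show ?case using frechet_derivative_comp[of "\<lambda>y. \<omega> y []" f] by (simp add: smooth_forms_smooth)
next
  case (Cons h hs)
  note cov = smooth_forms_covector[OF Cons(2)]
  let ?ws = "\<lambda>x. map (\<lambda>h. h x) hs"
  let ?Df = "frechet_derivative f (at x) v"
  let ?S = "\<lambda>\<omega>. \<Sum>j<length hs. \<omega> (f x) ((?ws x)[j := frechet_derivative (hs ! j) (at x) v])"
  have sm: "smooth (\<lambda>x. contract b \<omega> (f x) (?ws x))" for b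
    using Cons(4) by (intro smooth_form_eval[OF contract_smooth_forms[OF Cons(2)] Cons(3)]) auto
  have h: "vsmooth h" using Cons(4) by simp
  have IH: "frechet_derivative (\<lambda>x. contract b \<omega> (f x) (?ws x)) (at x) v
      = frechet_derivative (\<lambda>y. contract b \<omega> y (?ws x)) (at (f x)) ?Df + ?S (contract b \<omega>)" for b
    using Cons(4) by (intro Cons(1)[OF contract_smooth_forms[OF Cons(2)] Cons(3)]) auto
  have "(\<lambda>x. \<omega> (f x) (map (\<lambda>h. h x) (h # hs)))
      = (\<lambda>x. \<Sum>b\<in>Basis. (h x \<bullet> b) * contract b \<omega> (f x) (?ws x))"
    by (simp add: covectors_sum_hd[OF cov, of _ "h x" for x] contract_def)
  then have "frechet_derivative (\<lambda>x. \<omega> (f x) (map (\<lambda>h. h x) (h # hs))) (at x) v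
      = (\<Sum>b\<in>Basis. (h x \<bullet> b) * (frechet_derivative (\<lambda>y. contract b \<omega> y (?ws x)) (at (f x)) ?Df + ?S (contract b \<omega>))
          + (frechet_derivative h (at x) v \<bullet> b) * contract b \<omega> (f x) (?ws x))"
    by (simp add: fd_sum fd_mult smooth_mult sm vsmooth_inner[OF h] frechet_derivative_inner[OF h] IH)
  also have "\<dots> = (\<Sum>b\<in>Basis. (h x \<bullet> b) * frechet_derivative (\<lambda>y. contract b \<omega> y (?ws x)) (at (f x)) ?Df)
      + (\<Sum>b\<in>Basis. (h x \<bullet> b) * ?S (contract b \<omega>))
      + (\<Sum>b\<in>Basis. (frechet_derivative h (at x) v \<bullet> b) * contract b \<omega> (f x) (?ws x))"
    by (simp add: sum.distrib distrib_left)
  also have "(\<Sum>b\<in>Basis. (h x \<bullet> b) * frechet_derivative (\<lambda>y. contract b \<omega> y (?ws x)) (at (f x)) ?Df)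
      = frechet_derivative (\<lambda>y. \<omega> y (h x # ?ws x)) (at (f x)) ?Df"
    unfolding contract_def by (rule covectors_sum_hd[OF covector_derivative[OF Cons(2)], symmetric])
  also have "(\<Sum>b\<in>Basis. (frechet_derivative h (at x) v \<bullet> b) * contract b \<omega> (f x) (?ws x))
      = \<omega> (f x) (frechet_derivative h (at x) v # ?ws x)"
    unfolding contract_def by (rule covectors_sum_hd[OF cov, symmetric])
  also have "(\<Sum>b\<in>Basis. (h x \<bullet> b) * ?S (contract b \<omega>)) = ?S (\<lambda>y vs. \<omega> y (h x # vs))"
    unfolding sum_distrib_left by (subst sum.swap) (simp add: covectors_sum_hd[OF cov, of _ "h x"] contract_def)
  finally show ?case by (simp add: sum.lessThan_Suc_shift del: sum.lessThan_Suc)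
qed

definition pullback :: "('a::euclidean_space \<Rightarrow> 'b::euclidean_space) \<Rightarrow> 'b form \<Rightarrow> 'a form" where
  "pullback f \<omega> x vs = \<omega> (f x) (map (frechet_derivative f (at x)) vs)"

lemma linear_fd: "vsmooth f \<Longrightarrow> linear (frechet_derivative f (at x))"
  by (rule linear_frechet_derivative[OF vsmooth_differentiable])

lemma pullback_smooth_forms:
  assumes "\<omega> \<in> smooth_forms m" "vsmooth f" shows "pullback f \<omega> \<in> smooth_forms m"
proof (rule smooth_formsI)
  fix vs
  have "smooth (\<lambda>x. \<omega> (f x) (map (\<lambda>h. h x) (map (\<lambda>v x. frechet_derivative f (at x) v) vs)))"
    using assms by (intro smooth_form_eval) (auto intro: vsmooth_frechet_derivative)
  then show "smooth (\<lambda>x. pullback f \<omega> x vs)" by (simp add: pullback_def o_def)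
next
  fix x
  note cov = smooth_forms_covector[OF assms(1)] and lin = linear_fd[OF assms(2)]
  show "pullback f \<omega> x \<in> covectors m"
  proof (rule covectorsI)
    fix xs ys
    show "linear (\<lambda>v. pullback f \<omega> x (xs @ v # ys))"
      using linear_compose[OF lin covectors_linear[OF cov]] by (simp add: pullback_def o_def)
  qed (use covectors_alternating[OF cov] covectors_length[OF cov] in \<open>simp_all add: pullback_def\<close>)
qed

text \<open>These are the terms of d of a pullback in which the map is differentiated twice, with B
  its second derivative. Splitting off the first vector v, each pairing of v with another vector
  occurs twice, once from i = 0 and once from j = 0, with opposite signs; the remaining terms are
  the same sum for the covector contracted with L v.\<close>

lemma second_order_cancel:
  fixes L :: "'a \<Rightarrow> 'b::euclidean_space"
  assumes "\<phi> \<in> covectors m" "\<And>u v. B u v = B v u"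
  shows "(\<Sum>i<length vs. (- 1) ^ i * (\<Sum>j<length vs - 1.
    \<phi> ((map L (take i vs @ drop (Suc i) vs))[j := B (vs ! i) ((take i vs @ drop (Suc i) vs) ! j)]))) = 0"
  using assms(1)
proof (induction vs arbitrary: \<phi> m)
  case (Cons v us)
  let ?r = "\<lambda>k. take k us @ drop (Suc k) us"
  let ?n = "length us"
  have inner: "(\<Sum>j<?n. \<phi> ((map L (v # ?r k))[j := B (us ! k) ((v # ?r k) ! j)]))
      = \<phi> (B (us ! k) v # map L (?r k)) + (\<Sum>j<?n - 1. \<phi> (L v # (map L (?r k))[j := B (us ! k) (?r k ! j)]))"
    if "k < ?n" for k
  proof -
    have "?n \<noteq> 0" using that by linarith
    then obtain n where n: "?n = Suc n" using not0_implies_Suc by blast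
    show ?thesis unfolding n by (subst sum.lessThan_Suc_shift) simp
  qed
  have "(\<Sum>i<length (v # us). (- 1) ^ i * (\<Sum>j<length (v # us) - 1.
      \<phi> ((map L (take i (v # us) @ drop (Suc i) (v # us)))[j := B ((v # us) ! i) ((take i (v # us) @ drop (Suc i) (v # us)) ! j)])))
    = (\<Sum>j<?n. \<phi> ((map L us)[j := B v (us ! j)]))
      - (\<Sum>k<?n. (- 1) ^ k * (\<Sum>j<?n. \<phi> ((map L (v # ?r k))[j := B (us ! k) ((v # ?r k) ! j)])))"
    unfolding length_Cons by (subst sum.lessThan_Suc_shift) (simp add: sum_negf)
  also have "(\<Sum>k<?n. (- 1) ^ k * (\<Sum>j<?n. \<phi> ((map L (v # ?r k))[j := B (us ! k) ((v # ?r k) ! j)])))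
      = (\<Sum>k<?n. (- 1) ^ k * \<phi> (B (us ! k) v # map L (?r k)))
        + (\<Sum>k<?n. (- 1) ^ k * (\<Sum>j<?n - 1. \<phi> (L v # (map L (?r k))[j := B (us ! k) (?r k ! j)])))"
    by (simp only: sum.distrib[symmetric] distrib_left[symmetric]) (rule sum.cong, use inner in auto)
  also have "(\<Sum>k<?n. (- 1) ^ k * (\<Sum>j<?n - 1. \<phi> (L v # (map L (?r k))[j := B (us ! k) (?r k ! j)]))) = 0"
    by (rule Cons(1)[OF covectors_Cons[OF Cons(2)]])
  also have "(\<Sum>k<?n. (- 1) ^ k * \<phi> (B (us ! k) v # map L (?r k))) = (\<Sum>j<?n. \<phi> ((map L us)[j := B v (us ! j)]))"
  proof (rule sum.cong[OF refl])
    fix k assume "k \<in> {..<?n}"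
    then show "(- 1) ^ k * \<phi> (B (us ! k) v # map L (?r k)) = \<phi> ((map L us)[k := B v (us ! k)])"
      using covectors_update[OF Cons(2), of k "map L us" "B v (us ! k)"] assms(2)[of v "us ! k"]
      by (simp add: take_map drop_map)
  qed
  finally show ?case by simp
qed simp

lemma fd_commute_vec:
  fixes f :: "'a::euclidean_space \<Rightarrow> 'b::euclidean_space"
  assumes "vsmooth f"
  shows "frechet_derivative (\<lambda>y. frechet_derivative f (at y) u) (at x) v
    = frechet_derivative (\<lambda>y. frechet_derivative f (at y) v) (at x) u"
proof (rule euclidean_eqI)
  fix b :: 'b assume "b \<in> Basis"
  have "frechet_derivative (\<lambda>y. frechet_derivative f (at y) u) (at x) v \<bullet> b
      = frechet_derivative (\<lambda>y. frechet_derivative (\<lambda>z. f z \<bullet> b) (at y) u) (at x) v" for u v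
    by (simp add: frechet_derivative_inner[OF assms] frechet_derivative_inner[OF vsmooth_frechet_derivative[OF assms]])
  then show "frechet_derivative (\<lambda>y. frechet_derivative f (at y) u) (at x) v \<bullet> b
      = frechet_derivative (\<lambda>y. frechet_derivative f (at y) v) (at x) u \<bullet> b"
    using fd_commute[OF vsmooth_inner[OF assms]] by metis
qed

text \<open>The chain rule yields the pullback of the derivative together with second-order terms,
  which \<open>second_order_cancel\<close> removes.\<close>

lemma pullback_ext_deriv:
  fixes f :: "'a::euclidean_space \<Rightarrow> 'b::euclidean_space"
  assumes "\<omega> \<in> smooth_forms m" "vsmooth f"
  shows "ext_deriv (pullback f \<omega>) = pullback f (ext_deriv \<omega>)"
proof (intro ext)
  fix x :: 'a and vs :: "'a list"
  let ?L = "frechet_derivative f (at x)"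
  let ?B = "\<lambda>v w. frechet_derivative (\<lambda>y. frechet_derivative f (at y) w) (at x) v"
  let ?r = "\<lambda>i. take i vs @ drop (Suc i) vs"
  have hs: "vsmooth h" if "h \<in> set (map (\<lambda>v x. frechet_derivative f (at x) v) ws)" for h and ws :: "'a list"
    using that vsmooth_frechet_derivative[OF assms(2)] by auto
  have d: "frechet_derivative (\<lambda>y. pullback f \<omega> y ws) (at x) v =
      frechet_derivative (\<lambda>y. \<omega> y (map ?L ws)) (at (f x)) (?L v)
      + (\<Sum>j<length ws. \<omega> (f x) ((map ?L ws)[j := ?B v (ws ! j)]))" for ws v
    using fd_form_eval[OF assms, of "map (\<lambda>v x. frechet_derivative f (at x) v) ws" x v, OF hs]
    by (simp add: pullback_def o_def)
  have "ext_deriv (pullback f \<omega>) x vs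
    = (\<Sum>i<length vs. (- 1) ^ i * frechet_derivative (\<lambda>y. \<omega> y (map ?L (?r i))) (at (f x)) (?L (vs ! i)))
      + (\<Sum>i<length vs. (- 1) ^ i * (\<Sum>j<length vs - 1. \<omega> (f x) ((map ?L (?r i))[j := ?B (vs ! i) (?r i ! j)])))"
    unfolding ext_deriv_def d sum.distrib[symmetric] distrib_left[symmetric]
    by (intro sum.cong refl) auto
  also have "(\<Sum>i<length vs. (- 1) ^ i * (\<Sum>j<length vs - 1. \<omega> (f x) ((map ?L (?r i))[j := ?B (vs ! i) (?r i ! j)]))) = 0"
    by (rule second_order_cancel[OF smooth_forms_covector[OF assms(1)] fd_commute_vec[OF assms(2)]])
  also have "(\<Sum>i<length vs. (- 1) ^ i * frechet_derivative (\<lambda>y. \<omega> y (map ?L (?r i))) (at (f x)) (?L (vs ! i)))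
      = pullback f (ext_deriv \<omega>) x vs"
    by (simp add: pullback_def ext_deriv_def take_map drop_map)
  finally show "ext_deriv (pullback f \<omega>) x vs = pullback f (ext_deriv \<omega>) x vs" by simp
qed

subsection \<open>The homotopy formula\<close>

lemma smooth_foldr_partial: "smooth f \<Longrightarrow> bs \<in> lists Basis \<Longrightarrow> smooth (foldr partial_deriv bs f)"
  by (induction bs) (auto intro: smooth_partial)

lemma vsmooth_Pair: "vsmooth (\<lambda>x :: 'a::euclidean_space. (t :: real, x))"
  by (auto simp: vsmooth_def Basis_prod_def intro: vsmooth_inner)

lemma fd_Pair: "frechet_derivative (\<lambda>x :: 'a::euclidean_space. (t :: real, x)) (at x) v = (0, v)"
proof -
  have "((\<lambda>x :: 'a. (t, x)) has_derivative (\<lambda>v. (0, v))) (at x)"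
    by (auto intro!: derivative_eq_intros)
  then show ?thesis by (simp add: frechet_derivative_at[symmetric])
qed

lemma fd_slice:
  assumes "smooth \<psi>"
  shows "frechet_derivative (\<lambda>x. \<psi> (t :: real, x)) (at x) v = frechet_derivative \<psi> (at (t, x)) (0, v)"
  using frechet_derivative_comp[OF _ vsmooth_Pair, of \<psi> t x v] assms by (simp add: fd_Pair)

text \<open>Derivatives of a slice are derivatives on the product along the basis vectors (0, b);
  joint continuity of all orders, as \<open>smooth_integral\<close> demands, thus comes from
  smoothness on the product.\<close>

lemma foldr_partial_slice:
  assumes "smooth \<psi>" "bs \<in> lists Basis"
  shows "foldr partial_deriv bs (\<lambda>x. \<psi> (t :: real, x)) = (\<lambda>x. foldr partial_deriv (map (Pair 0) bs) \<psi> (t, x))"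
  using assms(2)
proof (induction bs)
  case (Cons b bs)
  have "map (Pair (0::real)) bs \<in> lists Basis" using Cons by (auto simp: Basis_prod_def)
  then have "smooth (foldr partial_deriv (map (Pair (0::real)) bs) \<psi>)"
    by (rule smooth_foldr_partial[OF assms(1)])
  then show ?case using Cons by (simp add: partial_deriv_def[abs_def] fd_slice)
qed simp

lemma slice_integral:
  fixes \<psi> :: "real \<times> 'a::euclidean_space \<Rightarrow> real"
  assumes "smooth \<psi>"
  shows "smooth (\<lambda>x. integral (cbox 0 1) (\<lambda>t. \<psi> (t, x)))"
    and "frechet_derivative (\<lambda>x. integral (cbox 0 1) (\<lambda>t. \<psi> (t, x))) (at x) v
      = integral (cbox 0 1) (\<lambda>t. frechet_derivative \<psi> (at (t, x)) (0, v))"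
proof -
  have 1: "smooth (\<lambda>x. \<psi> (t, x))" for t
    by (rule smooth_compose[OF assms vsmooth_Pair])
  have 2: "continuous_on (UNIV \<times> cbox 0 1) (\<lambda>(x, t). foldr partial_deriv bs (\<lambda>x. \<psi> (t, x)) x)"
    if "bs \<in> lists Basis" for bs
  proof -
    have "map (Pair (0::real)) bs \<in> lists Basis" using that by (auto simp: Basis_prod_def)
    then have "continuous_on UNIV (foldr partial_deriv (map (Pair (0::real)) bs) \<psi>)"
      by (intro smooth_continuous_on smooth_foldr_partial assms)
    then show ?thesis
      unfolding foldr_partial_slice[OF assms that] split_beta
      by (rule continuous_on_compose2) (auto intro!: continuous_intros)
  qed
  show "smooth (\<lambda>x. integral (cbox 0 1) (\<lambda>t. \<psi> (t, x)))"
    by (rule smooth_integral[OF 1 2])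
  show "frechet_derivative (\<lambda>x. integral (cbox 0 1) (\<lambda>t. \<psi> (t, x))) (at x) v
      = integral (cbox 0 1) (\<lambda>t. frechet_derivative \<psi> (at (t, x)) (0, v))"
    by (subst frechet_derivative_integral[OF 1 2]) (simp_all add: fd_slice[OF assms])
qed

lemma slice_integrable:
  "smooth \<psi> \<Longrightarrow> (\<lambda>t. \<psi> (t :: real, x)) integrable_on cbox 0 1"
  by (intro integrable_continuous continuous_on_compose2[OF smooth_continuous_on[of \<psi> UNIV]])
    (auto intro!: continuous_intros)

text \<open>The prism operator of the homotopy formula: contraction with the unit vector in the time
  direction, integrated over the fibre [0, 1].\<close>

definition cylinder_integral :: "(real \<times> 'a::euclidean_space) form \<Rightarrow> 'a form" where
  "cylinder_integral \<Omega> x vs = integral (cbox 0 1) (\<lambda>t. \<Omega> (t, x) ((1, 0) # map (Pair 0) vs))"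

text \<open>For m = 0 the truncated difference is 0 and the claim is still right: the integrand has
  a nonempty argument list, so the result is the zero form.\<close>

lemma cylinder_integral_smooth_forms:
  fixes \<Omega> :: "(real \<times> 'a::euclidean_space) form"
  assumes "\<Omega> \<in> smooth_forms m" shows "cylinder_integral \<Omega> \<in> smooth_forms (m - 1)"
proof (rule smooth_formsI)
  show "smooth (\<lambda>x. cylinder_integral \<Omega> x vs)" for vs
    unfolding cylinder_integral_def by (rule slice_integral(1)[OF smooth_forms_smooth[OF assms]])
next
  fix x
  note cov = covectors_Cons[OF smooth_forms_covector[OF assms]]
  note int = slice_integrable[OF smooth_forms_smooth[OF assms]]
  show "cylinder_integral \<Omega> x \<in> covectors (m - 1)"
  proof (rule covectorsI)
    fix xs ys
    have lin: "linear (\<lambda>v. \<Omega> (t, x) ((1, 0) # map (Pair 0) (xs @ v # ys)))" for t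
    proof -
      have "linear (Pair (0::real) :: 'a \<Rightarrow> _)" by (rule linearI) auto
      from linear_compose[OF this covectors_linear[OF cov]] show ?thesis by (simp add: o_def)
    qed
    show "linear (\<lambda>v. cylinder_integral \<Omega> x (xs @ v # ys))"
      unfolding cylinder_integral_def
      by (rule linearI) (simp_all only: linear_add[OF lin] linear_scale[OF lin] integral_add[OF int int]
        integral_mult_right real_scaleR_def)
  next
    fix xs v ys zs
    show "cylinder_integral \<Omega> x (xs @ v # ys @ v # zs) = 0"
      using covectors_alternating[OF cov, of _ "(1, 0)" "map (Pair 0) xs" "(0, v)" "map (Pair 0) ys" "map (Pair 0) zs"]
      by (simp add: cylinder_integral_def)
  next
    fix vs :: "'a list" assume "length vs \<noteq> m - 1"
    then show "cylinder_integral \<Omega> x vs = 0"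
      using covectors_length[OF cov, of "map (Pair 0) vs"] by (simp add: cylinder_integral_def)
  qed
qed

text \<open>Cartan's formula in the time direction splits the contraction of d\<Omega> into the time
  derivative of \<Omega>, integrated by the fundamental theorem, and d of the contraction, which
  commutes with integration over the fibre.\<close>

lemma cylinder_homotopy:
  fixes \<Omega> :: "(real \<times> 'a::euclidean_space) form"
  assumes \<Omega>: "\<Omega> \<in> smooth_forms m"
  shows "ext_deriv (cylinder_integral \<Omega>) x vs + cylinder_integral (ext_deriv \<Omega>) x vs
    = \<Omega> (1, x) (map (Pair 0) vs) - \<Omega> (0, x) (map (Pair 0) vs)"
proof -
  let ?ws = "map (Pair (0::real)) vs"
  let ?e = "(1::real, 0::'a)"
  let ?\<psi> = "\<lambda>y. \<Omega> y ?ws"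
  note sm = smooth_forms_smooth[OF \<Omega>]
  have ftc: "((\<lambda>t. frechet_derivative ?\<psi> (at (t, x)) ?e) has_integral (?\<psi> (1, x) - ?\<psi> (0, x))) (cbox 0 1)"
    unfolding cbox_interval
  proof (rule fundamental_theorem_of_calculus)
    fix t :: real
    show "((\<lambda>t. ?\<psi> (t, x)) has_vector_derivative frechet_derivative ?\<psi> (at (t, x)) ?e) (at t within {0..1})"
      using smooth_line_derivative[where y = "(0, x)" and u = ?e and s = t, OF sm, of ?ws]
      by (simp add: partial_deriv_def has_real_derivative_iff_has_vector_derivative has_vector_derivative_at_within)
  qed simp
  have "cylinder_integral (ext_deriv \<Omega>) x vs
      = integral (cbox 0 1) (\<lambda>t. frechet_derivative ?\<psi> (at (t, x)) ?e - ext_deriv (contract ?e \<Omega>) (t, x) ?ws)"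
    by (simp add: cylinder_integral_def ext_deriv_Cons lie_const_def)
  also have "\<dots> = (?\<psi> (1, x) - ?\<psi> (0, x)) - integral (cbox 0 1) (\<lambda>t. ext_deriv (contract ?e \<Omega>) (t, x) ?ws)"
    using slice_integrable[OF smooth_ext_deriv[OF contract_smooth_forms[OF \<Omega>]]] ftc
    by (subst integral_diff) (auto simp: integral_unique has_integral_integrable)
  also have "integral (cbox 0 1) (\<lambda>t. ext_deriv (contract ?e \<Omega>) (t, x) ?ws) = ext_deriv (cylinder_integral \<Omega>) x vs"
  proof -
    have int: "(\<lambda>t. (- 1) ^ i * frechet_derivative (\<lambda>y. \<Omega> y (?e # take i ?ws @ drop (Suc i) ?ws)) (at (t, x)) (?ws ! i))
        integrable_on cbox 0 1" for i
      by (rule slice_integrable[where \<psi> = "\<lambda>z. (- 1) ^ i *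
          frechet_derivative (\<lambda>y. \<Omega> y (?e # take i ?ws @ drop (Suc i) ?ws)) (at z) (?ws ! i)" and x = x])
        (intro smooth_mult smooth_const smooth_frechet_derivative sm)
    have "integral (cbox 0 1) (\<lambda>t. ext_deriv (contract ?e \<Omega>) (t, x) ?ws)
      = (\<Sum>i<length vs. integral (cbox 0 1) (\<lambda>t. (- 1) ^ i *
         frechet_derivative (\<lambda>y. \<Omega> y (?e # take i ?ws @ drop (Suc i) ?ws)) (at (t, x)) (?ws ! i)))"
      unfolding ext_deriv_def contract_def length_map
      by (rule integral_sum[OF finite_lessThan int])
    also have "\<dots> = (\<Sum>i<length vs. (- 1) ^ i * frechet_derivative (\<lambda>y. cylinder_integral \<Omega> y (take i vs @ drop (Suc i) vs)) (at x) (vs ! i))"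
      by (intro sum.cong refl) (simp add: cylinder_integral_def slice_integral(2)[OF sm, unfolded cbox_interval] take_map drop_map)
    finally show ?thesis by (simp only: ext_deriv_def)
  qed
  finally show ?thesis by simp
qed

definition line_homotopy :: "('a::euclidean_space \<Rightarrow> 'b::euclidean_space) \<Rightarrow> ('a \<Rightarrow> 'b) \<Rightarrow> real \<times> 'a \<Rightarrow> 'b" where
  "line_homotopy f g z = f (snd z) + fst z *\<^sub>R (g (snd z) - f (snd z))"

definition homotopy_form :: "('a::euclidean_space \<Rightarrow> 'b::euclidean_space) \<Rightarrow> ('a \<Rightarrow> 'b) \<Rightarrow> 'b form \<Rightarrow> 'a form" where
  "homotopy_form f g \<omega> = cylinder_integral (pullback (line_homotopy f g) \<omega>)"

lemma vsmooth_line_homotopy: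
  fixes f g :: "'a::euclidean_space \<Rightarrow> 'b::euclidean_space"
  assumes "vsmooth f" "vsmooth g" shows "vsmooth (line_homotopy f g)"
proof -
  have "vsmooth (snd :: real \<times> 'a \<Rightarrow> 'a)" by (rule vsmooth_linear[OF bounded_linear_snd])
  moreover have "smooth (fst :: real \<times> 'a \<Rightarrow> real)" by (rule smooth_linear[OF bounded_linear_fst])
  ultimately show ?thesis
    unfolding line_homotopy_def[abs_def]
    by (intro vsmooth_add vsmooth_scale vsmooth_diff vsmooth_compose[OF assms(1)] vsmooth_compose[OF assms(2)])
qed

lemma fd_line_homotopy:
  fixes f g :: "'a::euclidean_space \<Rightarrow> 'b::euclidean_space"
  assumes "vsmooth f" "vsmooth g"
  shows "frechet_derivative (line_homotopy f g) (at (t, x)) (s, v) =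
    frechet_derivative f (at x) v + t *\<^sub>R (frechet_derivative g (at x) v - frechet_derivative f (at x) v)
    + s *\<^sub>R (g x - f x)"
proof -
  have f: "((\<lambda>z. f (snd z)) has_derivative (\<lambda>w. frechet_derivative f (at x) (snd w))) (at (t, x))" if "vsmooth f" for f
    using has_derivative_compose[OF has_derivative_snd[OF has_derivative_ident], of f _ "(t, x)"] vsmooth_has_derivative[OF that]
    by simp
  have "(line_homotopy f g has_derivative (\<lambda>w. frechet_derivative f (at x) (snd w) +
      (fst (t, x) *\<^sub>R (frechet_derivative g (at x) (snd w) - frechet_derivative f (at x) (snd w))
        + fst w *\<^sub>R (g (snd (t, x)) - f (snd (t, x)))))) (at (t, x))"
    unfolding line_homotopy_def[abs_def]
    by (intro has_derivative_add has_derivative_scaleR has_derivative_diff f assms has_derivative_fst has_derivative_ident)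
  then show ?thesis by (simp add: frechet_derivative_at[symmetric])
qed

lemma homotopy_form_smooth_forms:
  "\<omega> \<in> smooth_forms m \<Longrightarrow> vsmooth f \<Longrightarrow> vsmooth g \<Longrightarrow> homotopy_form f g \<omega> \<in> smooth_forms (m - 1)"
  unfolding homotopy_form_def
  by (intro cylinder_integral_smooth_forms pullback_smooth_forms vsmooth_line_homotopy)

lemma homotopy_formula:
  fixes f g :: "'a::euclidean_space \<Rightarrow> 'b::euclidean_space"
  assumes "\<omega> \<in> smooth_forms m" "vsmooth f" "vsmooth g"
  shows "ext_deriv (homotopy_form f g \<omega>) x vs + homotopy_form f g (ext_deriv \<omega>) x vs
    = pullback g \<omega> x vs - pullback f \<omega> x vs"
proof -
  have "frechet_derivative (line_homotopy f g) (at (1, x)) \<circ> Pair 0 = frechet_derivative g (at x)"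
    "frechet_derivative (line_homotopy f g) (at (0, x)) \<circ> Pair 0 = frechet_derivative f (at x)"
    by (auto simp: fun_eq_iff fd_line_homotopy[OF assms(2,3)])
  then show ?thesis
    using cylinder_homotopy[OF pullback_smooth_forms[OF assms(1) vsmooth_line_homotopy[OF assms(2,3)]], of x vs]
    unfolding homotopy_form_def pullback_ext_deriv[OF assms(1) vsmooth_line_homotopy[OF assms(2,3)], symmetric]
    by (simp add: pullback_def[of _ _ "(_, _)"] pullback_def[of f] pullback_def[of g] line_homotopy_def)
qed

definition contraction :: "('a::euclidean_space \<Rightarrow> 'b::euclidean_space) \<Rightarrow> bool" where
  "contraction f \<longleftrightarrow> vsmooth f \<and> (\<forall>x v. norm (frechet_derivative f (at x) v) \<le> norm v)"

lemma norms_map_le: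
  assumes "\<And>v. norm (L v) \<le> norm v" shows "norms (map L vs) \<le> norms vs"
proof (induction vs)
  case (Cons v vs)
  then show ?case using assms[of v] norms_nonneg[of vs] norms_nonneg[of "map L vs"]
    by (simp add: mult_mono del: map_map)
qed simp

lemma pullback_bound:
  assumes "contraction f" "B \<ge> 0" "\<And>ws. \<bar>\<omega> (f x) ws\<bar> \<le> B * norms ws"
  shows "\<bar>pullback f \<omega> x vs\<bar> \<le> B * norms vs"
proof -
  have "\<bar>pullback f \<omega> x vs\<bar> \<le> B * norms (map (frechet_derivative f (at x)) vs)"
    unfolding pullback_def by (rule assms(3))
  also have "\<dots> \<le> B * norms vs"
    using assms(1) by (intro mult_left_mono[OF norms_map_le assms(2)]) (auto simp: contraction_def)
  finally show ?thesis .
qed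

text \<open>At fixed time the straight-line homotopy has the derivative (1-t) Df + t Dg, again
  norm-nonincreasing, and the time direction is mapped to g - f. So the displacement enters exactly
  once.\<close>

lemma homotopy_form_bound:
  fixes f g :: "'a::euclidean_space \<Rightarrow> 'b::euclidean_space"
  assumes \<omega>: "\<omega> \<in> smooth_forms m" and f: "contraction f" and g: "contraction g" and "B \<ge> 0"
    and B: "\<And>y ws. \<bar>\<omega> y ws\<bar> \<le> B * norms ws"
  shows "\<bar>homotopy_form f g \<omega> x vs\<bar> \<le> B * norm (g x - f x) * norms vs"
proof -
  let ?F = "line_homotopy f g"
  have fg: "vsmooth f" "vsmooth g" using f g by (auto simp: contraction_def)
  have "\<bar>pullback ?F \<omega> (t, x) ((1, 0) # map (Pair 0) vs)\<bar> \<le> B * norm (g x - f x) * norms vs"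
    if t: "t \<in> cbox 0 1" for t
  proof -
    let ?L = "\<lambda>v. frechet_derivative ?F (at (t, x)) (0, v)"
    have "norm (?L v) \<le> norm v" for v
    proof -
      have "?L v = (1 - t) *\<^sub>R frechet_derivative f (at x) v + t *\<^sub>R frechet_derivative g (at x) v"
        by (simp add: fd_line_homotopy[OF fg] algebra_simps)
      also have "norm \<dots> \<le> (1 - t) * norm (frechet_derivative f (at x) v) + t * norm (frechet_derivative g (at x) v)"
        using t norm_triangle_ineq[of "(1 - t) *\<^sub>R frechet_derivative f (at x) v" "t *\<^sub>R frechet_derivative g (at x) v"]
        by simp
      also have "\<dots> \<le> (1 - t) * norm v + t * norm v"
        using t f g by (intro add_mono mult_left_mono) (auto simp: contraction_def)
      finally show ?thesis by (simp add: algebra_simps)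
    qed
    then have n: "norms (map ?L vs) \<le> norms vs" by (rule norms_map_le)
    have e: "frechet_derivative ?F (at (t, x)) (1, 0) = g x - f x"
      using linear_0[OF linear_fd[OF fg(1)]] linear_0[OF linear_fd[OF fg(2)]] by (simp add: fd_line_homotopy[OF fg])
    have *: "map (frechet_derivative ?F (at (t, x))) ((1, 0) # map (Pair 0) vs) = (g x - f x) # map ?L vs"
      by (simp add: e)
    have "\<bar>pullback ?F \<omega> (t, x) ((1, 0) # map (Pair 0) vs)\<bar> \<le> B * norms ((g x - f x) # map ?L vs)"
      unfolding pullback_def * by (rule B)
    also have "\<dots> \<le> B * (norm (g x - f x) * norms vs)"
      using n \<open>B \<ge> 0\<close> by (auto intro!: mult_left_mono simp del: map_map)
    finally show ?thesis by (simp add: mult.assoc)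
  qed
  then have "norm (integral (cbox 0 1) (\<lambda>t. pullback ?F \<omega> (t, x) ((1, 0) # map (Pair 0) vs)))
      \<le> (B * norm (g x - f x) * norms vs) * Henstock_Kurzweil_Integration.content (cbox 0 (1::real))"
    using \<open>B \<ge> 0\<close> norms_nonneg[of vs]
    by (intro integrable_bound slice_integrable smooth_forms_smooth[OF pullback_smooth_forms[OF \<omega> vsmooth_line_homotopy[OF fg]]]) auto
  then show ?thesis by (simp add: homotopy_form_def cylinder_integral_def)
qed

subsection \<open>Forms of bounded comass\<close>

text \<open>By Hadamard's inequality and Gram--Schmidt this is the comass bound, with no loss in the
  constant.\<close>

definition form_le :: "real \<Rightarrow> 'a::euclidean_space form \<Rightarrow> bool" where
  "form_le B \<omega> \<longleftrightarrow> (\<forall>x vs. \<bar>\<omega> x vs\<bar> \<le> B * norms vs)"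

lemma form_norm_le_iff:
  assumes "\<omega> \<in> smooth_forms m" "B \<ge> 0"
  shows "form_norm m \<omega> \<le> ereal B \<longleftrightarrow> form_le B \<omega>"
  unfolding form_norm_def SUP_le_iff form_le_def
  by (simp add: comass_le_iff[OF smooth_forms_covector[OF assms(1)] assms(2)])

lemma form_le_mono: "form_le A \<omega> \<Longrightarrow> A \<le> B \<Longrightarrow> form_le B \<omega>"
  unfolding form_le_def by (meson mult_right_mono norms_nonneg order_trans)

lemma form_le_scale: "form_le A \<omega> \<Longrightarrow> form_le (\<bar>c\<bar> * A) (c *\<^sub>R \<omega>)"
  unfolding form_le_def by (auto simp: scaleR_fun_def abs_mult mult.assoc intro: mult_left_mono)

lemma smooth_forms_zero: "0 \<in> smooth_forms m"
  by (rule smooth_formsI) (auto simp: covectors_def linear_iff zero_fun_def)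

lemma smooth_forms_add:
  assumes "\<omega> \<in> smooth_forms m" "\<eta> \<in> smooth_forms m" shows "\<omega> + \<eta> \<in> smooth_forms m"
proof (rule smooth_formsI)
  fix x
  note c = smooth_forms_covector[OF assms(1), of x] smooth_forms_covector[OF assms(2), of x]
  show "(\<omega> + \<eta>) x \<in> covectors m"
    by (rule covectorsI)
      (auto intro: linear_compose_add covectors_linear[OF c(1)] covectors_linear[OF c(2)]
       simp: covectors_alternating[OF c(1)] covectors_alternating[OF c(2)] covectors_length[OF c(1)] covectors_length[OF c(2)])
next
  show "smooth (\<lambda>x. (\<omega> + \<eta>) x vs)" for vs
    using smooth_add[OF smooth_forms_smooth[OF assms(1)] smooth_forms_smooth[OF assms(2)]] by simp
qed

lemma smooth_forms_cutoff:
  assumes "\<omega> \<in> smooth_forms m" "smooth \<zeta>" shows "(\<lambda>x vs. \<zeta> x * \<omega> x vs) \<in> smooth_forms m"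
proof (rule smooth_formsI)
  fix x
  note c = smooth_forms_covector[OF assms(1), of x]
  show "(\<lambda>vs. \<zeta> x * \<omega> x vs) \<in> covectors m"
  proof (rule covectorsI)
    fix xs ys show "linear (\<lambda>v. \<zeta> x * \<omega> x (xs @ v # ys))"
      using linear_compose_scale_right[OF covectors_linear[OF c], of "\<zeta> x"] by simp
  qed (auto simp: covectors_alternating[OF c] covectors_length[OF c])
next
  show "smooth (\<lambda>x. \<zeta> x * \<omega> x vs)" for vs
    by (rule smooth_mult[OF assms(2) smooth_forms_smooth[OF assms(1)]])
qed

lemma smooth_forms_scale:
  assumes "\<omega> \<in> smooth_forms m" shows "c *\<^sub>R \<omega> \<in> smooth_forms m"
proof -
  have "c *\<^sub>R \<omega> = (\<lambda>x vs. c * \<omega> x vs)" by (simp add: scaleR_fun_def)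
  then show ?thesis using smooth_forms_cutoff[OF assms smooth_const[of c]] by simp
qed

lemma smooth_forms_diff: "\<omega> \<in> smooth_forms m \<Longrightarrow> \<eta> \<in> smooth_forms m \<Longrightarrow> \<omega> - \<eta> \<in> smooth_forms m"
  using smooth_forms_add[of \<omega> m "(-1) *\<^sub>R \<eta>"] smooth_forms_scale[of \<eta> m "-1"] by simp

lemma ext_deriv_form_scale: "\<omega> \<in> smooth_forms m \<Longrightarrow> ext_deriv (c *\<^sub>R \<omega>) = c *\<^sub>R ext_deriv \<omega>"
  using ext_deriv_scale[of \<omega> m c] by (auto simp: fun_eq_iff scaleR_fun_def)

lemma ext_deriv_form_zero: "ext_deriv 0 = 0"
  using ext_deriv_form_scale[OF smooth_forms_zero, of 0] by simp

lemma ext_deriv_cutoff: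
  assumes "\<omega> \<in> smooth_forms m" "smooth \<zeta>"
  shows "ext_deriv (\<lambda>x vs. \<zeta> x * \<omega> x vs) x vs = \<zeta> x * ext_deriv \<omega> x vs
    + (\<Sum>i<length vs. (- 1) ^ i * (frechet_derivative \<zeta> (at x) (vs ! i) * \<omega> x (take i vs @ drop (Suc i) vs)))"
  by (simp add: ext_deriv_def fd_mult[OF assms(2) smooth_forms_smooth[OF assms(1)]] sum_distrib_left
    distrib_left sum.distrib mult.left_commute)

text \<open>Leibniz' rule: the term with the derivative of \<zeta> has one summand for each of the m
  + 1 arguments, and each is at most c B times the product of the norms.\<close>

lemma ext_deriv_cutoff_bound:
  assumes \<omega>: "\<omega> \<in> smooth_forms m" and \<zeta>: "smooth \<zeta>"
    and c: "\<And>v. \<bar>frechet_derivative \<zeta> (at x) v\<bar> \<le> c * norm v" "c \<ge> 0"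
    and A: "\<bar>\<zeta> x * ext_deriv \<omega> x vs\<bar> \<le> A * norms vs" "A \<ge> 0" and B: "\<And>vs. \<bar>\<omega> x vs\<bar> \<le> B * norms vs" "B \<ge> 0"
  shows "\<bar>ext_deriv (\<lambda>x vs. \<zeta> x * \<omega> x vs) x vs\<bar> \<le> (A + (real m + 1) * (c * B)) * norms vs"
proof (cases "length vs = Suc m")
  case True
  let ?t = "\<lambda>i. (- 1) ^ i * (frechet_derivative \<zeta> (at x) (vs ! i) * \<omega> x (take i vs @ drop (Suc i) vs))"
  have "\<bar>?t i\<bar> \<le> c * B * norms vs" if i: "i < length vs" for i
  proof -
    have "\<bar>?t i\<bar> \<le> (c * norm (vs ! i)) * (B * norms (take i vs @ drop (Suc i) vs))"
      using c(1)[of "vs ! i"] B(1)[of "take i vs @ drop (Suc i) vs"] c(2)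
      by (simp add: abs_mult power_abs del: map_append prod_list.append) (intro mult_mono, auto)
    also have "\<dots> = c * B * (norms (take i vs) * (norm (vs ! i) * norms (drop (Suc i) vs)))" by simp
    also have "norms (take i vs) * (norm (vs ! i) * norms (drop (Suc i) vs)) = norms (take i vs @ vs ! i # drop (Suc i) vs)"
      by simp
    also have "take i vs @ vs ! i # drop (Suc i) vs = vs" using id_take_nth_drop[OF i] by simp
    finally show ?thesis .
  qed
  then have "\<bar>\<Sum>i<length vs. ?t i\<bar> \<le> (\<Sum>i<length vs. c * B * norms vs)"
    by (intro order_trans[OF sum_abs sum_mono]) auto
  also have "\<dots> = (real m + 1) * (c * B) * norms vs" using True by simp
  finally have "\<bar>\<Sum>i<length vs. ?t i\<bar> \<le> (real m + 1) * (c * B) * norms vs" .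
  then show ?thesis
    unfolding ext_deriv_cutoff[OF \<omega> \<zeta>] distrib_right
    by (intro order_trans[OF abs_triangle_ineq] add_mono A(1))
next
  case False
  then show ?thesis
    using ext_deriv_length[OF smooth_forms_cutoff[OF \<omega> \<zeta>] False] A B c norms_nonneg[of vs] by simp
qed

text \<open>The sum of the absolute values on all lists of basis vectors: cruder than comass, but a
  finite expression in the coefficients and therefore continuous along a smooth form.\<close>

fun covector_size :: "nat \<Rightarrow> ('a::euclidean_space list \<Rightarrow> real) \<Rightarrow> real" where
  "covector_size 0 \<phi> = \<bar>\<phi> []\<bar>"
| "covector_size (Suc m) \<phi> = (\<Sum>b\<in>Basis. covector_size m (\<lambda>vs. \<phi> (b # vs)))"

lemma covector_size_nonneg: "covector_size m \<phi> \<ge> 0"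
  by (induction m arbitrary: \<phi>) (auto intro: sum_nonneg)

lemma covector_size_bound: "\<phi> \<in> covectors m \<Longrightarrow> \<bar>\<phi> vs\<bar> \<le> covector_size m \<phi> * norms vs"
proof (induction m arbitrary: \<phi> vs)
  case 0
  then show ?case using covectors_length[OF 0, of vs] norms_nonneg[of vs] by (cases "vs = []") auto
next
  case (Suc m)
  show ?case
  proof (cases vs)
    case Nil
    then show ?thesis using covectors_length[OF Suc(2), of vs] covector_size_nonneg[of "Suc m" \<phi>] by simp
  next
    case (Cons v ws)
    have "\<bar>\<phi> (v # ws)\<bar> \<le> (\<Sum>b\<in>Basis. \<bar>(v \<bullet> b) * \<phi> (b # ws)\<bar>)"
      unfolding covectors_sum_hd[OF Suc(2), of v] by (rule sum_abs)
    also have "\<dots> \<le> (\<Sum>b\<in>Basis. norm v * (covector_size m (\<lambda>vs. \<phi> (b # vs)) * norms ws))"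
    proof (rule sum_mono)
      fix b :: 'a assume b: "b \<in> Basis"
      have "\<bar>\<phi> (b # ws)\<bar> \<le> covector_size m (\<lambda>vs. \<phi> (b # vs)) * norms ws"
        using Suc(1)[of "\<lambda>vs. \<phi> (b # vs)" ws] covectors_Cons[OF Suc(2), of b] by simp
      then show "\<bar>(v \<bullet> b) * \<phi> (b # ws)\<bar> \<le> norm v * (covector_size m (\<lambda>vs. \<phi> (b # vs)) * norms ws)"
        unfolding abs_mult using Basis_le_norm[OF b, of v] by (intro mult_mono) auto
    qed
    also have "\<dots> = covector_size (Suc m) \<phi> * norms vs"
      by (simp add: Cons sum_distrib_left sum_distrib_right mult_ac)
    finally show ?thesis by (simp add: Cons)
  qed
qed

lemma covector_size_le:
  fixes \<phi> :: "'a::euclidean_space list \<Rightarrow> real"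
  assumes "\<And>bs. length bs = m \<Longrightarrow> set bs \<subseteq> Basis \<Longrightarrow> \<bar>\<phi> bs\<bar> \<le> e" "e \<ge> 0"
  shows "covector_size m \<phi> \<le> real (DIM('a)) ^ m * e"
  using assms
proof (induction m arbitrary: \<phi>)
  case (Suc m)
  have "covector_size (Suc m) \<phi> \<le> (\<Sum>b\<in>(Basis::'a set). real (DIM('a)) ^ m * e)"
    unfolding covector_size.simps
  proof (rule sum_mono)
    fix b :: 'a assume b: "b \<in> Basis"
    show "covector_size m (\<lambda>vs. \<phi> (b # vs)) \<le> real (DIM('a)) ^ m * e"
      by (rule Suc(1)) (use Suc(2)[of "b # bs" for bs] Suc(3) b in auto)
  qed
  then show ?case by (simp add: mult_ac)
qed simp

lemma continuous_covector_size:
  "(\<And>vs. smooth (\<lambda>x. \<omega> x vs)) \<Longrightarrow> continuous_on S (\<lambda>x. covector_size m (\<omega> x))"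
proof (induction m arbitrary: \<omega>)
  case 0
  then show ?case unfolding covector_size.simps by (intro continuous_on_rabs smooth_continuous_on)
next
  case (Suc m)
  show ?case unfolding covector_size.simps
    by (intro continuous_on_sum Suc)
qed

lemma form_le_compact_support:
  assumes "\<omega> \<in> smooth_forms m" "\<And>x. norm x > R \<Longrightarrow> \<omega> x = 0"
  shows "\<exists>B\<ge>0. form_le B \<omega>"
proof -
  have "compact ((\<lambda>x. covector_size m (\<omega> x)) ` cball 0 R)"
    by (intro compact_continuous_image continuous_covector_size smooth_forms_smooth[OF assms(1)]) simp
  from compact_imp_bounded[OF this] obtain B where "\<forall>y\<in>(\<lambda>x. covector_size m (\<omega> x)) ` cball 0 R. norm y \<le> B"
    unfolding bounded_iff by blast
  then have B: "\<bar>covector_size m (\<omega> x)\<bar> \<le> B" if "x \<in> cball 0 R" for x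
    using that by simp
  have "\<bar>\<omega> x vs\<bar> \<le> max B 0 * norms vs" for x vs
  proof (cases "norm x > R")
    case True
    then show ?thesis using assms(2) norms_nonneg[of vs] by simp
  next
    case False
    then have "covector_size m (\<omega> x) \<le> max B 0" using B[of x] by (simp add: max.coboundedI1)
    then have "covector_size m (\<omega> x) * norms vs \<le> max B 0 * norms vs"
      by (rule mult_right_mono[OF _ norms_nonneg])
    then show ?thesis using covector_size_bound[OF smooth_forms_covector[OF assms(1)], of x vs] by linarith
  qed
  then show ?thesis by (intro exI[of _ "max B 0"]) (auto simp: form_le_def)
qed

subsection \<open>Cutoff functions\<close>

definition radial_cutoff :: "'a::euclidean_space \<Rightarrow> real \<Rightarrow> 'a \<Rightarrow> real" where
  "radial_cutoff a r x = smooth_step ((norm (x - a))\<^sup>2 / r\<^sup>2)"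

lemma radial_cutoff:
  assumes "r > 0"
  shows "smooth (radial_cutoff a r)" "0 \<le> radial_cutoff a r x" "radial_cutoff a r x \<le> 1"
    "norm (x - a) \<le> r \<Longrightarrow> radial_cutoff a r x = 1" "norm (x - a) \<ge> 2 * r \<Longrightarrow> radial_cutoff a r x = 0"
proof -
  show "smooth (radial_cutoff a r)"
    unfolding radial_cutoff_def[abs_def] divide_inverse
    by (rule smooth_compose[OF smooth_smooth_step])
      (simp, intro smooth_mult smooth_const smooth_norm_sq vsmooth_diff vsmooth_id vsmooth_const)
  show "0 \<le> radial_cutoff a r x" "radial_cutoff a r x \<le> 1"
    by (simp_all add: radial_cutoff_def smooth_step_bounds)
  show "radial_cutoff a r x = 1" if "norm (x - a) \<le> r"
  proof -
    have "(norm (x - a))\<^sup>2 \<le> r\<^sup>2" using that by (intro power_mono) auto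
    then show ?thesis unfolding radial_cutoff_def using assms by (intro smooth_step_1) (simp add: field_simps)
  qed
  show "radial_cutoff a r x = 0" if "norm (x - a) \<ge> 2 * r"
  proof -
    have "(2 * r)\<^sup>2 \<le> (norm (x - a))\<^sup>2" using that assms by (intro power_mono) auto
    moreover have "2 * r\<^sup>2 \<le> (2 * r)\<^sup>2" by (simp add: power_mult_distrib)
    ultimately have "2 * r\<^sup>2 \<le> (norm (x - a))\<^sup>2" by linarith
    then show ?thesis unfolding radial_cutoff_def using assms by (intro smooth_step_0) (simp add: field_simps)
  qed
qed

text \<open>Viewed as a 0-form, the cutoff has its gradient as exterior derivative, so the bound for
  forms vanishing outside a ball applies.\<close>

lemma radial_cutoff_derivative:
  assumes "r > 0"
  shows "\<exists>c\<ge>0. \<forall>x v. \<bar>frechet_derivative (radial_cutoff a r) (at x) v\<bar> \<le> c * norm v"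
proof -
  define \<omega> :: "'a form" where "\<omega> = (\<lambda>x vs. if vs = [] then radial_cutoff a r x else 0)"
  have \<omega>: "\<omega> \<in> smooth_forms 0"
  proof (rule smooth_formsI)
    show "\<omega> x \<in> covectors 0" for x by (simp add: \<omega>_def covectors_def)
    show "smooth (\<lambda>x. \<omega> x vs)" for vs
      using radial_cutoff(1)[OF assms] by (cases "vs = []") (simp_all add: \<omega>_def)
  qed
  have d: "ext_deriv \<omega> x [v] = frechet_derivative (radial_cutoff a r) (at x) v" for x v
    by (simp add: ext_deriv_def \<omega>_def)
  have "ext_deriv \<omega> x = 0" if x: "norm x > norm a + 2 * r" for x
  proof
    fix vs
    have "ext_deriv \<omega> x vs = ext_deriv 0 x vs"
      unfolding ext_deriv_def
    proof (intro sum.cong refl arg_cong2[of _ _ _ _ times])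
      fix i
      have "frechet_derivative (\<lambda>y. \<omega> y ws) (at x) = frechet_derivative (\<lambda>y. (0::'a form) y ws) (at x)" for ws
      proof (rule frechet_derivative_cong_open[of "{x. norm x > norm a + 2 * r}"])
        show "open {x::'a. norm a + 2 * r < norm x}" by (intro open_Collect_less continuous_intros)
        fix y :: 'a assume "y \<in> {x. norm a + 2 * r < norm x}"
        then have "norm (y - a) \<ge> 2 * r" using norm_triangle_ineq2[of y a] by simp
        then show "\<omega> y ws = (0::'a form) y ws" by (simp add: \<omega>_def radial_cutoff(5)[OF assms])
      qed (use x in simp)
      then show "frechet_derivative (\<lambda>y. \<omega> y (take i vs @ drop (Suc i) vs)) (at x) (vs ! i)
        = frechet_derivative (\<lambda>y. (0::'a form) y (take i vs @ drop (Suc i) vs)) (at x) (vs ! i)" by simp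
    qed
    then show "ext_deriv \<omega> x vs = 0 vs" by (simp add: ext_deriv_form_zero)
  qed
  then obtain B where B: "B \<ge> 0" "form_le B (ext_deriv \<omega>)"
    using form_le_compact_support[OF ext_deriv_smooth_forms[OF \<omega>], of "norm a + 2 * r"] by auto
  then have "\<bar>frechet_derivative (radial_cutoff a r) (at x) v\<bar> \<le> B * norm v" for x v
  proof -
    have "\<bar>ext_deriv \<omega> x [v]\<bar> \<le> B * norms [v]" using B(2) unfolding form_le_def by blast
    then show ?thesis by (simp add: d)
  qed
  then show ?thesis using B(1) by blast
qed

subsection \<open>Supports of currents\<close>

lemma currents_linear:
  assumes "T \<in> currents m"
  shows "\<omega> \<in> smooth_forms m \<Longrightarrow> \<eta> \<in> smooth_forms m \<Longrightarrow> T (\<omega> + \<eta>) = T \<omega> + T \<eta>"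
    "\<omega> \<in> smooth_forms m \<Longrightarrow> T (c *\<^sub>R \<omega>) = c * T \<omega>"
  using assms by (auto simp: currents_def linear_on_def)

lemma currents_outside: "T \<in> currents m \<Longrightarrow> \<omega> \<notin> smooth_forms m \<Longrightarrow> T \<omega> = 0"
  by (simp add: currents_def)

lemma currents_zero: "T \<in> currents m \<Longrightarrow> T 0 = 0"
  using currents_linear(2)[of T m 0 0] by (simp add: smooth_forms_zero)

lemma currents_diff:
  assumes "T \<in> currents m" "\<omega> \<in> smooth_forms m" "\<eta> \<in> smooth_forms m"
  shows "T (\<omega> - \<eta>) = T \<omega> - T \<eta>"
  using currents_linear(1)[OF assms(1,2) smooth_forms_scale[OF assms(3)], of "-1"] currents_linear(2)[OF assms(1,3), of "-1"]
  by simp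

lemma topspace_form_topology: "topspace (form_topology m) = smooth_forms m"
proof -
  have "\<omega> \<in> topspace (form_topology m)" if "\<omega> \<in> smooth_forms m" for \<omega> :: "'a form"
  proof -
    \<comment> \<open>The empty compact set imposes no condition, so this subbasic set consists of
      all smooth forms; \<open>replicate\<close> only supplies an argument list of the right
      length.\<close>
    have "{\<eta> \<in> smooth_forms m. \<forall>x\<in>{}. \<bar>foldr partial_deriv [] (\<lambda>y. \<eta> y (replicate m 0)) x
        - foldr partial_deriv [] (\<lambda>y. \<omega> y (replicate m 0)) x\<bar> < 1}
      \<in> {{\<eta> \<in> smooth_forms m. \<forall>x\<in>C. \<bar>foldr partial_deriv bs (\<lambda>y. \<eta> y vs) x
                                - foldr partial_deriv bs (\<lambda>y. \<omega> y vs) x\<bar> < \<epsilon>}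
      | \<omega> C bs vs \<epsilon>. \<omega> \<in> smooth_forms m \<and> compact C \<and> bs \<in> lists (Basis :: 'a set) \<and> length vs = m \<and> \<epsilon> > 0}"
      using that
      by (intro CollectI exI[of _ \<omega>] exI[of _ "{}"] exI[of _ "[]"] exI[of _ "replicate m 0"] exI[of _ 1]) simp
    then show ?thesis
      unfolding form_topology_def topology_generated_by_topspace by (rule UnionI) (use that in simp)
  qed
  then show ?thesis
    unfolding form_topology_def topology_generated_by_topspace by auto
qed

text \<open>Subbasic neighbourhoods test derivatives on a compact set only, and forms that agree on
  a larger open ball have the same derivatives there.\<close>

lemma currents_tendsto:
  assumes T: "T \<in> currents m" and \<omega>: "\<omega> \<in> smooth_forms m" "\<And>n. \<eta> n \<in> smooth_forms m"
    and ev: "\<And>R. eventually (\<lambda>n. \<forall>x. norm x < R \<longrightarrow> \<eta> n x = \<omega> x) sequentially"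
  shows "(\<lambda>n. T (\<eta> n)) \<longlonglongrightarrow> T \<omega>"
proof -
  have "eventually (\<lambda>n. \<eta> n \<in> U) sequentially" if "openin (form_topology m) U" "\<omega> \<in> U" for U
    using openin_topology_generated_by[OF that(1)[unfolded form_topology_def]] that(2)
  proof (induction rule: generate_topology_on.induct)
    case (Int a b)
    then show ?case by (simp add: eventually_conj_iff)
  next
    case (UN K)
    then obtain k where k: "k \<in> K" "\<omega> \<in> k" by blast
    show ?case by (rule eventually_mono[OF UN(2)[OF k]]) (use k in blast)
  next
    case (Basis s)
    then obtain \<xi> C bs vs \<epsilon> where s: "s = {\<eta> \<in> smooth_forms m. \<forall>x\<in>C. \<bar>foldr partial_deriv bs (\<lambda>y. \<eta> y vs) x
        - foldr partial_deriv bs (\<lambda>y. \<xi> y vs) x\<bar> < \<epsilon>}" "compact C" by blast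
    obtain R where R: "\<And>x. x \<in> C \<Longrightarrow> norm x < R"
      using compact_imp_bounded[OF s(2)] unfolding bounded_pos_less by blast
    show ?case
    proof (rule eventually_mono[OF ev[of R]])
      fix n assume n: "\<forall>x. norm x < R \<longrightarrow> \<eta> n x = \<omega> x"
      have "foldr partial_deriv bs (\<lambda>y. \<eta> n y vs) x = foldr partial_deriv bs (\<lambda>y. \<omega> y vs) x" if "x \<in> C" for x
        by (rule foldr_partial_cong_near[of "ball 0 R"]) (use n R that in auto)
      then show "\<eta> n \<in> s" using Basis(2) \<omega>(2) unfolding s(1) by simp
    qed
  qed simp
  then have lim: "limitin (form_topology m) \<eta> \<omega> sequentially"
    unfolding limitin_def topspace_form_topology using \<omega> by blast
  have "continuous_map (form_topology m) euclideanreal T" using T by (simp add: currents_def)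
  from continuous_map_limit[OF this lim] show ?thesis by (simp add: o_def)
qed

lemma currents_tendsto_cutoff:
  assumes "T \<in> currents m" "\<omega> \<in> smooth_forms m"
  shows "(\<lambda>n. T (\<lambda>x vs. radial_cutoff 0 (real (Suc n)) x * \<omega> x vs)) \<longlonglongrightarrow> T \<omega>"
proof (rule currents_tendsto[OF assms])
  show "(\<lambda>x vs. radial_cutoff 0 (real (Suc n)) x * \<omega> x vs) \<in> smooth_forms m" for n
    by (intro smooth_forms_cutoff assms radial_cutoff) simp
  fix R :: real
  obtain N where N: "R \<le> real N" using real_arch_simple by blast
  show "\<forall>\<^sub>F n in sequentially. \<forall>x. norm x < R \<longrightarrow> (\<lambda>vs. radial_cutoff 0 (real (Suc n)) x * \<omega> x vs) = \<omega> x"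
    using eventually_ge_at_top[of N]
  proof eventually_elim
    case (elim n)
    show ?case
    proof (intro allI impI)
      fix x :: 'a assume "norm x < R"
      then have "norm (x - 0) \<le> real (Suc n)" using N elim by simp
      then show "(\<lambda>vs. radial_cutoff 0 (real (Suc n)) x * \<omega> x vs) = \<omega> x"
        using radial_cutoff(4)[of "real (Suc n)" x 0] by (simp del: of_nat_Suc)
    qed
  qed
qed

lemma form_support_mem: "\<omega> x \<noteq> 0 \<Longrightarrow> x \<in> form_support \<omega>"
  unfolding form_support_def by (rule subsetD[OF closure_subset]) simp

lemma form_support_cutoff_subset: "form_support (\<lambda>x vs. \<zeta> x * \<omega> x vs) \<subseteq> form_support \<omega>"
  unfolding form_support_def
  by (rule closure_mono) (auto simp: fun_eq_iff)

text \<open>A partition of unity built one ball at a time: the radial cutoff at \<open>a\<close>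
  splits off a piece supported in the doubled ball, and what is left vanishes on the ball around
  \<open>a\<close>, hence lives in the others.\<close>

lemma currents_local_cover:
  assumes T: "T \<in> currents m" and "finite F"
    and F: "\<And>a. a \<in> F \<Longrightarrow> r a > 0 \<and> (\<forall>\<eta>\<in>smooth_forms m. compact (form_support \<eta>) \<and> form_support \<eta> \<subseteq> cball a (2 * r a) \<longrightarrow> T \<eta> = 0)"
    and "\<omega> \<in> smooth_forms m" "compact (form_support \<omega>)" "\<And>x. \<omega> x \<noteq> 0 \<Longrightarrow> \<exists>a\<in>F. x \<in> ball a (r a)"
  shows "T \<omega> = 0"
  using assms(2-6)
proof (induction F arbitrary: \<omega>)
  case empty
  then have "\<omega> = 0" by (auto simp: fun_eq_iff)
  from arg_cong[OF this, of T] show ?case unfolding currents_zero[OF T] .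
next
  case (insert a F)
  let ?\<psi> = "radial_cutoff a (r a)"
  let ?in = "\<lambda>x vs. ?\<psi> x * \<omega> x vs" and ?out = "\<lambda>x vs. (1 - ?\<psi> x) * \<omega> x vs"
  have ra: "r a > 0" using insert(4)[of a] by simp
  have sm: "?in \<in> smooth_forms m" "?out \<in> smooth_forms m"
    by (intro smooth_forms_cutoff insert(5) radial_cutoff ra smooth_diff smooth_const)+
  have cp: "compact (form_support (\<lambda>x vs. \<zeta> x * \<omega> x vs))" for \<zeta>
    using compact_Int_closed[OF insert(6), of "form_support (\<lambda>x vs. \<zeta> x * \<omega> x vs)"]
      form_support_cutoff_subset[of \<zeta> \<omega>] by (simp add: Int_absorb1 form_support_def)
  have "form_support ?in \<subseteq> cball a (2 * r a)"
    unfolding form_support_def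
  proof (rule closure_minimal)
    show "{x. ?in x \<noteq> 0} \<subseteq> cball a (2 * r a)"
    proof
      fix x assume "x \<in> {x. ?in x \<noteq> 0}"
      then have "?\<psi> x \<noteq> 0" by (auto simp: fun_eq_iff)
      then have "norm (x - a) \<le> 2 * r a"
        using radial_cutoff(5)[OF ra, of x a] by linarith
      then show "x \<in> cball a (2 * r a)" by (simp add: dist_norm norm_minus_commute)
    qed
  qed simp
  then have "T ?in = 0" using insert(4)[of a] sm(1) cp[of ?\<psi>] by simp
  moreover have "T ?out = 0"
  proof (rule insert(3)[OF _ sm(2) cp])
    fix x assume "?out x \<noteq> 0"
    then have x: "?\<psi> x \<noteq> 1" "\<omega> x \<noteq> 0" by (auto simp: fun_eq_iff)
    then have "x \<notin> ball a (r a)"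
      using radial_cutoff(4)[OF ra, of x a] by (auto simp: dist_norm norm_minus_commute[of a x])
    then show "\<exists>a\<in>F. x \<in> ball a (r a)" using insert(7)[OF x(2)] by blast
  qed (use insert(4) in blast)
  moreover have "\<omega> = ?in + ?out" by (simp add: fun_eq_iff left_diff_distrib)
  from arg_cong[OF this, of T] have "T \<omega> = T ?in + T ?out"
    unfolding currents_linear(1)[OF T sm] .
  ultimately show ?case by linarith
qed

text \<open>The complement of the support is a union of open null sets; compactness and the
  preceding lemma make the whole union null.\<close>

lemma currents_eq_0_compact:
  assumes T: "T \<in> currents m" and \<omega>: "\<omega> \<in> smooth_forms m" and c: "compact (form_support \<omega>)"
    and dis: "form_support \<omega> \<inter> spt m T = {}"
  shows "T \<omega> = 0"
proof -
  have "\<exists>r>0. \<forall>\<eta>\<in>smooth_forms m. compact (form_support \<eta>) \<and> form_support \<eta> \<subseteq> cball a (2 * r) \<longrightarrow> T \<eta> = 0"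
    if "a \<in> form_support \<omega>" for a
  proof -
    have "a \<notin> spt m T" using that dis by blast
    then obtain U where U: "open U" "a \<in> U"
      "\<forall>\<eta>\<in>smooth_forms m. compact (form_support \<eta>) \<and> form_support \<eta> \<subseteq> U \<longrightarrow> T \<eta> = 0"
      unfolding spt_def by blast
    then obtain e where e: "e > 0" "cball a e \<subseteq> U" using open_contains_cball by blast
    \<comment> \<open>Half the radius, because a radial cutoff of radius r reaches out to 2
      r.\<close>
    then show ?thesis using U(3) by (intro exI[of _ "e / 2"]) auto
  qed
  then obtain r where r: "\<And>a. a \<in> form_support \<omega> \<Longrightarrow> r a > 0 \<and>
    (\<forall>\<eta>\<in>smooth_forms m. compact (form_support \<eta>) \<and> form_support \<eta> \<subseteq> cball a (2 * r a) \<longrightarrow> T \<eta> = 0)"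
    by metis
  have "form_support \<omega> \<subseteq> (\<Union>a\<in>form_support \<omega>. ball a (r a))" using r by force
  then obtain F where F: "F \<subseteq> form_support \<omega>" "finite F" "form_support \<omega> \<subseteq> (\<Union>a\<in>F. ball a (r a))"
    using compactE_image[OF c, of "form_support \<omega>" "\<lambda>a. ball a (r a)"] by auto
  show ?thesis
  proof (rule currents_local_cover[OF T F(2) _ \<omega> c])
    show "r a > 0 \<and> (\<forall>\<eta>\<in>smooth_forms m. compact (form_support \<eta>) \<and> form_support \<eta> \<subseteq> cball a (2 * r a) \<longrightarrow> T \<eta> = 0)"
      if "a \<in> F" for a using r F(1) that by blast
    fix x assume "\<omega> x \<noteq> 0"
    then have "x \<in> form_support \<omega>" by (rule form_support_mem)
    then show "\<exists>a\<in>F. x \<in> ball a (r a)" using F(3) by blast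
  qed
qed

text \<open>\<open>spt\<close> is tested on compactly supported forms only; continuity of T along
  radial cutoffs carries the vanishing over to arbitrary forms.\<close>

lemma currents_local:
  assumes T: "T \<in> currents m" and \<omega>: "\<omega> \<in> smooth_forms m" and U: "open U" "spt m T \<subseteq> U" "\<And>x. x \<in> U \<Longrightarrow> \<omega> x = 0"
  shows "T \<omega> = 0"
proof -
  have "T (\<lambda>x vs. radial_cutoff 0 (real (Suc n)) x * \<omega> x vs) = 0" for n
  proof (rule currents_eq_0_compact[OF T])
    let ?\<eta> = "\<lambda>x vs. radial_cutoff 0 (real (Suc n)) x * \<omega> x vs"
    have n: "real (Suc n) > 0" by simp
    show "?\<eta> \<in> smooth_forms m" by (intro smooth_forms_cutoff \<omega> radial_cutoff(1) n)
    have "{x. ?\<eta> x \<noteq> 0} \<subseteq> cball 0 (2 * real (Suc n))"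
    proof
      fix x assume "x \<in> {x. ?\<eta> x \<noteq> 0}"
      then have "radial_cutoff 0 (real (Suc n)) x \<noteq> 0" by (auto simp: fun_eq_iff)
      then show "x \<in> cball 0 (2 * real (Suc n))"
        using radial_cutoff(5)[OF n, of x 0] by (cases "norm x \<le> 2 * real (Suc n)") auto
    qed
    then have "form_support ?\<eta> \<subseteq> cball 0 (2 * real (Suc n))"
      unfolding form_support_def by (rule closure_minimal) simp
    then show "compact (form_support ?\<eta>)"
      using compact_Int_closed[OF compact_cball, of "form_support ?\<eta>" 0 "2 * real (Suc n)"]
      by (simp add: Int_absorb1 form_support_def del: of_nat_Suc)
    have "{x. ?\<eta> x \<noteq> 0} \<subseteq> - U" using U(3) by (auto simp: fun_eq_iff)
    then have "form_support ?\<eta> \<subseteq> - U"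
      unfolding form_support_def by (rule closure_minimal) (use U(1) in \<open>simp add: closed_def\<close>)
    then show "form_support ?\<eta> \<inter> spt m T = {}" using U(2) by blast
  qed
  then show ?thesis using currents_tendsto_cutoff[OF T \<omega>] by (simp only: LIMSEQ_const_iff)
qed

lemma currents_local_eq:
  assumes "T \<in> currents m" "\<omega> \<in> smooth_forms m" "\<eta> \<in> smooth_forms m"
    and "open U" "spt m T \<subseteq> U" "\<And>x. x \<in> U \<Longrightarrow> \<omega> x = \<eta> x"
  shows "T \<omega> = T \<eta>"
  using currents_local[OF assms(1) smooth_forms_diff[OF assms(2,3)] assms(4,5)] currents_diff[OF assms(1-3)] assms(6)
  by simp

lemma spt_subsetI:
  assumes "closed K" "\<And>\<omega>. \<omega> \<in> smooth_forms m \<Longrightarrow> compact (form_support \<omega>) \<Longrightarrow> form_support \<omega> \<inter> K = {} \<Longrightarrow> T \<omega> = 0"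
  shows "spt m T \<subseteq> K"
proof -
  have "- K \<subseteq> \<Union> {U. open U \<and> (\<forall>\<omega>\<in>smooth_forms m. compact (form_support \<omega>) \<and> form_support \<omega> \<subseteq> U \<longrightarrow> T \<omega> = 0)}"
    by (rule Union_upper) (use assms in auto)
  then show ?thesis unfolding spt_def by blast
qed

lemma currents_disjoint_support:
  assumes "T \<in> currents m" "spt m T \<subseteq> K" "\<omega> \<in> smooth_forms m" "form_support \<omega> \<inter> K = {}"
  shows "T \<omega> = 0"
proof (rule currents_local[OF assms(1,3), of "- form_support \<omega>"])
  show "open (- form_support \<omega>)" unfolding form_support_def by (rule open_Compl[OF closed_closure])
  show "spt m T \<subseteq> - form_support \<omega>" using assms(2,4) by blast
  show "\<omega> x = 0" if "x \<in> - form_support \<omega>" for x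
    using that form_support_mem[of \<omega> x] by (cases "\<omega> x = 0") auto
qed

subsection \<open>Mass and flat norm\<close>

lemma form_norm_le_1: "\<omega> \<in> smooth_forms m \<Longrightarrow> form_norm m \<omega> \<le> 1 \<longleftrightarrow> form_le 1 \<omega>"
  using form_norm_le_iff[of \<omega> m 1] by (simp add: one_ereal_def)

lemma mass_le_iff: "mass m T \<le> ereal A \<longleftrightarrow> (\<forall>\<omega>\<in>smooth_forms m. form_le 1 \<omega> \<longrightarrow> T \<omega> \<le> A)"
  unfolding mass_def SUP_le_iff by (auto simp: form_norm_le_1)

lemma mass_upper: "\<omega> \<in> smooth_forms m \<Longrightarrow> form_le 1 \<omega> \<Longrightarrow> ereal (T \<omega>) \<le> mass m T"
  unfolding mass_def by (intro SUP_upper) (simp add: form_norm_le_1)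

lemma form_le_zero: "B \<ge> 0 \<Longrightarrow> form_le B 0"
  by (simp add: form_le_def norms_nonneg)

lemma mass_nonneg: "T 0 = 0 \<Longrightarrow> mass m T \<ge> 0"
  using mass_upper[OF smooth_forms_zero form_le_zero[of 1], where T = T] by (simp add: zero_ereal_def)

lemma boundary_apply: "m > 0 \<Longrightarrow> \<eta> \<in> smooth_forms (m - 1) \<Longrightarrow> boundary m T \<eta> = T (ext_deriv \<eta>)"
  by (simp add: boundary_def)

lemma boundary_zero: "T 0 = 0 \<Longrightarrow> boundary m T 0 = 0"
  by (simp add: boundary_def ext_deriv_form_zero)

lemma normal_mass_nonneg: "T 0 = 0 \<Longrightarrow> normal_mass m T \<ge> 0"
  by (simp add: normal_mass_def mass_nonneg boundary_zero)

lemma normal_currentsD: "T \<in> normal_currents m \<Longrightarrow> T \<in> currents m"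
  by (simp add: normal_currents_def)

lemma normal_currents_apply_0: "T \<in> normal_currents m \<Longrightarrow> T 0 = 0"
  by (rule currents_zero[OF normal_currentsD])

lemma normal_mass_real:
  assumes "T \<in> normal_currents m" shows "normal_mass m T = ereal (normal_norm m T)"
proof -
  have "0 \<le> normal_mass m T" by (rule normal_mass_nonneg[of T, OF normal_currents_apply_0[OF assms]])
  moreover have "normal_mass m T < \<infinity>" using assms by (simp add: normal_currents_def)
  ultimately show ?thesis unfolding normal_norm_def by (cases "normal_mass m T") simp_all
qed

lemma normal_norm_nonneg:
  assumes "T \<in> normal_currents m" shows "normal_norm m T \<ge> 0"
proof -
  have "0 \<le> normal_mass m T" by (rule normal_mass_nonneg[of T, OF normal_currents_apply_0[OF assms]])
  then show ?thesis unfolding normal_mass_real[OF assms] by simp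
qed

lemma mass_le_normal_norm:
  assumes "T \<in> normal_currents m"
  shows "mass m T \<le> ereal (normal_norm m T)"
    and "m > 0 \<Longrightarrow> mass (m - 1) (boundary m T) \<le> ereal (normal_norm m T)"
proof -
  have z: "T 0 = 0" by (rule currents_zero[OF normal_currentsD[OF assms]])
  have "mass m T \<ge> 0" "mass (m - 1) (boundary m T) \<ge> 0" by (intro mass_nonneg z boundary_zero)+
  then show "mass m T \<le> ereal (normal_norm m T)"
    "m > 0 \<Longrightarrow> mass (m - 1) (boundary m T) \<le> ereal (normal_norm m T)"
    unfolding normal_mass_real[OF assms, symmetric] normal_mass_def
    by (auto simp: add_increasing add_increasing2)
qed

lemma linear_bound:
  assumes lin: "\<And>c \<omega>. \<omega> \<in> smooth_forms m \<Longrightarrow> T (c *\<^sub>R \<omega>) = c * T \<omega>"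
    and A: "mass m T \<le> ereal A" and \<omega>: "\<omega> \<in> smooth_forms m" "form_le B \<omega>" and "B > 0"
  shows "\<bar>T \<omega>\<bar> \<le> A * B"
proof -
  have "T ((c / B) *\<^sub>R \<omega>) \<le> A" if "\<bar>c\<bar> = 1" for c
  proof -
    have "form_le 1 ((c / B) *\<^sub>R \<omega>)"
      using form_le_scale[OF \<omega>(2), of "c / B"] that \<open>B > 0\<close> by simp
    then show ?thesis using A smooth_forms_scale[OF \<omega>(1)] unfolding mass_le_iff by blast
  qed
  from this[of 1] this[of "-1"] have "T \<omega> / B \<le> A" "- T \<omega> / B \<le> A"
    using lin[OF \<omega>(1), of "1 / B"] lin[OF \<omega>(1), of "(-1) / B"] by simp_all
  then show ?thesis using \<open>B > 0\<close> by (auto simp: field_simps abs_le_iff)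
qed

lemma normal_bound:
  assumes T: "T \<in> normal_currents m" and \<omega>: "\<omega> \<in> smooth_forms m" "form_le B \<omega>" "B > 0"
  shows "\<bar>T \<omega>\<bar> \<le> normal_norm m T * B"
  by (rule linear_bound[OF currents_linear(2)[OF normal_currentsD[OF T]] mass_le_normal_norm(1)[OF T] \<omega>])

lemma normal_boundary_bound:
  assumes T: "T \<in> normal_currents m" and m: "m > 0" and \<eta>: "\<eta> \<in> smooth_forms (m - 1)" "form_le B \<eta>" "B > 0"
  shows "\<bar>T (ext_deriv \<eta>)\<bar> \<le> normal_norm m T * B"
proof -
  have "\<bar>boundary m T \<eta>\<bar> \<le> normal_norm m T * B"
  proof (rule linear_bound[OF _ mass_le_normal_norm(2)[OF T m] \<eta>])
    fix c and \<omega> :: "'a form" assume \<omega>: "\<omega> \<in> smooth_forms (m - 1)"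
    have "ext_deriv \<omega> \<in> smooth_forms m" using ext_deriv_smooth_forms[OF \<omega>] m by simp
    then show "boundary m T (c *\<^sub>R \<omega>) = c * boundary m T \<omega>"
      using m \<omega> smooth_forms_scale[OF \<omega>]
      by (simp add: boundary_apply ext_deriv_form_scale[OF \<omega>] currents_linear(2)[OF normal_currentsD[OF T]])
  qed
  then show ?thesis by (simp add: boundary_apply[OF m \<eta>(1)])
qed

definition flat_ball :: "nat \<Rightarrow> 'a::euclidean_space form set" where
  "flat_ball m = {\<omega> \<in> smooth_forms m. form_le 1 \<omega> \<and> form_le 1 (ext_deriv \<omega>)}"

lemma normal_flat_norm_eq: "normal_flat_norm m T = Sup (T ` flat_ball m)"
proof -
  have "{T \<omega> | \<omega>. \<omega> \<in> smooth_forms m \<and> max (form_norm m \<omega>) (form_norm (Suc m) (ext_deriv \<omega>)) \<le> 1} = T ` flat_ball m"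
    by (auto simp: flat_ball_def form_norm_le_1 form_norm_le_1[OF ext_deriv_smooth_forms])
  then show ?thesis by (simp add: normal_flat_norm_def)
qed

lemma flat_ball_zero: "0 \<in> flat_ball m"
  by (simp add: flat_ball_def smooth_forms_zero form_le_zero ext_deriv_form_zero)

text \<open>All flat currents satisfy this, and their flat norm is then given by the same supremum as for
  normal currents.\<close>

definition flat_bounded :: "nat \<Rightarrow> 'a::euclidean_space current \<Rightarrow> bool" where
  "flat_bounded m T \<longleftrightarrow> (\<forall>c. \<forall>\<omega>\<in>smooth_forms m. T (c *\<^sub>R \<omega>) = c * T \<omega>) \<and> bdd_above (T ` flat_ball m)"

lemma flat_norm_upper: "flat_bounded m T \<Longrightarrow> \<omega> \<in> flat_ball m \<Longrightarrow> T \<omega> \<le> normal_flat_norm m T"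
  unfolding normal_flat_norm_eq flat_bounded_def by (auto intro: cSUP_upper)

lemma flat_norm_least: "(\<And>\<omega>. \<omega> \<in> flat_ball m \<Longrightarrow> T \<omega> \<le> A) \<Longrightarrow> normal_flat_norm m T \<le> A"
  unfolding normal_flat_norm_eq using flat_ball_zero by (intro cSUP_least) auto

lemma flat_ball_scale: "\<omega> \<in> flat_ball m \<Longrightarrow> \<bar>c\<bar> \<le> 1 \<Longrightarrow> c *\<^sub>R \<omega> \<in> flat_ball m"
  unfolding flat_ball_def
  using form_le_scale[of 1 \<omega> c] form_le_scale[of 1 "ext_deriv \<omega>" c] form_le_mono[of "\<bar>c\<bar>" _ 1]
  by (auto simp: smooth_forms_scale ext_deriv_form_scale)

lemma flat_norm_abs:
  assumes T: "flat_bounded m T" and \<omega>: "\<omega> \<in> flat_ball m"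
  shows "\<bar>T \<omega>\<bar> \<le> normal_flat_norm m T"
proof -
  have "T ((-1) *\<^sub>R \<omega>) = (-1) * T \<omega>" using assms unfolding flat_bounded_def flat_ball_def by blast
  moreover have "T ((-1) *\<^sub>R \<omega>) \<le> normal_flat_norm m T"
    by (rule flat_norm_upper[OF T flat_ball_scale[OF \<omega>]]) simp
  ultimately show ?thesis using flat_norm_upper[OF T \<omega>] by linarith
qed

lemma flat_norm_nonneg: "flat_bounded m T \<Longrightarrow> normal_flat_norm m T \<ge> 0"
  using flat_norm_abs[OF _ flat_ball_zero] abs_ge_zero order_trans by blast

lemma flat_norm_bound:
  assumes T: "flat_bounded m T" and \<omega>: "\<omega> \<in> smooth_forms m" "form_le B \<omega>" "form_le B (ext_deriv \<omega>)" and "B > 0"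
  shows "\<bar>T \<omega>\<bar> \<le> normal_flat_norm m T * B"
proof -
  have "form_le 1 ((1 / B) *\<^sub>R \<omega>)" "form_le 1 ((1 / B) *\<^sub>R ext_deriv \<omega>)"
    using form_le_scale[OF \<omega>(2), of "1 / B"] form_le_scale[OF \<omega>(3), of "1 / B"] \<open>B > 0\<close> by simp_all
  then have *: "(1 / B) *\<^sub>R \<omega> \<in> flat_ball m"
    by (simp add: flat_ball_def smooth_forms_scale \<omega>(1) ext_deriv_form_scale[OF \<omega>(1)])
  have "\<bar>(1 / B) * T \<omega>\<bar> \<le> normal_flat_norm m T"
  proof -
    have "T ((1 / B) *\<^sub>R \<omega>) = (1 / B) * T \<omega>" using T \<omega>(1) unfolding flat_bounded_def by blast
    then show ?thesis using flat_norm_abs[OF T *] by simp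
  qed
  then show ?thesis using \<open>B > 0\<close> by (simp add: abs_mult field_simps)
qed

lemma normal_flat_bounded:
  assumes "T \<in> normal_currents m" shows "flat_bounded m T" "normal_flat_norm m T \<le> normal_norm m T"
proof -
  have *: "T \<omega> \<le> normal_norm m T" if "\<omega> \<in> flat_ball m" for \<omega>
    using normal_bound[OF assms, of \<omega> 1] that by (simp add: flat_ball_def)
  show "flat_bounded m T"
    unfolding flat_bounded_def using currents_linear(2)[OF normal_currentsD[OF assms]] * by (auto intro!: bdd_aboveI)
  show "normal_flat_norm m T \<le> normal_norm m T" by (rule flat_norm_least[OF *])
qed

subsection \<open>A sufficient condition for continuity\<close>

lemma ext_deriv_cong_open:
  assumes "open U" "x \<in> U" "\<And>y. y \<in> U \<Longrightarrow> \<omega> y = \<eta> y"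
  shows "ext_deriv \<omega> x = ext_deriv \<eta> x"
proof
  fix vs
  have "frechet_derivative (\<lambda>y. \<omega> y ws) (at x) = frechet_derivative (\<lambda>y. \<eta> y ws) (at x)" for ws
    by (rule frechet_derivative_cong_open[OF assms(1) _ assms(2)]) (simp add: assms(3))
  then show "ext_deriv \<omega> x vs = ext_deriv \<eta> x vs" by (simp add: ext_deriv_def)
qed

lemma linear_on_forms_diff:
  assumes "linear_on (smooth_forms m) T" "\<omega> \<in> smooth_forms m" "\<eta> \<in> smooth_forms m"
  shows "T (\<omega> - \<eta>) = T \<omega> - (T \<eta> :: real)"
proof -
  have "T (\<omega> + (-1) *\<^sub>R \<eta>) = T \<omega> + T ((-1) *\<^sub>R \<eta>)" "T ((-1) *\<^sub>R \<eta>) = (-1) *\<^sub>R T \<eta>"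
    using assms smooth_forms_scale[OF assms(3), of "-1"] unfolding linear_on_def by blast+
  then show ?thesis by simp
qed

text \<open>A sup bound of \<omega> and d\<omega> on a ball follows from finitely many seminorms,
  namely the coefficients on basis lists and their first partial derivatives; these cut out an open
  neighbourhood on which T varies little.\<close>

lemma currentsI:
  fixes T :: "'a::euclidean_space current"
  assumes lin: "linear_on (smooth_forms m) T" and out: "\<And>\<omega>. \<omega> \<notin> smooth_forms m \<Longrightarrow> T \<omega> = 0"
    and bd: "\<And>\<omega> B. \<omega> \<in> smooth_forms m \<Longrightarrow> B > 0 \<Longrightarrow> (\<And>x vs. norm x \<le> R \<Longrightarrow> \<bar>\<omega> x vs\<bar> \<le> B * norms vs) \<Longrightarrow>
      (\<And>x vs. norm x \<le> R \<Longrightarrow> \<bar>ext_deriv \<omega> x vs\<bar> \<le> B * norms vs) \<Longrightarrow> \<bar>T \<omega>\<bar> \<le> c * B"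
  shows "T \<in> currents m"
proof -
  define D where "D = real DIM('a)"
  \<comment> \<open>Turns \<delta>-closeness of coefficients into bounds by products of norms: there
    are D^m basis lists for the form, and D^(m+1) lists with m + 1 summands each for its
    derivative.\<close>
  define M where "M = D ^ m + D ^ Suc m * (real m + 1)"
  have D: "D \<ge> 1" by (simp add: D_def Suc_leI)
  have Dp: "D ^ m > 0" "D ^ Suc m * (real m + 1) > 0" using D by (simp_all add: add_nonneg_pos)
  have M: "M > 0" unfolding M_def by (rule add_pos_pos[OF Dp])
  define V where "V = {vs. set vs \<subseteq> (Basis :: 'a set) \<and> length vs = m}"
  define J where "J = insert [] ((\<lambda>b. [b]) ` (Basis :: 'a set))"
  have fin: "finite (V \<times> J)" unfolding V_def J_def by (simp add: finite_lists_length_eq)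
  obtain b0 :: 'a where "b0 \<in> Basis" using nonempty_Basis by blast
  then have "replicate m b0 \<in> V" by (auto simp: V_def)
  then have ne: "V \<times> J \<noteq> {}" by (auto simp: J_def)
  have "openin (form_topology m) {\<omega> \<in> topspace (form_topology m). T \<omega> \<in> U}" if U: "open U" for U
    unfolding topspace_form_topology
  proof (subst openin_subopen, intro ballI)
    fix \<omega>0 assume "\<omega>0 \<in> {\<omega> \<in> smooth_forms m. T \<omega> \<in> U}"
    then have \<omega>0: "\<omega>0 \<in> smooth_forms m" "T \<omega>0 \<in> U" by auto
    obtain e where e: "e > 0" "\<And>y. \<bar>y - T \<omega>0\<bar> < e \<Longrightarrow> y \<in> U"
      using U \<omega>0(2) unfolding open_dist dist_real_def by blast
    \<comment> \<open>Makes c M \<delta> at most e/2; the added 1 guards against c = 0.\<close>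
    define \<delta> where "\<delta> = e / (2 * (\<bar>c\<bar> + 1) * M)"
    have \<delta>: "\<delta> > 0" unfolding \<delta>_def using e M by (intro divide_pos_pos mult_pos_pos) auto
    define N where "N = (\<lambda>(vs, bs). {\<eta> \<in> smooth_forms m. \<forall>x\<in>cball 0 R. \<bar>foldr partial_deriv bs (\<lambda>y. \<eta> y vs) x
                                - foldr partial_deriv bs (\<lambda>y. \<omega>0 y vs) x\<bar> < \<delta>})"
    define W where "W = \<Inter> (N ` (V \<times> J))"
    have "openin (form_topology m) W"
      unfolding W_def
    proof (rule openin_Inter)
      fix X assume "X \<in> N ` (V \<times> J)"
      then obtain vs bs where X: "X = N (vs, bs)" "vs \<in> V" "bs \<in> J" by blast
      show "openin (form_topology m) X"
        unfolding form_topology_def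
        by (rule topology_generated_by_Basis, rule CollectI, rule exI[of _ \<omega>0], rule exI[of _ "cball 0 R"],
          rule exI[of _ bs], rule exI[of _ vs], rule exI[of _ \<delta>])
          (use X \<omega>0 \<delta> in \<open>auto simp: N_def V_def J_def\<close>)
    qed (use fin ne in auto)
    moreover have "\<omega>0 \<in> W" using \<omega>0 \<delta> by (auto simp: W_def N_def)
    moreover have "W \<subseteq> {\<omega> \<in> smooth_forms m. T \<omega> \<in> U}"
    proof
      fix \<eta> assume W: "\<eta> \<in> W"
      then have \<eta>: "\<eta> \<in> smooth_forms m" using ne unfolding W_def N_def by auto
      have near: "\<bar>foldr partial_deriv bs (\<lambda>y. \<eta> y vs) x - foldr partial_deriv bs (\<lambda>y. \<omega>0 y vs) x\<bar> < \<delta>"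
        if "vs \<in> V" "bs \<in> J" "norm x \<le> R" for vs bs x
        using W that unfolding W_def N_def by fastforce
      have \<zeta>: "\<eta> - \<omega>0 \<in> smooth_forms m" by (rule smooth_forms_diff[OF \<eta> \<omega>0(1)])
      have 0: "\<bar>(\<eta> - \<omega>0) x vs\<bar> \<le> M * \<delta> * norms vs" if x: "norm x \<le> R" for x vs
      proof -
        have "covector_size m ((\<eta> - \<omega>0) x) \<le> D ^ m * \<delta>"
          unfolding D_def
        proof (rule covector_size_le)
          fix bs assume "length bs = m" "set bs \<subseteq> (Basis :: 'a set)"
          then have "bs \<in> V" by (simp add: V_def)
          from near[OF this _ x, of "[]"] show "\<bar>(\<eta> - \<omega>0) x bs\<bar> \<le> \<delta>" by (simp add: J_def)
        qed (use \<delta> in simp)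
        also have "\<dots> \<le> M * \<delta>" using \<delta> D by (simp add: M_def mult_right_mono)
        finally have "covector_size m ((\<eta> - \<omega>0) x) * norms vs \<le> M * \<delta> * norms vs"
          by (rule mult_right_mono[OF _ norms_nonneg])
        then show ?thesis using covector_size_bound[OF smooth_forms_covector[OF \<zeta>], of x vs] by linarith
      qed
      have 1: "\<bar>ext_deriv (\<eta> - \<omega>0) x vs\<bar> \<le> M * \<delta> * norms vs" if x: "norm x \<le> R" for x vs
      proof -
        have "covector_size (Suc m) (ext_deriv (\<eta> - \<omega>0) x) \<le> D ^ Suc m * ((real m + 1) * \<delta>)"
          unfolding D_def
        proof (rule covector_size_le)
          fix us assume us: "length us = Suc m" "set us \<subseteq> (Basis :: 'a set)"
          let ?t = "\<lambda>i. (- 1) ^ i * frechet_derivative (\<lambda>y. (\<eta> - \<omega>0) y (take i us @ drop (Suc i) us)) (at x) (us ! i)"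
          have "\<bar>?t i\<bar> \<le> \<delta>" if i: "i < length us" for i
          proof -
            let ?vs = "take i us @ drop (Suc i) us"
            have "?vs \<in> V" using us i set_take_subset[of i us] set_drop_subset[of "Suc i" us] by (auto simp: V_def)
            moreover have "us ! i \<in> Basis" using us(2) nth_mem[OF i] by blast
            then have "[us ! i] \<in> J" by (simp add: J_def)
            ultimately have "\<bar>partial_deriv (us ! i) (\<lambda>y. \<eta> y ?vs) x - partial_deriv (us ! i) (\<lambda>y. \<omega>0 y ?vs) x\<bar> < \<delta>"
              using near[of ?vs "[us ! i]" x] x by simp
            then show ?thesis
              by (simp add: abs_mult power_abs partial_deriv_def fd_diff smooth_forms_smooth[OF \<eta>] smooth_forms_smooth[OF \<omega>0(1)])
          qed
          then have "\<bar>\<Sum>i<length us. ?t i\<bar> \<le> (\<Sum>i<length us. \<delta>)"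
            by (intro order_trans[OF sum_abs sum_mono]) auto
          also have "(\<Sum>i<length us. \<delta>) = (real m + 1) * \<delta>" using us by simp
          finally show "\<bar>ext_deriv (\<eta> - \<omega>0) x us\<bar> \<le> (real m + 1) * \<delta>"
            unfolding ext_deriv_def .
        qed (use \<delta> in simp)
        also have "\<dots> = (D ^ Suc m * (real m + 1)) * \<delta>" by (simp only: mult.assoc)
        also have "\<dots> \<le> M * \<delta>"
          unfolding M_def using Dp \<delta> by (intro mult_right_mono) linarith+
        finally have "covector_size (Suc m) (ext_deriv (\<eta> - \<omega>0) x) * norms vs \<le> M * \<delta> * norms vs"
          by (rule mult_right_mono[OF _ norms_nonneg])
        then show ?thesis
          using covector_size_bound[OF smooth_forms_covector[OF ext_deriv_smooth_forms[OF \<zeta>]], of x vs] by linarith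
      qed
      have "\<bar>T (\<eta> - \<omega>0)\<bar> \<le> c * (M * \<delta>)"
        by (rule bd[OF \<zeta> _ 0 1]) (use M \<delta> in simp_all)
      also have "\<dots> \<le> (\<bar>c\<bar> + 1) * (M * \<delta>)" using M \<delta> by (intro mult_right_mono) auto
      also have "\<dots> = e / 2"
      proof -
        have "k * (M * (e / (2 * k * M))) = e / 2" if "k > 0" for k using that M by (simp add: field_simps)
        from this[of "\<bar>c\<bar> + 1"] show ?thesis by (simp add: \<delta>_def)
      qed
      also have "\<dots> < e" using e by simp
      finally show "\<eta> \<in> {\<omega> \<in> smooth_forms m. T \<omega> \<in> U}"
        using e(2)[of "T \<eta>"] \<eta> by (simp add: linear_on_forms_diff[OF lin \<eta> \<omega>0(1)])
    qed
    ultimately show "\<exists>W. openin (form_topology m) W \<and> \<omega>0 \<in> W \<and> W \<subseteq> {\<omega> \<in> smooth_forms m. T \<omega> \<in> U}"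
      by blast
  qed
  then have "continuous_map (form_topology m) euclideanreal T"
    by (simp add: continuous_map_def)
  then show ?thesis using lin out by (simp add: currents_def)
qed

lemma cutoff_form_bound:
  fixes \<omega> :: "'a::euclidean_space form"
  assumes \<omega>: "\<omega> \<in> smooth_forms m" and R: "R > 0"
    and c: "\<And>x v :: 'a. \<bar>frechet_derivative (radial_cutoff 0 R) (at x) v\<bar> \<le> c * norm v" "c \<ge> 0"
    and B: "B \<ge> 0" "\<And>x vs. norm x \<le> 2 * R \<Longrightarrow> \<bar>\<omega> x vs\<bar> \<le> B * norms vs"
      "\<And>x vs. norm x \<le> 2 * R \<Longrightarrow> \<bar>ext_deriv \<omega> x vs\<bar> \<le> B * norms vs"
  shows "form_le (B + (real m + 1) * (c * B)) (\<lambda>x vs. radial_cutoff 0 R x * \<omega> x vs)"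
    and "form_le (B + (real m + 1) * (c * B)) (ext_deriv (\<lambda>x vs. radial_cutoff 0 R x * \<omega> x vs))"
proof -
  let ?\<zeta> = "radial_cutoff 0 R :: 'a \<Rightarrow> real"
  let ?C = "B + (real m + 1) * (c * B)"
  have C: "B \<le> ?C" "0 \<le> ?C" using B(1) c(2) by auto
  have z: "(\<lambda>vs. ?\<zeta> x * \<omega> x vs) = (\<lambda>_. 0)" if "norm x > 2 * R" for x
    using radial_cutoff(5)[OF R, of x 0] that by simp
  have mul: "\<bar>?\<zeta> x * t\<bar> \<le> B * norms vs" if "\<bar>t\<bar> \<le> B * norms vs" for x t vs
  proof -
    have "\<bar>?\<zeta> x * t\<bar> \<le> 1 * (B * norms vs)"
      unfolding abs_mult using radial_cutoff(2,3)[OF R, of 0 x] that by (intro mult_mono) auto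
    then show ?thesis by simp
  qed
  show "form_le ?C (\<lambda>x vs. ?\<zeta> x * \<omega> x vs)"
    unfolding form_le_def
  proof (intro allI)
    fix x vs
    have "\<bar>?\<zeta> x * \<omega> x vs\<bar> \<le> B * norms vs"
    proof (cases "norm x \<le> 2 * R")
      case True then show ?thesis by (intro mul B(2))
    next
      case False
      then have *: "?\<zeta> x * \<omega> x vs = 0" using fun_cong[OF z, of x vs] by linarith
      show ?thesis unfolding * using B(1) norms_nonneg[of vs] by simp
    qed
    also have "\<dots> \<le> ?C * norms vs" by (rule mult_right_mono[OF C(1) norms_nonneg])
    finally show "\<bar>?\<zeta> x * \<omega> x vs\<bar> \<le> ?C * norms vs" .
  qed
  show "form_le ?C (ext_deriv (\<lambda>x vs. ?\<zeta> x * \<omega> x vs))"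
    unfolding form_le_def
  proof (intro allI)
    fix x vs
    show "\<bar>ext_deriv (\<lambda>x vs. ?\<zeta> x * \<omega> x vs) x vs\<bar> \<le> ?C * norms vs"
    proof (cases "norm x \<le> 2 * R")
      case True
      show ?thesis
        by (rule ext_deriv_cutoff_bound[OF \<omega> radial_cutoff(1)[OF R] _ c(2) mul[OF B(3)[OF True]] B(1) _ B(1)])
          (rule c(1), rule B(2)[OF True])
    next
      case False
      have "ext_deriv (\<lambda>x vs. ?\<zeta> x * \<omega> x vs) x = ext_deriv 0 x"
      proof (rule ext_deriv_cong_open[of "{x. norm x > 2 * R}"])
        show "open {x :: 'a. norm x > 2 * R}" by (intro open_Collect_less continuous_intros)
        show "(\<lambda>vs. ?\<zeta> y * \<omega> y vs) = 0 y" if "y \<in> {x. norm x > 2 * R}" for y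
          using z[of y] that by (simp add: zero_fun_def)
      qed (use False in simp)
      then show ?thesis using C(2) norms_nonneg[of vs] by (simp add: ext_deriv_form_zero)
    qed
  qed
qed

text \<open>T does not notice a cutoff at radius R, and cutting off turns bounds on the ball of
  radius 2R into global ones at the price of the factor k. Thus boundedness on the flat ball gives
  the local estimate required by \<open>currentsI\<close>.\<close>

lemma currentsI_cutoff:
  fixes T :: "'a::euclidean_space current"
  assumes lin: "linear_on (smooth_forms m) T" and out: "\<And>\<omega>. \<omega> \<notin> smooth_forms m \<Longrightarrow> T \<omega> = 0"
    and R: "R > 0" and loc: "\<And>\<omega>. \<omega> \<in> smooth_forms m \<Longrightarrow> T (\<lambda>x vs. radial_cutoff 0 R x * \<omega> x vs) = T \<omega>"
    and A: "\<And>\<omega>. \<omega> \<in> flat_ball m \<Longrightarrow> T \<omega> \<le> A"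
  shows "T \<in> currents m"
proof -
  obtain c where c: "c \<ge> 0" "\<And>x v. \<bar>frechet_derivative (radial_cutoff 0 R :: 'a \<Rightarrow> real) (at x) v\<bar> \<le> c * norm v"
    using radial_cutoff_derivative[OF R] by blast
  define k where "k = 1 + (real m + 1) * c"
  have k: "k > 0" using c(1) by (simp add: k_def add_pos_nonneg)
  have fb: "flat_bounded m T"
    using lin A unfolding flat_bounded_def linear_on_def by (auto intro!: bdd_aboveI)
  show ?thesis
  proof (rule currentsI[OF lin out, where R = "2 * R" and c = "normal_flat_norm m T * k"])
    fix \<omega> :: "'a form" and B assume \<omega>: "\<omega> \<in> smooth_forms m" and B: "B > 0"
      and b: "\<And>x vs. norm x \<le> 2 * R \<Longrightarrow> \<bar>\<omega> x vs\<bar> \<le> B * norms vs"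
        "\<And>x vs. norm x \<le> 2 * R \<Longrightarrow> \<bar>ext_deriv \<omega> x vs\<bar> \<le> B * norms vs"
    have eq: "B + (real m + 1) * (c * B) = k * B" by (simp add: k_def algebra_simps)
    have "\<bar>T (\<lambda>x vs. radial_cutoff 0 R x * \<omega> x vs)\<bar> \<le> normal_flat_norm m T * (k * B)"
      using cutoff_form_bound[OF \<omega> R c(2,1) _ b] B k unfolding eq
      by (intro flat_norm_bound[OF fb] smooth_forms_cutoff \<omega> radial_cutoff(1) R) auto
    then show "\<bar>T \<omega>\<bar> \<le> normal_flat_norm m T * k * B" by (simp add: loc[OF \<omega>] mult.assoc)
  qed
qed

text \<open>The flat norm controls only values on globally bounded forms. A current supported in the
  open ball of radius R does not distinguish \<eta> from \<omega>.\<close>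

lemma bounded_replacement:
  fixes \<omega> :: "'a::euclidean_space form"
  assumes \<omega>: "\<omega> \<in> smooth_forms m"
  shows "\<exists>\<eta> c. \<eta> \<in> smooth_forms m \<and> c > 0 \<and> form_le c \<eta> \<and> form_le c (ext_deriv \<eta>) \<and>
    (\<forall>x. norm x < R \<longrightarrow> \<eta> x = \<omega> x)"
proof -
  define r where "r = max R 1"
  have r: "r > 0" "R \<le> r" by (auto simp: r_def)
  let ?\<eta> = "\<lambda>x vs. radial_cutoff 0 r x * \<omega> x vs"
  have \<eta>: "?\<eta> \<in> smooth_forms m" by (intro smooth_forms_cutoff \<omega> radial_cutoff(1) r)
  have z: "?\<eta> x = 0" if "norm x > 2 * r" for x
    using radial_cutoff(5)[OF r(1), of x 0] that by (simp add: fun_eq_iff)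
  have "ext_deriv ?\<eta> x = 0" if "norm x > 2 * r" for x
  proof -
    have "ext_deriv ?\<eta> x = ext_deriv 0 x"
    proof (rule ext_deriv_cong_open[of "{x. norm x > 2 * r}"])
      show "open {x :: 'a. norm x > 2 * r}" by (intro open_Collect_less continuous_intros)
      show "?\<eta> y = 0 y" if "y \<in> {x. norm x > 2 * r}" for y
        using z[of y] that by simp
    qed (use that in simp)
    then show ?thesis by (simp add: ext_deriv_form_zero)
  qed
  then obtain B1 where B1: "B1 \<ge> 0" "form_le B1 (ext_deriv ?\<eta>)"
    using form_le_compact_support[OF ext_deriv_smooth_forms[OF \<eta>], of "2 * r"] by blast
  obtain B0 where B0: "B0 \<ge> 0" "form_le B0 ?\<eta>"
    using form_le_compact_support[OF \<eta> z] by blast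
  have "?\<eta> x = \<omega> x" if "norm x < R" for x
    using radial_cutoff(4)[OF r(1), of x 0] that r(2) by (simp add: fun_eq_iff)
  then show ?thesis
    using \<eta> B0 B1 form_le_mono[OF B0(2), of "B0 + B1 + 1"] form_le_mono[OF B1(2), of "B0 + B1 + 1"]
    by (intro exI[of _ ?\<eta>] exI[of _ "B0 + B1 + 1"]) auto
qed

subsection \<open>Operations on normal currents\<close>

lemma currents_add: "T \<in> currents m \<Longrightarrow> S \<in> currents m \<Longrightarrow> T + S \<in> currents m"
  unfolding currents_def linear_on_def plus_fun_def
  by (auto simp: algebra_simps intro: continuous_map_add)

lemma currents_scale: "T \<in> currents m \<Longrightarrow> c *\<^sub>R T \<in> currents m"
  unfolding currents_def linear_on_def scaleR_fun_def
  by (auto simp: algebra_simps intro: continuous_map_real_mult_left)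

lemma currents_zero_mem: "0 \<in> currents m"
  by (simp add: currents_def linear_on_def zero_fun_def)

lemma boundary_scale:
  assumes "T \<in> currents m" "m > 0" "\<omega> \<in> smooth_forms (m - 1)"
  shows "boundary m T (c *\<^sub>R \<omega>) = c * boundary m T \<omega>"
proof -
  have "ext_deriv \<omega> \<in> smooth_forms m" using ext_deriv_smooth_forms[OF assms(3)] assms(2) by simp
  then show ?thesis
    unfolding boundary_apply[OF assms(2) assms(3)] boundary_apply[OF assms(2) smooth_forms_scale[OF assms(3)]]
      ext_deriv_form_scale[OF assms(3)] by (rule currents_linear(2)[OF assms(1)])
qed

text \<open>Lets both branches of \<open>normal_mass\<close> be treated at once: in degree 0 the
  boundary part is recorded as b = 0.\<close>

lemma normal_split:
  assumes T: "T \<in> normal_currents m"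
  obtains a b where "mass m T = ereal a" "m > 0 \<Longrightarrow> mass (m - 1) (boundary m T) = ereal b" "m = 0 \<Longrightarrow> b = 0"
    "a + b = normal_norm m T"
proof -
  have z: "T 0 = 0" by (rule normal_currents_apply_0[OF T])
  have p: "mass m T \<ge> 0" "mass (m - 1) (boundary m T) \<ge> 0" by (intro mass_nonneg z boundary_zero)+
  have u: "mass m T \<le> ereal (normal_norm m T)" by (rule mass_le_normal_norm(1)[OF T])
  obtain a where a: "mass m T = ereal a" using p(1) u by (cases "mass m T") auto
  show thesis
  proof (cases "m = 0")
    case True
    then have "ereal a = ereal (normal_norm m T)"
      using normal_mass_real[OF T] a by (simp add: normal_mass_def)
    then show thesis using that[of a 0] a True by simp
  next
    case False
    obtain b where b: "mass (m - 1) (boundary m T) = ereal b"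
      using p(2) mass_le_normal_norm(2)[OF T] False by (cases "mass (m - 1) (boundary m T)") auto
    have "ereal a + ereal b = ereal (normal_norm m T)"
      using normal_mass_real[OF T] a b False by (simp add: normal_mass_def)
    then show thesis using that[of a b] a b False by simp
  qed
qed

lemma normalI:
  assumes T: "T \<in> currents m" and a: "mass m T \<le> ereal a"
    and b: "m > 0 \<Longrightarrow> mass (m - 1) (boundary m T) \<le> ereal b" "m = 0 \<Longrightarrow> b = 0"
  shows "T \<in> normal_currents m" "normal_norm m T \<le> a + b"
proof -
  have "normal_mass m T \<le> ereal (a + b)"
    using a b add_mono[OF a b(1)] by (cases "m = 0") (auto simp: normal_mass_def)
  then show 1: "T \<in> normal_currents m" using T by (auto simp: normal_currents_def intro: le_less_trans)
  show "normal_norm m T \<le> a + b"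
    using \<open>normal_mass m T \<le> ereal (a + b)\<close> unfolding normal_mass_real[OF 1] by simp
qed

lemma mass_apply_le: "mass m T = ereal a \<Longrightarrow> \<omega> \<in> smooth_forms m \<Longrightarrow> form_le 1 \<omega> \<Longrightarrow> T \<omega> \<le> a"
  using mass_upper[of \<omega> m T] by simp

lemma normal_add:
  assumes T: "T \<in> normal_currents m" and S: "S \<in> normal_currents m"
  shows "T + S \<in> normal_currents m" "normal_norm m (T + S) \<le> normal_norm m T + normal_norm m S"
proof -
  obtain a b where T': "mass m T = ereal a" "m > 0 \<Longrightarrow> mass (m - 1) (boundary m T) = ereal b" "m = 0 \<Longrightarrow> b = 0"
    "a + b = normal_norm m T" using normal_split[OF T] by blast
  obtain c d where S': "mass m S = ereal c" "m > 0 \<Longrightarrow> mass (m - 1) (boundary m S) = ereal d" "m = 0 \<Longrightarrow> d = 0"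
    "c + d = normal_norm m S" using normal_split[OF S] by blast
  have 0: "T + S \<in> currents m" by (intro currents_add normal_currentsD T S)
  have 1: "mass m (T + S) \<le> ereal (a + c)"
    unfolding mass_le_iff using mass_apply_le[OF T'(1)] mass_apply_le[OF S'(1)] by (auto intro: add_mono)
  have 2: "mass (m - 1) (boundary m (T + S)) \<le> ereal (b + d)" if "m > 0"
    unfolding mass_le_iff
  proof (intro ballI impI)
    fix \<omega> :: "'a form" assume "\<omega> \<in> smooth_forms (m - 1)" "form_le 1 \<omega>"
    then show "boundary m (T + S) \<omega> \<le> b + d"
      using mass_apply_le[OF T'(2)[OF that]] mass_apply_le[OF S'(2)[OF that]]
      by (simp add: boundary_def add_mono)
  qed
  have 3: "b + d = 0" if "m = 0" using T'(3) S'(3) that by simp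
  show "T + S \<in> normal_currents m" by (rule normalI(1)[OF 0 1 2 3])
  show "normal_norm m (T + S) \<le> normal_norm m T + normal_norm m S"
    using normalI(2)[OF 0 1 2 3] T'(4) S'(4) by simp
qed

lemma normal_scale:
  assumes T: "T \<in> normal_currents m"
  shows "c *\<^sub>R T \<in> normal_currents m" "normal_norm m (c *\<^sub>R T) \<le> \<bar>c\<bar> * normal_norm m T"
proof -
  obtain a b where T': "mass m T = ereal a" "m > 0 \<Longrightarrow> mass (m - 1) (boundary m T) = ereal b" "m = 0 \<Longrightarrow> b = 0"
    "a + b = normal_norm m T" using normal_split[OF T] by blast
  have T0: "T \<in> currents m" by (rule normal_currentsD[OF T])
  have 0: "c *\<^sub>R T \<in> currents m" by (rule currents_scale[OF T0])
  have abs: "c * t \<le> \<bar>c\<bar> * u" if "\<bar>t\<bar> \<le> u" for t u :: real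
    using mult_left_mono[OF that abs_ge_zero[of c]] abs_ge_self[of "c * t"] by (simp add: abs_mult)
  have 1: "mass m (c *\<^sub>R T) \<le> ereal (\<bar>c\<bar> * a)"
    unfolding mass_le_iff
  proof (intro ballI impI)
    fix \<omega> :: "'a form" assume \<omega>: "\<omega> \<in> smooth_forms m" "form_le 1 \<omega>"
    have "\<bar>T \<omega>\<bar> \<le> a * 1"
      by (rule linear_bound[OF currents_linear(2)[OF T0] _ \<omega>]) (simp_all add: T'(1))
    then show "(c *\<^sub>R T) \<omega> \<le> \<bar>c\<bar> * a" using abs[of "T \<omega>" a] by (simp add: scaleR_fun_def)
  qed
  have 2: "mass (m - 1) (boundary m (c *\<^sub>R T)) \<le> ereal (\<bar>c\<bar> * b)" if m: "m > 0"
    unfolding mass_le_iff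
  proof (intro ballI impI)
    fix \<omega> :: "'a form" assume \<omega>: "\<omega> \<in> smooth_forms (m - 1)" "form_le 1 \<omega>"
    have "\<bar>boundary m T \<omega>\<bar> \<le> b * 1"
      by (rule linear_bound[OF boundary_scale[OF T0 m] _ \<omega>]) (simp_all add: T'(2)[OF m, simplified])
    then show "boundary m (c *\<^sub>R T) \<omega> \<le> \<bar>c\<bar> * b"
      using abs[of "boundary m T \<omega>" b] \<omega>(1) by (simp add: boundary_def scaleR_fun_def)
  qed
  have 3: "\<bar>c\<bar> * b = 0" if "m = 0" using T'(3) that by simp
  show "c *\<^sub>R T \<in> normal_currents m" by (rule normalI(1)[OF 0 1 2 3])
  show "normal_norm m (c *\<^sub>R T) \<le> \<bar>c\<bar> * normal_norm m T"
    using normalI(2)[OF 0 1 2 3] T'(4) by (simp add: distrib_left[symmetric])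
qed

lemma normal_zero: "(0 :: 'a::euclidean_space current) \<in> normal_currents m" "normal_norm m (0 :: 'a current) = 0"
proof -
  have 1: "mass m (0 :: 'a current) \<le> ereal 0" by (simp add: mass_le_iff)
  have 2: "mass (m - 1) (boundary m (0 :: 'a current)) \<le> ereal 0" by (simp add: mass_le_iff boundary_def)
  show 0: "(0 :: 'a current) \<in> normal_currents m" by (rule normalI(1)[OF currents_zero_mem 1, of 0]) (use 2 in simp_all)
  have "normal_norm m (0 :: 'a current) \<le> 0 + 0" by (rule normalI(2)[OF currents_zero_mem 1]) (use 2 in simp_all)
  then show "normal_norm m (0 :: 'a current) = 0" using normal_norm_nonneg[OF 0] by simp
qed

lemma normal_diff:
  assumes T: "T \<in> normal_currents m" and S: "S \<in> normal_currents m"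
  shows "T - S \<in> normal_currents m" "normal_norm m (T - S) \<le> normal_norm m T + normal_norm m S"
  using normal_add[OF T normal_scale(1)[OF S, of "-1"]] normal_scale(2)[OF S, of "-1"] by simp_all

lemma sum_current_apply: "(sum S A) \<omega> = (\<Sum>i\<in>A. S i \<omega>)" for S :: "'i \<Rightarrow> 'a current"
proof (induction A rule: infinite_finite_induct)
  case (insert x F)
  then show ?case unfolding sum.insert[OF insert(1,2)] by (simp add: plus_fun_def)
qed (simp_all add: zero_fun_def)

lemma normal_sum:
  assumes "\<And>i. i \<in> A \<Longrightarrow> S i \<in> normal_currents m"
  shows "sum S A \<in> normal_currents m \<and> normal_norm m (sum S A) \<le> (\<Sum>i\<in>A. normal_norm m (S i))"
  using assms
proof (induction A rule: infinite_finite_induct)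
  case (insert x F)
  then have IH: "sum S F \<in> normal_currents m" "normal_norm m (sum S F) \<le> (\<Sum>i\<in>F. normal_norm m (S i))"
    and x: "S x \<in> normal_currents m" by auto
  show ?case
    unfolding sum.insert[OF insert(1,2)] using normal_add[OF x IH(1)] IH(2) by linarith
qed (simp_all add: normal_zero)

lemma spt_add_subset:
  assumes "T \<in> currents m" "S \<in> currents m" "spt m T \<subseteq> K" "spt m S \<subseteq> K" "closed K"
  shows "spt m (T + S) \<subseteq> K"
  by (rule spt_subsetI[OF assms(5)]) (simp add: currents_disjoint_support[OF assms(1,3)] currents_disjoint_support[OF assms(2,4)])

lemma spt_scale_subset:
  assumes "T \<in> currents m" "spt m T \<subseteq> K" "closed K"
  shows "spt m (c *\<^sub>R T) \<subseteq> K"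
  by (rule spt_subsetI[OF assms(3)]) (simp add: currents_disjoint_support[OF assms(1,2)] scaleR_fun_def)

lemma spt_diff_subset:
  assumes "T \<in> currents m" "S \<in> currents m" "spt m T \<subseteq> K" "spt m S \<subseteq> K" "closed K"
  shows "spt m (T - S) \<subseteq> K"
  by (rule spt_subsetI[OF assms(5)]) (simp add: currents_disjoint_support[OF assms(1,3)] currents_disjoint_support[OF assms(2,4)])

lemma spt_sum_subset:
  assumes "\<And>i. i \<in> A \<Longrightarrow> S i \<in> currents m" "\<And>i. i \<in> A \<Longrightarrow> spt m (S i) \<subseteq> K" "closed K"
  shows "spt m (sum S A) \<subseteq> K"
  by (rule spt_subsetI[OF assms(3)])
    (auto intro!: sum.neutral currents_disjoint_support[OF assms(1,2)] simp: sum_current_apply)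

subsection \<open>Push-forwards\<close>

definition push :: "nat \<Rightarrow> ('a::euclidean_space \<Rightarrow> 'a) \<Rightarrow> 'a current \<Rightarrow> 'a current" where
  "push m p T \<omega> = (if \<omega> \<in> smooth_forms m then T (pullback p \<omega>) else 0)"

lemma form_le_pullback: "contraction p \<Longrightarrow> B \<ge> 0 \<Longrightarrow> form_le B \<omega> \<Longrightarrow> form_le B (pullback p \<omega>)"
  unfolding form_le_def using pullback_bound[of p B \<omega>] by blast

lemma pullback_flat_ball:
  assumes "contraction p" "\<omega> \<in> flat_ball m" shows "pullback p \<omega> \<in> flat_ball m"
  using assms pullback_smooth_forms[of \<omega> m p] form_le_pullback[OF assms(1), of 1] pullback_ext_deriv[of \<omega> m p]
  unfolding flat_ball_def contraction_def by auto

lemma pullback_add: "pullback p (\<omega> + \<eta>) = pullback p \<omega> + pullback p \<eta>"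
  and pullback_scale: "pullback p (c *\<^sub>R \<omega>) = c *\<^sub>R pullback p \<omega>"
  by (auto simp: pullback_def fun_eq_iff scaleR_fun_def)

text \<open>The pullback sees a form only on the range of p. That range being bounded makes the
  push-forward insensitive to cutoffs, which is what continuity requires.\<close>

lemma push_currents:
  assumes T: "T \<in> normal_currents m" and p: "contraction p" and R: "R > 0" "\<And>x. norm (p x) \<le> R"
  shows "push m p T \<in> currents m"
proof (rule currentsI_cutoff[OF _ _ R(1)])
  have pv: "vsmooth p" using p by (simp add: contraction_def)
  note T0 = normal_currentsD[OF T]
  show "linear_on (smooth_forms m) (push m p T)"
    unfolding linear_on_def push_def
    by (auto simp: smooth_forms_add smooth_forms_scale pullback_add pullback_scale
      currents_linear[OF T0] pullback_smooth_forms[OF _ pv])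
  show "push m p T \<omega> = 0" if "\<omega> \<notin> smooth_forms m" for \<omega> using that by (simp add: push_def)
  show "push m p T (\<lambda>x vs. radial_cutoff 0 R x * \<omega> x vs) = push m p T \<omega>" if "\<omega> \<in> smooth_forms m" for \<omega>
  proof -
    have "radial_cutoff 0 R (p x) = 1" for x
      using radial_cutoff(4)[OF R(1), of "p x" 0] R(2)[of x] by simp
    then have "pullback p (\<lambda>x vs. radial_cutoff 0 R x * \<omega> x vs) = pullback p \<omega>"
      by (simp add: pullback_def fun_eq_iff)
    then show ?thesis
      using smooth_forms_cutoff[OF that radial_cutoff(1)[OF R(1), of 0]] that by (simp add: push_def)
  qed
  show "push m p T \<omega> \<le> normal_norm m T" if "\<omega> \<in> flat_ball m" for \<omega>
    using normal_bound[OF T, of "pullback p \<omega>" 1] pullback_flat_ball[OF p that] that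
    by (simp add: push_def flat_ball_def)
qed

text \<open>Pullback by a contraction does not increase comass and commutes with d, so it maps the
  unit balls defining mass, boundary mass and flat norm into themselves.\<close>

lemma push_normal:
  assumes T: "T \<in> normal_currents m" and p: "contraction p" and K: "compact K" "\<And>x. p x \<in> K"
  shows "push m p T \<in> normal_currents m" "normal_norm m (push m p T) \<le> normal_norm m T"
    "normal_flat_norm m (push m p T) \<le> normal_flat_norm m T" "spt m (push m p T) \<subseteq> K"
proof -
  have pv: "vsmooth p" using p by (simp add: contraction_def)
  obtain R where R: "R > 0" "\<And>y. y \<in> K \<Longrightarrow> norm y \<le> R"
    using compact_imp_bounded[OF K(1)] unfolding bounded_pos by blast
  have 0: "push m p T \<in> currents m" by (rule push_currents[OF T p R(1) R(2)[OF K(2)]])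
  obtain a b where T': "mass m T = ereal a" "m > 0 \<Longrightarrow> mass (m - 1) (boundary m T) = ereal b" "m = 0 \<Longrightarrow> b = 0"
    "a + b = normal_norm m T" using normal_split[OF T] by blast
  have 1: "mass m (push m p T) \<le> ereal a"
    unfolding mass_le_iff
  proof (intro ballI impI)
    fix \<omega> :: "'a form" assume \<omega>: "\<omega> \<in> smooth_forms m" "form_le 1 \<omega>"
    have "T (pullback p \<omega>) \<le> a"
      by (rule mass_apply_le[OF T'(1) pullback_smooth_forms[OF \<omega>(1) pv] form_le_pullback[OF p _ \<omega>(2)]]) simp
    then show "push m p T \<omega> \<le> a" using \<omega>(1) by (simp add: push_def)
  qed
  have 2: "mass (m - 1) (boundary m (push m p T)) \<le> ereal b" if m: "m > 0"
    unfolding mass_le_iff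
  proof (intro ballI impI)
    fix \<omega> :: "'a form" assume \<omega>: "\<omega> \<in> smooth_forms (m - 1)" "form_le 1 \<omega>"
    have d: "ext_deriv \<omega> \<in> smooth_forms m" using ext_deriv_smooth_forms[OF \<omega>(1)] m by simp
    have "boundary m (push m p T) \<omega> = T (ext_deriv (pullback p \<omega>))"
      by (simp add: boundary_apply[OF m \<omega>(1)] push_def d pullback_ext_deriv[OF \<omega>(1) pv])
    also have "\<dots> = boundary m T (pullback p \<omega>)"
      by (simp add: boundary_apply[OF m pullback_smooth_forms[OF \<omega>(1) pv]])
    also have "\<dots> \<le> b"
      by (rule mass_apply_le[OF T'(2)[OF m] pullback_smooth_forms[OF \<omega>(1) pv] form_le_pullback[OF p _ \<omega>(2)]]) simp
    finally show "boundary m (push m p T) \<omega> \<le> b" .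
  qed
  show "push m p T \<in> normal_currents m" by (rule normalI(1)[OF 0 1 2 T'(3)])
  show "normal_norm m (push m p T) \<le> normal_norm m T"
    using normalI(2)[OF 0 1 2 T'(3)] T'(4) by simp
  show "normal_flat_norm m (push m p T) \<le> normal_flat_norm m T"
  proof (rule flat_norm_least)
    fix \<omega> :: "'a form" assume \<omega>: "\<omega> \<in> flat_ball m"
    have "T (pullback p \<omega>) \<le> normal_flat_norm m T"
      by (rule flat_norm_upper[OF normal_flat_bounded(1)[OF T] pullback_flat_ball[OF p \<omega>]])
    then show "push m p T \<omega> \<le> normal_flat_norm m T" using \<omega> by (simp add: push_def flat_ball_def)
  qed
  show "spt m (push m p T) \<subseteq> K"
  proof (rule spt_subsetI[OF compact_imp_closed[OF K(1)]])
    fix \<omega> :: "'a form" assume "\<omega> \<in> smooth_forms m" "form_support \<omega> \<inter> K = {}"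
    then have "\<omega> (p x) = 0" for x using K(2)[of x] form_support_mem[of \<omega> "p x"] by blast
    then have "pullback p \<omega> = 0" by (simp add: pullback_def fun_eq_iff)
    then show "push m p T \<omega> = 0" using currents_zero[OF normal_currentsD[OF T]] by (simp add: push_def)
  qed
qed

lemma homotopy_form_0:
  assumes "\<omega> \<in> smooth_forms 0" "vsmooth f" "vsmooth g" shows "homotopy_form f g \<omega> = 0"
proof (intro ext)
  fix x vs
  have "pullback (line_homotopy f g) \<omega> (t, x) ((1, 0) # map (Pair 0) vs) = 0" for t
    by (rule smooth_forms_length[OF pullback_smooth_forms[OF assms(1) vsmooth_line_homotopy[OF assms(2,3)]]]) simp
  then show "homotopy_form f g \<omega> x vs = 0 x vs"
    by (simp add: homotopy_form_def cylinder_integral_def)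
qed

text \<open>In degree 0 the homotopy form of \<omega> is zero and its derivative is not of degree 0,
  since m - 1 is truncated; hence the case distinction.\<close>

lemma current_homotopy:
  assumes T: "T \<in> currents m" and \<omega>: "\<omega> \<in> smooth_forms m" and fg: "vsmooth f" "vsmooth g"
  shows "T (pullback g \<omega> - pullback f \<omega>)
    = (if m = 0 then 0 else T (ext_deriv (homotopy_form f g \<omega>))) + T (homotopy_form f g (ext_deriv \<omega>))"
proof -
  have eq: "pullback g \<omega> - pullback f \<omega> = ext_deriv (homotopy_form f g \<omega>) + homotopy_form f g (ext_deriv \<omega>)"
    using homotopy_formula[OF \<omega> fg] by (simp add: fun_eq_iff)
  have h: "homotopy_form f g (ext_deriv \<omega>) \<in> smooth_forms m"
    using homotopy_form_smooth_forms[OF ext_deriv_smooth_forms[OF \<omega>] fg] by simp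
  show ?thesis
  proof (cases "m = 0")
    case True
    then show ?thesis using eq homotopy_form_0[of \<omega> f g] \<omega> fg by (simp add: ext_deriv_form_zero)
  next
    case False
    then have "ext_deriv (homotopy_form f g \<omega>) \<in> smooth_forms m"
      using ext_deriv_smooth_forms[OF homotopy_form_smooth_forms[OF \<omega> fg]] by simp
    then show ?thesis using False h by (simp add: eq currents_linear(1)[OF T])
  qed
qed

lemma form_le_homotopy:
  assumes "\<omega> \<in> smooth_forms m" "contraction f" "contraction g" "form_le B \<omega>" "B \<ge> 0" "\<And>x. norm (g x - f x) \<le> s"
  shows "form_le (B * s) (homotopy_form f g \<omega>)"
  unfolding form_le_def
proof (intro allI)
  fix x vs
  have "\<bar>homotopy_form f g \<omega> x vs\<bar> \<le> B * norm (g x - f x) * norms vs"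
    using assms by (intro homotopy_form_bound) (auto simp: form_le_def)
  also have "\<dots> \<le> B * s * norms vs"
    using assms norms_nonneg[of vs] by (intro mult_right_mono mult_left_mono) auto
  finally show "\<bar>homotopy_form f g \<omega> x vs\<bar> \<le> B * s * norms vs" .
qed

text \<open>The factor 2 comes from the two terms of the homotopy formula: the exact one is paid for
  by the boundary mass of T, the other by its mass, and both homotopy forms have comass at most
  s.\<close>

lemma push_diff:
  assumes T: "T \<in> normal_currents m" and f: "contraction f" and g: "contraction g"
    and s: "s > 0" "\<And>x. norm (g x - f x) \<le> s"
  shows "normal_flat_norm m (push m g T - push m f T) \<le> 2 * s * normal_norm m T"
proof (rule flat_norm_least)
  fix \<omega> :: "'a form" assume "\<omega> \<in> flat_ball m"
  then have \<omega>: "\<omega> \<in> smooth_forms m" "form_le 1 \<omega>" "form_le 1 (ext_deriv \<omega>)" by (auto simp: flat_ball_def)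
  have fg: "vsmooth f" "vsmooth g" using f g by (auto simp: contraction_def)
  have h1: "form_le s (homotopy_form f g \<omega>)" "form_le s (homotopy_form f g (ext_deriv \<omega>))"
    using form_le_homotopy[OF \<omega>(1) f g \<omega>(2) _ s(2)] form_le_homotopy[OF ext_deriv_smooth_forms[OF \<omega>(1)] f g \<omega>(3) _ s(2)]
    by simp_all
  have h2: "homotopy_form f g \<omega> \<in> smooth_forms (m - 1)" "homotopy_form f g (ext_deriv \<omega>) \<in> smooth_forms m"
    using homotopy_form_smooth_forms[OF \<omega>(1) fg] homotopy_form_smooth_forms[OF ext_deriv_smooth_forms[OF \<omega>(1)] fg]
    by simp_all
  have "(push m g T - push m f T) \<omega> = T (pullback g \<omega> - pullback f \<omega>)"
    using currents_diff[OF normal_currentsD[OF T] pullback_smooth_forms[OF \<omega>(1) fg(2)] pullback_smooth_forms[OF \<omega>(1) fg(1)]]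
      \<omega>(1) by (simp add: push_def)
  also have "\<dots> = (if m = 0 then 0 else T (ext_deriv (homotopy_form f g \<omega>))) + T (homotopy_form f g (ext_deriv \<omega>))"
    by (rule current_homotopy[OF normal_currentsD[OF T] \<omega>(1) fg])
  also have "\<dots> \<le> normal_norm m T * s + normal_norm m T * s"
  proof (rule add_mono)
    show "(if m = 0 then 0 else T (ext_deriv (homotopy_form f g \<omega>))) \<le> normal_norm m T * s"
      using normal_boundary_bound[OF T _ h2(1) h1(1) s(1)] normal_norm_nonneg[OF T] s(1) by auto
    show "T (homotopy_form f g (ext_deriv \<omega>)) \<le> normal_norm m T * s"
      using normal_bound[OF T h2(2) h1(2) s(1)] by simp
  qed
  finally show "(push m g T - push m f T) \<omega> \<le> 2 * s * normal_norm m T" by simp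
qed

subsection \<open>Flat currents\<close>

lemma flat_boundedI:
  assumes "\<And>c \<omega>. \<omega> \<in> smooth_forms m \<Longrightarrow> T (c *\<^sub>R \<omega>) = c * T \<omega>" "\<And>\<omega>. \<omega> \<in> flat_ball m \<Longrightarrow> T \<omega> \<le> A"
  shows "flat_bounded m T" "normal_flat_norm m T \<le> A"
  using assms flat_norm_least[of m T A] by (auto simp: flat_bounded_def intro!: bdd_aboveI)

lemma flat_bounded_add:
  assumes T: "flat_bounded m T" and S: "flat_bounded m S"
  shows "flat_bounded m (T + S)" "normal_flat_norm m (T + S) \<le> normal_flat_norm m T + normal_flat_norm m S"
proof -
  have 1: "(T + S) (c *\<^sub>R \<omega>) = c * (T + S) \<omega>" if "\<omega> \<in> smooth_forms m" for c \<omega>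
    using T S that by (simp add: flat_bounded_def distrib_left)
  have 2: "(T + S) \<omega> \<le> normal_flat_norm m T + normal_flat_norm m S" if "\<omega> \<in> flat_ball m" for \<omega>
    using flat_norm_upper[OF T that] flat_norm_upper[OF S that] by simp
  show "flat_bounded m (T + S)" by (rule flat_boundedI(1)[OF 1 2])
  show "normal_flat_norm m (T + S) \<le> normal_flat_norm m T + normal_flat_norm m S" by (rule flat_boundedI(2)[OF 1 2])
qed

lemma flat_bounded_scale:
  assumes T: "flat_bounded m T"
  shows "flat_bounded m (c *\<^sub>R T)" "normal_flat_norm m (c *\<^sub>R T) \<le> \<bar>c\<bar> * normal_flat_norm m T"
proof -
  have 1: "(c *\<^sub>R T) (d *\<^sub>R \<omega>) = d * (c *\<^sub>R T) \<omega>" if "\<omega> \<in> smooth_forms m" for d \<omega>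
    using T that by (simp add: flat_bounded_def scaleR_fun_def[of c])
  have 2: "(c *\<^sub>R T) \<omega> \<le> \<bar>c\<bar> * normal_flat_norm m T" if "\<omega> \<in> flat_ball m" for \<omega>
    using mult_left_mono[OF flat_norm_abs[OF T that] abs_ge_zero[of c]] abs_ge_self[of "c * T \<omega>"]
    by (simp add: scaleR_fun_def abs_mult)
  show "flat_bounded m (c *\<^sub>R T)" by (rule flat_boundedI(1)[OF 1 2])
  show "normal_flat_norm m (c *\<^sub>R T) \<le> \<bar>c\<bar> * normal_flat_norm m T" by (rule flat_boundedI(2)[OF 1 2])
qed

lemma flat_bounded_diff:
  assumes T: "flat_bounded m T" and S: "flat_bounded m S"
  shows "flat_bounded m (T - S)" "normal_flat_norm m (T - S) \<le> normal_flat_norm m T + normal_flat_norm m S"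
  using flat_bounded_add[OF T flat_bounded_scale(1)[OF S, of "-1"]] flat_bounded_scale(2)[OF S, of "-1"] by simp_all

lemma flat_bounded_zero:
  "flat_bounded m (0 :: 'a::euclidean_space current)" "normal_flat_norm m (0 :: 'a current) \<le> 0"
  by (rule flat_boundedI(1)[where A = 0]; simp) (rule flat_boundedI(2)[where A = 0]; simp)

lemma flat_bounded_sum:
  fixes S :: "'i \<Rightarrow> 'a::euclidean_space current"
  assumes "\<And>i. i \<in> A \<Longrightarrow> flat_bounded m (S i)"
  shows "flat_bounded m (sum S A) \<and> normal_flat_norm m (sum S A) \<le> (\<Sum>i\<in>A. normal_flat_norm m (S i))"
  using assms
proof (induction A rule: infinite_finite_induct)
  case (insert x F)
  then have IH: "flat_bounded m (sum S F)" "normal_flat_norm m (sum S F) \<le> (\<Sum>i\<in>F. normal_flat_norm m (S i))"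
    and x: "flat_bounded m (S x)" by auto
  show ?case
    unfolding sum.insert[OF insert(1,2)] using flat_bounded_add[OF x IH(1)] IH(2) by linarith
next
  case (infinite A)
  then show ?case unfolding sum.infinite[OF infinite(1)] by (intro conjI flat_bounded_zero)
next
  case empty
  show ?case unfolding sum.empty by (intro conjI flat_bounded_zero)
qed

text \<open>In the Cauchy estimate between \<open>S n\<close> and \<open>S j\<close> the index j
  tends to infinity for each form of the flat ball separately; the resulting bound is uniform over
  the ball, so weak convergence improves to convergence in the flat norm.\<close>

lemma flat_approx_limit:
  assumes "flat_approx m S T"
  shows "flat_bounded m T" "\<And>n. flat_bounded m (S n - T)" "(\<lambda>n. normal_flat_norm m (S n - T)) \<longlonglongrightarrow> 0"
proof -
  have S: "S n \<in> normal_currents m" for n using assms by (simp add: flat_approx_def)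
  have lim: "(\<lambda>n. S n \<omega>) \<longlonglongrightarrow> T \<omega>" if "\<omega> \<in> smooth_forms m" for \<omega> using assms that by (simp add: flat_approx_def)
  have sc: "T (c *\<^sub>R \<omega>) = c * T \<omega>" if "\<omega> \<in> smooth_forms m" for c \<omega>
  proof (rule LIMSEQ_unique)
    show "(\<lambda>n. S n (c *\<^sub>R \<omega>)) \<longlonglongrightarrow> T (c *\<^sub>R \<omega>)" by (rule lim[OF smooth_forms_scale[OF that]])
    show "(\<lambda>n. S n (c *\<^sub>R \<omega>)) \<longlonglongrightarrow> c * T \<omega>"
      unfolding currents_linear(2)[OF normal_currentsD[OF S] that] by (intro tendsto_intros lim that)
  qed
  have scd: "(S n - T) (c *\<^sub>R \<omega>) = c * (S n - T) \<omega>" if "\<omega> \<in> smooth_forms m" for n c \<omega>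
    by (simp add: sc[OF that] currents_linear(2)[OF normal_currentsD[OF S] that] right_diff_distrib)
  have key: "\<exists>N. \<forall>n\<ge>N. \<forall>\<omega>\<in>flat_ball m. \<bar>(S n - T) \<omega>\<bar> \<le> \<epsilon>" if "\<epsilon> > 0" for \<epsilon>
  proof -
    obtain N where N: "\<And>i j. i \<ge> N \<Longrightarrow> j \<ge> N \<Longrightarrow> normal_flat_norm m (S i - S j) < \<epsilon>"
      using assms \<open>\<epsilon> > 0\<close> unfolding flat_approx_def Cauchy_wrt_def by blast
    have "\<bar>(S n - T) \<omega>\<bar> \<le> \<epsilon>" if "n \<ge> N" "\<omega> \<in> flat_ball m" for n \<omega>
    proof (rule tendsto_upperbound)
      have "\<omega> \<in> smooth_forms m" using that by (simp add: flat_ball_def)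
      from lim[OF this] show "(\<lambda>j. \<bar>S n \<omega> - S j \<omega>\<bar>) \<longlonglongrightarrow> \<bar>(S n - T) \<omega>\<bar>"
        unfolding fun_diff_def by (intro tendsto_intros)
      show "\<forall>\<^sub>F j in sequentially. \<bar>S n \<omega> - S j \<omega>\<bar> \<le> \<epsilon>"
        using eventually_ge_at_top[of N]
      proof eventually_elim
        case (elim j)
        have "\<bar>(S n - S j) \<omega>\<bar> \<le> normal_flat_norm m (S n - S j)"
          by (rule flat_norm_abs[OF normal_flat_bounded(1)[OF normal_diff(1)[OF S S]] that(2)])
        then show ?case using N[OF that(1) elim] by simp
      qed
    qed simp
    then show ?thesis by blast
  qed
  have fb: "flat_bounded m (S n - T)" for n
  proof -
    obtain N where N: "\<And>n \<omega>. n \<ge> N \<Longrightarrow> \<omega> \<in> flat_ball m \<Longrightarrow> \<bar>(S n - T) \<omega>\<bar> \<le> 1" using key[of 1] by auto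
    have "(S n - T) \<omega> \<le> normal_flat_norm m (S n - S N) + 1" if "\<omega> \<in> flat_ball m" for \<omega>
      using flat_norm_upper[OF normal_flat_bounded(1)[OF normal_diff(1)[OF S S]] that, of n N] N[OF order_refl that]
      by simp
    from flat_boundedI(1)[OF scd this] show ?thesis .
  qed
  then show "\<And>n. flat_bounded m (S n - T)" .
  have "flat_bounded m (S 0 - (S 0 - T))"
    by (rule flat_bounded_diff(1)[OF normal_flat_bounded(1)[OF S] fb])
  then show "flat_bounded m T" by simp
  show "(\<lambda>n. normal_flat_norm m (S n - T)) \<longlonglongrightarrow> 0"
  proof (rule LIMSEQ_I)
    fix r :: real assume r: "r > 0"
    obtain N where N: "\<And>n \<omega>. n \<ge> N \<Longrightarrow> \<omega> \<in> flat_ball m \<Longrightarrow> \<bar>(S n - T) \<omega>\<bar> \<le> r / 2" using key[of "r / 2"] r by auto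
    have "norm (normal_flat_norm m (S n - T) - 0) < r" if "n \<ge> N" for n
    proof -
      have "normal_flat_norm m (S n - T) \<le> r / 2"
        using N[OF that] by (intro flat_norm_least) (meson abs_le_D1)
      then show ?thesis using flat_norm_nonneg[OF fb, of n] r by simp
    qed
    then show "\<exists>no. \<forall>n\<ge>no. norm (normal_flat_norm m (S n - T) - 0) < r" by blast
  qed
qed

text \<open>Justifies the definite description in \<open>flat_norm\<close>: along every
  approximating sequence the norms converge to the same supremum.\<close>

lemma flat_norm_eq:
  assumes "flat_approx m S T" shows "flat_norm m T = normal_flat_norm m T"
proof -
  have conv: "(\<lambda>n. normal_flat_norm m (S n)) \<longlonglongrightarrow> normal_flat_norm m T" if "flat_approx m S T" for S
  proof -
    note fl = flat_approx_limit[OF that]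
    have S: "flat_bounded m (S n)" for n using that normal_flat_bounded(1)[of "S n" m] by (simp add: flat_approx_def)
    have "norm (normal_flat_norm m (S n) - normal_flat_norm m T) \<le> normal_flat_norm m (S n - T)" for n
      using flat_bounded_add(2)[OF fl(2) fl(1), of n] flat_bounded_diff(2)[OF S fl(2), of n n] by simp
    then have "(\<lambda>n. normal_flat_norm m (S n) - normal_flat_norm m T) \<longlonglongrightarrow> 0"
      by (intro Lim_null_comparison[OF _ fl(3)] always_eventually allI)
    then show ?thesis by (simp add: LIM_zero_iff)
  qed
  show ?thesis unfolding flat_norm_def
  proof (rule the_equality)
    show "\<exists>S. flat_approx m S T \<and> (\<lambda>n. normal_flat_norm m (S n)) \<longlonglongrightarrow> normal_flat_norm m T"
      using assms conv by blast
    show "L = normal_flat_norm m T" if "\<exists>S. flat_approx m S T \<and> (\<lambda>n. normal_flat_norm m (S n)) \<longlonglongrightarrow> L" for L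
      using that conv LIMSEQ_unique by blast
  qed
qed

lemma bounded_spt_closure:
  assumes "\<And>n. spt m (S n) \<subseteq> C" "compact C" shows "compact (closure (\<Union>n. spt m (S n)))"
proof -
  have "(\<Union>n. spt m (S n)) \<subseteq> C" using assms(1) by blast
  then have "bounded (\<Union>n. spt m (S n))" by (rule bounded_subset[OF compact_imp_bounded[OF assms(2)]])
  then show ?thesis by simp
qed

lemma flat_approx_diff:
  assumes S: "flat_approx m S T" and R: "R \<in> normal_currents m" "spt m R \<subseteq> C" "compact C"
  shows "flat_approx m (\<lambda>n. S n - R) (T - R)"
proof -
  have n: "S n \<in> normal_currents m" for n using S by (simp add: flat_approx_def)
  let ?C = "closure (\<Union>n. spt m (S n)) \<union> C"
  have C: "compact ?C" using S R(3) by (auto simp: flat_approx_def)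
  have "spt m (S n - R) \<subseteq> ?C" for n
  proof (rule spt_diff_subset[OF normal_currentsD[OF n] normal_currentsD[OF R(1)] _ _ compact_imp_closed[OF C]])
    show "spt m (S n) \<subseteq> ?C" using closure_subset[of "\<Union>n. spt m (S n)"] by blast
    show "spt m R \<subseteq> ?C" using R(2) by blast
  qed
  then have "compact (closure (\<Union>n. spt m (S n - R)))" using C by (rule bounded_spt_closure)
  then show ?thesis
    using S normal_diff(1)[OF n R(1)] by (simp add: flat_approx_def Cauchy_wrt_def tendsto_diff)
qed

text \<open>Locality is inherited from the approximants, whose supports stand in for that of T; this
  makes it available while T is still being shown to be a current.\<close>

lemma flat_currents_local:
  assumes T: "flat_approx m S T" "closure (\<Union>n. spt m (S n)) \<subseteq> U" and U: "open U"
    and \<omega>: "\<omega> \<in> smooth_forms m" "\<eta> \<in> smooth_forms m" "\<And>x. x \<in> U \<Longrightarrow> \<omega> x = \<eta> x"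
  shows "T \<omega> = T \<eta>"
proof -
  have "S n \<omega> = S n \<eta>" for n
  proof (rule currents_local_eq[OF _ \<omega>(1,2) U _ \<omega>(3)])
    show "S n \<in> currents m" using T(1) by (simp add: flat_approx_def normal_currentsD)
    show "spt m (S n) \<subseteq> U" using T(2) closure_subset[of "\<Union>n. spt m (S n)"] by blast
  qed
  then have "(\<lambda>n. S n \<omega>) = (\<lambda>n. S n \<eta>)" by (rule ext)
  moreover have "(\<lambda>n. S n \<omega>) \<longlonglongrightarrow> T \<omega>" "(\<lambda>n. S n \<eta>) \<longlonglongrightarrow> T \<eta>"
    using T(1) \<omega>(1,2) unfolding flat_approx_def by blast+
  ultimately show ?thesis using LIMSEQ_unique by metis
qed

lemma compact_subset_ball: "compact C \<Longrightarrow> \<exists>R>0. C \<subseteq> ball 0 R" for C :: "'a::real_normed_vector set"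
  using compact_imp_bounded bounded_subset_ballD[of C 0] by blast

subsection \<open>Series of normal currents\<close>

lemma partial_sums_normal:
  assumes "\<And>k. S k \<in> normal_currents m" "\<And>k. spt m (S k) \<subseteq> C" "compact C"
  shows "(\<Sum>k<n. S k) \<in> normal_currents m" "spt m (\<Sum>k<n. S k) \<subseteq> C"
proof -
  show "(\<Sum>k<n. S k) \<in> normal_currents m" by (rule conjunct1[OF normal_sum]) (rule assms(1))
  show "spt m (\<Sum>k<n. S k) \<subseteq> C"
    by (rule spt_sum_subset[OF normal_currentsD[OF assms(1)] assms(2) compact_imp_closed[OF assms(3)]])
qed

text \<open>Summable flat norms make the partial sums Cauchy, so together with the weak limit they
  form a \<open>flat_approx\<close> of T; continuity of T then comes from
  \<open>currentsI_cutoff\<close>.\<close>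

lemma normal_series:
  fixes S :: "nat \<Rightarrow> 'a::euclidean_space current"
  assumes S: "\<And>k. S k \<in> normal_currents m" "\<And>k. spt m (S k) \<subseteq> C" "compact C"
    and F: "summable (\<lambda>k. normal_flat_norm m (S k))"
    and T: "\<And>\<omega>. \<omega> \<in> smooth_forms m \<Longrightarrow> (\<lambda>k. S k \<omega>) sums T \<omega>" "\<And>\<omega>. \<omega> \<notin> smooth_forms m \<Longrightarrow> T \<omega> = 0"
  shows "T \<in> flat_currents m" "spt m T \<subseteq> C" "(\<lambda>n. flat_norm m (T - (\<Sum>k<n. S k))) \<longlonglongrightarrow> 0"
proof -
  let ?P = "\<lambda>n. \<Sum>k<n. S k"
  let ?F = "\<lambda>k. normal_flat_norm m (S k)"
  have P: "?P n \<in> normal_currents m" "spt m (?P n) \<subseteq> C" for n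
    by (rule partial_sums_normal[OF S])+
  have Papp: "?P n \<omega> = (\<Sum>k<n. S k \<omega>)" for n \<omega> by (rule sum_current_apply)
  have lim: "(\<lambda>n. ?P n \<omega>) \<longlonglongrightarrow> T \<omega>" if "\<omega> \<in> smooth_forms m" for \<omega>
    using T(1)[OF that] unfolding sums_def Papp .
  have Pdiff: "normal_flat_norm m (?P i - ?P j) \<le> (\<Sum>k. ?F (k + min i j))" for i j
  proof -
    have tail: "normal_flat_norm m (sum S {i..<j}) \<le> (\<Sum>k. ?F (k + i))" if "i \<le> j" for i j
    proof -
      have "normal_flat_norm m (sum S {i..<j}) \<le> (\<Sum>k\<in>{i..<j}. ?F k)"
        using flat_bounded_sum[of "{i..<j}" m S] normal_flat_bounded(1)[OF S(1)] by blast
      also have "\<dots> = (\<Sum>k<j - i. ?F (k + i))"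
        by (rule sum.reindex_bij_witness[of _ "\<lambda>k. k + i" "\<lambda>k. k - i"]) (use that in auto)
      also have "\<dots> \<le> (\<Sum>k. ?F (k + i))"
        using F by (intro sum_le_suminf) (auto simp: summable_iff_shift[of ?F] flat_norm_nonneg normal_flat_bounded(1)[OF S(1)])
      finally show ?thesis .
    qed
    have d: "?P j - ?P i = sum S {i..<j}" if "i \<le> j" for i j
      using sum.lessThan_Suc sum_diff[of "{..<j}" "{..<i}" S] that
      by (simp add: lessThan_minus_lessThan)
    show ?thesis
    proof (cases "i \<le> j")
      case True
      have fb: "flat_bounded m (sum S {i..<j})"
        using flat_bounded_sum[of "{i..<j}" m S] normal_flat_bounded(1)[OF S(1)] by blast
      have "?P i - ?P j = (-1) *\<^sub>R sum S {i..<j}"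
        unfolding d[OF True, symmetric] scaleR_minus1_left by (rule minus_diff_eq[symmetric])
      then have "normal_flat_norm m (?P i - ?P j) \<le> normal_flat_norm m (sum S {i..<j})"
        using flat_bounded_scale(2)[OF fb, of "-1"] by simp
      then show ?thesis using tail[OF True] True by (simp add: min_def)
    next
      case False
      then show ?thesis using d[of j i] tail[of j i] by (simp add: min_def)
    qed
  qed
  have tail0: "(\<lambda>n. \<Sum>k. ?F (k + n)) \<longlonglongrightarrow> 0" by (rule suminf_exist_split2[OF F])
  have "Cauchy_wrt (normal_flat_norm m) ?P"
    unfolding Cauchy_wrt_def
  proof (intro allI impI)
    fix \<epsilon> :: real assume "\<epsilon> > 0"
    then obtain N where N: "\<And>n. n \<ge> N \<Longrightarrow> norm ((\<Sum>k. ?F (k + n)) - 0) < \<epsilon>" using LIMSEQ_D[OF tail0] by blast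
    have "normal_flat_norm m (?P i - ?P j) < \<epsilon>" if "i \<ge> N" "j \<ge> N" for i j
      using Pdiff[of i j] N[of "min i j"] that by simp
    then show "\<exists>N. \<forall>i\<ge>N. \<forall>j\<ge>N. normal_flat_norm m (?P i - ?P j) < \<epsilon>" by blast
  qed
  then have fa: "flat_approx m ?P T"
    unfolding flat_approx_def using P lim bounded_spt_closure[of m ?P C] S(3) by blast
  obtain R where R: "R > 0" "C \<subseteq> ball 0 R"
    using compact_subset_ball[OF S(3)] by blast
  have "T \<in> currents m"
  proof (rule currentsI_cutoff[OF _ T(2) R(1)])
    show "linear_on (smooth_forms m) T"
      unfolding linear_on_def
    proof (intro conjI ballI allI)
      fix \<omega> \<eta> :: "'a form" assume *: "\<omega> \<in> smooth_forms m" "\<eta> \<in> smooth_forms m"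
      show "T (\<omega> + \<eta>) = T \<omega> + T \<eta>"
        using sums_add[OF T(1)[OF *(1)] T(1)[OF *(2)]] T(1)[OF smooth_forms_add[OF *]] sums_unique2
        by (simp add: currents_linear(1)[OF normal_currentsD[OF S(1)] *])
    next
      fix c and \<omega> :: "'a form" assume *: "\<omega> \<in> smooth_forms m"
      show "T (c *\<^sub>R \<omega>) = c *\<^sub>R T \<omega>"
        using sums_mult[OF T(1)[OF *], of c] T(1)[OF smooth_forms_scale[OF *, of c]] sums_unique2
        by (simp add: currents_linear(2)[OF normal_currentsD[OF S(1)] *])
    qed
    fix \<omega> :: "'a form"
    show "T (\<lambda>x vs. radial_cutoff 0 R x * \<omega> x vs) = T \<omega>" if "\<omega> \<in> smooth_forms m"
    proof (rule flat_currents_local[OF fa _ _ smooth_forms_cutoff[OF that radial_cutoff(1)[OF R(1)]] that])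
      show "closure (\<Union>n. spt m (?P n)) \<subseteq> ball 0 R"
        using closure_minimal[of "\<Union>n. spt m (?P n)" C] P(2) compact_imp_closed[OF S(3)] R(2) by blast
      show "(\<lambda>vs. radial_cutoff 0 R x * \<omega> x vs) = \<omega> x" if "x \<in> ball 0 R" for x
        using radial_cutoff(4)[OF R(1), of x 0] that by simp
    qed simp
    show "T \<omega> \<le> normal_flat_norm m T" if "\<omega> \<in> flat_ball m"
      by (rule flat_norm_upper[OF flat_approx_limit(1)[OF fa] that])
  qed
  then show "T \<in> flat_currents m" using fa by (auto simp: flat_currents_def)
  show "spt m T \<subseteq> C"
  proof (rule spt_subsetI[OF compact_imp_closed[OF S(3)]])
    fix \<omega> :: "'a form" assume \<omega>: "\<omega> \<in> smooth_forms m" "form_support \<omega> \<inter> C = {}"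
    then have "(\<lambda>k. S k \<omega>) = (\<lambda>k. 0)"
      using currents_disjoint_support[OF normal_currentsD[OF S(1)] S(2)] by blast
    then show "T \<omega> = 0" using T(1)[OF \<omega>(1)] sums_unique2[OF _ sums_zero] by metis
  qed
  show "(\<lambda>n. flat_norm m (T - ?P n)) \<longlonglongrightarrow> 0"
  proof (rule Lim_null_comparison[OF always_eventually flat_approx_limit(3)[OF fa]], rule allI)
    fix n
    have "flat_norm m (T - ?P n) = normal_flat_norm m (T - ?P n)"
      by (rule flat_norm_eq[OF flat_approx_diff[OF fa P S(3)]])
    moreover have "normal_flat_norm m (T - ?P n) \<le> normal_flat_norm m (?P n - T)"
    proof -
      have e: "T - ?P n = (-1) *\<^sub>R (?P n - T)" by simp
      have "normal_flat_norm m ((-1) *\<^sub>R (?P n - T)) \<le> \<bar>-1\<bar> * normal_flat_norm m (?P n - T)"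
        by (rule flat_bounded_scale(2)[OF flat_approx_limit(2)[OF fa]])
      then show ?thesis unfolding e[symmetric] by simp
    qed
    moreover have "0 \<le> normal_flat_norm m (T - ?P n)"
      by (rule flat_norm_nonneg[OF flat_bounded_diff(1)[OF flat_approx_limit(1)[OF fa] normal_flat_bounded(1)[OF P(1)]]])
    ultimately show "norm (flat_norm m (T - ?P n)) \<le> normal_flat_norm m (?P n - T)"
      unfolding real_norm_def by linarith
  qed
qed

text \<open>Flat convergence controls bounded forms only, so \<omega> is first replaced by a bounded
  form that agrees with it on a ball around all supports involved.\<close>

lemma decomposition_sums:
  fixes S :: "nat \<Rightarrow> 'a::euclidean_space current"
  assumes T: "T \<in> flat_currents m" and S: "fractional_decomposition \<alpha> m T S" and \<omega>: "\<omega> \<in> smooth_forms m"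
  shows "(\<lambda>k. S k \<omega>) sums T \<omega>"
proof -
  obtain A where A: "flat_approx m A T" using T by (auto simp: flat_currents_def)
  have n: "\<And>k. S k \<in> normal_currents m" using S by (simp add: fractional_decomposition_def)
  obtain C where C: "compact C" "\<And>k. spt m (S k) \<subseteq> C" using S by (auto simp: fractional_decomposition_def)
  let ?P = "\<lambda>n. \<Sum>k<n. S k"
  have P: "?P n \<in> normal_currents m" "spt m (?P n) \<subseteq> C" for n
    by (rule partial_sums_normal[OF n C(2,1)])+
  let ?K = "closure (\<Union>n. spt m (A n)) \<union> C"
  have "compact ?K" using A C(1) by (auto simp: flat_approx_def)
  then obtain R where R: "?K \<subseteq> ball 0 R" using compact_subset_ball by blast
  obtain \<eta> c where \<eta>: "\<eta> \<in> smooth_forms m" "c > 0" "form_le c \<eta>" "form_le c (ext_deriv \<eta>)"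
    "\<And>x. norm x < R \<Longrightarrow> \<eta> x = \<omega> x"
    using bounded_replacement[OF \<omega>, of R] by blast
  have T\<eta>: "T \<eta> = T \<omega>"
    by (rule flat_currents_local[OF A _ _ \<eta>(1) \<omega>, of "ball 0 R"]) (use R \<eta>(5) in auto)
  have P\<eta>: "?P n \<eta> = ?P n \<omega>" for n
    by (rule currents_local_eq[OF normal_currentsD[OF P(1)] \<eta>(1) \<omega>, of "ball 0 R"]) (use P(2)[of n] R \<eta>(5) in auto)
  have bound: "norm (?P n \<omega> - T \<omega>) \<le> flat_norm m (T - ?P n) * c" for n
  proof -
    have fa: "flat_approx m (\<lambda>j. A j - ?P n) (T - ?P n)" by (rule flat_approx_diff[OF A P C(1)])
    have "\<bar>(T - ?P n) \<eta>\<bar> \<le> normal_flat_norm m (T - ?P n) * c"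
      by (rule flat_norm_bound[OF flat_approx_limit(1)[OF fa] \<eta>(1,3,4,2)])
    then show ?thesis unfolding flat_norm_eq[OF fa] by (simp add: T\<eta> P\<eta> abs_minus_commute)
  qed
  have "(\<lambda>n. flat_norm m (T - ?P n) * c) \<longlonglongrightarrow> 0"
    using S by (intro tendsto_mult_left_zero) (simp add: fractional_decomposition_def)
  from Lim_null_comparison[OF always_eventually[OF allI[OF bound]] this]
  have "(\<lambda>n. ?P n \<omega>) \<longlonglongrightarrow> T \<omega>" by (rule LIM_zero_cancel)
  then show ?thesis unfolding sums_def sum_current_apply .
qed

subsection \<open>Smooth approximations of the nearest point projection\<close>

lemma smooth_projection:
  fixes K :: "'a::euclidean_space set"
  assumes K: "compact K" "convex K" "K \<noteq> {}" and \<delta>: "\<delta> > 0"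
  shows "\<exists>p. contraction p \<and> (\<forall>x. p x \<in> K) \<and> (\<forall>x. norm (p x - closest_point K x) \<le> \<delta>)"
proof -
  have cl: "closed K" by (rule compact_imp_closed[OF K(1)])
  have lip: "norm (closest_point K x - closest_point K y) \<le> norm (x - y)" for x y
    using closest_point_lipschitz[OF K(2) cl K(3), of x y] by (simp add: dist_norm)
  obtain p where p: "vsmooth p" "\<forall>x. p x \<in> K" "\<forall>x. norm (p x - closest_point K x) \<le> \<delta>"
    "\<forall>x y. norm (p x - p y) \<le> norm (x - y)"
    using mollify[OF cl K(2) closest_point_in_set[OF cl K(3)] lip \<delta>] by blast
  have "contraction p"
    unfolding contraction_def using p(1) nonexpansive_derivative[OF p(1)] p(4) by simp
  then show ?thesis using p by blast
qed

lemma contraction_id: "contraction (\<lambda>x. x)"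
  by (simp add: contraction_def)

lemma pullback_id: "pullback (\<lambda>x. x) \<omega> = \<omega>"
  by (simp add: pullback_def fun_eq_iff)

text \<open>The forms compared here are \<open>d H + H d\<close> of a homotopy with \<open>H\<close> of size \<open>\<delta>\<close> near \<open>K\<close>.
  After cutting off at distance \<open>\<delta>\<close> from \<open>K\<close> the primitives are still of size \<open>\<delta>\<close>, so that the
  normal current \<open>R\<close> does not see them, while their exterior derivatives stay bounded.\<close>

lemma push_estimate:
  fixes T :: "'a::euclidean_space current"
  assumes T: "T \<in> currents m" "spt m T \<subseteq> K" and R: "R \<in> normal_currents m" "flat_bounded m (R - T)"
    and p: "contraction p" "\<And>x. x \<in> K \<Longrightarrow> norm (x - p x) \<le> \<delta>" and \<delta>: "0 < \<delta>" "\<delta> \<le> 1"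
    and b: "\<And>x. \<bar>partial_deriv 1 smooth_step x\<bar> \<le> b" "b > 0"
    and \<omega>: "\<omega> \<in> smooth_forms m" "form_le B \<omega>" "form_le B (ext_deriv \<omega>)" and B: "B > 0"
  shows "\<bar>T \<omega> - T (pullback p \<omega>)\<bar>
    \<le> 6 * \<delta> * B * normal_norm m R + 2 * ((5 + (real m + 1) * 9 * b) * B) * normal_flat_norm m (R - T)"
proof -
  \<comment> \<open>Bounds d of a cut-off primitive: 5 B for d of the primitive, plus m + 1 Leibniz
    terms of size 9 b B. In these the factor 3 b / \<delta> from the cutoff meets a primitive of
    size 3 \<delta> B, so \<delta> cancels.\<close>
  define C where "C = (5 + (real m + 1) * 9 * b) * B"
  have C: "5 * B \<le> C" unfolding C_def using b(2) B by (intro mult_right_mono) auto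
  have pv: "vsmooth p" using p(1) by (simp add: contraction_def)
  define q where "q x = x - p x" for x
  have qv: "vsmooth q" unfolding q_def[abs_def] by (intro vsmooth_diff vsmooth_id pv)
  have dq: "norm (frechet_derivative q (at x) v) \<le> 2 * norm v" for x v
  proof -
    have "((\<lambda>x. x - p x) has_derivative (\<lambda>v. v - frechet_derivative p (at x) v)) (at x)"
      by (intro has_derivative_diff has_derivative_ident vsmooth_has_derivative[OF pv])
    then have "frechet_derivative q (at x) v = v - frechet_derivative p (at x) v"
      unfolding q_def[abs_def] by (simp add: frechet_derivative_at[symmetric])
    moreover have "norm (frechet_derivative p (at x) v) \<le> norm v" using p(1) by (simp add: contraction_def)
    ultimately show ?thesis using norm_triangle_ineq4[of v "frechet_derivative p (at x) v"] by simp
  qed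
  \<comment> \<open>The displacement x - p x replaces the distance to K because it is smooth with
    derivative at most 2. The scaling makes \<zeta> equal to 1 for displacements up to 2 \<delta>
    and 0 from 3 \<delta> on.\<close>
  define \<zeta> where "\<zeta> x = smooth_step ((norm (q x))\<^sup>2 * (1 / (4 * \<delta>\<^sup>2)))" for x
  have \<zeta>sm: "smooth \<zeta>"
    unfolding \<zeta>_def[abs_def]
    by (rule smooth_compose[OF smooth_smooth_step], simp only: vsmooth_real)
      (intro smooth_mult smooth_const smooth_norm_sq qv)
  have \<zeta>1: "\<zeta> x = 1" if "norm (q x) \<le> 2 * \<delta>" for x
  proof -
    have "(norm (q x))\<^sup>2 \<le> (2 * \<delta>)\<^sup>2" using that by (intro power_mono) auto
    then show ?thesis unfolding \<zeta>_def using \<delta> by (intro smooth_step_1) (simp add: field_simps power_mult_distrib)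
  qed
  have \<zeta>0: "\<zeta> x = 0" if "norm (q x) \<ge> 3 * \<delta>" for x
  proof -
    have "(3 * \<delta>)\<^sup>2 \<le> (norm (q x))\<^sup>2" using that \<delta> by (intro power_mono) auto
    moreover have "8 * \<delta>\<^sup>2 \<le> (3 * \<delta>)\<^sup>2" by (simp add: power_mult_distrib)
    ultimately have "8 * \<delta>\<^sup>2 \<le> (norm (q x))\<^sup>2" by linarith
    then show ?thesis unfolding \<zeta>_def using \<delta> by (intro smooth_step_0) (simp add: field_simps)
  qed
  have \<zeta>b: "0 \<le> \<zeta> x" "\<zeta> x \<le> 1" for x by (simp_all add: \<zeta>_def smooth_step_bounds)
  have d\<zeta>: "\<bar>frechet_derivative \<zeta> (at x) v\<bar> \<le> (3 * b / \<delta>) * norm v" if x: "norm (q x) \<le> 3 * \<delta>" for x v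
  proof -
    let ?g = "\<lambda>x. (norm (q x))\<^sup>2 * (1 / (4 * \<delta>\<^sup>2))"
    have gsm: "smooth ?g" by (intro smooth_mult smooth_const smooth_norm_sq qv)
    have "frechet_derivative ?g (at x) v = 2 * (q x \<bullet> frechet_derivative q (at x) v) * (1 / (4 * \<delta>\<^sup>2))"
      by (simp add: fd_mult[OF smooth_norm_sq[OF qv] smooth_const] frechet_derivative_norm_sq[OF qv] del: times_divide_eq_right)
    moreover have "frechet_derivative \<zeta> (at x) v = frechet_derivative smooth_step (at (?g x)) (frechet_derivative ?g (at x) v)"
      unfolding \<zeta>_def[abs_def] using frechet_derivative_comp[of smooth_step ?g x v] smooth_smooth_step gsm by simp
    moreover have "\<dots> = frechet_derivative ?g (at x) v * partial_deriv 1 smooth_step (?g x)"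
      using fd_linear_scale[OF smooth_smooth_step, of "?g x" "frechet_derivative ?g (at x) v" 1]
      by (simp add: partial_deriv_def)
    ultimately have "\<bar>frechet_derivative \<zeta> (at x) v\<bar>
        = 2 * \<bar>q x \<bullet> frechet_derivative q (at x) v\<bar> * (1 / (4 * \<delta>\<^sup>2)) * \<bar>partial_deriv 1 smooth_step (?g x)\<bar>"
      by (simp add: abs_mult)
    also have "\<dots> \<le> 2 * ((3 * \<delta>) * (2 * norm v)) * (1 / (4 * \<delta>\<^sup>2)) * b"
    proof -
      have "\<bar>q x \<bullet> frechet_derivative q (at x) v\<bar> \<le> norm (q x) * norm (frechet_derivative q (at x) v)"
        by (rule Cauchy_Schwarz_ineq2)
      also have "\<dots> \<le> (3 * \<delta>) * (2 * norm v)" using x dq \<delta> by (intro mult_mono) auto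
      finally show ?thesis using b(1) by (intro mult_mono mult_right_mono mult_left_mono) auto
    qed
    also have "\<dots> = (3 * b / \<delta>) * norm v" using \<delta> by (simp add: field_simps power2_eq_square)
    finally show ?thesis .
  qed
  let ?H = "homotopy_form p (\<lambda>x. x)"
  have id: "vsmooth (\<lambda>x :: 'a. x)" by simp
  have dd: "ext_deriv (ext_deriv \<omega>) = 0" using ext_deriv_ext_deriv[OF \<omega>(1)] by (simp add: fun_eq_iff)
  have hom: "ext_deriv (?H \<eta>) x vs + ?H (ext_deriv \<eta>) x vs = \<eta> x vs - pullback p \<eta> x vs"
    if "\<eta> \<in> smooth_forms k" for \<eta> k x vs
    using homotopy_formula[OF that pv id, of x vs] by (simp add: pullback_id)
  have Hb: "\<bar>?H \<eta> x vs\<bar> \<le> (3 * \<delta> * B) * norms vs"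
    if "\<eta> \<in> smooth_forms k" "form_le B \<eta>" "norm (q x) \<le> 3 * \<delta>" for \<eta> k x vs
  proof -
    have "\<bar>?H \<eta> x vs\<bar> \<le> B * norm (x - p x) * norms vs"
      by (rule homotopy_form_bound[OF that(1) p(1) contraction_id]) (use B that(2) in \<open>auto simp: form_le_def\<close>)
    also have "\<dots> \<le> B * (3 * \<delta>) * norms vs"
      using that(3) B norms_nonneg[of vs] by (intro mult_right_mono mult_left_mono) (auto simp: q_def)
    finally show ?thesis by (simp add: mult_ac)
  qed
  have Pb: "\<bar>pullback p \<eta> x vs\<bar> \<le> B * norms vs" if "form_le B \<eta>" for \<eta> x vs
    using form_le_pullback[OF p(1) less_imp_le[OF B] that] by (simp add: form_le_def)
  \<comment> \<open>Read off from the homotopy formula: \<eta>, its pullback and the primitive of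
    d\<eta> contribute B, B and 3 \<delta> B, where \<delta> is at most 1.\<close>
  have dHb: "\<bar>ext_deriv (?H \<eta>) x vs\<bar> \<le> 5 * B * norms vs"
    if \<eta>: "\<eta> \<in> smooth_forms k" "form_le B \<eta>" and d: "form_le B (ext_deriv \<eta>)" and x: "norm (q x) \<le> 3 * \<delta>" for \<eta> k x vs
  proof -
    have "ext_deriv (?H \<eta>) x vs = \<eta> x vs - pullback p \<eta> x vs - ?H (ext_deriv \<eta>) x vs"
      using hom[OF \<eta>(1), of x vs] by simp
    then have "\<bar>ext_deriv (?H \<eta>) x vs\<bar> \<le> B * norms vs + B * norms vs + (3 * \<delta> * B) * norms vs"
      using \<eta>(2) Pb[OF \<eta>(2), of x vs] Hb[OF ext_deriv_smooth_forms[OF \<eta>(1)] d x, of vs]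
      unfolding form_le_def by (smt (verit, best))
    also have "\<dots> \<le> B * norms vs + B * norms vs + (3 * B) * norms vs"
      using \<delta> B norms_nonneg[of vs] by (intro add_left_mono mult_right_mono) auto
    finally show ?thesis by (simp add: algebra_simps)
  qed
  let ?cut = "\<lambda>\<eta> x vs. \<zeta> x * ?H \<eta> x vs"
  \<comment> \<open>Needed in two degrees, for \<omega> with k = m and for d\<omega> with k = m +
    1.\<close>
  have cut: "?cut \<eta> \<in> smooth_forms (k - 1) \<and> form_le (3 * \<delta> * B) (?cut \<eta>) \<and> form_le C (ext_deriv (?cut \<eta>))"
    if \<eta>: "\<eta> \<in> smooth_forms k" "form_le B \<eta>" "form_le B (ext_deriv \<eta>)" and k: "k \<le> Suc m" for \<eta> k
  proof (intro conjI)
    have H: "?H \<eta> \<in> smooth_forms (k - 1)" by (rule homotopy_form_smooth_forms[OF \<eta>(1) pv id])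
    show "?cut \<eta> \<in> smooth_forms (k - 1)" by (rule smooth_forms_cutoff[OF H \<zeta>sm])
    have small: "\<bar>\<zeta> x * t\<bar> \<le> a" if "\<bar>t\<bar> \<le> a" for x t a
    proof -
      have "\<bar>\<zeta> x * t\<bar> \<le> 1 * a" unfolding abs_mult using \<zeta>b[of x] that by (intro mult_mono) auto
      then show ?thesis by simp
    qed
    show "form_le (3 * \<delta> * B) (?cut \<eta>)"
      unfolding form_le_def
    proof (intro allI)
      fix x vs
      show "\<bar>?cut \<eta> x vs\<bar> \<le> 3 * \<delta> * B * norms vs"
      proof (cases "norm (q x) \<le> 3 * \<delta>")
        case True then show ?thesis by (intro small Hb[OF \<eta>(1,2)])
      next
        case False
        then have "\<zeta> x = 0" by (intro \<zeta>0) simp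
        then show ?thesis using \<delta> B norms_nonneg[of vs] by simp
      qed
    qed
    show "form_le C (ext_deriv (?cut \<eta>))"
      unfolding form_le_def
    proof (intro allI)
      fix x vs
      show "\<bar>ext_deriv (?cut \<eta>) x vs\<bar> \<le> C * norms vs"
      proof (cases "norm (q x) \<le> 3 * \<delta>")
        case True
        have "\<bar>ext_deriv (?cut \<eta>) x vs\<bar> \<le> (5 * B + (real (k - 1) + 1) * ((3 * b / \<delta>) * (3 * \<delta> * B))) * norms vs"
        proof (rule ext_deriv_cutoff_bound[OF H \<zeta>sm])
          show "\<bar>frechet_derivative \<zeta> (at x) v\<bar> \<le> 3 * b / \<delta> * norm v" for v by (rule d\<zeta>[OF True])
          show "\<bar>\<zeta> x * ext_deriv (?H \<eta>) x vs\<bar> \<le> 5 * B * norms vs" by (rule small[OF dHb[OF \<eta> True]])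
          show "\<bar>?H \<eta> x vs\<bar> \<le> 3 * \<delta> * B * norms vs" for vs by (rule Hb[OF \<eta>(1,2) True])
        qed (use \<delta> B b(2) in auto)
        also have "(3 * b / \<delta>) * (3 * \<delta> * B) = 9 * b * B" using \<delta> by simp
        also have "(5 * B + (real (k - 1) + 1) * (9 * b * B)) * norms vs \<le> C * norms vs"
        proof (rule mult_right_mono[OF _ norms_nonneg])
          have "real (k - 1) + 1 \<le> real m + 1" using k by linarith
          then have "(real (k - 1) + 1) * (9 * b * B) \<le> (real m + 1) * (9 * b * B)"
            using b(2) B by (intro mult_right_mono) auto
          then show "5 * B + (real (k - 1) + 1) * (9 * b * B) \<le> C" by (simp add: C_def algebra_simps)
        qed
        finally show ?thesis .
      next
        case False
        have "ext_deriv (?cut \<eta>) x = ext_deriv 0 x"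
        proof (rule ext_deriv_cong_open[of "{x. 3 * \<delta> < norm (q x)}"])
          show "open {x. 3 * \<delta> < norm (q x)}"
            by (intro open_Collect_less continuous_intros vsmooth_continuous_on[OF qv])
          show "?cut \<eta> y = 0 y" if "y \<in> {x. 3 * \<delta> < norm (q x)}" for y
            using \<zeta>0[of y] that by (simp add: fun_eq_iff)
        qed (use False in simp)
        then show ?thesis using C B norms_nonneg[of vs] by (simp add: ext_deriv_form_zero)
      qed
    qed
  qed
  have c0: "?cut \<omega> \<in> smooth_forms (m - 1)" "form_le (3 * \<delta> * B) (?cut \<omega>)" "form_le C (ext_deriv (?cut \<omega>))"
    using cut[OF \<omega>] by simp_all
  have "form_le B (ext_deriv (ext_deriv \<omega>))" using B by (simp add: dd form_le_zero)
  from cut[OF ext_deriv_smooth_forms[OF \<omega>(1)] \<omega>(3) this]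
  have c1: "?cut (ext_deriv \<omega>) \<in> smooth_forms m" "form_le (3 * \<delta> * B) (?cut (ext_deriv \<omega>))"
    "form_le C (ext_deriv (?cut (ext_deriv \<omega>)))" by simp_all
  define U where "U = {x. norm (q x) < 2 * \<delta>}"
  have U: "open U" unfolding U_def by (intro open_Collect_less continuous_intros vsmooth_continuous_on[OF qv])
  have KU: "spt m T \<subseteq> U"
  proof
    fix x assume "x \<in> spt m T"
    then have "norm (q x) \<le> \<delta>" unfolding q_def using T(2) p(2) by blast
    then show "x \<in> U" using \<delta> by (simp add: U_def)
  qed
  have agree: "?cut \<eta> x = ?H \<eta> x" if "x \<in> U" for \<eta> x
    using \<zeta>1[of x] that by (simp add: U_def fun_eq_iff)
  have 3: "3 * \<delta> * B > 0" using \<delta> B by simp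
  have CB: "3 * \<delta> * B \<le> C" "C > 0"
  proof -
    have "3 * \<delta> * B \<le> 3 * B" using \<delta> B by simp
    then show "3 * \<delta> * B \<le> C" "C > 0" using C B by linarith+
  qed
  \<comment> \<open>R may have large N but meets forms of size \<delta>; R - T has small flat norm
    and meets forms whose size and derivative stay bounded by C.\<close>
  have split: "T \<eta> = R \<eta> - (R - T) \<eta>" for \<eta> by simp
  have t1: "\<bar>if m = 0 then 0 else T (ext_deriv (?H \<omega>))\<bar> \<le> normal_norm m R * (3 * \<delta> * B) + normal_flat_norm m (R - T) * C"
  proof (cases "m = 0")
    case True
    then show ?thesis using normal_norm_nonneg[OF R(1)] flat_norm_nonneg[OF R(2)] 3 CB(2) by simp
  next
    case False
    have d0: "ext_deriv (?cut \<omega>) \<in> smooth_forms m" using ext_deriv_smooth_forms[OF c0(1)] False by simp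
    have "T (ext_deriv (?H \<omega>)) = T (ext_deriv (?cut \<omega>))"
    proof (rule currents_local_eq[OF T(1) _ d0 U KU])
      show "ext_deriv (?H \<omega>) \<in> smooth_forms m"
        using ext_deriv_smooth_forms[OF homotopy_form_smooth_forms[OF \<omega>(1) pv id]] False by simp
      show "ext_deriv (?H \<omega>) x = ext_deriv (?cut \<omega>) x" if "x \<in> U" for x
        by (rule ext_deriv_cong_open[OF U that]) (rule agree[symmetric])
    qed
    moreover have "\<bar>R (ext_deriv (?cut \<omega>))\<bar> \<le> normal_norm m R * (3 * \<delta> * B)"
      by (rule normal_boundary_bound[OF R(1) _ c0(1,2) 3]) (use False in simp)
    moreover have "\<bar>(R - T) (ext_deriv (?cut \<omega>))\<bar> \<le> normal_flat_norm m (R - T) * C"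
    proof (rule flat_norm_bound[OF R(2) d0 c0(3) _ CB(2)])
      have "ext_deriv (ext_deriv (?cut \<omega>)) = 0" using ext_deriv_ext_deriv[OF c0(1)] by (simp add: fun_eq_iff)
      then show "form_le C (ext_deriv (ext_deriv (?cut \<omega>)))" using CB(2) by (simp add: form_le_zero)
    qed
    ultimately show ?thesis unfolding if_not_P[OF False] using split[of "ext_deriv (?cut \<omega>)"] by linarith
  qed
  have t2: "\<bar>T (?H (ext_deriv \<omega>))\<bar> \<le> normal_norm m R * (3 * \<delta> * B) + normal_flat_norm m (R - T) * C"
  proof -
    have "T (?H (ext_deriv \<omega>)) = T (?cut (ext_deriv \<omega>))"
      by (rule currents_local_eq[OF T(1) _ c1(1) U KU])
        (use homotopy_form_smooth_forms[OF ext_deriv_smooth_forms[OF \<omega>(1)] pv id] agree in auto)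
    moreover have "\<bar>R (?cut (ext_deriv \<omega>))\<bar> \<le> normal_norm m R * (3 * \<delta> * B)"
      by (rule normal_bound[OF R(1) c1(1,2) 3])
    moreover have "\<bar>(R - T) (?cut (ext_deriv \<omega>))\<bar> \<le> normal_flat_norm m (R - T) * C"
      by (rule flat_norm_bound[OF R(2) c1(1) form_le_mono[OF c1(2) CB(1)] c1(3) CB(2)])
    ultimately show ?thesis using split[of "?cut (ext_deriv \<omega>)"] by linarith
  qed
  have "T \<omega> - T (pullback p \<omega>) = T (pullback (\<lambda>x. x) \<omega> - pullback p \<omega>)"
    by (simp add: pullback_id currents_diff[OF T(1) \<omega>(1) pullback_smooth_forms[OF \<omega>(1) pv]])
  also have "\<dots> = (if m = 0 then 0 else T (ext_deriv (?H \<omega>))) + T (?H (ext_deriv \<omega>))"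
    by (rule current_homotopy[OF T(1) \<omega>(1) pv id])
  finally have "\<bar>T \<omega> - T (pullback p \<omega>)\<bar> \<le> (normal_norm m R * (3 * \<delta> * B) + normal_flat_norm m (R - T) * C)
      + (normal_norm m R * (3 * \<delta> * B) + normal_flat_norm m (R - T) * C)"
    by (simp only: order_trans[OF abs_triangle_ineq add_mono[OF t1 t2]])
  also have "\<dots> = 6 * \<delta> * B * normal_norm m R + 2 * C * normal_flat_norm m (R - T)" by simp
  finally show ?thesis unfolding C_def .
qed

text \<open>The order of choices matters: first an approximant \<open>A n\<close> flatly close to T,
  then j so large that \<epsilon> j beats its possibly large N.\<close>

lemma push_tendsto:
  fixes T :: "'a::euclidean_space current"
  assumes K: "compact K" "convex K" "K \<noteq> {}" and T: "T \<in> flat_currents m" "spt m T \<subseteq> K"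
    and p: "\<And>j. contraction (p j)" "\<And>j x. p j x \<in> K" "\<And>j x. norm (p j x - closest_point K x) \<le> \<epsilon> j"
    and \<epsilon>: "\<And>j. \<epsilon> j > 0" "\<epsilon> \<longlonglongrightarrow> 0" and \<omega>: "\<omega> \<in> smooth_forms m"
  shows "(\<lambda>j. T (pullback (p j) \<omega>)) \<longlonglongrightarrow> T \<omega>"
proof -
  have T0: "T \<in> currents m" using T by (simp add: flat_currents_def)
  obtain A where A: "flat_approx m A T" using T(1) by (auto simp: flat_currents_def)
  have AN: "A n \<in> normal_currents m" for n using A by (simp add: flat_approx_def)
  obtain r where r: "K \<subseteq> ball 0 r" using compact_subset_ball[OF K(1)] by blast
  obtain \<eta> B where \<eta>: "\<eta> \<in> smooth_forms m" "B > 0" "form_le B \<eta>" "form_le B (ext_deriv \<eta>)"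
    "\<And>x. norm x < r \<Longrightarrow> \<eta> x = \<omega> x"
    using bounded_replacement[OF \<omega>, of r] by blast
  have T\<eta>: "T \<eta> = T \<omega>"
    by (rule currents_local_eq[OF T0 \<eta>(1) \<omega>, of "ball 0 r"]) (use r T(2) \<eta>(5) in auto)
  have P\<eta>: "pullback (p j) \<eta> = pullback (p j) \<omega>" for j
  proof -
    have "\<eta> (p j x) = \<omega> (p j x)" for x using r p(2)[of j x] by (intro \<eta>(5)) auto
    then show ?thesis by (simp add: pullback_def fun_eq_iff)
  qed
  obtain b where b: "b > 0" "\<And>x. \<bar>partial_deriv 1 smooth_step x\<bar> \<le> b" using smooth_step_derivative_bound by blast
  define C where "C = 2 * ((5 + (real m + 1) * 9 * b) * B)"
  have C: "C > 0" unfolding C_def using b(1) \<eta>(2) by (intro mult_pos_pos add_pos_nonneg) auto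
  have est: "\<bar>T \<eta> - T (pullback (p j) \<eta>)\<bar> \<le> 6 * \<epsilon> j * B * normal_norm m (A n) + C * normal_flat_norm m (A n - T)"
    if "\<epsilon> j \<le> 1" for j n
    unfolding C_def
  proof (rule push_estimate[OF T0 T(2) AN flat_approx_limit(2)[OF A] p(1) _ \<epsilon>(1) that b(2,1) \<eta>(1,3,4,2)])
    fix x assume "x \<in> K"
    then have "closest_point K x = x" by (simp add: closest_point_self)
    then show "norm (x - p j x) \<le> \<epsilon> j" using p(3)[of j x] by (simp add: norm_minus_commute)
  qed
  have "(\<lambda>j. T (pullback (p j) \<eta>)) \<longlonglongrightarrow> T \<eta>"
  proof (rule LIMSEQ_I)
    fix s :: real assume s: "s > 0"
    have "\<forall>\<^sub>F n in sequentially. normal_flat_norm m (A n - T) < s / (2 * C)"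
      using order_tendstoD(2)[OF flat_approx_limit(3)[OF A], of "s / (2 * C)"] s C by simp
    then obtain n where n: "normal_flat_norm m (A n - T) < s / (2 * C)"
      by (auto simp: eventually_sequentially)
    have lim: "(\<lambda>j. 6 * \<epsilon> j * B * normal_norm m (A n)) \<longlonglongrightarrow> 6 * 0 * B * normal_norm m (A n)"
      by (intro tendsto_intros \<epsilon>(2))
    have "\<forall>\<^sub>F j in sequentially. 6 * \<epsilon> j * B * normal_norm m (A n) < s / 2"
      by (rule order_tendstoD(2)[OF lim]) (use s in simp)
    moreover have "\<forall>\<^sub>F j in sequentially. \<epsilon> j < 1" using order_tendstoD(2)[OF \<epsilon>(2), of 1] by simp
    ultimately have "\<forall>\<^sub>F j in sequentially. norm (T (pullback (p j) \<eta>) - T \<eta>) < s"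
    proof eventually_elim
      case (elim j)
      have "C * normal_flat_norm m (A n - T) < s / 2" using n C by (simp add: field_simps)
      then show ?case using est[of j n] elim by (simp add: abs_minus_commute)
    qed
    then show "\<exists>no. \<forall>n\<ge>no. norm (T (pullback (p n) \<eta>) - T \<eta>) < s" by (simp add: eventually_sequentially)
  qed
  then show ?thesis unfolding T\<eta> P\<eta> .
qed

subsection \<open>Double series\<close>

text \<open>Fubini for absolutely summable families, rearranged along the pairing bijection:
  decompositions are indexed by a single natural number, so series of series must be
  flattened.\<close>

lemma sums_prod_decode:
  fixes f :: "nat \<Rightarrow> nat \<Rightarrow> real"
  assumes a: "\<And>j. summable (\<lambda>k. \<bar>f j k\<bar>)" and b: "summable (\<lambda>j. \<Sum>k. \<bar>f j k\<bar>)"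
  shows "summable (\<lambda>i. \<bar>case_prod f (prod_decode i)\<bar>)"
    and "(\<lambda>i. case_prod f (prod_decode i)) sums (\<Sum>j. \<Sum>k. f j k)"
proof -
  let ?g = "case_prod f"
  have in1: "(\<lambda>k. norm (f j k)) summable_on UNIV" for j
    using a[of j] by (intro summable_nonneg_imp_summable_on) auto
  have in2: "infsum (\<lambda>k. norm (f j k)) UNIV = (\<Sum>k. \<bar>f j k\<bar>)" for j
    using sums_nonneg_imp_has_sum[OF summable_sums[OF a[of j]]] by (intro infsumI) simp
  have G: "(\<lambda>z. norm (?g z)) summable_on UNIV \<times> UNIV"
  proof (rule Infinite_Sum.abs_summable_on_Sigma_iff[THEN iffD2], intro conjI ballI)
    show "(\<lambda>y. norm (?g (x, y))) summable_on UNIV" for x using in1 by simp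
    have "0 \<le> (\<Sum>k. \<bar>f j k\<bar>)" for j by (rule suminf_nonneg[OF a]) simp
    then have "(\<lambda>j. \<bar>\<Sum>k. \<bar>f j k\<bar>\<bar>) summable_on UNIV"
      using b by (simp add: summable_nonneg_imp_summable_on)
    then show "(\<lambda>x. norm (infsum (\<lambda>y. norm (?g (x, y))) UNIV)) summable_on UNIV"
      using in2 by simp
  qed
  have bij: "bij_betw prod_decode UNIV (UNIV :: (nat \<times> nat) set)" by (rule bij_prod_decode)
  have "(\<lambda>i. norm (?g (prod_decode i))) summable_on UNIV"
    using summable_on_reindex_bij_betw[OF bij, of "\<lambda>z. norm (?g z)"] G by simp
  from summable_on_imp_summable[OF this] show "summable (\<lambda>i. \<bar>case_prod f (prod_decode i)\<bar>)"
    by simp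
  have Gs: "?g summable_on UNIV \<times> UNIV" by (rule Infinite_Sum.abs_summable_summable[OF G])
  have in3: "infsum (\<lambda>k. f j k) UNIV = (\<Sum>k. f j k)" for j
    using norm_summable_imp_has_sum[of "f j"] summable_sums[OF summable_rabs_cancel[OF a[of j]]] a[of j]
    by (intro infsumI) simp
  have le: "\<bar>\<Sum>k. f j k\<bar> \<le> (\<Sum>k. \<bar>f j k\<bar>)" for j by (rule summable_rabs[OF a])
  have outer: "summable (\<lambda>j. \<bar>\<Sum>k. f j k\<bar>)"
    by (rule summable_comparison_test'[OF b, of 0]) (use le in simp)
  have in4: "infsum (\<lambda>j. \<Sum>k. f j k) UNIV = (\<Sum>j. \<Sum>k. f j k)"
    using norm_summable_imp_has_sum[of "\<lambda>j. \<Sum>k. f j k"] outer summable_sums[OF summable_rabs_cancel[OF outer]]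
    by (intro infsumI) simp
  have "infsum ?g (UNIV \<times> UNIV) = (\<Sum>j. \<Sum>k. f j k)"
    using infsum_Sigma_banach[OF Gs] by (simp add: in3 in4)
  then have "(?g has_sum (\<Sum>j. \<Sum>k. f j k)) UNIV" using has_sum_infsum[OF Gs] by simp
  then have "((\<lambda>i. ?g (prod_decode i)) has_sum (\<Sum>j. \<Sum>k. f j k)) UNIV"
    using has_sum_reindex_bij_betw[OF bij, of ?g] by simp
  then show "(\<lambda>i. case_prod f (prod_decode i)) sums (\<Sum>j. \<Sum>k. f j k)" by (rule has_sum_imp_sums)
qed

subsection \<open>Decompositions inside a compact set\<close>

lemma interp_mono_bound:
  assumes "0 < \<alpha>" "\<alpha> \<le> 1" "0 \<le> normal_norm m T" "normal_norm m T \<le> a" "0 \<le> normal_flat_norm m T" "normal_flat_norm m T \<le> b"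
  shows "interp \<alpha> m T \<le> a powr (1 - \<alpha>) * b powr \<alpha>"
  unfolding interp_def using assms by (intro mult_mono powr_mono2) auto

lemma interp_nonneg: "interp \<alpha> m T \<ge> 0"
  by (simp add: interp_def)

text \<open>Write F as F^(1-\<alpha>) F^\<alpha> and use F \<le> N in the first factor.\<close>

lemma flat_le_interp:
  assumes T: "T \<in> normal_currents m" and \<alpha>: "0 < \<alpha>" "\<alpha> \<le> 1"
  shows "normal_flat_norm m T \<le> interp \<alpha> m T"
proof -
  let ?f = "normal_flat_norm m T"
  have f: "0 \<le> ?f" "?f \<le> normal_norm m T"
    using flat_norm_nonneg[OF normal_flat_bounded(1)[OF T]] normal_flat_bounded(2)[OF T] by auto
  have "?f = ?f powr (1 - \<alpha>) * ?f powr \<alpha>"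
    using f(1) by (cases "?f = 0") (simp_all add: powr_add[symmetric])
  also have "\<dots> \<le> interp \<alpha> m T"
    unfolding interp_def using f \<alpha> by (intro mult_right_mono powr_mono2) auto
  finally show ?thesis .
qed

lemma normal_in_iff: "T \<in> normal_currents_in m K \<longleftrightarrow> T \<in> normal_currents m \<and> spt m T \<subseteq> K"
  by (simp add: normal_currents_in_def)

lemma interp_scale_le:
  assumes T: "T \<in> normal_currents m" and \<alpha>: "0 < \<alpha>" "\<alpha> \<le> 1"
  shows "interp \<alpha> m (c *\<^sub>R T) \<le> \<bar>c\<bar> * interp \<alpha> m T"
proof -
  have n: "0 \<le> normal_norm m T" by (rule normal_norm_nonneg[OF T])
  have f: "0 \<le> normal_flat_norm m T" by (rule flat_norm_nonneg[OF normal_flat_bounded(1)[OF T]])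
  have "interp \<alpha> m (c *\<^sub>R T) \<le> (\<bar>c\<bar> * normal_norm m T) powr (1 - \<alpha>) * (\<bar>c\<bar> * normal_flat_norm m T) powr \<alpha>"
    by (rule interp_mono_bound[OF \<alpha> normal_norm_nonneg[OF normal_scale(1)[OF T]] normal_scale(2)[OF T]
        flat_norm_nonneg[OF flat_bounded_scale(1)[OF normal_flat_bounded(1)[OF T]]]
        flat_bounded_scale(2)[OF normal_flat_bounded(1)[OF T]]])
  also have "\<dots> = (\<bar>c\<bar> powr (1 - \<alpha>) * \<bar>c\<bar> powr \<alpha>) * interp \<alpha> m T"
    using n f by (simp add: interp_def powr_mult)
  also have "\<bar>c\<bar> powr (1 - \<alpha>) * \<bar>c\<bar> powr \<alpha> = \<bar>c\<bar>"
    by (cases "c = 0") (simp_all add: powr_add[symmetric])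
  finally show ?thesis .
qed

lemma interp_zero: "interp \<alpha> m 0 = 0"
proof -
  have "normal_flat_norm m (0 :: 'a current) = 0"
    using flat_bounded_zero[where 'a = 'a] flat_norm_nonneg by (metis order_antisym)
  then show "interp \<alpha> m (0 :: 'a::euclidean_space current) = 0" by (simp add: interp_def)
qed

text \<open>Weak convergence is enough here: summability of the cost makes the series converge in the
  flat norm.\<close>

definition kseries :: "real \<Rightarrow> nat \<Rightarrow> 'a::euclidean_space set \<Rightarrow> (nat \<Rightarrow> 'a current) \<Rightarrow> 'a current \<Rightarrow> bool" where
  "kseries \<alpha> m K S T \<longleftrightarrow> (\<forall>k. S k \<in> normal_currents_in m K) \<and> summable (\<lambda>k. interp \<alpha> m (S k)) \<and>
     (\<forall>\<omega>\<in>smooth_forms m. (\<lambda>k. S k \<omega>) sums T \<omega>) \<and> (\<forall>\<omega>. \<omega> \<notin> smooth_forms m \<longrightarrow> T \<omega> = 0)"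

lemma kseriesD:
  assumes "kseries \<alpha> m K S T"
  shows "S k \<in> normal_currents_in m K" "S k \<in> normal_currents m" "spt m (S k) \<subseteq> K" "summable (\<lambda>k. interp \<alpha> m (S k))"
    "\<omega> \<in> smooth_forms m \<Longrightarrow> (\<lambda>k. S k \<omega>) sums T \<omega>" "\<omega> \<notin> smooth_forms m \<Longrightarrow> T \<omega> = 0"
  using assms by (auto simp: kseries_def normal_in_iff)

text \<open>Makes evaluation at a fixed form bounded by the cost, with a constant depending on K and
  \<omega> only; summability of costs thereby implies weak convergence.\<close>

lemma normal_apply_bound:
  fixes K :: "'a::euclidean_space set"
  assumes K: "compact K" and \<alpha>: "0 < \<alpha>" "\<alpha> \<le> 1" and \<omega>: "\<omega> \<in> smooth_forms m"
  shows "\<exists>c\<ge>0. \<forall>S\<in>normal_currents_in m K. \<bar>S \<omega>\<bar> \<le> c * interp \<alpha> m S"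
proof -
  obtain R where R: "K \<subseteq> ball 0 R" using compact_subset_ball[OF K] by blast
  obtain \<eta> c where \<eta>: "\<eta> \<in> smooth_forms m" "c > 0" "form_le c \<eta>" "form_le c (ext_deriv \<eta>)"
    "\<And>x. norm x < R \<Longrightarrow> \<eta> x = \<omega> x"
    using bounded_replacement[OF \<omega>, of R] by blast
  have "\<bar>S \<omega>\<bar> \<le> c * interp \<alpha> m S" if "S \<in> normal_currents_in m K" for S
  proof -
    have S: "S \<in> normal_currents m" "spt m S \<subseteq> K" using that by (auto simp: normal_in_iff)
    have "S \<omega> = S \<eta>"
      by (rule currents_local_eq[OF normal_currentsD[OF S(1)] \<omega> \<eta>(1), of "ball 0 R"]) (use S(2) R \<eta>(5) in auto)
    then have "\<bar>S \<omega>\<bar> \<le> normal_flat_norm m S * c"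
      using flat_norm_bound[OF normal_flat_bounded(1)[OF S(1)] \<eta>(1,3,4,2)] by simp
    also have "\<dots> \<le> interp \<alpha> m S * c"
      by (rule mult_right_mono[OF flat_le_interp[OF S(1) \<alpha>]]) (use \<eta>(2) in simp)
    finally show ?thesis by (simp add: mult.commute)
  qed
  then show ?thesis using \<eta>(2) by (intro exI[of _ c]) auto
qed

lemma kseries_fractional:
  assumes K: "compact K" and \<alpha>: "0 < \<alpha>" "\<alpha> \<le> 1" and S: "kseries \<alpha> m K S T"
  shows "T \<in> fractional_currents_in \<alpha> m K" "fractional_norm \<alpha> m T \<le> (\<Sum>k. interp \<alpha> m (S k))"
proof -
  note D = kseriesD[OF S]
  have F: "summable (\<lambda>k. normal_flat_norm m (S k))"
    by (rule summable_comparison_test'[OF D(4), of 0])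
      (use flat_le_interp[OF D(2) \<alpha>] flat_norm_nonneg[OF normal_flat_bounded(1)[OF D(2)]] in simp)
  note ns = normal_series[OF D(2,3) K F D(5,6)]
  have fd: "fractional_decomposition \<alpha> m T S"
    unfolding fractional_decomposition_def using D(2,3,4) K ns(3) by blast
  then show "T \<in> fractional_currents_in \<alpha> m K"
    using ns(1,2) by (auto simp: fractional_currents_in_def fractional_currents_def)
  show "fractional_norm \<alpha> m T \<le> (\<Sum>k. interp \<alpha> m (S k))"
    unfolding fractional_norm_def
  proof (rule cInf_lower)
    show "bdd_below {\<Sum>k. interp \<alpha> m (S k) | S. fractional_decomposition \<alpha> m T S}"
      by (rule bdd_belowI[of _ 0]) (auto simp: fractional_decomposition_def interp_nonneg intro: suminf_nonneg)
  qed (use fd in blast)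
qed

lemma fractional_norm_nonneg:
  assumes "T \<in> fractional_currents_in \<alpha> m K" shows "fractional_norm \<alpha> m T \<ge> 0"
  unfolding fractional_norm_def
  by (rule cInf_greatest)
    (use assms in \<open>auto simp: fractional_currents_in_def fractional_currents_def fractional_decomposition_def
      interp_nonneg intro: suminf_nonneg\<close>)

text \<open>The engine for addition, completeness and the telescoping series. The cost of the
  flattened series is exactly the sum of the costs of its rows.\<close>

lemma kseries_combine:
  fixes U :: "nat \<Rightarrow> nat \<Rightarrow> 'a::euclidean_space current"
  assumes K: "compact K" and \<alpha>: "0 < \<alpha>" "\<alpha> \<le> 1"
    and U: "\<And>j. kseries \<alpha> m K (U j) (V j)" "summable (\<lambda>j. \<Sum>k. interp \<alpha> m (U j k))"
    and T: "\<And>\<omega>. \<omega> \<in> smooth_forms m \<Longrightarrow> (\<lambda>j. V j \<omega>) sums T \<omega>" "\<And>\<omega>. \<omega> \<notin> smooth_forms m \<Longrightarrow> T \<omega> = 0"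
  shows "kseries \<alpha> m K (\<lambda>i. case_prod U (prod_decode i)) T"
    "(\<Sum>i. interp \<alpha> m (case_prod U (prod_decode i))) = (\<Sum>j. \<Sum>k. interp \<alpha> m (U j k))"
proof -
  let ?S = "\<lambda>i. case_prod U (prod_decode i)"
  have I: "interp \<alpha> m (?S i) = case_prod (\<lambda>j k. interp \<alpha> m (U j k)) (prod_decode i)" for i
    by (simp add: split_beta)
  have a: "summable (\<lambda>k. \<bar>interp \<alpha> m (U j k)\<bar>)" for j using kseriesD(4)[OF U(1)[of j]] by (simp add: interp_nonneg)
  have b: "summable (\<lambda>j. \<Sum>k. \<bar>interp \<alpha> m (U j k)\<bar>)" using U(2) by (simp add: interp_nonneg)
  have cost: "(\<lambda>i. interp \<alpha> m (?S i)) sums (\<Sum>j. \<Sum>k. interp \<alpha> m (U j k))"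
    unfolding I by (rule sums_prod_decode(2)[OF a b])
  then show "(\<Sum>i. interp \<alpha> m (?S i)) = (\<Sum>j. \<Sum>k. interp \<alpha> m (U j k))" by (rule sums_unique[symmetric])
  have mem: "?S i \<in> normal_currents_in m K" for i using kseriesD(1)[OF U(1)] by (simp add: split_beta)
  have "(\<lambda>i. ?S i \<omega>) sums T \<omega>" if \<omega>: "\<omega> \<in> smooth_forms m" for \<omega>
  proof -
    obtain c where c: "c \<ge> 0" "\<And>S. S \<in> normal_currents_in m K \<Longrightarrow> \<bar>S \<omega>\<bar> \<le> c * interp \<alpha> m S"
      using normal_apply_bound[OF K \<alpha> \<omega>] by blast
    have le: "\<bar>U j k \<omega>\<bar> \<le> c * interp \<alpha> m (U j k)" for j k by (rule c(2)[OF kseriesD(1)[OF U(1)]])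
    have a': "summable (\<lambda>k. \<bar>U j k \<omega>\<bar>)" for j
      by (rule summable_comparison_test'[OF summable_mult[OF kseriesD(4)[OF U(1)[of j]], of c], of 0]) (use le in simp)
    have b': "summable (\<lambda>j. \<Sum>k. \<bar>U j k \<omega>\<bar>)"
    proof (rule summable_comparison_test'[OF summable_mult[OF U(2), of c], of 0])
      fix j
      have "(\<Sum>k. \<bar>U j k \<omega>\<bar>) \<le> (\<Sum>k. c * interp \<alpha> m (U j k))"
        by (rule suminf_le[OF le a' summable_mult[OF kseriesD(4)[OF U(1)]]])
      also have "\<dots> = c * (\<Sum>k. interp \<alpha> m (U j k))" by (rule suminf_mult[OF kseriesD(4)[OF U(1)]])
      finally show "norm (\<Sum>k. \<bar>U j k \<omega>\<bar>) \<le> c * (\<Sum>k. interp \<alpha> m (U j k))"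
        using suminf_nonneg[OF a'[of j]] by simp
    qed
    have "(\<Sum>k. U j k \<omega>) = V j \<omega>" for j using kseriesD(5)[OF U(1) \<omega>] sums_unique by metis
    then have "(\<Sum>j. \<Sum>k. U j k \<omega>) = T \<omega>" using sums_unique[OF T(1)[OF \<omega>]] by simp
    then show ?thesis using sums_prod_decode(2)[OF a' b'] by (simp add: split_beta)
  qed
  then show "kseries \<alpha> m K ?S T"
    unfolding kseries_def using mem cost sums_summable T(2) by blast
qed

lemma kseries_scale:
  assumes K: "compact K" and \<alpha>: "0 < \<alpha>" "\<alpha> \<le> 1" and S: "kseries \<alpha> m K S T"
  shows "kseries \<alpha> m K (\<lambda>k. c *\<^sub>R S k) (c *\<^sub>R T)" "(\<Sum>k. interp \<alpha> m (c *\<^sub>R S k)) \<le> \<bar>c\<bar> * (\<Sum>k. interp \<alpha> m (S k))"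
proof -
  note D = kseriesD[OF S]
  have le: "interp \<alpha> m (c *\<^sub>R S k) \<le> \<bar>c\<bar> * interp \<alpha> m (S k)" for k by (rule interp_scale_le[OF D(2) \<alpha>])
  have sm: "summable (\<lambda>k. interp \<alpha> m (c *\<^sub>R S k))"
    by (rule summable_comparison_test'[OF summable_mult[OF D(4), of "\<bar>c\<bar>"], of 0]) (use le in \<open>simp add: interp_nonneg\<close>)
  have mem: "c *\<^sub>R S k \<in> normal_currents_in m K" for k
    using normal_scale(1)[OF D(2)] spt_scale_subset[OF normal_currentsD[OF D(2)] D(3) compact_imp_closed[OF K]]
    by (simp add: normal_in_iff)
  show "kseries \<alpha> m K (\<lambda>k. c *\<^sub>R S k) (c *\<^sub>R T)"
    unfolding kseries_def using mem sm sums_mult[OF D(5), of _ c] D(6) by (auto simp: scaleR_fun_def)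
  have "(\<Sum>k. interp \<alpha> m (c *\<^sub>R S k)) \<le> (\<Sum>k. \<bar>c\<bar> * interp \<alpha> m (S k))"
    by (rule suminf_le[OF le sm summable_mult[OF D(4)]])
  then show "(\<Sum>k. interp \<alpha> m (c *\<^sub>R S k)) \<le> \<bar>c\<bar> * (\<Sum>k. interp \<alpha> m (S k))"
    by (simp add: suminf_mult[OF D(4)])
qed

lemma normal_in_zero: "closed K \<Longrightarrow> 0 \<in> normal_currents_in m K"
  using normal_zero(1) spt_subsetI[of K m 0] by (simp add: normal_in_iff)

lemma kseries_zero:
  assumes "closed K" shows "kseries \<alpha> m K (\<lambda>k. 0) 0"
  unfolding kseries_def using normal_in_zero[OF assms] by (simp add: interp_zero)

lemma kseries_single:
  assumes K: "closed K" and T: "T \<in> normal_currents_in m K"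
  shows "kseries \<alpha> m K (\<lambda>k. if k = 0 then T else 0) T"
    "(\<Sum>k. interp \<alpha> m (if k = 0 then T else 0)) = interp \<alpha> m T"
proof -
  have 1: "(\<lambda>k::nat. interp \<alpha> m (if k = 0 then T else 0)) = (\<lambda>k. if k = 0 then interp \<alpha> m T else 0)"
    by (simp add: interp_zero fun_eq_iff)
  have 2: "(\<lambda>k::nat. (if k = 0 then T else 0) \<omega>) = (\<lambda>k. if k = 0 then T \<omega> else 0)" for \<omega>
    by (simp add: fun_eq_iff)
  show "kseries \<alpha> m K (\<lambda>k. if k = 0 then T else 0) T"
    unfolding kseries_def 1 2
    using T normal_in_zero[OF K] sums_summable[OF sums_single[of 0 "\<lambda>_. interp \<alpha> m T"]] sums_single[of 0 "\<lambda>_. T \<omega>" for \<omega>]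
      currents_outside[of T m]
    by (auto simp: normal_in_iff normal_currentsD)
  show "(\<Sum>k. interp \<alpha> m (if k = 0 then T else 0)) = interp \<alpha> m T"
    unfolding 1 using sums_unique[OF sums_single[of 0 "\<lambda>_. interp \<alpha> m T"]] by simp
qed

text \<open>A sum of two decompositions is a double series with only two nonzero rows.\<close>

lemma kseries_add:
  assumes K: "compact K" and \<alpha>: "0 < \<alpha>" "\<alpha> \<le> 1" and S: "kseries \<alpha> m K S T" and S': "kseries \<alpha> m K S' T'"
  defines "U \<equiv> \<lambda>j::nat. if j = 0 then S else if j = 1 then S' else (\<lambda>k. 0)"
  shows "kseries \<alpha> m K (\<lambda>i. case_prod U (prod_decode i)) (T + T')"
    "(\<Sum>i. interp \<alpha> m (case_prod U (prod_decode i))) = (\<Sum>k. interp \<alpha> m (S k)) + (\<Sum>k. interp \<alpha> m (S' k))"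
proof -
  define V where "V = (\<lambda>j::nat. if j = 0 then T else if j = 1 then T' else 0)"
  have U: "kseries \<alpha> m K (U j) (V j)" for j
    using S S' kseries_zero[OF compact_imp_closed[OF K]] by (simp add: U_def V_def)
  have "(\<lambda>j. \<Sum>k. interp \<alpha> m (U j k)) sums (\<Sum>j\<in>{0,1}. \<Sum>k. interp \<alpha> m (U j k))"
    by (rule sums_finite) (auto simp: U_def interp_zero)
  then have c: "(\<lambda>j. \<Sum>k. interp \<alpha> m (U j k)) sums ((\<Sum>k. interp \<alpha> m (S k)) + (\<Sum>k. interp \<alpha> m (S' k)))"
    by (simp add: U_def)
  have "(\<lambda>j. V j \<omega>) sums (T + T') \<omega>" for \<omega>
  proof -
    have "(\<lambda>j. V j \<omega>) sums (\<Sum>j\<in>{0,1}. V j \<omega>)" by (rule sums_finite) (auto simp: V_def)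
    then show ?thesis by (simp add: V_def)
  qed
  note comb = kseries_combine[OF K \<alpha> U sums_summable[OF c] this]
  show "kseries \<alpha> m K (\<lambda>i. case_prod U (prod_decode i)) (T + T')"
    by (rule comb(1)) (simp add: kseriesD(6)[OF S] kseriesD(6)[OF S'])
  show "(\<Sum>i. interp \<alpha> m (case_prod U (prod_decode i))) = (\<Sum>k. interp \<alpha> m (S k)) + (\<Sum>k. interp \<alpha> m (S' k))"
    using comb(2) sums_unique[OF c] kseriesD(6)[OF S] kseriesD(6)[OF S'] by simp
qed

text \<open>Two competing bounds: the first is summable in k but does not become small as p
  approaches q; the second becomes small but carries N instead of the cost.\<close>

lemma interp_push_diff:
  fixes K :: "'a::euclidean_space set"
  assumes K: "compact K" and \<alpha>: "0 < \<alpha>" "\<alpha> \<le> 1" and S: "S \<in> normal_currents m"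
    and p: "contraction p" "\<And>x. p x \<in> K" and q: "contraction q" "\<And>x. q x \<in> K"
  shows "push m p S - push m q S \<in> normal_currents_in m K"
    "interp \<alpha> m (push m p S - push m q S) \<le> 2 * interp \<alpha> m S"
    "s > 0 \<Longrightarrow> (\<And>x. norm (p x - q x) \<le> s) \<Longrightarrow> interp \<alpha> m (push m p S - push m q S) \<le> 2 * normal_norm m S * s powr \<alpha>"
proof -
  let ?D = "push m p S - push m q S"
  note P = push_normal[OF S p(1) K p(2)] and Q = push_normal[OF S q(1) K q(2)]
  have n0: "0 \<le> normal_norm m S" by (rule normal_norm_nonneg[OF S])
  have f0: "0 \<le> normal_flat_norm m S" by (rule flat_norm_nonneg[OF normal_flat_bounded(1)[OF S]])
  have D: "?D \<in> normal_currents m" by (rule normal_diff(1)[OF P(1) Q(1)])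
  have "spt m ?D \<subseteq> K"
    by (rule spt_diff_subset[OF normal_currentsD[OF P(1)] normal_currentsD[OF Q(1)] P(4) Q(4) compact_imp_closed[OF K]])
  then show "?D \<in> normal_currents_in m K" using D by (simp add: normal_in_iff)
  have nD: "0 \<le> normal_norm m ?D" by (rule normal_norm_nonneg[OF D])
  have fD: "0 \<le> normal_flat_norm m ?D" by (rule flat_norm_nonneg[OF normal_flat_bounded(1)[OF D]])
  have n: "normal_norm m ?D \<le> 2 * normal_norm m S"
    using normal_diff(2)[OF P(1) Q(1)] P(2) Q(2) by linarith
  have f: "normal_flat_norm m ?D \<le> 2 * normal_flat_norm m S"
    using flat_bounded_diff(2)[OF normal_flat_bounded(1)[OF P(1)] normal_flat_bounded(1)[OF Q(1)]] P(3) Q(3) by linarith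
  have two: "(2::real) powr (1 - \<alpha>) * 2 powr \<alpha> = 2" by (simp add: powr_add[symmetric])
  have "interp \<alpha> m ?D \<le> (2 * normal_norm m S) powr (1 - \<alpha>) * (2 * normal_flat_norm m S) powr \<alpha>"
    by (rule interp_mono_bound[OF \<alpha> nD n fD f])
  also have "\<dots> = (2 powr (1 - \<alpha>) * 2 powr \<alpha>) * interp \<alpha> m S"
    using n0 f0 by (simp add: interp_def powr_mult)
  finally show "interp \<alpha> m ?D \<le> 2 * interp \<alpha> m S" unfolding two .
  assume s: "s > 0" "\<And>x. norm (p x - q x) \<le> s"
  have "interp \<alpha> m ?D \<le> (2 * normal_norm m S) powr (1 - \<alpha>) * (2 * s * normal_norm m S) powr \<alpha>"
    by (rule interp_mono_bound[OF \<alpha> nD n fD push_diff[OF S q(1) p(1) s]])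
  also have "\<dots> = (2 powr (1 - \<alpha>) * 2 powr \<alpha>) * (normal_norm m S powr (1 - \<alpha>) * normal_norm m S powr \<alpha>) * s powr \<alpha>"
    using n0 s(1) by (simp add: powr_mult)
  also have "normal_norm m S powr (1 - \<alpha>) * normal_norm m S powr \<alpha> = normal_norm m S"
    using n0 by (cases "normal_norm m S = 0") (simp_all add: powr_add[symmetric])
  finally show "interp \<alpha> m ?D \<le> 2 * normal_norm m S * s powr \<alpha>" unfolding two .
qed

text \<open>The sum of all N may diverge, so closeness of the maps is exploited for the first M
  terms only; the tail costs at most twice the tail of the original cost, for any pair of
  maps.\<close>

lemma push_diff_cost:
  fixes K :: "'a::euclidean_space set"
  assumes K: "compact K" and \<alpha>: "0 < \<alpha>" "\<alpha> \<le> 1"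
    and S: "\<And>k. S k \<in> normal_currents m" "summable (\<lambda>k. interp \<alpha> m (S k))" and \<eta>: "\<eta> > 0"
  shows "\<exists>s>0. \<forall>p q. contraction p \<and> contraction q \<and> (\<forall>x. p x \<in> K) \<and> (\<forall>x. q x \<in> K) \<and> (\<forall>x. norm (p x - q x) \<le> s) \<longrightarrow>
    summable (\<lambda>k. interp \<alpha> m (push m p (S k) - push m q (S k))) \<and>
    (\<Sum>k. interp \<alpha> m (push m p (S k) - push m q (S k))) \<le> \<eta>"
proof -
  let ?I = "\<lambda>k. interp \<alpha> m (S k)"
  have "(\<lambda>n. \<Sum>k. ?I (k + n)) \<longlonglongrightarrow> 0" by (rule suminf_exist_split2[OF S(2)])
  from LIMSEQ_D[OF this, of "\<eta> / 4"] \<eta> obtain M where M: "norm ((\<Sum>k. ?I (k + M)) - 0) < \<eta> / 4" by auto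
  define N where "N = (\<Sum>k<M. normal_norm m (S k))"
  have N: "N \<ge> 0" unfolding N_def by (intro sum_nonneg normal_norm_nonneg S(1))
  \<comment> \<open>Makes 2 N s^\<alpha> at most \<eta>/2, which leaves the other half for the tail;
    N + 1 avoids a zero denominator.\<close>
  define s where "s = (\<eta> / (4 * (N + 1))) powr (1 / \<alpha>)"
  have s: "s > 0" unfolding s_def using \<eta> N by simp
  have sa: "s powr \<alpha> = \<eta> / (4 * (N + 1))" unfolding s_def using \<alpha> \<eta> N by (simp add: powr_powr)
  have "summable (\<lambda>k. interp \<alpha> m (push m p (S k) - push m q (S k))) \<and>
    (\<Sum>k. interp \<alpha> m (push m p (S k) - push m q (S k))) \<le> \<eta>"
    if pq: "contraction p" "contraction q" "\<And>x. p x \<in> K" "\<And>x. q x \<in> K" "\<And>x. norm (p x - q x) \<le> s" for p q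
  proof -
    let ?J = "\<lambda>k. interp \<alpha> m (push m p (S k) - push m q (S k))"
    note b = interp_push_diff[OF K \<alpha> S(1) pq(1) pq(3) pq(2) pq(4)]
    have sm: "summable ?J"
      by (rule summable_comparison_test'[OF summable_mult[OF S(2), of 2], of 0]) (use b(2) in \<open>simp add: interp_nonneg\<close>)
    have smM: "summable (\<lambda>k. ?J (k + M))" "summable (\<lambda>k. ?I (k + M))"
      by (rule summable_ignore_initial_segment[OF sm], rule summable_ignore_initial_segment[OF S(2)])
    have h1: "suminf ?J = (\<Sum>k. ?J (k + M)) + (\<Sum>k<M. ?J k)"
      by (rule suminf_split_initial_segment[OF sm])
    have h2: "(\<Sum>k. ?J (k + M)) \<le> (\<Sum>k. 2 * ?I (k + M))"
      by (rule suminf_le[OF b(2) smM(1) summable_mult[OF smM(2)]])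
    have h3: "(\<Sum>k. 2 * ?I (k + M)) = 2 * (\<Sum>k. ?I (k + M))" by (rule suminf_mult[OF smM(2)])
    have h4: "(\<Sum>k<M. ?J k) \<le> (\<Sum>k<M. 2 * normal_norm m (S k) * s powr \<alpha>)"
      by (rule sum_mono, rule b(3)[OF s pq(5)])
    have h5: "(\<Sum>k<M. 2 * normal_norm m (S k) * s powr \<alpha>) = 2 * N * s powr \<alpha>"
      by (simp add: N_def sum_distrib_left sum_distrib_right)
    have h6: "2 * N * s powr \<alpha> \<le> \<eta> / 2" unfolding sa using N \<eta> by (simp add: field_simps)
    have "(\<Sum>k. ?I (k + M)) < \<eta> / 4" using M by simp
    then have "suminf ?J \<le> \<eta>" using h1 h2 h3 h4 h5 h6 by linarith
    then show ?thesis using sm by (rule conjI[rotated])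
  qed
  then show ?thesis using s by blast
qed

lemma fractional_decomposition_in:
  fixes K :: "'a::euclidean_space set"
  assumes K: "compact K" "convex K" and \<alpha>: "0 < \<alpha>" "\<alpha> \<le> 1"
    and T: "T \<in> fractional_currents_in \<alpha> m K" and \<epsilon>: "\<epsilon> > 0"
  shows "\<exists>S. kseries \<alpha> m K S T \<and> (\<Sum>k. interp \<alpha> m (S k)) \<le> fractional_norm \<alpha> m T + \<epsilon>"
proof (cases "K = {}")
  case True
  \<comment> \<open>Without points in K there is no projection, but a current with empty support is
    zero.\<close>
  have T0: "T \<in> currents m" "spt m T \<subseteq> {}"
    using T True by (auto simp: fractional_currents_in_def fractional_currents_def flat_currents_def)
  have "T \<omega> = 0" for \<omega>
    using currents_local[OF T0(1), of \<omega> "{}"] T0(2) currents_outside[OF T0(1)] by (cases "\<omega> \<in> smooth_forms m") auto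
  then have "T = 0" by (simp add: fun_eq_iff)
  then show ?thesis
    using kseries_zero[of K \<alpha> m] K fractional_norm_nonneg[OF T] \<epsilon>
    by (intro exI[of _ "\<lambda>k. 0"]) (simp add: interp_zero compact_imp_closed)
next
  case False
  have Tf: "T \<in> flat_currents m" "spt m T \<subseteq> K" and ex: "\<exists>S. fractional_decomposition \<alpha> m T S"
    using T by (auto simp: fractional_currents_in_def fractional_currents_def)
  \<comment> \<open>One half of \<epsilon> goes into the choice of a nearly optimal decomposition,
    the other into the telescoping differences.\<close>
  have "\<exists>S. fractional_decomposition \<alpha> m T S \<and> (\<Sum>k. interp \<alpha> m (S k)) < fractional_norm \<alpha> m T + \<epsilon> / 2"
    using cInf_lessD[of "{\<Sum>k. interp \<alpha> m (S k) | S. fractional_decomposition \<alpha> m T S}" "fractional_norm \<alpha> m T + \<epsilon> / 2"]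
      ex \<epsilon> unfolding fractional_norm_def by auto
  then obtain S where S: "fractional_decomposition \<alpha> m T S" "(\<Sum>k. interp \<alpha> m (S k)) < fractional_norm \<alpha> m T + \<epsilon> / 2" by blast
  have Sn: "S k \<in> normal_currents m" for k using S(1) by (simp add: fractional_decomposition_def)
  have Ss: "summable (\<lambda>k. interp \<alpha> m (S k))" using S(1) by (simp add: fractional_decomposition_def)
  note sums = decomposition_sums[OF Tf(1) S(1)]
  define cost where "cost p q = (\<Sum>k. interp \<alpha> m (push m p (S k) - push m q (S k)))" for p q
  \<comment> \<open>The tolerance \<open>s i\<close> keeps the cost of the i-th difference below a
    term of a geometric series with sum \<epsilon>/2.\<close>
  have "\<exists>s. \<forall>i::nat. s i > 0 \<and> (\<forall>p q. contraction p \<and> contraction q \<and> (\<forall>x. p x \<in> K) \<and> (\<forall>x. q x \<in> K) \<and>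
      (\<forall>x. norm (p x - q x) \<le> s i) \<longrightarrow>
    summable (\<lambda>k. interp \<alpha> m (push m p (S k) - push m q (S k))) \<and> cost p q \<le> \<epsilon> / 2 * (1 / 2) ^ Suc i)"
    unfolding cost_def by (rule choice, intro allI, rule push_diff_cost[OF K(1) \<alpha> Sn Ss]) (use \<epsilon> in simp)
  then obtain s where s: "\<forall>i::nat. s i > 0 \<and> (\<forall>p q. contraction p \<and> contraction q \<and> (\<forall>x. p x \<in> K) \<and> (\<forall>x. q x \<in> K) \<and>
      (\<forall>x. norm (p x - q x) \<le> s i) \<longrightarrow>
    summable (\<lambda>k. interp \<alpha> m (push m p (S k) - push m q (S k))) \<and> cost p q \<le> \<epsilon> / 2 * (1 / 2) ^ Suc i)"
    by (rule exE)
  have s0: "s i > 0" for i by (rule conjunct1[OF spec[OF s]])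
  \<comment> \<open>Below 1/(i+1) so that the maps converge to the projection, and below half of
    every earlier tolerance so that two consecutive maps differ by at most
    \<open>s i\<close>.\<close>
  define d where "d i = Min (insert (inverse (real (Suc i))) ((\<lambda>l. s l / 2) ` {..i}))" for i
  have d: "d i > 0" "d i \<le> inverse (real (Suc i))" for i
    unfolding d_def using s0 by (auto intro: Min_le)
  have ds: "d i \<le> s l / 2" if "l \<le> i" for i l unfolding d_def using that by (intro Min_le) auto
  have dlim: "d \<longlonglongrightarrow> 0"
    by (rule Lim_null_comparison[OF _ LIMSEQ_inverse_real_of_nat]) (use d in \<open>auto simp: less_imp_le\<close>)
  have "\<exists>p. \<forall>i. contraction (p i) \<and> (\<forall>x. p i x \<in> K) \<and> (\<forall>x. norm (p i x - closest_point K x) \<le> d i)"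
    by (rule choice) (use smooth_projection[OF K False] d(1) in blast)
  then obtain p where p: "\<And>i. contraction (p i)" "\<And>i x. p i x \<in> K" "\<And>i x. norm (p i x - closest_point K x) \<le> d i" by blast
  have pv: "vsmooth (p i)" for i using p(1) by (simp add: contraction_def)
  have pd: "norm (p (Suc i) x - p i x) \<le> s i" for i x
  proof -
    have "norm ((p (Suc i) x - closest_point K x) - (p i x - closest_point K x)) \<le> d (Suc i) + d i"
      by (rule order_trans[OF norm_triangle_ineq4 add_mono[OF p(3) p(3)]])
    then show ?thesis using ds[of i i] ds[of i "Suc i"] by simp
  qed
  have c: "summable (\<lambda>k. interp \<alpha> m (push m (p (Suc i)) (S k) - push m (p i) (S k))) \<and> cost (p (Suc i)) (p i) \<le> \<epsilon> / 2 * (1 / 2) ^ Suc i" for i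
    by (rule mp[OF spec[OF spec[OF conjunct2[OF spec[OF s]]]]]) (intro conjI allI p(1) p(2) pd)
  define U where "U j = (case j of 0 \<Rightarrow> \<lambda>k. push m (p 0) (S k) | Suc i \<Rightarrow> \<lambda>k. push m (p (Suc i)) (S k) - push m (p i) (S k))" for j
  define V where "V j = (case j of 0 \<Rightarrow> push m (p 0) T | Suc i \<Rightarrow> push m (p (Suc i)) T - push m (p i) T)" for j
  have ps: "(\<lambda>k. push m (p i) (S k) \<omega>) sums push m (p i) T \<omega>" if "\<omega> \<in> smooth_forms m" for i \<omega>
    using sums[OF pullback_smooth_forms[OF that pv]] that by (simp add: push_def)
  have "kseries \<alpha> m K (U j) (V j) \<and> (\<Sum>k. interp \<alpha> m (U j k)) \<le> (case j of 0 \<Rightarrow> \<Sum>k. interp \<alpha> m (S k) | Suc i \<Rightarrow> \<epsilon> / 2 * (1 / 2) ^ Suc i)" for j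
  proof (cases j)
    case 0
    note P = push_normal[OF Sn p(1) K(1) p(2)]
    \<comment> \<open>The leading row costs no more than the original decomposition. A constant
      above 1 here would spoil the isometry.\<close>
    have le: "interp \<alpha> m (push m (p 0) (S k)) \<le> interp \<alpha> m (S k)" for k
      using interp_mono_bound[OF \<alpha> normal_norm_nonneg[OF P(1)] P(2) flat_norm_nonneg[OF normal_flat_bounded(1)[OF P(1)]] P(3)]
      by (simp add: interp_def)
    have sm: "summable (\<lambda>k. interp \<alpha> m (push m (p 0) (S k)))"
      by (rule summable_comparison_test'[OF Ss, of 0]) (use le in \<open>simp add: interp_nonneg\<close>)
    have "kseries \<alpha> m K (\<lambda>k. push m (p 0) (S k)) (push m (p 0) T)"
      unfolding kseries_def using P(1,4) sm ps by (auto simp: normal_in_iff push_def)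
    then show ?thesis using suminf_le[OF le sm Ss] by (simp add: U_def V_def 0)
  next
    case (Suc i)
    have "kseries \<alpha> m K (\<lambda>k. push m (p (Suc i)) (S k) - push m (p i) (S k)) (push m (p (Suc i)) T - push m (p i) T)"
      unfolding kseries_def
    proof (intro conjI allI ballI impI)
      show "push m (p (Suc i)) (S k) - push m (p i) (S k) \<in> normal_currents_in m K" for k
        by (rule interp_push_diff(1)[OF K(1) \<alpha> Sn p(1,2) p(1,2)])
      show "summable (\<lambda>k. interp \<alpha> m (push m (p (Suc i)) (S k) - push m (p i) (S k)))" by (rule conjunct1[OF c])
      show "(\<lambda>k. (push m (p (Suc i)) (S k) - push m (p i) (S k)) \<omega>) sums (push m (p (Suc i)) T - push m (p i) T) \<omega>"
        if "\<omega> \<in> smooth_forms m" for \<omega>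
        using sums_diff[OF ps[OF that] ps[OF that]] by simp
    qed (simp add: push_def)
    then show ?thesis using c[of i] by (simp add: U_def V_def Suc cost_def)
  qed
  then have U: "\<And>j. kseries \<alpha> m K (U j) (V j)"
    and Uc: "\<And>j. (\<Sum>k. interp \<alpha> m (U j k)) \<le> (case j of 0 \<Rightarrow> \<Sum>k. interp \<alpha> m (S k) | Suc i \<Rightarrow> \<epsilon> / 2 * (1 / 2) ^ Suc i)"
    by blast+
  define C where "C j = (case j of 0 \<Rightarrow> \<Sum>k. interp \<alpha> m (S k) | Suc i \<Rightarrow> \<epsilon> / 2 * (1 / 2) ^ Suc i)" for j
  have "(\<lambda>i. \<epsilon> / 2 * (1 / 2) ^ Suc i) sums (\<epsilon> / 2 * 1)" by (intro sums_mult power_half_series)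
  then have "(\<lambda>i. C (Suc i)) sums (\<epsilon> / 2)" by (simp add: C_def)
  then have Cs: "C sums (\<epsilon> / 2 + C 0)" by (simp add: sums_Suc_iff)
  have Us: "summable (\<lambda>j. \<Sum>k. interp \<alpha> m (U j k))"
    by (rule summable_comparison_test'[OF sums_summable[OF Cs], of 0])
      (use Uc suminf_nonneg[OF kseriesD(4)[OF U]] in \<open>simp add: C_def interp_nonneg\<close>)
  have Vs: "(\<lambda>j. V j \<omega>) sums T \<omega>" if \<omega>: "\<omega> \<in> smooth_forms m" for \<omega>
  proof -
    have tele: "(\<Sum>j<Suc n. V j \<omega>) = T (pullback (p n) \<omega>)" for n
      by (induction n) (simp_all add: V_def push_def \<omega>)
    have "(\<lambda>n. T (pullback (p n) \<omega>)) \<longlonglongrightarrow> T \<omega>"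
      by (rule push_tendsto[OF K False Tf p d(1) dlim \<omega>])
    then show ?thesis unfolding sums_def tele[symmetric] by (rule LIMSEQ_imp_Suc)
  qed
  have out: "T \<omega> = 0" if "\<omega> \<notin> smooth_forms m" for \<omega>
    by (rule currents_outside[OF _ that]) (use Tf(1) in \<open>simp add: flat_currents_def\<close>)
  have comb1: "kseries \<alpha> m K (\<lambda>i. case_prod U (prod_decode i)) T"
    by (rule kseries_combine(1)[OF K(1) \<alpha> U Us Vs out])
  have comb2: "(\<Sum>i. interp \<alpha> m (case_prod U (prod_decode i))) = (\<Sum>j. \<Sum>k. interp \<alpha> m (U j k))"
    by (rule kseries_combine(2)[OF K(1) \<alpha> U Us Vs out])
  have "(\<Sum>j. \<Sum>k. interp \<alpha> m (U j k)) \<le> suminf C"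
    by (rule suminf_le[OF _ Us sums_summable[OF Cs]]) (use Uc in \<open>simp add: C_def\<close>)
  also have "\<dots> = \<epsilon> / 2 + (\<Sum>k. interp \<alpha> m (S k))" using sums_unique[OF Cs] by (simp add: C_def)
  finally have "(\<Sum>j. \<Sum>k. interp \<alpha> m (U j k)) \<le> fractional_norm \<alpha> m T + \<epsilon>" using S(2) by simp
  then show ?thesis unfolding comb2[symmetric] using comb1 by (intro exI conjI)
qed

subsection \<open>The Banach space of fractional currents\<close>

lemma sums_abs_le:
  fixes f g :: "nat \<Rightarrow> real"
  assumes "f sums s" "\<And>k. \<bar>f k\<bar> \<le> g k" "summable g"
  shows "summable (\<lambda>k. \<bar>f k\<bar>)" "\<bar>s\<bar> \<le> suminf g"
proof -
  show sm: "summable (\<lambda>k. \<bar>f k\<bar>)"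
    by (rule summable_comparison_test'[OF assms(3), of 0]) (simp add: assms(2))
  have "\<bar>s\<bar> = \<bar>suminf f\<bar>" using sums_unique[OF assms(1)] by simp
  also have "\<dots> \<le> (\<Sum>k. \<bar>f k\<bar>)" by (rule summable_rabs[OF sm])
  also have "\<dots> \<le> suminf g" by (rule suminf_le[OF assms(2) sm assms(3)])
  finally show "\<bar>s\<bar> \<le> suminf g" .
qed

lemma linear_on_zero:
  assumes "subspace V" "linear_on V f" shows "f 0 = 0"
proof -
  have "f (0 *\<^sub>R 0) = 0 *\<^sub>R f 0" using assms subspace_0 unfolding linear_on_def by blast
  then show ?thesis by simp
qed

lemma linear_on_sum:
  assumes V: "subspace V" "linear_on V f" and S: "\<And>i. i \<in> A \<Longrightarrow> S i \<in> V"
  shows "f (sum S A) = (\<Sum>i\<in>A. f (S i))"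
  using S
proof (induction A rule: infinite_finite_induct)
  case (insert x F)
  have "sum S F \<in> V" by (rule subspace_sum[OF V(1)]) (use insert.prems in simp)
  moreover have "S x \<in> V" using insert.prems by simp
  ultimately have "f (S x + sum S F) = f (S x) + f (sum S F)" using V(2) unfolding linear_on_def by blast
  then show ?case using insert by simp
qed (simp_all add: linear_on_zero[OF V])

lemma linear_on_diff:
  assumes V: "subspace V" "linear_on V f" and xy: "x \<in> V" "y \<in> V"
  shows "f (x - y) = f x - f y"
proof -
  have 1: "(-1) *\<^sub>R y \<in> V" by (rule subspace_scale[OF V(1) xy(2)])
  have "f (x + (-1) *\<^sub>R y) = f x + f ((-1) *\<^sub>R y)" using V(2) xy(1) 1 unfolding linear_on_def by blast
  moreover have "f ((-1) *\<^sub>R y) = (-1) *\<^sub>R f y" using V(2) xy(2) unfolding linear_on_def by blast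
  ultimately show ?thesis by simp
qed

lemma normal_in_subspace:
  assumes "closed K" shows "subspace (normal_currents_in m K)"
  unfolding subspace_def
proof (intro conjI ballI allI)
  show "0 \<in> normal_currents_in m K" by (rule normal_in_zero[OF assms])
  fix T c assume T: "T \<in> normal_currents_in m K"
  then have T': "T \<in> normal_currents m" "spt m T \<subseteq> K" by (simp_all add: normal_in_iff)
  show "c *\<^sub>R T \<in> normal_currents_in m K"
    unfolding normal_in_iff by (intro conjI normal_scale(1) spt_scale_subset normal_currentsD T' assms)
  fix S assume S: "S \<in> normal_currents_in m K"
  then have S': "S \<in> normal_currents m" "spt m S \<subseteq> K" by (simp_all add: normal_in_iff)
  show "T + S \<in> normal_currents_in m K"
    unfolding normal_in_iff by (intro conjI normal_add(1) spt_add_subset normal_currentsD T' S' assms)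
qed

lemma kseries_tail:
  assumes S: "kseries \<alpha> m K S T"
  shows "kseries \<alpha> m K (\<lambda>k. S (k + n)) (T - (\<Sum>k<n. S k))"
  unfolding kseries_def
proof (intro conjI allI ballI impI)
  show "S (k + n) \<in> normal_currents_in m K" for k by (rule kseriesD(1)[OF S])
  show "summable (\<lambda>k. interp \<alpha> m (S (k + n)))" by (rule summable_ignore_initial_segment[OF kseriesD(4)[OF S]])
  show "(\<lambda>k. S (k + n) \<omega>) sums (T - (\<Sum>k<n. S k)) \<omega>" if "\<omega> \<in> smooth_forms m" for \<omega>
    using sums_split_initial_segment[OF kseriesD(5)[OF S that], of n] by (simp add: sum_current_apply)
  show "(T - (\<Sum>k<n. S k)) \<omega> = 0" if "\<omega> \<notin> smooth_forms m" for \<omega>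
    using kseriesD(6)[OF S that] currents_outside[OF normal_currentsD[OF kseriesD(2)[OF S]] that]
    by (simp add: sum_current_apply)
qed

lemma kseries_apply_le:
  assumes S: "kseries \<alpha> m K S T" and c: "\<forall>R\<in>normal_currents_in m K. \<bar>R \<omega>\<bar> \<le> c * interp \<alpha> m R"
    and \<omega>: "\<omega> \<in> smooth_forms m"
  shows "\<bar>T \<omega>\<bar> \<le> c * (\<Sum>k. interp \<alpha> m (S k))"
proof -
  have b: "\<bar>S k \<omega>\<bar> \<le> c * interp \<alpha> m (S k)" for k by (rule bspec[OF c kseriesD(1)[OF S]])
  have "\<bar>T \<omega>\<bar> \<le> (\<Sum>k. c * interp \<alpha> m (S k))"
    by (rule sums_abs_le(2)[OF kseriesD(5)[OF S \<omega>] b summable_mult[OF kseriesD(4)[OF S]]])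
  then show ?thesis using suminf_mult[OF kseriesD(4)[OF S], of c] by simp
qed

lemma sums_remove_finite:
  fixes f :: "nat \<Rightarrow> real"
  assumes "f sums s" "finite A" shows "(\<lambda>k. if k \<in> A then 0 else f k) sums (s - sum f A)"
proof -
  have "(\<lambda>k. f k - (if k \<in> A then f k else 0)) sums (s - sum f A)"
    by (rule sums_diff[OF assms(1) sums_If_finite_set[OF assms(2)]])
  moreover have "(\<lambda>k. f k - (if k \<in> A then f k else 0)) = (\<lambda>k. if k \<in> A then 0 else f k)" by auto
  ultimately show ?thesis by simp
qed

text \<open>Ensures that the ratio N/F, which is 0 by convention for F = 0, still bounds N by a
  multiple of F.\<close>

lemma normal_norm_zero_of_flat:
  fixes \<alpha> :: real
  assumes K: "compact K" and \<alpha>: "0 < \<alpha>" "\<alpha> \<le> 1" and S: "S \<in> normal_currents_in m K" and 0: "normal_flat_norm m S = 0"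
  shows "normal_norm m S = 0"
proof -
  have I: "interp \<alpha> m S = 0" using 0 by (simp add: interp_def)
  have "S \<omega> = 0" for \<omega>
  proof (cases "\<omega> \<in> smooth_forms m")
    case True
    from normal_apply_bound[OF K \<alpha> True] S I show ?thesis by fastforce
  next
    case False
    show ?thesis by (rule currents_outside[OF normal_currentsD False]) (use S in \<open>simp add: normal_in_iff\<close>)
  qed
  then have "S = 0" by (simp add: fun_eq_iff)
  then show ?thesis by (simp add: normal_zero(2))
qed

text \<open>Splitting by the ratio n/f at the threshold l: below it n^\<alpha> is exchanged for (l
  f)^\<alpha>, above it f^(1-\<alpha>) for (n/l)^(1-\<alpha>). Each time one of the two quantities
  is controlled by the cost.\<close>

lemma interp_split_bounds:
  fixes n f l :: real
  assumes \<alpha>: "0 < \<alpha>" "\<alpha> \<le> 1" and nf: "0 \<le> n" "0 \<le> f" "0 < l"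
  shows "n \<le> l * f \<Longrightarrow> n \<le> l powr \<alpha> * (n powr (1 - \<alpha>) * f powr \<alpha>)"
    "l * f < n \<Longrightarrow> f \<le> l powr (\<alpha> - 1) * (n powr (1 - \<alpha>) * f powr \<alpha>)"
proof -
  have split: "x powr (1 - \<alpha>) * x powr \<alpha> = x" if "0 \<le> x" for x :: real
    using that by (cases "x = 0") (simp_all add: powr_add[symmetric])
  assume "n \<le> l * f"
  then have "n powr \<alpha> \<le> (l * f) powr \<alpha>" using \<alpha> nf by (intro powr_mono2) auto
  then have "n powr (1 - \<alpha>) * n powr \<alpha> \<le> n powr (1 - \<alpha>) * (l * f) powr \<alpha>" by (intro mult_left_mono) auto
  then show "n \<le> l powr \<alpha> * (n powr (1 - \<alpha>) * f powr \<alpha>)"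
    unfolding split[OF nf(1)] using nf by (simp add: powr_mult mult_ac)
next
  have split: "x powr (1 - \<alpha>) * x powr \<alpha> = x" if "0 \<le> x" for x :: real
    using that by (cases "x = 0") (simp_all add: powr_add[symmetric])
  assume "l * f < n"
  then have "f \<le> n / l" using nf by (simp add: field_simps)
  then have "f powr (1 - \<alpha>) \<le> (n / l) powr (1 - \<alpha>)" using \<alpha> nf by (intro powr_mono2) auto
  then have "f powr (1 - \<alpha>) * f powr \<alpha> \<le> (n / l) powr (1 - \<alpha>) * f powr \<alpha>" by (intro mult_right_mono) auto
  also have "(n / l) powr (1 - \<alpha>) = l powr (\<alpha> - 1) * n powr (1 - \<alpha>)"
    using nf by (simp add: powr_divide powr_minus_divide[of l "1 - \<alpha>", simplified])
  finally show "f \<le> l powr (\<alpha> - 1) * (n powr (1 - \<alpha>) * f powr \<alpha>)"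
    unfolding split[OF nf(2)] by (simp add: mult_ac)
qed

text \<open>The decomposition is picked by choice and depends on T alone, so linearity in \<omega>
  is immediate while linearity in T needs independence of the choice. The value 0 outside matches
  the convention of \<open>dual_space\<close>.\<close>

definition charge_bracket ::
  "real \<Rightarrow> nat \<Rightarrow> 'a::euclidean_space set \<Rightarrow> ('a current \<Rightarrow> real) \<Rightarrow> 'a current \<Rightarrow> real" where
  "charge_bracket \<alpha> m K \<omega> T =
     (if T \<in> fractional_currents_in \<alpha> m K then \<Sum>k. \<omega> ((SOME S. kseries \<alpha> m K S T) k) else 0)"

lemma dual_norm_bound:
  assumes V: "normed_space_on V n" and f: "f \<in> dual_space V n"
  shows "0 \<le> dual_norm V n f" "x \<in> V \<Longrightarrow> \<bar>f x\<bar> \<le> dual_norm V n f * n x"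
proof -
  have sub: "subspace V" and lin: "linear_on V f" using V f by (auto simp: normed_space_on_def dual_space_def)
  obtain C where C: "\<forall>x\<in>V. \<bar>f x\<bar> \<le> C * n x" using f by (auto simp: dual_space_def)
  have n0: "0 \<le> n x" if "x \<in> V" for x using V that by (auto simp: normed_space_on_def)
  \<comment> \<open>The real supremum is meaningful only for a bounded set; C may be negative, hence
    its absolute value.\<close>
  have bdd: "bdd_above {\<bar>f x\<bar> | x. x \<in> V \<and> n x \<le> 1}"
  proof (rule bdd_aboveI)
    fix y assume "y \<in> {\<bar>f x\<bar> | x. x \<in> V \<and> n x \<le> 1}"
    then obtain x where x: "x \<in> V" "n x \<le> 1" "y = \<bar>f x\<bar>" by blast
    have "y \<le> C * n x" using C x by simp
    also have "\<dots> \<le> \<bar>C\<bar> * n x" by (rule mult_right_mono) (use n0 x in simp_all)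
    also have "\<dots> \<le> \<bar>C\<bar> * 1" by (rule mult_left_mono) (use x in simp_all)
    finally show "y \<le> \<bar>C\<bar>" by simp
  qed
  have up: "\<bar>f x\<bar> \<le> dual_norm V n f" if "x \<in> V" "n x \<le> 1" for x
    unfolding dual_norm_def by (rule cSup_upper[OF _ bdd]) (use that in blast)
  have z: "0 \<in> V" "n 0 = 0" using V subspace_0[OF sub] by (auto simp: normed_space_on_def)
  show "0 \<le> dual_norm V n f" using up[of 0] z by simp
  assume x: "x \<in> V"
  show "\<bar>f x\<bar> \<le> dual_norm V n f * n x"
  proof (cases "n x = 0")
    case True
    then have "\<bar>f x\<bar> \<le> 0" using C x by fastforce
    then show ?thesis using True by simp
  next
    case False
    then have nx: "n x > 0" using n0[OF x] by simp
    have "n ((1 / n x) *\<^sub>R x) = \<bar>1 / n x\<bar> * n x" using V x unfolding normed_space_on_def by blast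
    then have "n ((1 / n x) *\<^sub>R x) \<le> 1" using nx by simp
    then have "\<bar>f ((1 / n x) *\<^sub>R x)\<bar> \<le> dual_norm V n f" by (rule up[OF subspace_scale[OF sub x]])
    moreover have "f ((1 / n x) *\<^sub>R x) = (1 / n x) *\<^sub>R f x" using lin x unfolding linear_on_def by blast
    ultimately have "\<bar>f x\<bar> / n x \<le> dual_norm V n f" using nx by (simp add: abs_mult)
    then show ?thesis using nx by (simp add: pos_divide_le_eq)
  qed
qed

section \<open>The fractional norm over a fixed compact convex set\<close>

context
  fixes K :: "'a::euclidean_space set" and \<alpha> :: real and m :: nat
  assumes K: "compact K" "convex K" and \<alpha>: "0 < \<alpha>" "\<alpha> \<le> 1"
begin

abbreviation (input) "FK \<equiv> fractional_currents_in \<alpha> m K"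
abbreviation (input) "NK \<equiv> normal_currents_in m K"
abbreviation (input) "cost S \<equiv> (\<Sum>k. interp \<alpha> m (S k))"

lemma fractional_norm_zero: "(0 :: 'a current) \<in> FK" "fractional_norm \<alpha> m (0 :: 'a current) = 0"
proof -
  have "kseries \<alpha> m K (\<lambda>k. 0) (0 :: 'a current)" by (rule kseries_zero[OF compact_imp_closed[OF K(1)]])
  note z = kseries_fractional[OF K(1) \<alpha> this]
  show 0: "(0 :: 'a current) \<in> FK" by (rule z(1))
  show "fractional_norm \<alpha> m (0 :: 'a current) = 0"
    using z(2) fractional_norm_nonneg[OF 0] by (simp add: interp_zero)
qed

text \<open>Decompositions inside K of arbitrarily small cost force every value of T to be
  arbitrarily small, by \<open>kseries_apply_le\<close>.\<close>

lemma fractional_norm_eq_zero: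
  assumes T: "T \<in> FK" and 0: "fractional_norm \<alpha> m T = 0" shows "T = 0"
proof (rule ext)
  fix \<omega> :: "'a form"
  show "T \<omega> = 0 \<omega>"
  proof (cases "\<omega> \<in> smooth_forms m")
    case True
    obtain c where c: "c \<ge> 0" "\<forall>R\<in>NK. \<bar>R \<omega>\<bar> \<le> c * interp \<alpha> m R"
      using normal_apply_bound[OF K(1) \<alpha> True] by blast
    have "\<bar>T \<omega>\<bar> \<le> 0"
    proof (rule field_le_epsilon)
      fix e :: real assume e: "e > 0"
      then have "e / (c + 1) > 0" using c(1) by simp
      from fractional_decomposition_in[OF K \<alpha> T this] obtain S where S: "kseries \<alpha> m K S T" "cost S \<le> e / (c + 1)"
        unfolding 0 by auto
      have "\<bar>T \<omega>\<bar> \<le> c * cost S" by (rule kseries_apply_le[OF S(1) c(2) True])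
      also have "\<dots> \<le> c * (e / (c + 1))" by (rule mult_left_mono[OF S(2) c(1)])
      also have "\<dots> \<le> e" using c(1) e by (simp add: field_simps)
      finally show "\<bar>T \<omega>\<bar> \<le> 0 + e" by simp
    qed
    then show ?thesis by simp
  next
    case False
    obtain S where "kseries \<alpha> m K S T" using fractional_decomposition_in[OF K \<alpha> T, of 1] by auto
    from kseriesD(6)[OF this False] show ?thesis by simp
  qed
qed

lemma fractional_norm_add:
  assumes T: "T \<in> FK" and T': "T' \<in> FK"
  shows "T + T' \<in> FK" "fractional_norm \<alpha> m (T + T') \<le> fractional_norm \<alpha> m T + fractional_norm \<alpha> m T'"
proof -
  have *: "T + T' \<in> FK \<and> fractional_norm \<alpha> m (T + T') \<le> fractional_norm \<alpha> m T + fractional_norm \<alpha> m T' + e" if e: "e > 0" for e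
  proof -
    have e2: "e / 2 > 0" using e by simp
    obtain S where S: "kseries \<alpha> m K S T" "cost S \<le> fractional_norm \<alpha> m T + e / 2"
      using fractional_decomposition_in[OF K \<alpha> T e2] by blast
    obtain S' where S': "kseries \<alpha> m K S' T'" "cost S' \<le> fractional_norm \<alpha> m T' + e / 2"
      using fractional_decomposition_in[OF K \<alpha> T' e2] by blast
    note a = kseries_add[OF K(1) \<alpha> S(1) S'(1)]
    from kseries_fractional[OF K(1) \<alpha> a(1)] show ?thesis unfolding a(2) using S(2) S'(2) by auto
  qed
  show "T + T' \<in> FK" using *[of 1] by simp
  show "fractional_norm \<alpha> m (T + T') \<le> fractional_norm \<alpha> m T + fractional_norm \<alpha> m T'"
    by (rule field_le_epsilon) (use * in blast)
qed

lemma fractional_norm_scale_le: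
  assumes T: "T \<in> FK"
  shows "c *\<^sub>R T \<in> FK" "fractional_norm \<alpha> m (c *\<^sub>R T) \<le> \<bar>c\<bar> * fractional_norm \<alpha> m T"
proof -
  have *: "c *\<^sub>R T \<in> FK \<and> fractional_norm \<alpha> m (c *\<^sub>R T) \<le> \<bar>c\<bar> * fractional_norm \<alpha> m T + e" if e: "e > 0" for e
  proof -
    have e2: "e / (\<bar>c\<bar> + 1) > 0" using e by (simp add: add_nonneg_pos)
    obtain S where S: "kseries \<alpha> m K S T" "cost S \<le> fractional_norm \<alpha> m T + e / (\<bar>c\<bar> + 1)"
      using fractional_decomposition_in[OF K \<alpha> T e2] by blast
    note s = kseries_scale[OF K(1) \<alpha> S(1), of c]
    note f = kseries_fractional[OF K(1) \<alpha> s(1)]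
    have "fractional_norm \<alpha> m (c *\<^sub>R T) \<le> \<bar>c\<bar> * (fractional_norm \<alpha> m T + e / (\<bar>c\<bar> + 1))"
      by (rule order_trans[OF f(2) order_trans[OF s(2) mult_left_mono[OF S(2)]]]) simp
    also have "\<dots> \<le> \<bar>c\<bar> * fractional_norm \<alpha> m T + e"
    proof -
      have "(\<bar>c\<bar> / (\<bar>c\<bar> + 1)) * e \<le> 1 * e" using e by (intro mult_right_mono) simp_all
      then show ?thesis by (simp add: distrib_left)
    qed
    finally show ?thesis using f(1) by blast
  qed
  show "c *\<^sub>R T \<in> FK" using *[of 1] by simp
  show "fractional_norm \<alpha> m (c *\<^sub>R T) \<le> \<bar>c\<bar> * fractional_norm \<alpha> m T"
    by (rule field_le_epsilon) (use * in blast)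
qed

text \<open>Equality follows from the one-sided estimate applied to c and to 1/c.\<close>

lemma fractional_norm_scale:
  assumes T: "T \<in> FK"
  shows "fractional_norm \<alpha> m (c *\<^sub>R T) = \<bar>c\<bar> * fractional_norm \<alpha> m T"
proof (cases "c = 0")
  case True
  then show ?thesis by (simp add: fractional_norm_zero(2))
next
  case False
  note s = fractional_norm_scale_le[OF T, of c]
  have "fractional_norm \<alpha> m ((1 / c) *\<^sub>R c *\<^sub>R T) \<le> \<bar>1 / c\<bar> * fractional_norm \<alpha> m (c *\<^sub>R T)"
    by (rule fractional_norm_scale_le(2)[OF s(1)])
  moreover have "(1 / c) *\<^sub>R c *\<^sub>R T = T" using False by simp
  ultimately have "\<bar>c\<bar> * fractional_norm \<alpha> m T \<le> \<bar>c\<bar> * (\<bar>1 / c\<bar> * fractional_norm \<alpha> m (c *\<^sub>R T))"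
    by (intro mult_left_mono) simp_all
  also have "\<dots> = fractional_norm \<alpha> m (c *\<^sub>R T)" using False by (simp add: abs_mult[symmetric] mult.assoc[symmetric])
  finally show ?thesis using s(2) by simp
qed

lemma fractional_subspace: "subspace FK"
  unfolding subspace_def using fractional_norm_zero(1) fractional_norm_add(1) fractional_norm_scale_le(1) by blast

lemma fractional_normed_space: "normed_space_on FK (fractional_norm \<alpha> m)"
  unfolding normed_space_on_def
proof (intro conjI ballI allI fractional_subspace)
  fix T assume T: "T \<in> FK"
  show "0 \<le> fractional_norm \<alpha> m T" by (rule fractional_norm_nonneg[OF T])
  show "fractional_norm \<alpha> m T = 0 \<longleftrightarrow> T = 0" using fractional_norm_eq_zero[OF T] fractional_norm_zero(2) by blast
  show "fractional_norm \<alpha> m (c *\<^sub>R T) = \<bar>c\<bar> * fractional_norm \<alpha> m T" for c by (rule fractional_norm_scale[OF T])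
  show "fractional_norm \<alpha> m (T + T') \<le> fractional_norm \<alpha> m T + fractional_norm \<alpha> m T'" if "T' \<in> FK" for T'
    by (rule fractional_norm_add(2)[OF T that])
qed

lemma fractional_norm_commute:
  assumes "S - T \<in> FK" shows "fractional_norm \<alpha> m (T - S) = fractional_norm \<alpha> m (S - T)"
  using fractional_norm_scale[OF assms, of "-1"] by simp

text \<open>Completeness in terms of absolutely convergent series. Decompositions within (1/2)^j of
  the norm keep the total cost finite; flattened, they decompose the weak sum, and the rows from n
  on decompose the remainder.\<close>

lemma fractional_series:
  assumes V: "\<And>j. V j \<in> FK" "summable (\<lambda>j. fractional_norm \<alpha> m (V j))"
  shows "\<exists>T\<in>FK. (\<lambda>n. fractional_norm \<alpha> m (T - (\<Sum>j<n. V j))) \<longlonglongrightarrow> 0"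
proof -
  have "\<exists>U. \<forall>j. kseries \<alpha> m K (U j) (V j) \<and> cost (U j) \<le> fractional_norm \<alpha> m (V j) + (1 / 2) ^ j"
    by (rule choice) (use fractional_decomposition_in[OF K \<alpha> V(1)] in simp)
  then obtain U where UV: "\<forall>j. kseries \<alpha> m K (U j) (V j) \<and> cost (U j) \<le> fractional_norm \<alpha> m (V j) + (1 / 2) ^ j"
    by (rule exE)
  have U: "kseries \<alpha> m K (U j) (V j)" for j by (rule conjunct1[OF spec[OF UV]])
  have Uc: "cost (U j) \<le> fractional_norm \<alpha> m (V j) + (1 / 2) ^ j" for j by (rule conjunct2[OF spec[OF UV]])
  have U0: "0 \<le> cost (U j)" for j by (rule suminf_nonneg[OF kseriesD(4)[OF U] interp_nonneg])
  have sm: "summable (\<lambda>j. cost (U j))"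
    by (rule summable_comparison_test'[OF summable_add[OF V(2) summable_geometric[of "1/2"]], of 0]) (use Uc U0 in auto)
  define T where "T \<omega> = (if \<omega> \<in> smooth_forms m then \<Sum>j. V j \<omega> else 0)" for \<omega>
  have T: "(\<lambda>j. V j \<omega>) sums T \<omega>" if \<omega>: "\<omega> \<in> smooth_forms m" for \<omega>
  proof -
    obtain c where c: "\<forall>R\<in>NK. \<bar>R \<omega>\<bar> \<le> c * interp \<alpha> m R" using normal_apply_bound[OF K(1) \<alpha> \<omega>] by blast
    have "summable (\<lambda>j. V j \<omega>)"
      by (rule summable_comparison_test'[OF summable_mult[OF sm, of c], of 0])
        (use kseries_apply_le[OF U c \<omega>] in simp)
    then show ?thesis by (simp add: T_def \<omega> summable_sums)
  qed
  have T0: "T \<omega> = 0" if "\<omega> \<notin> smooth_forms m" for \<omega> using that by (simp add: T_def)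
  have TF: "T \<in> FK" by (rule kseries_fractional(1)[OF K(1) \<alpha> kseries_combine(1)[OF K(1) \<alpha> U sm T T0]])
  have le: "fractional_norm \<alpha> m (T - (\<Sum>j<n. V j)) \<le> (\<Sum>j. cost (U (j + n)))" and
    mem: "T - (\<Sum>j<n. V j) \<in> FK" for n
  proof -
    have a: "kseries \<alpha> m K (U (j + n)) (V (j + n))" for j by (rule U)
    have b: "summable (\<lambda>j. cost (U (j + n)))" by (rule summable_ignore_initial_segment[OF sm])
    have c: "(\<lambda>j. V (j + n) \<omega>) sums (T - (\<Sum>j<n. V j)) \<omega>" if "\<omega> \<in> smooth_forms m" for \<omega>
      using sums_split_initial_segment[OF T[OF that], of n] by (simp add: sum_current_apply)
    have d: "(T - (\<Sum>j<n. V j)) \<omega> = 0" if "\<omega> \<notin> smooth_forms m" for \<omega>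
      using T0[OF that] kseriesD(6)[OF U that] by (simp add: sum_current_apply)
    have k1: "kseries \<alpha> m K (\<lambda>i. case_prod (\<lambda>j. U (j + n)) (prod_decode i)) (T - (\<Sum>j<n. V j))"
      by (rule kseries_combine(1)[OF K(1) \<alpha> a b c d])
    have k2: "cost (\<lambda>i. case_prod (\<lambda>j. U (j + n)) (prod_decode i)) = (\<Sum>j. cost (U (j + n)))"
      by (rule kseries_combine(2)[OF K(1) \<alpha> a b c d])
    show "fractional_norm \<alpha> m (T - (\<Sum>j<n. V j)) \<le> (\<Sum>j. cost (U (j + n)))"
      using kseries_fractional(2)[OF K(1) \<alpha> k1] unfolding k2 .
    show "T - (\<Sum>j<n. V j) \<in> FK" by (rule kseries_fractional(1)[OF K(1) \<alpha> k1])
  qed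
  have "(\<lambda>n. fractional_norm \<alpha> m (T - (\<Sum>j<n. V j))) \<longlonglongrightarrow> 0"
    by (rule tendsto_sandwich[OF _ _ tendsto_const suminf_exist_split2[OF sm]])
      (simp_all add: le fractional_norm_nonneg[OF mem])
  with TF show ?thesis by blast
qed

lemma fractional_banach: "banach_space_on FK (fractional_norm \<alpha> m)"
  unfolding banach_space_on_def
proof (intro conjI allI impI fractional_normed_space)
  fix s :: "nat \<Rightarrow> 'a current"
  assume "(\<forall>k. s k \<in> FK) \<and> Cauchy_wrt (fractional_norm \<alpha> m) s"
  then have s: "\<And>k. s k \<in> FK" and C: "Cauchy_wrt (fractional_norm \<alpha> m) s" by blast+
  have "\<exists>N. \<forall>n. \<forall>i\<ge>N n. \<forall>j\<ge>N n. fractional_norm \<alpha> m (s i - s j) < (1 / 2) ^ n"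
    by (rule choice, intro allI, rule mp[OF spec[OF C[unfolded Cauchy_wrt_def]]]) simp
  then obtain N where N: "\<forall>n. \<forall>i\<ge>N n. \<forall>j\<ge>N n. fractional_norm \<alpha> m (s i - s j) < (1 / 2) ^ n" by (rule exE)
  \<comment> \<open>A nondecreasing sequence above N, so that consecutive members of the subsequence
    are (1/2)^n-close.\<close>
  define r where "r n = sum N {..n}" for n
  have rN: "r n \<ge> N n" for n unfolding r_def by (rule member_le_sum) auto
  have rS: "r (Suc n) \<ge> r n" for n by (simp add: r_def)
  have close: "fractional_norm \<alpha> m (s i - s (r n)) < (1 / 2) ^ n" if "i \<ge> r n" for i n
    using N rN[of n] that by (meson order_trans)
  have dF: "x - y \<in> FK" if "x \<in> FK" "y \<in> FK" for x y by (rule subspace_diff[OF fractional_subspace that])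
  define V where "V j = (case j of 0 \<Rightarrow> s (r 0) | Suc n \<Rightarrow> s (r (Suc n)) - s (r n))" for j
  have V: "V j \<in> FK" for j by (cases j) (auto simp: V_def intro: s dF)
  have "summable (\<lambda>n. fractional_norm \<alpha> m (V (Suc n)))"
  proof (rule summable_comparison_test'[OF summable_geometric[of "1/2"], of 0])
    fix n show "norm (fractional_norm \<alpha> m (V (Suc n))) \<le> (1 / 2) ^ n"
      using close[OF rS, of n] fractional_norm_nonneg[OF V, of "Suc n"] by (simp add: V_def)
  qed simp
  then have "summable (\<lambda>j. fractional_norm \<alpha> m (V j))" by (rule summable_Suc_iff[THEN iffD1])
  from fractional_series[OF V this] obtain T where T: "T \<in> FK"
    "(\<lambda>n. fractional_norm \<alpha> m (T - (\<Sum>j<n. V j))) \<longlonglongrightarrow> 0" by blast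
  have tele: "(\<Sum>j<Suc n. V j) = s (r n)" for n
  proof (induction n)
    case (Suc n)
    have "(\<Sum>j<Suc (Suc n). V j) = s (r n) + (s (r (Suc n)) - s (r n))"
      unfolding sum.lessThan_Suc[of V "Suc n"] Suc.IH by (simp only: V_def nat.case)
    also have "\<dots> = s (r (Suc n))" by (simp only: add.commute[of "s (r n)"] diff_add_cancel)
    finally show ?case .
  qed (simp add: V_def)
  have lim: "(\<lambda>n. fractional_norm \<alpha> m (T - s (r n))) \<longlonglongrightarrow> 0"
    using LIMSEQ_Suc[OF T(2)] unfolding tele .
  have "(\<lambda>k. fractional_norm \<alpha> m (s k - T)) \<longlonglongrightarrow> 0"
  proof (rule LIMSEQ_I)
    fix e :: real assume e: "e > 0"
    have half: "(\<lambda>n. (1 / 2 :: real) ^ n) \<longlonglongrightarrow> 0" by (rule LIMSEQ_power_zero) simp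
    have "eventually (\<lambda>n. fractional_norm \<alpha> m (T - s (r n)) < e / 2 \<and> (1 / 2 :: real) ^ n < e / 2) sequentially"
      by (intro eventually_conj order_tendstoD(2)[OF lim] order_tendstoD(2)[OF half]) (use e in simp_all)
    then obtain n where n: "fractional_norm \<alpha> m (T - s (r n)) < e / 2" "(1 / 2 :: real) ^ n < e / 2"
      unfolding eventually_sequentially by blast
    have "norm (fractional_norm \<alpha> m (s k - T) - 0) < e" if k: "k \<ge> r n" for k
    proof -
      have "s k - T = (s k - s (r n)) + (s (r n) - T)" by simp
      then have "fractional_norm \<alpha> m (s k - T) \<le> fractional_norm \<alpha> m (s k - s (r n)) + fractional_norm \<alpha> m (s (r n) - T)"
        using fractional_norm_add(2)[OF dF[OF s s] dF[OF s T(1)]] by metis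
      moreover have "fractional_norm \<alpha> m (s (r n) - T) < e / 2"
        unfolding fractional_norm_commute[OF dF[OF T(1) s]] by (rule n(1))
      moreover note close[OF k] n(2)
      ultimately have "fractional_norm \<alpha> m (s k - T) < e" by linarith
      then show ?thesis using fractional_norm_nonneg[OF dF[OF s T(1)], of k] unfolding real_norm_def by linarith
    qed
    then show "\<exists>no. \<forall>k\<ge>no. norm (fractional_norm \<alpha> m (s k - T) - 0) < e" by blast
  qed
  with T(1) show "\<exists>x\<in>FK. (\<lambda>k. fractional_norm \<alpha> m (s k - x)) \<longlonglongrightarrow> 0" by blast
qed

subsection \<open>Charges and duality\<close>

abbreviation (input) "CH \<equiv> fractional_charges \<alpha> m K"

lemma chargeD:
  assumes "\<omega> \<in> CH"
  shows "linear_on NK \<omega>" "\<exists>C\<ge>0. \<forall>T\<in>NK. \<bar>\<omega> T\<bar> \<le> C * interp \<alpha> m T" "T \<notin> NK \<Longrightarrow> \<omega> T = 0"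
  using assms by (auto simp: fractional_charges_def)

lemma NK_subspace: "subspace NK"
  by (rule normal_in_subspace[OF compact_imp_closed[OF K(1)]])

lemma charge_zero: "\<omega> \<in> CH \<Longrightarrow> \<omega> 0 = 0"
  by (rule linear_on_zero[OF NK_subspace chargeD(1)])

lemma charge_abs_summable:
  assumes \<omega>: "\<omega> \<in> CH" and S: "kseries \<alpha> m K S T"
  shows "summable (\<lambda>k. \<bar>\<omega> (S k)\<bar>)"
proof -
  obtain C where C: "\<forall>T\<in>NK. \<bar>\<omega> T\<bar> \<le> C * interp \<alpha> m T" using chargeD(2)[OF \<omega>] by blast
  show ?thesis
    by (rule summable_comparison_test'[OF summable_mult[OF kseriesD(4)[OF S], of C], of 0])
      (use bspec[OF C kseriesD(1)[OF S]] in simp)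
qed

text \<open>Most of the series is captured by the finite sum over the indices \<open>k\<close> with
  \<open>N(S\<^sub>k) \<le> \<lambda>F(S\<^sub>k)\<close>; as the whole series vanishes, the flat norm of that sum is also
  the flat norm of the remainder, and the powers of \<open>\<lambda>\<close> cancel in \<open>N\<^bsup>1-\<alpha>\<^esup>F\<^bsup>\<alpha>\<^esup>\<close>.\<close>

lemma charge_null_series_bound:
  assumes \<omega>: "\<omega> \<in> CH" and S: "kseries \<alpha> m K S 0" and C: "C \<ge> 0" "\<forall>T\<in>NK. \<bar>\<omega> T\<bar> \<le> C * interp \<alpha> m T"
    and e: "e > 0"
  shows "\<bar>\<Sum>k. \<omega> (S k)\<bar> \<le> C * (cost S powr (1 - \<alpha>) * (2 * e) powr \<alpha> + e)"
proof -
  let ?I = "\<lambda>k. interp \<alpha> m (S k)" and ?n = "\<lambda>k. normal_norm m (S k)" and ?f = "\<lambda>k. normal_flat_norm m (S k)"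
  note SD = kseriesD[OF S]
  have n0: "0 \<le> ?n k" for k by (rule normal_norm_nonneg[OF SD(2)])
  have fb: "flat_bounded m (S k)" for k by (rule normal_flat_bounded(1)[OF SD(2)])
  have f0: "0 \<le> ?f k" for k by (rule flat_norm_nonneg[OF fb])
  have I0: "0 \<le> ?I k" for k by (rule interp_nonneg)
  have Isum: "?I sums cost S" by (rule summable_sums[OF SD(4)])
  have Q0: "0 \<le> cost S" by (rule suminf_nonneg[OF SD(4) I0])
  have fsm: "summable ?f"
    by (rule summable_comparison_test'[OF SD(4), of 0]) (simp add: f0 flat_le_interp[OF SD(2) \<alpha>])
  have "eventually (\<lambda>M. cost S - e < (\<Sum>k<M. ?I k)) sequentially"
    by (rule order_tendstoD(1)[OF Isum[unfolded sums_def]]) (use e in simp)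
  \<comment> \<open>Beyond M the cost is below e, for the charge and for the flat norm of the
    remainder alike.\<close>
  then obtain M where M: "cost S - (\<Sum>k<M. ?I k) < e" unfolding eventually_sequentially by (force simp: algebra_simps)
  \<comment> \<open>Large enough that the first M indices all lie below the threshold ratio.\<close>
  define l where "l = 1 + (\<Sum>k<M. ?n k / ?f k)"
  have l1: "l \<ge> 1" unfolding l_def using n0 f0 by (simp add: sum_nonneg)
  have l: "l > 0" using l1 by simp
  have small: "?n k \<le> l * ?f k" if "k < M" for k
  proof (cases "?f k = 0")
    case True
    then show ?thesis using normal_norm_zero_of_flat[OF K(1) \<alpha> SD(1)] by simp
  next
    case False
    have "?n k / ?f k \<le> (\<Sum>k<M. ?n k / ?f k)" by (rule member_le_sum) (use that n0 f0 in simp_all)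
    then have "?n k / ?f k \<le> l" unfolding l_def by simp
    then show ?thesis using False f0[of k] by (simp add: pos_divide_le_eq)
  qed
  have le: "l powr (\<alpha> - 1) * e > 0" using l e by simp
  \<comment> \<open>Chosen after l: the flat tail has to be small compared with a power of l, which
    may be far smaller than e.\<close>
  have "eventually (\<lambda>n. suminf ?f - l powr (\<alpha> - 1) * e < (\<Sum>k<n. ?f k) \<and> n \<ge> M) sequentially"
    by (intro eventually_conj order_tendstoD(1)[OF summable_sums[OF fsm, unfolded sums_def]] eventually_ge_at_top)
      (use le in simp)
  then obtain n where n: "suminf ?f - (\<Sum>k<n. ?f k) < l powr (\<alpha> - 1) * e" "n \<ge> M"
    unfolding eventually_sequentially by (force simp: algebra_simps)
  define A where "A = {k. k < n \<and> ?n k \<le> l * ?f k}"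
  have A: "finite A" unfolding A_def by simp
  have MA: "k \<ge> M" if "k \<notin> A" for k using small[of k] that n(2) unfolding A_def by fastforce
  have Itail: "(\<lambda>k. if k \<in> {..<M} then 0 else ?I k) sums (cost S - (\<Sum>k<M. ?I k))"
    by (rule sums_remove_finite[OF Isum]) simp
  define R where "R = sum S A"
  have R: "R \<in> NK" unfolding R_def by (rule subspace_sum[OF NK_subspace SD(1)])
  have Rn: "R \<in> normal_currents m" using R by (simp add: normal_in_iff)
  have "normal_norm m R \<le> (\<Sum>k\<in>A. ?n k)"
    unfolding R_def by (rule conjunct2[OF normal_sum]) (rule SD(2))
  also have "\<dots> \<le> (\<Sum>k\<in>A. l powr \<alpha> * ?I k)"
    unfolding interp_def by (rule sum_mono, rule interp_split_bounds(1)[OF \<alpha> n0 f0 l]) (simp add: A_def)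
  also have "\<dots> = l powr \<alpha> * sum ?I A" by (simp add: sum_distrib_left)
  also have "\<dots> \<le> l powr \<alpha> * cost S" by (intro mult_left_mono sum_le_suminf SD(4) A) (simp_all add: I0)
  finally have RN: "normal_norm m R \<le> l powr \<alpha> * cost S" .
  have "normal_flat_norm m R \<le> 2 * e * l powr (\<alpha> - 1)"
  proof (rule flat_norm_least)
    fix \<eta> :: "'a form" assume \<eta>: "\<eta> \<in> flat_ball m"
    then have \<eta>s: "\<eta> \<in> smooth_forms m" by (simp add: flat_ball_def)
    \<comment> \<open>Dominates the terms outside A. An index below n that is not in A exceeds the
      threshold and is at least M, so its flat norm is covered by the cost; from n on the flat norms
      themselves are used.\<close>
    let ?g = "\<lambda>k. l powr (\<alpha> - 1) * (if k \<in> {..<M} then 0 else ?I k) + (if k \<in> {..<n} then 0 else ?f k)"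
    have g: "?g sums (l powr (\<alpha> - 1) * (cost S - (\<Sum>k<M. ?I k)) + (suminf ?f - (\<Sum>k<n. ?f k)))"
      by (intro sums_add sums_mult Itail sums_remove_finite summable_sums[OF fsm]) simp
    have s: "(\<lambda>k. if k \<in> A then 0 else S k \<eta>) sums (0 - (\<Sum>k\<in>A. S k \<eta>))"
      using sums_remove_finite[OF SD(5)[OF \<eta>s] A] by simp
    have b: "\<bar>if k \<in> A then 0 else S k \<eta>\<bar> \<le> ?g k" for k
    proof (cases "k \<in> A")
      case True
      then show ?thesis using I0 f0 by simp
    next
      case False
      have "\<bar>S k \<eta>\<bar> \<le> ?f k" by (rule flat_norm_abs[OF fb \<eta>])
      moreover have "?f k \<le> ?g k"
      proof (cases "k < n")
        case True
        then have "l * ?f k < ?n k" using False unfolding A_def by simp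
        then have "?f k \<le> l powr (\<alpha> - 1) * ?I k" unfolding interp_def by (rule interp_split_bounds(2)[OF \<alpha> n0 f0 l])
        then show ?thesis using True MA[OF False] by simp
      next
        case nk: False
        then show ?thesis using I0 by simp
      qed
      ultimately show ?thesis using False by simp
    qed
    have "\<bar>0 - (\<Sum>k\<in>A. S k \<eta>)\<bar> \<le> suminf ?g" by (rule sums_abs_le(2)[OF s b sums_summable[OF g]])
    also have "\<dots> = l powr (\<alpha> - 1) * (cost S - (\<Sum>k<M. ?I k)) + (suminf ?f - (\<Sum>k<n. ?f k))"
      by (rule sums_unique[OF g, symmetric])
    also have "\<dots> \<le> l powr (\<alpha> - 1) * e + l powr (\<alpha> - 1) * e"
      by (rule add_mono[OF mult_left_mono[OF less_imp_le[OF M] powr_ge_zero] less_imp_le[OF n(1)]])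
    finally show "R \<eta> \<le> 2 * e * l powr (\<alpha> - 1)" unfolding R_def by (simp add: sum_current_apply)
  qed
  then have "interp \<alpha> m R \<le> (l powr \<alpha> * cost S) powr (1 - \<alpha>) * (2 * e * l powr (\<alpha> - 1)) powr \<alpha>"
    by (intro interp_mono_bound \<alpha> normal_norm_nonneg[OF Rn] RN flat_norm_nonneg[OF normal_flat_bounded(1)[OF Rn]])
  also have "\<dots> = (l powr (\<alpha> * (1 - \<alpha>)) * l powr ((\<alpha> - 1) * \<alpha>)) * (cost S powr (1 - \<alpha>) * (2 * e) powr \<alpha>)"
    using Q0 e l by (simp add: powr_mult powr_powr)
  \<comment> \<open>The exponents \<alpha> (1-\<alpha>) and (\<alpha>-1) \<alpha> add up to 0, so
    the bound does not depend on l, over which there is no control.\<close>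
  also have "l powr (\<alpha> * (1 - \<alpha>)) * l powr ((\<alpha> - 1) * \<alpha>) = 1"
    using l by (simp add: powr_add[symmetric] algebra_simps)
  finally have RI: "interp \<alpha> m R \<le> cost S powr (1 - \<alpha>) * (2 * e) powr \<alpha>" by simp
  have wS: "(\<lambda>k. \<omega> (S k)) sums (\<Sum>k. \<omega> (S k))"
    by (rule summable_sums, rule summable_rabs_cancel, rule charge_abs_summable[OF \<omega> S])
  have wR: "\<omega> R = (\<Sum>k\<in>A. \<omega> (S k))" unfolding R_def by (rule linear_on_sum[OF NK_subspace chargeD(1)[OF \<omega>] SD(1)])
  have s: "(\<lambda>k. if k \<in> A then 0 else \<omega> (S k)) sums ((\<Sum>k. \<omega> (S k)) - \<omega> R)"
    unfolding wR by (rule sums_remove_finite[OF wS A])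
  have g: "(\<lambda>k. C * (if k \<in> {..<M} then 0 else ?I k)) sums (C * (cost S - (\<Sum>k<M. ?I k)))"
    by (rule sums_mult[OF Itail])
  \<comment> \<open>The terms left out of A start at M, where the remaining cost is below e.\<close>
  have b: "\<bar>if k \<in> A then 0 else \<omega> (S k)\<bar> \<le> C * (if k \<in> {..<M} then 0 else ?I k)" for k
    using MA[of k] bspec[OF C(2) SD(1)] C(1) I0 by auto
  have "\<bar>(\<Sum>k. \<omega> (S k)) - \<omega> R\<bar> \<le> C * (cost S - (\<Sum>k<M. ?I k))"
    using sums_abs_le(2)[OF s b sums_summable[OF g]] unfolding sums_unique[OF g, symmetric] .
  also have "\<dots> \<le> C * e" by (intro mult_left_mono C less_imp_le M)
  finally have 1: "\<bar>(\<Sum>k. \<omega> (S k)) - \<omega> R\<bar> \<le> C * e" .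
  have "\<bar>\<omega> R\<bar> \<le> C * (cost S powr (1 - \<alpha>) * (2 * e) powr \<alpha>)"
    by (rule order_trans[OF bspec[OF C(2) R] mult_left_mono[OF RI C(1)]])
  with 1 show ?thesis unfolding distrib_left by linarith
qed

text \<open>Let e tend to 0 in the preceding bound; as \<alpha> > 0, the factor (2 e)^\<alpha> tends
  to 0 as well.\<close>

lemma charge_null_series:
  assumes \<omega>: "\<omega> \<in> CH" and S: "kseries \<alpha> m K S 0"
  shows "(\<Sum>k. \<omega> (S k)) = 0"
proof -
  obtain C where C: "C \<ge> 0" "\<forall>T\<in>NK. \<bar>\<omega> T\<bar> \<le> C * interp \<alpha> m T" using chargeD(2)[OF \<omega>] by blast
  let ?e = "\<lambda>n. inverse (real (Suc n))"
  have "(\<lambda>n. (2 * ?e n) powr \<alpha>) \<longlonglongrightarrow> 0"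
    by (rule tendsto_zero_powrI[OF _ tendsto_const])
      (use \<alpha> tendsto_mult_right_zero[OF LIMSEQ_inverse_real_of_nat, of 2] in simp_all)
  then have "(\<lambda>n. C * (cost S powr (1 - \<alpha>) * (2 * ?e n) powr \<alpha> + ?e n)) \<longlonglongrightarrow> C * (cost S powr (1 - \<alpha>) * 0 + 0)"
    by (intro tendsto_intros LIMSEQ_inverse_real_of_nat)
  then have "\<bar>\<Sum>k. \<omega> (S k)\<bar> \<le> C * (cost S powr (1 - \<alpha>) * 0 + 0)"
    by (rule LIMSEQ_le_const) (intro exI allI impI charge_null_series_bound[OF \<omega> S C], simp)
  then show ?thesis by simp
qed

lemma charge_sum_series:
  assumes \<omega>: "\<omega> \<in> CH" and S: "kseries \<alpha> m K S T" and S': "kseries \<alpha> m K S' T'"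
  defines "U \<equiv> \<lambda>j::nat. if j = 0 then S else if j = 1 then S' else (\<lambda>k. 0)"
  shows "(\<Sum>i. \<omega> (case_prod U (prod_decode i))) = (\<Sum>k. \<omega> (S k)) + (\<Sum>k. \<omega> (S' k))"
proof -
  let ?f = "\<lambda>j k. \<omega> (U j k)"
  have a: "summable (\<lambda>k. \<bar>?f j k\<bar>)" for j
    using charge_abs_summable[OF \<omega> S] charge_abs_summable[OF \<omega> S'] by (simp add: U_def charge_zero[OF \<omega>])
  have z: "?f j k = 0" if "j \<notin> {0, 1}" for j k using that by (simp add: U_def charge_zero[OF \<omega>])
  have b: "summable (\<lambda>j. \<Sum>k. \<bar>?f j k\<bar>)" by (rule summable_finite[of "{0, 1}"]) (simp_all add: z)
  have "(\<Sum>j. \<Sum>k. ?f j k) = (\<Sum>j\<in>{0, 1}. \<Sum>k. ?f j k)" by (rule suminf_finite) (simp_all add: z)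
  also have "\<dots> = (\<Sum>k. \<omega> (S k)) + (\<Sum>k. \<omega> (S' k))" by (simp add: U_def)
  finally show ?thesis using sums_unique[OF sums_prod_decode(2)[OF a b]] by (simp add: split_beta)
qed

text \<open>The difference of two decompositions, interleaved into one series, decomposes 0.\<close>

lemma charge_series_unique:
  assumes \<omega>: "\<omega> \<in> CH" and S: "kseries \<alpha> m K S T" and S': "kseries \<alpha> m K S' T"
  shows "(\<Sum>k. \<omega> (S k)) = (\<Sum>k. \<omega> (S' k))"
proof -
  note s = kseries_scale(1)[OF K(1) \<alpha> S', of "-1"]
  have z: "T + (-1) *\<^sub>R T = 0" by simp
  have "(\<Sum>k. \<omega> (S k)) + (\<Sum>k. \<omega> ((-1) *\<^sub>R S' k)) = 0"
    using charge_null_series[OF \<omega> kseries_add(1)[OF K(1) \<alpha> S s, unfolded z]] unfolding charge_sum_series[OF \<omega> S s] .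
  moreover have "\<omega> ((-1) *\<^sub>R S' k) = (-1) *\<^sub>R \<omega> (S' k)" for k
    using chargeD(1)[OF \<omega>] kseriesD(1)[OF S', of k] unfolding linear_on_def by blast
  moreover have "(\<Sum>k. (-1) *\<^sub>R \<omega> (S' k)) = - (\<Sum>k. \<omega> (S' k))"
    using suminf_minus[OF summable_rabs_cancel[OF charge_abs_summable[OF \<omega> S']]] by simp
  ultimately show ?thesis by (simp only:)
qed



section \<open>The bracket as an isometric isomorphism\<close>

abbreviation (input) "nrm \<equiv> fractional_norm \<alpha> m"
abbreviation (input) "bracket \<equiv> charge_bracket \<alpha> m K"

lemma charge_bracket_sums:
  assumes \<omega>: "\<omega> \<in> CH" and S: "kseries \<alpha> m K S T"
  shows "(\<lambda>k. \<omega> (S k)) sums bracket \<omega> T"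
proof -
  have "kseries \<alpha> m K (SOME S. kseries \<alpha> m K S T) T" by (rule someI[of "\<lambda>S. kseries \<alpha> m K S T", OF S])
  then have "bracket \<omega> T = (\<Sum>k. \<omega> (S k))"
    using charge_series_unique[OF \<omega> S] kseries_fractional(1)[OF K(1) \<alpha> S] by (simp add: charge_bracket_def)
  then show ?thesis
    using summable_sums[OF summable_rabs_cancel[OF charge_abs_summable[OF \<omega> S]]] by simp
qed

lemma kseries_exists: "T \<in> FK \<Longrightarrow> \<exists>S. kseries \<alpha> m K S T"
  using fractional_decomposition_in[OF K \<alpha>, of T m 1] by auto

lemma charge_bracket_normal:
  assumes \<omega>: "\<omega> \<in> CH" and T: "T \<in> NK"
  shows "bracket \<omega> T = \<omega> T" "T \<in> FK" "nrm T \<le> interp \<alpha> m T"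
proof -
  note s = kseries_single[OF compact_imp_closed[OF K(1)] T, of \<alpha>]
  have "(\<lambda>k. if k = 0 then \<omega> T else 0) sums \<omega> T" by (rule sums_single)
  then have "(\<lambda>k::nat. \<omega> (if k = 0 then T else 0)) sums \<omega> T"
    using charge_zero[OF \<omega>] by (simp add: if_distrib cong: if_cong)
  then show "bracket \<omega> T = \<omega> T" by (rule sums_unique2[OF charge_bracket_sums[OF \<omega> s(1)]])
  show "T \<in> FK" by (rule kseries_fractional(1)[OF K(1) \<alpha> s(1)])
  show "nrm T \<le> interp \<alpha> m T" using kseries_fractional(2)[OF K(1) \<alpha> s(1)] unfolding s(2) .
qed

lemma charge_bracket_linear:
  assumes \<omega>: "\<omega> \<in> CH"
  shows "linear_on FK (bracket \<omega>)"
  unfolding linear_on_def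
proof (intro conjI ballI allI)
  fix T c assume T: "T \<in> FK"
  obtain S where S: "kseries \<alpha> m K S T" using kseries_exists[OF T] by blast
  have "\<omega> (c *\<^sub>R S k) = c *\<^sub>R \<omega> (S k)" for k
    using chargeD(1)[OF \<omega>] kseriesD(1)[OF S, of k] unfolding linear_on_def by blast
  then have "(\<lambda>k. \<omega> (c *\<^sub>R S k)) sums (c *\<^sub>R bracket \<omega> T)"
    using sums_mult[OF charge_bracket_sums[OF \<omega> S], of c] by simp
  then show "bracket \<omega> (c *\<^sub>R T) = c *\<^sub>R bracket \<omega> T"
    by (rule sums_unique2[OF charge_bracket_sums[OF \<omega> kseries_scale(1)[OF K(1) \<alpha> S]]])
  fix T' assume T': "T' \<in> FK"
  obtain S' where S': "kseries \<alpha> m K S' T'" using kseries_exists[OF T'] by blast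
  show "bracket \<omega> (T + T') = bracket \<omega> T + bracket \<omega> T'"
    using sums_unique[OF charge_bracket_sums[OF \<omega> kseries_add(1)[OF K(1) \<alpha> S S']]]
      charge_sum_series[OF \<omega> S S'] sums_unique[OF charge_bracket_sums[OF \<omega> S]]
      sums_unique[OF charge_bracket_sums[OF \<omega> S']] by argo
qed

text \<open>The defining infimum is itself an admissible constant: divide by the cost where it is
  positive; where it vanishes, any admissible constant already forces the value 0.\<close>

lemma charge_norm_attained:
  assumes \<omega>: "\<omega> \<in> CH"
  shows "0 \<le> charge_norm \<alpha> m K \<omega>" "T \<in> NK \<Longrightarrow> \<bar>\<omega> T\<bar> \<le> charge_norm \<alpha> m K \<omega> * interp \<alpha> m T"
proof -
  let ?X = "{C. C \<ge> 0 \<and> (\<forall>T\<in>NK. \<bar>\<omega> T\<bar> \<le> C * interp \<alpha> m T)}"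
  have ne: "?X \<noteq> {}" using chargeD(2)[OF \<omega>] by auto
  show "0 \<le> charge_norm \<alpha> m K \<omega>" unfolding charge_norm_def by (rule cInf_greatest[OF ne]) simp
  assume T: "T \<in> NK"
  show "\<bar>\<omega> T\<bar> \<le> charge_norm \<alpha> m K \<omega> * interp \<alpha> m T"
  proof (cases "interp \<alpha> m T = 0")
    case True
    then show ?thesis using ne T by fastforce
  next
    case False
    then have I: "interp \<alpha> m T > 0" using interp_nonneg[of \<alpha> m T] by simp
    have "\<bar>\<omega> T\<bar> / interp \<alpha> m T \<le> charge_norm \<alpha> m K \<omega>"
      unfolding charge_norm_def by (rule cInf_greatest[OF ne]) (use I T in \<open>simp add: pos_divide_le_eq\<close>)
    then show ?thesis using I by (simp add: pos_divide_le_eq)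
  qed
qed

text \<open>Here the exact constant is obtained: termwise the charge is bounded by its norm times
  the cost, and decompositions inside K come within any e of the fractional norm.\<close>

lemma charge_bracket_bound:
  assumes \<omega>: "\<omega> \<in> CH" and T: "T \<in> FK"
  shows "\<bar>bracket \<omega> T\<bar> \<le> charge_norm \<alpha> m K \<omega> * nrm T"
proof (rule field_le_epsilon)
  let ?C = "charge_norm \<alpha> m K \<omega>"
  note C = charge_norm_attained[OF \<omega>]
  fix e :: real assume e: "e > 0"
  then have "e / (?C + 1) > 0" using C(1) by simp
  from fractional_decomposition_in[OF K \<alpha> T this] obtain S where S: "kseries \<alpha> m K S T"
    "(\<Sum>k. interp \<alpha> m (S k)) \<le> nrm T + e / (?C + 1)" by blast
  have "\<bar>bracket \<omega> T\<bar> \<le> (\<Sum>k. ?C * interp \<alpha> m (S k))"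
    by (rule sums_abs_le(2)[OF charge_bracket_sums[OF \<omega> S(1)] C(2)[OF kseriesD(1)[OF S(1)]] summable_mult[OF kseriesD(4)[OF S(1)]]])
  also have "\<dots> = ?C * (\<Sum>k. interp \<alpha> m (S k))" by (rule suminf_mult[OF kseriesD(4)[OF S(1)]])
  also have "\<dots> \<le> ?C * (nrm T + e / (?C + 1))" by (rule mult_left_mono[OF S(2) C(1)])
  also have "\<dots> = ?C * nrm T + (?C / (?C + 1)) * e" by (simp add: distrib_left)
  also have "\<dots> \<le> ?C * nrm T + 1 * e" using C(1) e by (intro add_left_mono mult_right_mono) simp_all
  finally show "\<bar>bracket \<omega> T\<bar> \<le> ?C * nrm T + e" by simp
qed

lemma charge_bracket_dual: "\<omega> \<in> CH \<Longrightarrow> bracket \<omega> \<in> dual_space FK nrm"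
  unfolding dual_space_def using charge_bracket_linear charge_bracket_bound
  by (auto simp: charge_bracket_def)

text \<open>One inequality is \<open>charge_bracket_bound\<close>; the other holds because the
  fractional norm of a normal current in K is at most its own cost, so the dual norm is an
  admissible constant for \<omega>.\<close>

lemma charge_bracket_isometric:
  assumes \<omega>: "\<omega> \<in> CH"
  shows "dual_norm FK nrm (bracket \<omega>) = charge_norm \<alpha> m K \<omega>"
proof (rule order_antisym)
  note C = charge_norm_attained[OF \<omega>]
  note D = dual_norm_bound[OF fractional_normed_space charge_bracket_dual[OF \<omega>]]
  show "dual_norm FK nrm (bracket \<omega>) \<le> charge_norm \<alpha> m K \<omega>"
    unfolding dual_norm_def
  proof (rule cSup_least)
    show "{\<bar>bracket \<omega> x\<bar> | x. x \<in> FK \<and> nrm x \<le> 1} \<noteq> {}"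
      using fractional_norm_zero by force
    fix y assume "y \<in> {\<bar>bracket \<omega> x\<bar> | x. x \<in> FK \<and> nrm x \<le> 1}"
    then obtain x where x: "x \<in> FK" "nrm x \<le> 1" "y = \<bar>bracket \<omega> x\<bar>" by blast
    have "y \<le> charge_norm \<alpha> m K \<omega> * nrm x" unfolding x(3) by (rule charge_bracket_bound[OF \<omega> x(1)])
    also have "\<dots> \<le> charge_norm \<alpha> m K \<omega> * 1" by (rule mult_left_mono[OF x(2) C(1)])
    finally show "y \<le> charge_norm \<alpha> m K \<omega>" by simp
  qed
  show "charge_norm \<alpha> m K \<omega> \<le> dual_norm FK nrm (bracket \<omega>)"
    unfolding charge_norm_def
  proof (rule cInf_lower)
    have "\<bar>\<omega> T\<bar> \<le> dual_norm FK nrm (bracket \<omega>) * interp \<alpha> m T" if T: "T \<in> NK" for T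
    proof -
      note t = charge_bracket_normal[OF \<omega> T]
      show ?thesis using D(2)[OF t(2)] mult_left_mono[OF t(3) D(1)] unfolding t(1) by linarith
    qed
    then show "dual_norm FK nrm (bracket \<omega>) \<in> {C. C \<ge> 0 \<and> (\<forall>T\<in>NK. \<bar>\<omega> T\<bar> \<le> C * interp \<alpha> m T)}"
      using D(1) by blast
  qed (rule bdd_belowI[of _ 0], simp)
qed

lemma charge_bracket_surj:
  assumes f: "f \<in> dual_space FK nrm"
  shows "\<exists>\<omega>\<in>CH. bracket \<omega> = f"
proof -
  have sub: "subspace FK" by (rule fractional_subspace)
  note NKs = NK_subspace
  have lin: "linear_on FK f" and f0: "\<And>T. T \<notin> FK \<Longrightarrow> f T = 0" using f by (auto simp: dual_space_def)
  note D = dual_norm_bound[OF fractional_normed_space f]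
  let ?D = "dual_norm FK nrm f"
  define \<omega> where "\<omega> T = (if T \<in> NK then f T else 0)" for T
  have NF: "T \<in> FK" "nrm T \<le> interp \<alpha> m T" if "T \<in> NK" for T
  proof -
    note s = kseries_single[OF compact_imp_closed[OF K(1)] that, of \<alpha>]
    show "T \<in> FK" by (rule kseries_fractional(1)[OF K(1) \<alpha> s(1)])
    show "nrm T \<le> interp \<alpha> m T" using kseries_fractional(2)[OF K(1) \<alpha> s(1)] unfolding s(2) .
  qed
  have \<omega>: "\<omega> \<in> CH"
    unfolding fractional_charges_def
  proof (intro CollectI conjI exI allI impI)
    show "linear_on NK \<omega>"
      using lin NF(1) subspace_add[OF NKs] subspace_scale[OF NKs] unfolding linear_on_def \<omega>_def by simp
    show "0 \<le> ?D" by (rule D(1))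
    show "\<forall>T\<in>NK. \<bar>\<omega> T\<bar> \<le> ?D * interp \<alpha> m T"
    proof
      fix T assume T: "T \<in> NK"
      show "\<bar>\<omega> T\<bar> \<le> ?D * interp \<alpha> m T"
        using D(2)[OF NF(1)[OF T]] mult_left_mono[OF NF(2)[OF T] D(1)] T by (simp add: \<omega>_def)
    qed
  qed (simp add: \<omega>_def)
  have "bracket \<omega> T = f T" if T: "T \<in> FK" for T
  proof -
    obtain S where S: "kseries \<alpha> m K S T" using kseries_exists[OF T] by blast
    have SF: "S k \<in> FK" for k by (rule NF(1)[OF kseriesD(1)[OF S]])
    have "(\<lambda>n. (\<Sum>k<n. f (S k)) - f T) \<longlonglongrightarrow> 0"
    proof (rule Lim_null_comparison)
      show "(\<lambda>n. ?D * (\<Sum>k. interp \<alpha> m (S (k + n)))) \<longlonglongrightarrow> 0"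
        by (rule tendsto_mult_right_zero[OF suminf_exist_split2[OF kseriesD(4)[OF S]]])
      have "norm ((\<Sum>k<n. f (S k)) - f T) \<le> ?D * (\<Sum>k. interp \<alpha> m (S (k + n)))" for n
      proof -
        note t = kseries_fractional[OF K(1) \<alpha> kseries_tail[OF S, of n]]
        have e1: "f (T - (\<Sum>k<n. S k)) = f T - f (\<Sum>k<n. S k)"
          by (rule linear_on_diff[OF sub lin T subspace_sum[OF sub SF]])
        have e2: "f (\<Sum>k<n. S k) = (\<Sum>k<n. f (S k))" by (rule linear_on_sum[OF sub lin SF])
        have "norm ((\<Sum>k<n. f (S k)) - f T) = \<bar>f (T - (\<Sum>k<n. S k))\<bar>"
          unfolding e1 e2 real_norm_def by (rule abs_minus_commute)
        also have "\<dots> \<le> ?D * nrm (T - (\<Sum>k<n. S k))" by (rule D(2)[OF t(1)])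
        also have "\<dots> \<le> ?D * (\<Sum>k. interp \<alpha> m (S (k + n)))" by (rule mult_left_mono[OF t(2) D(1)])
        finally show ?thesis .
      qed
      then show "\<forall>\<^sub>F n in sequentially. norm ((\<Sum>k<n. f (S k)) - f T) \<le> ?D * (\<Sum>k. interp \<alpha> m (S (k + n)))"
        by (intro always_eventually allI)
    qed
    then have "(\<lambda>k. f (S k)) sums f T" unfolding sums_def by (rule LIM_zero_cancel)
    moreover have "f (S k) = \<omega> (S k)" for k using kseriesD(1)[OF S] by (simp add: \<omega>_def)
    ultimately have "(\<lambda>k. \<omega> (S k)) sums f T" by simp
    then show ?thesis by (rule sums_unique2[OF charge_bracket_sums[OF \<omega> S]])
  qed
  then have "bracket \<omega> = f" using f0 by (auto simp: fun_eq_iff charge_bracket_def)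
  with \<omega> show ?thesis by blast
qed

lemma charge_bracket_inj:
  assumes \<omega>: "\<omega> \<in> CH" "\<omega>' \<in> CH" and eq: "bracket \<omega> = bracket \<omega>'"
  shows "\<omega> = \<omega>'"
proof (rule ext)
  fix T
  show "\<omega> T = \<omega>' T"
  proof (cases "T \<in> NK")
    case True
    show ?thesis
      using charge_bracket_normal(1)[OF \<omega>(1) True] charge_bracket_normal(1)[OF \<omega>(2) True] fun_cong[OF eq, of T] by argo
  next
    case False
    then show ?thesis using chargeD(3)[OF \<omega>(1)] chargeD(3)[OF \<omega>(2)] by simp
  qed
qed

lemma charge_bracket_isomorphism:
  "isometric_isomorphism CH (charge_norm \<alpha> m K) (dual_space FK nrm) (dual_norm FK nrm) bracket"
  unfolding isometric_isomorphism_def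
proof (intro conjI ballI charge_bracket_isometric)
  show "linear_on CH bracket"
    unfolding linear_on_def
  proof (intro conjI ballI allI)
    \<comment> \<open>The same chosen decomposition serves all charges, so linearity in \<omega> is
      that of convergent series.\<close>
    let ?S = "\<lambda>T. SOME S. kseries \<alpha> m K S T"
    have sm: "summable (\<lambda>k. \<omega> (?S T k))" if "\<omega> \<in> CH" "T \<in> FK" for \<omega> T
    proof (rule summable_rabs_cancel, rule charge_abs_summable[OF that(1)])
      show "kseries \<alpha> m K (?S T) T" by (rule someI_ex[OF kseries_exists[OF that(2)]])
    qed
    fix \<omega> c assume \<omega>: "\<omega> \<in> CH"
    show "bracket (c *\<^sub>R \<omega>) = c *\<^sub>R bracket \<omega>"
    proof
      fix T show "bracket (c *\<^sub>R \<omega>) T = (c *\<^sub>R bracket \<omega>) T"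
        by (simp add: charge_bracket_def scaleR_fun_def suminf_mult[OF sm[OF \<omega>]])
    qed
    fix \<omega>' assume \<omega>': "\<omega>' \<in> CH"
    show "bracket (\<omega> + \<omega>') = bracket \<omega> + bracket \<omega>'"
    proof
      fix T show "bracket (\<omega> + \<omega>') T = (bracket \<omega> + bracket \<omega>') T"
        by (simp add: charge_bracket_def suminf_add[OF sm[OF \<omega>] sm[OF \<omega>']])
    qed
  qed
  show "bij_betw bracket CH (dual_space FK nrm)"
    unfolding bij_betw_def
  proof
    show "inj_on bracket CH" by (rule inj_onI, rule charge_bracket_inj)
    show "bracket ` CH = dual_space FK nrm"
    proof
      show "bracket ` CH \<subseteq> dual_space FK nrm" using charge_bracket_dual by blast
      show "dual_space FK nrm \<subseteq> bracket ` CH"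
      proof
        fix f assume "f \<in> dual_space FK nrm"
        from charge_bracket_surj[OF this] show "f \<in> bracket ` CH" by blast
      qed
    qed
  qed
qed

end

theorem theorem6p4:
  fixes K :: "(real ^ 'd) set" and m :: nat and \<alpha> :: real
  assumes "compact K" and "convex K" and "0 < \<alpha>" and "\<alpha> \<le> 1"
  shows "banach_space_on (fractional_currents_in \<alpha> m K) (fractional_norm \<alpha> m) \<and>
    (\<exists>bracket.
       isometric_isomorphism
         (fractional_charges \<alpha> m K) (charge_norm \<alpha> m K)
         (dual_space (fractional_currents_in \<alpha> m K) (fractional_norm \<alpha> m))
         (dual_norm (fractional_currents_in \<alpha> m K) (fractional_norm \<alpha> m))
         bracket \<and>
       (\<forall>\<omega>\<in>fractional_charges \<alpha> m K. \<forall>T\<in>normal_currents_in m K. bracket \<omega> T = \<omega> T))"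
  using fractional_banach[OF assms] charge_bracket_isomorphism[OF assms] charge_bracket_normal(1)[OF assms]
  by (intro conjI exI[of _ "charge_bracket \<alpha> m K"]) auto

end
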